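(* Let $k\ge1$, let $n$ be an integer, let $r\in H^k(S^1)$ be a complex-valued function on the unit circle $S^1$, let $z_1,\dots,z_J$ be distinct points with $|z_j|>1$, and let $c_1,\dots,c_J\in\mathbb{C}$ be arbitrary. Let $\Sigma=S^1\cup\bigcup_{j}C[z_j]\cup\bigcup_jC[z_j]^\sharp$ and the $2\times2$ jump matrix $v$ on $\Sigma$ be as defined in the context. Then: (i) The Riemann-Hilbert problem $$m_+=m_-v\ \text{ on }\Sigma,\qquad m(z)\to I\ (z\to\infty)$$ has a unique solution $m\in\mathcal{H}^k(\mathbb{C}\setminus\Sigma)$. (ii) The Riemann-Hilbert problem with poles \begin{align*} & M_{+}(z)=M_{-}(z)V(z)\ \text{ on } S^{1},\qquad V(z)=\begin{bmatrix}1+|r(z)|^{2} & z^{2n}\overline{r(z)}\\ z^{-2n}r(z) & 1\end{bmatrix},\\ & \mathrm{Res}(M(z);z_{j})=\lim_{z\to z_{j}}M(z)\begin{bmatrix}0&0\\ z_{j}^{-2n}c_{j}&0\end{bmatrix}\quad (j=1,\dots,J),\\ & \mathrm{Res}(M(z);\bar z_{j}^{-1})=\lim_{z\to\bar z_{j}^{-1}}M(z)\begin{bmatrix}0&\bar z_{j}^{-2n-2}\bar c_{j}\\ 0&0\end{bmatrix}\quad (j=1,\dots,J),\\ & M(z)\to I\ \text{ as } z\to\infty \end{align*} has a unique solution $M$, where $M$ is a $2\times 2$ matrix function, holomorphic on $\mathbb{C}\setminus S^1$ except for at most simple poles at the points $z_j,\bar z_j^{-1}$, extending continuously to $S^1$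 from each side with boundary values $M_\pm\in H^k(S^1)$, where $M_+$ and $M_-$ are the boundary values from the outside and from the inside of $S^1$ respectively. (iii) All partial indices of $v$ relative to $\Sigma$ are zero.
   Context: Contour and jump matrix. $S^1$ is oriented clockwise. For each $j$, $C[z_j]$ is a circle centered at $z_j$, oriented clockwise, of radius so small that the closed discs bounded by the $C[z_j]$ are pairwise disjoint and contained in $\{|z|>1\}$. $C[z_j]^\sharp=\{1/\bar z: z\in C[z_j]\}$ is its image under inversion in $S^1$; it is a simple closed curve enclosing $1/\bar z_j$ and is oriented counterclockwise. $\Sigma=S^{1}\cup\bigcup_{j=1}^{J}C[z_{j}]\cup\bigcup_{j=1}^{J}C[z_{j}]^{\sharp}$. With these orientations $\Sigma$ is the positively oriented boundary of the open set $\Omega_+$ consisting of the points outside $S^1$ and outside all $C[z_j]$, together with the points inside some $C[z_j]^\sharp$; $\Omega_-=\mathbb{C}\setminus(\Sigma\cup\Omega_+)$. On $\Sigma$ define $$v(z)=\begin{cases}V(z)=\begin{bmatrix}1+|r(z)|^{2} & z^{2n}\overline{r(z)}\\ z^{-2n}r(z)&1\end{bmatrix} & \text{on } S^1,\\[2ex] \begin{bmatrix}1&0\\ \frac{z_j^{-2n}c_j}{z-z_j}&1\end{bmatrix} & \text{on } C[z_j],\\[2ex] \begin{bmatrix}1&-\frac{\bar z_j^{-2n-2}\bar c_j}{z-\bar z_j^{-1}}\\ 0&1\end{bmatrix} & \text{on } C[z_j]^\sharp.\end{cases}$$ Function spaces. $H^k(\Sigma)$ is the Sobolev space of complex $2\times2$-matrix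 functions on $\Sigma$ whose derivatives along $\Sigma$ of orders $0,\dots,k$ are in $L^2$ with respect to arclength (similarly $H^k(S^1)$, also for scalar functions). Cauchy operators: $C_{\pm}f(z)=\lim_{z'\to z}\frac{1}{2\pi i}\int_{\Sigma}\frac{f(w)\,dw}{w-z'}$, the nontangential limit $z'\to z\in\Sigma$ being taken from $\Omega_{\pm}$; they are bounded on $H^k(\Sigma)$. Holomorphic classes. $\mathcal{H}^{k}(\mathbb{C}\setminus\Sigma)$ is the set of holomorphic matrix functions $m$ on $\mathbb{C}\setminus\Sigma$ with a limit $m(\infty)$ and boundary values $m_\pm$ from $\Omega_\pm$ such that $m$ is the extension given by its boundary values, with $m_{\pm}-m(\infty)\in\mathrm{Range}(C_{\pm}:H^k\to H^k)$. $G\mathcal{H}^{k}(\mathbb{C}\setminus\Sigma)$ is the set of such $m$ with $\det m$ vanishing nowhere (on $\mathbb{C}\setminus\Sigma$, at $\infty$, and for the boundary values). Partial indices. Fix $z_\pm\in\Omega_\pm$. Every $v\in H^k(\Sigma)$ with $\det v\ne0$ on $\Sigma$ can be written $v=m_-^{-1}\theta m_+$ on $\Sigma$ with $m\in G\mathcal{H}^k(\mathbb{C}\setminus\Sigma)$ and $\theta=\mathrm{diag}\big[(\frac{z-z_+}{z-z_-})^{k_1},(\frac{z-z_+}{z-z_-})^{k_2}\big]$, with integers $k_1\ge k_2$ uniquely determined by $v$; these are the partial indices of $v$ relative to $\Sigma$. *)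

theory Defs
  imports "HOL-Complex_Analysis.Complex_Analysis"
begin

definition mat2 :: "complex \<Rightarrow> complex \<Rightarrow> complex \<Rightarrow> complex \<Rightarrow> complex^2^2" where
  "mat2 a b c d = vector [vector [a, b], vector [c, d]]"

definition holomorphic_mat_on :: "(complex \<Rightarrow> complex^2^2) \<Rightarrow> complex set \<Rightarrow> bool" where
  "holomorphic_mat_on m S \<longleftrightarrow> (\<forall>i l. (\<lambda>z. m z $ i $ l) holomorphic_on S)"

text \<open>An oriented contour is represented by a finite set \<open>\<Gamma>\<close> of disjoint smooth regular closed curves
  on \<open>{0..1}\<close>, one parametrization for each component.\<close>

definition contour_trace :: "(real \<Rightarrow> complex) set \<Rightarrow> complex set" where
  "contour_trace \<Gamma> = (\<Union>\<gamma>\<in>\<Gamma>. path_image \<gamma>)"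

definition speed :: "(real \<Rightarrow> complex) \<Rightarrow> real \<Rightarrow> real" where
  "speed \<gamma> t = norm (vector_derivative \<gamma> (at t within {0..1}))"

definition L2_along :: "(real \<Rightarrow> complex) \<Rightarrow> (real \<Rightarrow> 'a::euclidean_space) \<Rightarrow> bool" where
  "L2_along \<gamma> g \<longleftrightarrow> g \<in> borel_measurable (lebesgue_on {0..1}) \<and>
     integrable (lebesgue_on {0..1}) (\<lambda>t. speed \<gamma> t * (norm (g t))\<^sup>2)"

text \<open>Here \<open>g\<close> is a function of the parameter of the curve, and \<open>h\<close> is its derivative with respect to
  arclength \<open>ds = speed \<gamma> t dt\<close>. For positive order, \<open>g\<close> has to be an absolutely continuous function
  on the closed curve (hence \<open>g 1 = g 0\<close>), i.e. elements of the Sobolev space are represented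
  by their continuous representatives.\<close>

primrec sobolev_param ::
  "nat \<Rightarrow> (real \<Rightarrow> complex) \<Rightarrow> (real \<Rightarrow> 'a::euclidean_space) \<Rightarrow> bool" where
  "sobolev_param 0 \<gamma> g \<longleftrightarrow> L2_along \<gamma> g"
| "sobolev_param (Suc k) \<gamma> g \<longleftrightarrow> L2_along \<gamma> g \<and> g 1 = g 0 \<and>
     (\<exists>h. sobolev_param k \<gamma> h \<and>
        (\<forall>t\<in>{0..1}. ((\<lambda>s. speed \<gamma> s *\<^sub>R h s) has_integral (g t - g 0)) {0..t}))"

definition Hsob :: "nat \<Rightarrow> (real \<Rightarrow> complex) set \<Rightarrow> (complex \<Rightarrow> 'a::euclidean_space) set" where
  "Hsob k \<Gamma> = {f. \<forall>\<gamma>\<in>\<Gamma>. sobolev_param k \<gamma> (f \<circ> \<gamma>)}"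

text \<open>The nontangential approach regions at \<open>z \<in> S\<close> consist of the points whose distance to \<open>z\<close> is
  comparable to their distance to \<open>S\<close>; \<open>\<alpha>\<close> measures the aperture.\<close>

definition has_nt_limit ::
  "complex set \<Rightarrow> complex set \<Rightarrow> (complex \<Rightarrow> 'a::t2_space) \<Rightarrow> complex \<Rightarrow> 'a \<Rightarrow> bool" where
  "has_nt_limit S A F z L \<longleftrightarrow>
     (\<forall>\<alpha>>1. (F \<longlongrightarrow> L) (at z within {w\<in>A. dist w z < \<alpha> * infdist w S}))"

definition nt_limit ::
  "complex set \<Rightarrow> complex set \<Rightarrow> (complex \<Rightarrow> 'a::t2_space) \<Rightarrow> complex \<Rightarrow> 'a" where
  "nt_limit S A F z = (THE L. has_nt_limit S A F z L)"

definition cauchy_integral ::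
  "(real \<Rightarrow> complex) set \<Rightarrow> (complex \<Rightarrow> complex^2^2) \<Rightarrow> complex \<Rightarrow> complex^2^2" where
  "cauchy_integral \<Gamma> f z = (\<chi> i l. 1 / (2 * of_real pi * \<i>) *
     (\<Sum>\<gamma>\<in>\<Gamma>. contour_integral \<gamma> (\<lambda>w. f w $ i $ l / (w - z))))"

text \<open>The Cauchy operators map \<open>H\<^sup>k\<close> to \<open>H\<^sup>k\<close>, so \<open>g \<in> Hsob k \<Gamma>\<close> only records the codomain.\<close>

definition cauchy_range ::
  "nat \<Rightarrow> (real \<Rightarrow> complex) set \<Rightarrow> complex set \<Rightarrow> (complex \<Rightarrow> complex^2^2) set" where
  "cauchy_range k \<Gamma> A = {g \<in> Hsob k \<Gamma>. \<exists>f\<in>Hsob k \<Gamma>. \<forall>z\<in>contour_trace \<Gamma>.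
     has_nt_limit (contour_trace \<Gamma>) A (cauchy_integral \<Gamma> f) z (g z)}"

text \<open>In the following, \<open>P\<close> is the set \<open>\<Omega>\<^sub>+\<close>, of which \<open>\<Gamma>\<close> is the positively oriented boundary.\<close>

definition minus_side :: "(real \<Rightarrow> complex) set \<Rightarrow> complex set \<Rightarrow> complex set" where
  "minus_side \<Gamma> P = - (contour_trace \<Gamma> \<union> P)"

definition bv_plus ::
  "(real \<Rightarrow> complex) set \<Rightarrow> complex set \<Rightarrow> (complex \<Rightarrow> complex^2^2) \<Rightarrow> complex \<Rightarrow> complex^2^2" where
  "bv_plus \<Gamma> P m = nt_limit (contour_trace \<Gamma>) P m"

definition bv_minus ::
  "(real \<Rightarrow> complex) set \<Rightarrow> complex set \<Rightarrow> (complex \<Rightarrow> complex^2^2) \<Rightarrow> complex \<Rightarrow> complex^2^2" where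
  "bv_minus \<Gamma> P m = nt_limit (contour_trace \<Gamma>) (minus_side \<Gamma> P) m"

text \<open>The last two conditions express that \<open>m\<close> is the extension given by its boundary values: the Cauchy
  integral formula on \<open>\<Omega>\<^sub>+\<close>, and on \<open>\<Omega>\<^sub>-\<close>, whose positively oriented boundary is \<open>\<Gamma>\<close> reversed.
  A function \<open>m\<close> is only regarded off the contour; its values on \<open>contour_trace \<Gamma>\<close> are irrelevant.\<close>

definition Hhol ::
  "nat \<Rightarrow> (real \<Rightarrow> complex) set \<Rightarrow> complex set \<Rightarrow> (complex \<Rightarrow> complex^2^2) set" where
  "Hhol k \<Gamma> P = {m. holomorphic_mat_on m (- contour_trace \<Gamma>) \<and>
     (\<exists>m0. (m \<longlongrightarrow> m0) at_infinity \<and>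
       (\<forall>z\<in>contour_trace \<Gamma>. has_nt_limit (contour_trace \<Gamma>) P m z (bv_plus \<Gamma> P m z)) \<and>
       (\<forall>z\<in>contour_trace \<Gamma>. has_nt_limit (contour_trace \<Gamma>) (minus_side \<Gamma> P) m z (bv_minus \<Gamma> P m z)) \<and>
       (\<lambda>z. bv_plus \<Gamma> P m z - m0) \<in> cauchy_range k \<Gamma> P \<and>
       (\<lambda>z. bv_minus \<Gamma> P m z - m0) \<in> cauchy_range k \<Gamma> (minus_side \<Gamma> P) \<and>
       (\<forall>z\<in>P. m z = m0 + cauchy_integral \<Gamma> (\<lambda>w. bv_plus \<Gamma> P m w - m0) z) \<and>
       (\<forall>z\<in>minus_side \<Gamma> P. m z = m0 - cauchy_integral \<Gamma> (\<lambda>w. bv_minus \<Gamma> P m w - m0) z))}"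

definition GHhol ::
  "nat \<Rightarrow> (real \<Rightarrow> complex) set \<Rightarrow> complex set \<Rightarrow> (complex \<Rightarrow> complex^2^2) set" where
  "GHhol k \<Gamma> P = {m \<in> Hhol k \<Gamma> P.
     (\<forall>z. z \<notin> contour_trace \<Gamma> \<longrightarrow> det (m z) \<noteq> 0) \<and>
     (\<exists>m0. (m \<longlongrightarrow> m0) at_infinity \<and> det m0 \<noteq> 0) \<and>
     (\<forall>z\<in>contour_trace \<Gamma>. det (bv_plus \<Gamma> P m z) \<noteq> 0 \<and> det (bv_minus \<Gamma> P m z) \<noteq> 0)}"

text \<open>\<open>k1 \<ge> k2\<close> are the partial indices of \<open>v\<close> relative to \<open>\<Gamma>\<close>; \<open>zp\<close> and \<open>zm\<close> are the base points
  in \<open>\<Omega>\<^sub>+\<close> and \<open>\<Omega>\<^sub>-\<close>.\<close>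

definition partial_indices ::
  "nat \<Rightarrow> (real \<Rightarrow> complex) set \<Rightarrow> complex set \<Rightarrow> complex \<Rightarrow> complex \<Rightarrow>
   (complex \<Rightarrow> complex^2^2) \<Rightarrow> int \<Rightarrow> int \<Rightarrow> bool" where
  "partial_indices k \<Gamma> P zp zm v k1 k2 \<longleftrightarrow> k1 \<ge> k2 \<and>
     (\<exists>m\<in>GHhol k \<Gamma> P. \<forall>z\<in>contour_trace \<Gamma>.
        v z = matrix_inv (bv_minus \<Gamma> P m z)
              ** mat2 (((z - zp) / (z - zm)) powi k1) 0 0 (((z - zp) / (z - zm)) powi k2)
              ** bv_plus \<Gamma> P m z)"

definition rhp_solution ::
  "nat \<Rightarrow> (real \<Rightarrow> complex) set \<Rightarrow> complex set \<Rightarrow> (complex \<Rightarrow> complex^2^2) \<Rightarrow>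
   (complex \<Rightarrow> complex^2^2) \<Rightarrow> bool" where
  "rhp_solution k \<Gamma> P v m \<longleftrightarrow> m \<in> Hhol k \<Gamma> P \<and>
     (\<forall>z\<in>contour_trace \<Gamma>. bv_plus \<Gamma> P m z = bv_minus \<Gamma> P m z ** v z) \<and>
     (m \<longlongrightarrow> mat 1) at_infinity"

text \<open>Recall that \<open>circlepath\<close> runs counterclockwise.\<close>

definition unit_circle :: "real \<Rightarrow> complex" where
  "unit_circle = reversepath (circlepath 0 1)"

definition pole_circle :: "complex \<Rightarrow> real \<Rightarrow> real \<Rightarrow> complex" where
  "pole_circle a \<rho> = reversepath (circlepath a \<rho>)"

text \<open>Inversion in the unit circle reverses the orientation, so if the closed disc lies in
  \<open>|z| > 1\<close>, then this image of a clockwise circle runs counterclockwise.\<close>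

definition pole_circle_sharp :: "complex \<Rightarrow> real \<Rightarrow> real \<Rightarrow> complex" where
  "pole_circle_sharp a \<rho> = (\<lambda>t. 1 / cnj (pole_circle a \<rho> t))"

definition contour :: "nat \<Rightarrow> (nat \<Rightarrow> complex) \<Rightarrow> (nat \<Rightarrow> real) \<Rightarrow> (real \<Rightarrow> complex) set" where
  "contour J p \<epsilon> = {unit_circle} \<union> (\<lambda>j. pole_circle (p j) (\<epsilon> j)) ` {1..J}
     \<union> (\<lambda>j. pole_circle_sharp (p j) (\<epsilon> j)) ` {1..J}"

definition Omega_plus :: "nat \<Rightarrow> (nat \<Rightarrow> complex) \<Rightarrow> (nat \<Rightarrow> real) \<Rightarrow> complex set" where
  "Omega_plus J p \<epsilon> =
     {z \<in> outside (path_image unit_circle).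
        \<forall>j\<in>{1..J}. z \<in> outside (path_image (pole_circle (p j) (\<epsilon> j)))}
     \<union> (\<Union>j\<in>{1..J}. inside (path_image (pole_circle_sharp (p j) (\<epsilon> j))))"

definition Omega_minus :: "nat \<Rightarrow> (nat \<Rightarrow> complex) \<Rightarrow> (nat \<Rightarrow> real) \<Rightarrow> complex set" where
  "Omega_minus J p \<epsilon> = minus_side (contour J p \<epsilon>) (Omega_plus J p \<epsilon>)"

definition jump_V :: "int \<Rightarrow> (complex \<Rightarrow> complex) \<Rightarrow> complex \<Rightarrow> complex^2^2" where
  "jump_V n r z = mat2 (1 + of_real ((norm (r z))\<^sup>2)) (z powi (2*n) * cnj (r z))
                       (z powi (-2*n) * r z)          1"

text \<open>The indices \<open>j\<close> below are unique when the closed discs are disjoint and contained in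
  \<open>|z| > 1\<close>. The value off the contour is irrelevant.\<close>

definition jump_v ::
  "int \<Rightarrow> (complex \<Rightarrow> complex) \<Rightarrow> nat \<Rightarrow> (nat \<Rightarrow> complex) \<Rightarrow> (nat \<Rightarrow> complex) \<Rightarrow> (nat \<Rightarrow> real) \<Rightarrow>
   complex \<Rightarrow> complex^2^2" where
  "jump_v n r J p c \<epsilon> z =
     (if z \<in> path_image unit_circle then jump_V n r z
      else if \<exists>j\<in>{1..J}. z \<in> path_image (pole_circle (p j) (\<epsilon> j)) then
        (let j = (THE j. j \<in> {1..J} \<and> z \<in> path_image (pole_circle (p j) (\<epsilon> j)))
         in mat2 1 0 (p j powi (-2*n) * c j / (z - p j)) 1)
      else
        (let j = (THE j. j \<in> {1..J} \<and> z \<in> path_image (pole_circle_sharp (p j) (\<epsilon> j)))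
         in mat2 1 (- (cnj (p j) powi (-2*n - 2) * cnj (c j) / (z - 1 / cnj (p j)))) 0 1))"

definition poles :: "nat \<Rightarrow> (nat \<Rightarrow> complex) \<Rightarrow> complex set" where
  "poles J p = p ` {1..J} \<union> (\<lambda>j. 1 / cnj (p j)) ` {1..J}"

text \<open>For a function that is holomorphic in a punctured neighbourhood of \<open>a\<close>. (The library's \<open>zorder\<close> is
  unsuitable here, as matrix entries may vanish identically.)\<close>

definition at_most_simple_pole :: "(complex \<Rightarrow> complex) \<Rightarrow> complex \<Rightarrow> bool" where
  "at_most_simple_pole f a \<longleftrightarrow> (\<exists>L. ((\<lambda>z. (z - a) * f z) \<longlongrightarrow> L) (at a))"

definition residue_mat :: "(complex \<Rightarrow> complex^2^2) \<Rightarrow> complex \<Rightarrow> complex^2^2" where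
  "residue_mat M a = (\<chi> i l. residue (\<lambda>z. M z $ i $ l) a)"

definition rhp_poles_solution ::
  "nat \<Rightarrow> int \<Rightarrow> (complex \<Rightarrow> complex) \<Rightarrow> nat \<Rightarrow> (nat \<Rightarrow> complex) \<Rightarrow> (nat \<Rightarrow> complex) \<Rightarrow>
   (complex \<Rightarrow> complex^2^2) \<Rightarrow> bool" where
  "rhp_poles_solution k n r J p c M \<longleftrightarrow>
     holomorphic_mat_on M (- (sphere 0 1 \<union> poles J p)) \<and>
     (\<forall>a\<in>poles J p. \<forall>i l. at_most_simple_pole (\<lambda>z. M z $ i $ l) a) \<and>
     (\<exists>Mp Mm. Mp \<in> Hsob k {unit_circle} \<and> Mm \<in> Hsob k {unit_circle} \<and>
        (\<forall>z\<in>sphere 0 1. (M \<longlongrightarrow> Mp z) (at z within {w. norm w > 1}) \<and>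
                        (M \<longlongrightarrow> Mm z) (at z within {w. norm w < 1}) \<and>
                        Mp z = Mm z ** jump_V n r z)) \<and>
     (\<forall>j\<in>{1..J}.
        ((\<lambda>z. M z ** mat2 0 0 (p j powi (-2*n) * c j) 0) \<longlongrightarrow> residue_mat M (p j)) (at (p j))) \<and>
     (\<forall>j\<in>{1..J}.
        ((\<lambda>z. M z ** mat2 0 (cnj (p j) powi (-2*n - 2) * cnj (c j)) 0 0)
           \<longlongrightarrow> residue_mat M (1 / cnj (p j))) (at (1 / cnj (p j)))) \<and>
     (M \<longlongrightarrow> mat 1) at_infinity"

end

theory Submission
  imports Defs "HOL-Real_Asymp.Real_Asymp"
begin

text \<open>
  On \<open>S\<^sup>1\<close> we have \<open>V = [[1, a\<^sup>*], [0, 1]] [[1, 0], [a, 1]]\<close> with \<open>a = z\<^sup>-\<^sup>2\<^sup>n r\<close>, so in terms of the mixed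
  boundary values \<open>u\<close> (first entry of a row of \<open>M\<close>, from the inside) and \<open>w\<close> (second entry, from the outside) the
  jump relation becomes symmetric: \<open>M\<^sub>1\<^sub>+ = u + a w\<close> and \<open>w = M\<^sub>2\<^sub>- + a\<^sup>* u\<close>. Comparing Laurent
  coefficients, and using that the residue conditions add \<open>- \<Sum> C\<^sub>j / (z - z\<^sub>j)\<close> to the symbol \<open>a\<close>, the
  problem with poles turns into \<open>u = e\<^sub>1 - T w\<close>, \<open>w = e\<^sub>2 + T\<^sup>* u\<close> for a Hankel operator \<open>T\<close>. As \<open>1 + T T\<^sup>*\<close> is
  positive definite, this is uniquely solvable, and the decay of the coefficients of the symbol, which encodes
  \<open>r \<in> H\<^sup>k\<close>, carries over to \<open>u\<close> and \<open>w\<close>.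

  Multiplying a solution \<open>M\<close> inside the small circles by unipotent rational matrices removes the poles and creates the jumps
  on these circles, which solves the problem on \<open>\<Sigma>\<close>. All jump matrices have determinant \<open>1\<close>, hence so does the
  solution \<open>m\<close>, and uniqueness is Liouville's theorem for \<open>m' m\<^sup>-\<^sup>1\<close>. For a factorization with partial indices
  \<open>k\<^sub>1 \<ge> k\<^sub>2\<close>, a positive \<open>k\<^sub>1\<close> would give an entire row that vanishes at \<open>z\<^sub>+\<close>, and a negative \<open>k\<^sub>1 + k\<^sub>2\<close> would
  do the same for the reciprocal of the determinant.
\<close>

subsection \<open>Square summable families and Hilbert--Schmidt matrices\<close>

text \<open>The choice of the mixed pair \<open>u\<close>, \<open>w\<close> is dictated by the
  residue conditions. They admit poles of the first column only at the \<open>z_j\<close> and of the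
  second column only at the reflected points, so the first column inside and the second column
  outside are the pole-free pieces, given by one-sided Laurent series. The values of
  \<open>w\<close> at \<open>z_j\<close> and of \<open>u\<close> at \<open>1 / cnj z_j\<close> need
  not be introduced as unknowns: the Hankel matrix of \<open>1 / (z - a)\<close> has rank one and
  evaluates a series at \<open>a\<close>. Both residue conditions thus fit into one operator and its
  adjoint, whence positivity for arbitrary \<open>c_j\<close>. As \<open>k \<ge> 1\<close>, the
  coefficients of the symbol are square summable with weight \<open>1 + |m|\<close>, which makes the
  Hankel matrix Hilbert-Schmidt. The solution is at first only square summable; its decay is
  recovered by applying the two equations alternately. Boundary values are treated one circle at a
  time by Laurent series. The inverted circles are run with nonconstant speed, so their Cauchy
  integrals are reduced to those of the original circles by reflection.\<close>

lemma infsum_sum_swap: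
  fixes f :: "'b \<Rightarrow> 'a \<Rightarrow> 'c::{topological_comm_monoid_add, t2_space}"
  assumes "\<And>k. k \<in> F \<Longrightarrow> f k summable_on S"
  shows "(\<Sum>k\<in>F. infsum (f k) S) = infsum (\<lambda>l. \<Sum>k\<in>F. f k l) S"
    and "(\<lambda>l. \<Sum>k\<in>F. f k l) summable_on S"
proof -
  have "((\<lambda>l. \<Sum>k\<in>F. f k l) has_sum (\<Sum>k\<in>F. infsum (f k) S)) S"
    using assms
  proof (induction F rule: infinite_finite_induct)
    case (insert x F)
    then show ?case by (auto intro!: has_sum_add)
  qed auto
  then show "(\<Sum>k\<in>F. infsum (f k) S) = infsum (\<lambda>l. \<Sum>k\<in>F. f k l) S"
    and "(\<lambda>l. \<Sum>k\<in>F. f k l) summable_on S"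
    by (auto simp: infsumI has_sum_imp_summable)
qed

lemma summable_on_prod_nonneg:
  fixes f :: "'a \<Rightarrow> 'b \<Rightarrow> real"
  assumes "\<And>x y. 0 \<le> f x y" and "\<And>x. f x summable_on UNIV"
    and "(\<lambda>x. infsum (f x) UNIV) summable_on UNIV"
  shows "(\<lambda>(x, y). f x y) summable_on UNIV"
proof -
  have "(\<lambda>(x, y). f x y) summable_on (UNIV \<times> UNIV)"
    by (rule summable_on_SigmaI[where g = "\<lambda>x. infsum (f x) UNIV"])
      (use assms in \<open>auto intro!: has_sum_infsum\<close>)
  then show ?thesis by simp
qed

lemma summable_on_norm_le:
  fixes f :: "'a \<Rightarrow> complex"
  assumes "g summable_on S" and "\<And>x. x \<in> S \<Longrightarrow> norm (f x) \<le> g x"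
  shows "f summable_on S"
  using Infinite_Sum.abs_summable_on_comparison_test'[OF assms] abs_summable_summable by blast

lemma summable_on_real_le:
  fixes f g :: "'a \<Rightarrow> real"
  assumes "g summable_on S" and "\<And>x. x \<in> S \<Longrightarrow> 0 \<le> f x" and "\<And>x. x \<in> S \<Longrightarrow> f x \<le> g x"
  shows "f summable_on S"
  using assms by (intro Infinite_Sum.summable_on_comparison_test[of g S f]) auto

lemma norm_infsum_le_infsum:
  fixes f :: "'a \<Rightarrow> complex"
  assumes "g summable_on S" and "\<And>x. x \<in> S \<Longrightarrow> norm (f x) \<le> g x"
  shows "norm (infsum f S) \<le> infsum g S"
proof -
  have s: "(\<lambda>x. norm (f x)) summable_on S"
    using assms by (rule Infinite_Sum.abs_summable_on_comparison_test')
  have "norm (infsum f S) \<le> (\<Sum>\<^sub>\<infinity>x\<in>S. norm (f x))"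
    using s by (rule norm_infsum_bound)
  also have "\<dots> \<le> infsum g S"
    using s assms by (intro infsum_mono) auto
  finally show ?thesis .
qed

lemma summable_on_square_mult:
  fixes f g :: "'a \<Rightarrow> real"
  assumes "(\<lambda>x. (f x)\<^sup>2) summable_on S" and "(\<lambda>x. (g x)\<^sup>2) summable_on S"
  shows "(\<lambda>x. f x * g x) summable_on S"
proof -
  have "(\<lambda>x. (f x)\<^sup>2 + (g x)\<^sup>2) summable_on S"
    using assms by (rule summable_on_add)
  moreover have "norm (f x * g x) \<le> (f x)\<^sup>2 + (g x)\<^sup>2" for x
  proof -
    have "0 \<le> (\<bar>f x\<bar> - \<bar>g x\<bar>)\<^sup>2" by simp
    also have "\<dots> = (f x)\<^sup>2 + (g x)\<^sup>2 - 2 * \<bar>f x * g x\<bar>"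
      by (simp add: power2_diff abs_mult)
    finally show ?thesis by simp
  qed
  ultimately have "(\<lambda>x. norm (f x * g x)) summable_on S"
    by (intro Infinite_Sum.abs_summable_on_comparison_test') auto
  then show ?thesis by (rule abs_summable_summable)
qed

lemma infsum_Cauchy_Schwarz:
  fixes f g :: "'a \<Rightarrow> real"
  assumes f: "(\<lambda>x. (f x)\<^sup>2) summable_on S" and g: "(\<lambda>x. (g x)\<^sup>2) summable_on S"
  shows "(infsum (\<lambda>x. f x * g x) S)\<^sup>2 \<le> infsum (\<lambda>x. (f x)\<^sup>2) S * infsum (\<lambda>x. (g x)\<^sup>2) S"
proof -
  let ?A = "infsum (\<lambda>x. (f x)\<^sup>2) S" and ?B = "infsum (\<lambda>x. (g x)\<^sup>2) S"
  have s: "(\<lambda>x. \<bar>f x\<bar> * \<bar>g x\<bar>) summable_on S"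
    by (rule summable_on_square_mult) (use f g in auto)
  have "infsum (\<lambda>x. \<bar>f x\<bar> * \<bar>g x\<bar>) S \<le> sqrt (?A * ?B)"
  proof (rule infsum_le_finite_sums[OF s])
    fix F assume F: "finite F" "F \<subseteq> S"
    have "(\<Sum>x\<in>F. \<bar>f x\<bar> * \<bar>g x\<bar>)\<^sup>2 \<le> (\<Sum>x\<in>F. \<bar>f x\<bar>\<^sup>2) * (\<Sum>x\<in>F. \<bar>g x\<bar>\<^sup>2)"
      by (rule Cauchy_Schwarz_ineq_sum)
    also have "\<dots> \<le> ?A * ?B"
      using F f g by (intro mult_mono) (auto intro!: finite_sum_le_infsum sum_nonneg infsum_nonneg)
    finally show "(\<Sum>x\<in>F. \<bar>f x\<bar> * \<bar>g x\<bar>) \<le> sqrt (?A * ?B)"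
      by (rule real_le_rsqrt)
  qed
  moreover have "\<bar>infsum (\<lambda>x. f x * g x) S\<bar> \<le> infsum (\<lambda>x. \<bar>f x\<bar> * \<bar>g x\<bar>) S"
    using norm_infsum_bound[of "\<lambda>x. f x * g x" S] s by (simp add: abs_mult)
  ultimately have "\<bar>infsum (\<lambda>x. f x * g x) S\<bar> \<le> sqrt (?A * ?B)" by simp
  then have "\<bar>infsum (\<lambda>x. f x * g x) S\<bar>\<^sup>2 \<le> (sqrt (?A * ?B))\<^sup>2"
    by (rule power_mono) simp
  moreover have "0 \<le> ?A * ?B" by (intro mult_nonneg_nonneg infsum_nonneg) auto
  ultimately show ?thesis by simp
qed

text \<open>Covers both ordinary convolutions and Hankel matrices, through the choice of \<open>\<phi>\<close>.\<close>

lemma Young_l2_l1: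
  fixes \<beta> :: "'c \<Rightarrow> real" and \<xi> :: "'b \<Rightarrow> real" and \<phi> :: "'b \<Rightarrow> 'a \<Rightarrow> 'c"
  assumes \<beta>: "\<And>i. 0 \<le> \<beta> i" "(\<lambda>i. (\<beta> i)\<^sup>2) summable_on UNIV"
    and \<xi>: "\<And>l. 0 \<le> \<xi> l" "\<xi> summable_on UNIV"
    and \<phi>: "\<And>l. inj (\<phi> l)"
  shows "(\<lambda>l. \<beta> (\<phi> l k) * \<xi> l) summable_on UNIV"
    and "(\<lambda>k. (infsum (\<lambda>l. \<beta> (\<phi> l k) * \<xi> l) UNIV)\<^sup>2) summable_on UNIV"
proof -
  let ?B = "infsum (\<lambda>i. (\<beta> i)\<^sup>2) UNIV" and ?X = "infsum \<xi> UNIV"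
  have B1: "(\<beta> i)\<^sup>2 \<le> ?B" for i
    using finite_sum_le_infsum[OF \<beta>(2), of "{i}"] by simp
  have s2: "(\<lambda>l. (\<beta> (\<phi> l k))\<^sup>2 * \<xi> l) summable_on UNIV" for k
    by (rule summable_on_real_le[OF summable_on_cmult_right[OF \<xi>(2), of ?B]])
      (use \<xi> B1 in \<open>auto intro!: mult_right_mono\<close>)
  \<comment> \<open>Splitting \<open>\<xi> l\<close> into two square roots before Cauchy-Schwarz
    leaves a factor \<open>?X\<close> outside. In the remaining sum, the sum over \<open>k\<close>
    is at most \<open>?B\<close> for each fixed \<open>l\<close>, as \<open>\<phi> l\<close> is
    injective.\<close>
  have sq: "(\<lambda>l. (\<beta> (\<phi> l k) * sqrt (\<xi> l))\<^sup>2) summable_on UNIV" "(\<lambda>l. (sqrt (\<xi> l))\<^sup>2) summable_on UNIV" for k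
    using s2[of k] \<xi> by (auto simp: power_mult_distrib)
  have e: "\<beta> (\<phi> l k) * sqrt (\<xi> l) * sqrt (\<xi> l) = \<beta> (\<phi> l k) * \<xi> l" for k l
    using \<xi>(1) by (simp add: mult.assoc)
  show "(\<lambda>l. \<beta> (\<phi> l k) * \<xi> l) summable_on UNIV" for k
    using summable_on_square_mult[OF sq] by (simp add: e)
  have le: "(infsum (\<lambda>l. \<beta> (\<phi> l k) * \<xi> l) UNIV)\<^sup>2 \<le> infsum (\<lambda>l. (\<beta> (\<phi> l k))\<^sup>2 * \<xi> l) UNIV * ?X" for k
    using infsum_Cauchy_Schwarz[OF sq, of k] \<xi>(1) by (simp add: e power_mult_distrib)
  show "(\<lambda>k. (infsum (\<lambda>l. \<beta> (\<phi> l k) * \<xi> l) UNIV)\<^sup>2) summable_on UNIV"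
  proof (rule nonneg_bounded_partial_sums_imp_summable_on[where C = "?B * ?X * ?X"])
    show "\<forall>\<^sub>F F in finite_subsets_at_top UNIV.
        (\<Sum>k\<in>F. (infsum (\<lambda>l. \<beta> (\<phi> l k) * \<xi> l) UNIV)\<^sup>2) \<le> ?B * ?X * ?X"
    proof (rule eventually_finite_subsets_at_top_weakI)
      fix F :: "'a set" assume F: "finite F"
      have "(\<Sum>k\<in>F. (infsum (\<lambda>l. \<beta> (\<phi> l k) * \<xi> l) UNIV)\<^sup>2)
          \<le> (\<Sum>k\<in>F. infsum (\<lambda>l. (\<beta> (\<phi> l k))\<^sup>2 * \<xi> l) UNIV * ?X)"
        by (rule sum_mono) (rule le)
      also have "\<dots> = infsum (\<lambda>l. \<Sum>k\<in>F. (\<beta> (\<phi> l k))\<^sup>2 * \<xi> l) UNIV * ?X"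
        using s2 by (simp add: infsum_sum_swap(1) sum_distrib_right[symmetric])
      also have "\<dots> \<le> infsum (\<lambda>l. ?B * \<xi> l) UNIV * ?X"
      proof (intro mult_right_mono infsum_mono)
        show "(\<Sum>k\<in>F. (\<beta> (\<phi> l k))\<^sup>2 * \<xi> l) \<le> ?B * \<xi> l" for l
        proof -
          have "(\<Sum>k\<in>F. (\<beta> (\<phi> l k))\<^sup>2) = (\<Sum>i\<in>\<phi> l ` F. (\<beta> i)\<^sup>2)"
            using \<phi>[of l] by (subst sum.reindex) (auto simp: inj_on_def)
          also have "\<dots> \<le> ?B"
            using F \<beta> by (intro finite_sum_le_infsum) auto
          finally show ?thesis
            using \<xi>(1)[of l] by (simp add: sum_distrib_right[symmetric] mult_right_mono)
        qed
      qed (use F s2 \<xi> in \<open>auto intro!: infsum_sum_swap(2) summable_on_cmult_right infsum_nonneg\<close>)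
      also have "\<dots> = ?B * ?X * ?X"
        using \<xi> by (simp add: infsum_cmult_right)
      finally show "(\<Sum>k\<in>F. (infsum (\<lambda>l. \<beta> (\<phi> l k) * \<xi> l) UNIV)\<^sup>2) \<le> ?B * ?X * ?X" .
    qed
  qed auto
qed

section \<open>Square summable families and the Hilbert-Schmidt matrices acting on them\<close>

definition ell2 :: "('a \<Rightarrow> complex) \<Rightarrow> bool" where
  "ell2 x \<longleftrightarrow> (\<lambda>i. (norm (x i))\<^sup>2) summable_on UNIV"

definition ell2_sq :: "('a \<Rightarrow> complex) \<Rightarrow> real" where
  "ell2_sq x = infsum (\<lambda>i. (norm (x i))\<^sup>2) UNIV"

definition mat_apply :: "('a \<Rightarrow> 'b \<Rightarrow> complex) \<Rightarrow> ('b \<Rightarrow> complex) \<Rightarrow> 'a \<Rightarrow> complex" where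
  "mat_apply K y m = infsum (\<lambda>l. K m l * y l) UNIV"

definition mat_adj :: "('a \<Rightarrow> 'b \<Rightarrow> complex) \<Rightarrow> 'b \<Rightarrow> 'a \<Rightarrow> complex" where
  "mat_adj K l m = cnj (K m l)"

definition hilbert_schmidt :: "('a \<Rightarrow> 'b \<Rightarrow> complex) \<Rightarrow> bool" where
  "hilbert_schmidt K \<longleftrightarrow> (\<lambda>(m, l). (norm (K m l))\<^sup>2) summable_on UNIV"

definition hs_sq :: "('a \<Rightarrow> 'b \<Rightarrow> complex) \<Rightarrow> real" where
  "hs_sq K = infsum (\<lambda>(m, l). (norm (K m l))\<^sup>2) UNIV"

lemma hilbert_schmidt_adj:
  assumes "hilbert_schmidt K"
  shows "hilbert_schmidt (mat_adj K)" and "hs_sq (mat_adj K) = hs_sq K"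
proof -
  have "((\<lambda>(m, l). (norm (K m l))\<^sup>2) has_sum hs_sq K) UNIV"
    using assms unfolding hilbert_schmidt_def hs_sq_def by (rule has_sum_infsum)
  then have "((\<lambda>(l, m). (norm (mat_adj K l m))\<^sup>2) has_sum hs_sq K) UNIV"
    by (subst has_sum_reindex_bij_witness[of _ prod.swap prod.swap UNIV "\<lambda>(m, l). (norm (K m l))\<^sup>2" _ "hs_sq K"])
      (auto simp: mat_adj_def)
  then show "hilbert_schmidt (mat_adj K)" and "hs_sq (mat_adj K) = hs_sq K"
    unfolding hilbert_schmidt_def hs_sq_def by (auto simp: has_sum_imp_summable infsumI)
qed

lemma hilbert_schmidt_rows:
  assumes "hilbert_schmidt K"
  shows "ell2 (K m)" and "(\<lambda>m. ell2_sq (K m)) summable_on UNIV" and "infsum (\<lambda>m. ell2_sq (K m)) UNIV = hs_sq K"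
proof -
  have s: "(\<lambda>(m, l). (norm (K m l))\<^sup>2) summable_on (UNIV \<times> UNIV)"
    using assms by (simp add: hilbert_schmidt_def)
  show "ell2 (K m)"
    using summable_on_SigmaD1[OF s, of m] by (simp add: ell2_def)
  show "(\<lambda>m. ell2_sq (K m)) summable_on UNIV"
    using summable_on_Sigma_banach[OF s] by (simp add: ell2_sq_def)
  show "infsum (\<lambda>m. ell2_sq (K m)) UNIV = hs_sq K"
    using infsum_Sigma_banach[OF s] by (simp add: ell2_sq_def hs_sq_def)
qed

lemma hs_sq_nonneg: "0 \<le> hs_sq K"
  unfolding hs_sq_def by (intro infsum_nonneg) auto

lemma ell2_sq_nonneg: "0 \<le> ell2_sq x"
  unfolding ell2_sq_def by (intro infsum_nonneg) auto

lemma ell2_norm_le: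
  assumes "ell2 x"
  shows "(norm (x i))\<^sup>2 \<le> ell2_sq x"
  using finite_sum_le_infsum[of "\<lambda>i. (norm (x i))\<^sup>2" UNIV "{i}"] assms
  by (simp add: ell2_def ell2_sq_def)

lemma ell2_mult_summable:
  assumes "ell2 x" "ell2 y"
  shows "(\<lambda>i. x i * y i) summable_on UNIV"
    and "(norm (infsum (\<lambda>i. x i * y i) UNIV))\<^sup>2 \<le> ell2_sq x * ell2_sq y"
proof -
  have x: "(\<lambda>i. (norm (x i))\<^sup>2) summable_on UNIV" and y: "(\<lambda>i. (norm (y i))\<^sup>2) summable_on UNIV"
    using assms by (auto simp: ell2_def)
  have s: "(\<lambda>i. norm (x i) * norm (y i)) summable_on UNIV"
    using x y by (rule summable_on_square_mult)
  show "(\<lambda>i. x i * y i) summable_on UNIV"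
    using s by (rule summable_on_norm_le) (simp add: norm_mult)
  have "norm (infsum (\<lambda>i. x i * y i) UNIV) \<le> infsum (\<lambda>i. norm (x i) * norm (y i)) UNIV"
    using s by (rule norm_infsum_le_infsum) (simp add: norm_mult)
  then have "(norm (infsum (\<lambda>i. x i * y i) UNIV))\<^sup>2 \<le> (infsum (\<lambda>i. norm (x i) * norm (y i)) UNIV)\<^sup>2"
    by (rule power_mono) simp
  also have "\<dots> \<le> ell2_sq x * ell2_sq y"
    unfolding ell2_sq_def using x y by (rule infsum_Cauchy_Schwarz)
  finally show "(norm (infsum (\<lambda>i. x i * y i) UNIV))\<^sup>2 \<le> ell2_sq x * ell2_sq y" .
qed

lemma mat_apply_ell2:
  assumes K: "hilbert_schmidt K" and y: "ell2 y"
  shows "ell2 (mat_apply K y)" and "ell2_sq (mat_apply K y) \<le> hs_sq K * ell2_sq y"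
proof -
  have le: "(norm (mat_apply K y m))\<^sup>2 \<le> ell2_sq (K m) * ell2_sq y" for m
    unfolding mat_apply_def using hilbert_schmidt_rows(1)[OF K] y by (rule ell2_mult_summable)
  have s: "(\<lambda>m. ell2_sq (K m) * ell2_sq y) summable_on UNIV"
    using hilbert_schmidt_rows(2)[OF K] by (rule summable_on_cmult_left)
  show e: "ell2 (mat_apply K y)"
    unfolding ell2_def using s by (rule summable_on_real_le) (use le in auto)
  have "ell2_sq (mat_apply K y) \<le> infsum (\<lambda>m. ell2_sq (K m) * ell2_sq y) UNIV"
    unfolding ell2_sq_def[of "mat_apply K y"] using e s le by (intro infsum_mono) (auto simp: ell2_def)
  also have "\<dots> = hs_sq K * ell2_sq y"
    using hilbert_schmidt_rows[OF K] by (simp add: infsum_cmult_left)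
  finally show "ell2_sq (mat_apply K y) \<le> hs_sq K * ell2_sq y" .
qed

text \<open>Exchanging the two sums is legitimate because \<open>K\<close> and the family
  \<open>x m * y l\<close> are both square summable over the index pairs, so their product is
  absolutely summable there.\<close>

lemma mat_apply_adj:
  assumes K: "hilbert_schmidt K" and x: "ell2 x" and y: "ell2 y"
  shows "infsum (\<lambda>m. mat_apply K y m * cnj (x m)) UNIV = infsum (\<lambda>l. y l * cnj (mat_apply (mat_adj K) x l)) UNIV"
proof -
  have "(\<lambda>(m, l). (norm (x m))\<^sup>2 * (norm (y l))\<^sup>2) summable_on UNIV"
    using x y unfolding ell2_def
    by (intro summable_on_prod_nonneg) (auto simp: infsum_cmult_right' intro!: summable_on_cmult_right summable_on_cmult_left)
  then have xy: "(\<lambda>(m, l). (norm (x m) * norm (y l))\<^sup>2) summable_on UNIV"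
    by (simp add: power_mult_distrib)
  have "(\<lambda>p. (norm (K (fst p) (snd p)))\<^sup>2) summable_on UNIV"
    "(\<lambda>p. (norm (x (fst p)) * norm (y (snd p)))\<^sup>2) summable_on UNIV"
    using K xy by (simp_all add: hilbert_schmidt_def case_prod_unfold)
  then have "(\<lambda>p. norm (K (fst p) (snd p)) * (norm (x (fst p)) * norm (y (snd p)))) summable_on UNIV"
    by (rule summable_on_square_mult)
  then have s: "(\<lambda>(m, l). K m l * y l * cnj (x m)) summable_on (UNIV \<times> UNIV)"
    by (simp add: case_prod_unfold) (rule summable_on_norm_le, auto simp: norm_mult)
  have "infsum (\<lambda>m. mat_apply K y m * cnj (x m)) UNIV = infsum (\<lambda>m. infsum (\<lambda>l. K m l * y l * cnj (x m)) UNIV) UNIV"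
    unfolding mat_apply_def
    by (intro infsum_cong infsum_cmult_left[symmetric] ell2_mult_summable hilbert_schmidt_rows K y)
  also have "\<dots> = infsum (\<lambda>l. infsum (\<lambda>m. K m l * y l * cnj (x m)) UNIV) UNIV"
    using s by (rule infsum_swap_banach)
  also have "\<dots> = infsum (\<lambda>l. y l * cnj (mat_apply (mat_adj K) x l)) UNIV"
  proof (intro infsum_cong)
    fix l
    have "(\<lambda>m. cnj (mat_adj K l m * x m)) summable_on UNIV"
      using ell2_mult_summable(1)[OF hilbert_schmidt_rows(1)[OF hilbert_schmidt_adj(1)[OF K]] x]
      by (subst summable_on_cnj_iff)
    then have "infsum (\<lambda>m. y l * cnj (mat_adj K l m * x m)) UNIV = y l * infsum (\<lambda>m. cnj (mat_adj K l m * x m)) UNIV"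
      by (rule infsum_cmult_right)
    then show "infsum (\<lambda>m. K m l * y l * cnj (x m)) UNIV = y l * cnj (mat_apply (mat_adj K) x l)"
      by (simp add: mat_apply_def mat_adj_def mult.assoc mult.left_commute flip: infsum_cnj)
  qed
  finally show ?thesis .
qed

text \<open>Since \<open>\<parallel>T T\<^sup>* x\<parallel>\<^sup>2 \<le> \<parallel>T\<parallel>\<^sup>2 \<langle>T T\<^sup>* x, x\<rangle>\<close>, the map \<open>x \<mapsto> x - \<tau> (x + T T\<^sup>* x)\<close> is a contraction
  with constant \<open>1 - \<tau>\<close> for \<open>\<tau> = 2 / (2 + \<parallel>T\<parallel>\<^sup>2)\<close>.\<close>

lemma hs_contraction:
  fixes K :: "'a \<Rightarrow> 'b \<Rightarrow> complex"
  assumes K: "hilbert_schmidt K" and x: "ell2 x"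
  defines "\<tau> \<equiv> 2 / (2 + hs_sq K)"
  defines "y \<equiv> \<lambda>k. x k - of_real \<tau> * (x k + mat_apply K (mat_apply (mat_adj K) x) k)"
  shows "ell2 y" and "ell2_sq y \<le> (1 - \<tau>)\<^sup>2 * ell2_sq x"
proof -
  define t where "t = mat_apply (mat_adj K) x"
  define z where "z = mat_apply K t"
  have t: "ell2 t" unfolding t_def by (intro mat_apply_ell2 hilbert_schmidt_adj K x)
  have z: "ell2 z" and zt: "ell2_sq z \<le> hs_sq K * ell2_sq t"
    unfolding z_def by (intro mat_apply_ell2 K t)+
  have e: "infsum (\<lambda>k. z k * cnj (x k)) UNIV = of_real (ell2_sq t)"
  proof -
    have "infsum (\<lambda>k. z k * cnj (x k)) UNIV = infsum (\<lambda>l. t l * cnj (t l)) UNIV"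
      unfolding z_def using mat_apply_adj[OF K x t] by (simp add: t_def)
    also have "\<dots> = infsum (\<lambda>l. of_real ((norm (t l))\<^sup>2)) UNIV"
      by (intro infsum_cong) (simp add: complex_norm_square[symmetric])
    also have "\<dots> = of_real (ell2_sq t)"
      unfolding ell2_sq_def by (rule infsumI, rule has_sum_of_real, rule has_sum_infsum)
        (use t in \<open>simp add: ell2_def\<close>)
    finally show ?thesis .
  qed
  have cx: "ell2 (\<lambda>k. cnj (x k))" using x by (simp add: ell2_def)
  have zx: "((\<lambda>k. Re (z k * cnj (x k))) has_sum ell2_sq t) UNIV"
    using has_sum_Re[OF has_sum_infsum[OF ell2_mult_summable(1)[OF z cx]]] by (simp add: e)
  have xs: "((\<lambda>k. (norm (x k))\<^sup>2) has_sum ell2_sq x) UNIV"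
    and zs: "((\<lambda>k. (norm (z k))\<^sup>2) has_sum ell2_sq z) UNIV"
    using x z unfolding ell2_def ell2_sq_def by (auto intro!: has_sum_infsum)
  have y: "(norm (y k))\<^sup>2 = (1 - \<tau>)\<^sup>2 * (norm (x k))\<^sup>2 + (- (2 * \<tau> * (1 - \<tau>)) * Re (z k * cnj (x k)) + \<tau>\<^sup>2 * (norm (z k))\<^sup>2)" for k
  proof -
    have yk: "y k = of_real (1 - \<tau>) * x k - of_real \<tau> * z k"
      by (simp add: y_def z_def t_def algebra_simps)
    show ?thesis
      unfolding cmod_power2 yk by (simp add: power2_eq_square algebra_simps)
  qed
  have "((\<lambda>k. (norm (y k))\<^sup>2) has_sum ((1 - \<tau>)\<^sup>2 * ell2_sq x + (- (2 * \<tau> * (1 - \<tau>)) * ell2_sq t + \<tau>\<^sup>2 * ell2_sq z))) UNIV"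
    unfolding y by (intro has_sum_add has_sum_cmult_right xs zx zs)
  then have "ell2 y" and "ell2_sq y = (1 - \<tau>)\<^sup>2 * ell2_sq x + (- (2 * \<tau> * (1 - \<tau>)) * ell2_sq t + \<tau>\<^sup>2 * ell2_sq z)"
    unfolding ell2_def ell2_sq_def by (auto simp: has_sum_imp_summable infsumI)
  moreover have "\<tau>\<^sup>2 * ell2_sq z \<le> \<tau>\<^sup>2 * (hs_sq K * ell2_sq t)"
    using zt by (intro mult_left_mono) auto
  \<comment> \<open>The origin of \<open>\<tau>\<close>: it is the value for which the quadratic
    term, estimated by \<open>hs_sq K\<close>, cancels the cross term exactly.\<close>
  moreover have "\<tau>\<^sup>2 * (hs_sq K * ell2_sq t) = 2 * \<tau> * (1 - \<tau>) * ell2_sq t"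
    using hs_sq_nonneg[of K] by (simp add: \<tau>_def field_simps power2_eq_square)
  ultimately show "ell2 y" and "ell2_sq y \<le> (1 - \<tau>)\<^sup>2 * ell2_sq x" by auto
qed

section \<open>Neumann series for the positive definite equation\<close>

lemma L2_set_norm_sum_le:
  "L2_set (\<lambda>k. norm (\<Sum>i<n::nat. d i k :: complex)) F \<le> (\<Sum>i<n. L2_set (\<lambda>k. norm (d i k)) F)"
proof (induction n)
  case (Suc n)
  have "L2_set (\<lambda>k. norm (\<Sum>i<Suc n. d i k)) F \<le> L2_set (\<lambda>k. norm (\<Sum>i<n. d i k) + norm (d n k)) F"
    by (rule L2_set_mono) (auto intro: norm_triangle_ineq)
  also have "\<dots> \<le> L2_set (\<lambda>k. norm (\<Sum>i<n. d i k)) F + L2_set (\<lambda>k. norm (d n k)) F"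
    by (rule L2_set_triangle_ineq)
  finally show ?case using Suc by simp
qed (simp add: L2_set_def)

text \<open>Minkowski's inequality bounds the partial sums on every finite index set by the same
  constant \<open>C / (1 - q)\<close>; the bound survives the pointwise limit on a finite set, and
  finite sets suffice for square summability.\<close>

lemma geometric_ell2_series:
  fixes d :: "nat \<Rightarrow> 'a \<Rightarrow> complex"
  assumes d: "\<And>i. ell2 (d i)" "\<And>i. ell2_sq (d i) \<le> (q ^ i * C)\<^sup>2" and q: "0 \<le> q" "q < 1" and C: "0 \<le> C"
  shows "summable (\<lambda>i. norm (d i k))" and "ell2 (\<lambda>k. \<Sum>i. d i k)"
proof -
  have le: "norm (d i k) \<le> q ^ i * C" for i k
  proof -
    have "(norm (d i k))\<^sup>2 \<le> (q ^ i * C)\<^sup>2"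
      using ell2_norm_le[OF d(1), of i k] d(2)[of i] by linarith
    then show ?thesis
      by (rule power2_le_imp_le) (use q C in auto)
  qed
  have sq: "summable (\<lambda>i. q ^ i * C)"
    using q by (intro summable_mult2 summable_geometric) auto
  show sd: "summable (\<lambda>i. norm (d i k))" for k
    by (rule summable_comparison_test'[OF sq, of 0]) (use le in auto)
  have "L2_set (\<lambda>k. norm (\<Sum>i. d i k)) F \<le> C / (1 - q)" for F :: "'a set"
  proof -
    have "(\<lambda>n. L2_set (\<lambda>k. norm (\<Sum>i<n. d i k)) F) \<longlonglongrightarrow> L2_set (\<lambda>k. norm (\<Sum>i. d i k)) F"
      unfolding L2_set_def
      by (intro tendsto_intros summable_LIMSEQ summable_norm_cancel[OF sd])
    moreover have "L2_set (\<lambda>k. norm (\<Sum>i<n. d i k)) F \<le> C / (1 - q)" for n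
    proof -
      have "L2_set (\<lambda>k. norm (d i k)) F \<le> q ^ i * C" for i
      proof (cases "finite F")
        case True
        have "(\<Sum>k\<in>F. (norm (d i k))\<^sup>2) \<le> ell2_sq (d i)"
          unfolding ell2_sq_def using d(1)[of i] True by (intro finite_sum_le_infsum) (auto simp: ell2_def)
        also have "\<dots> \<le> (q ^ i * C)\<^sup>2" by (rule d)
        finally have "sqrt (\<Sum>k\<in>F. (norm (d i k))\<^sup>2) \<le> sqrt ((q ^ i * C)\<^sup>2)" by (rule real_sqrt_le_mono)
        then show ?thesis using q C by (simp add: L2_set_def)
      qed (use q C in \<open>simp add: L2_set_def\<close>)
      then have "L2_set (\<lambda>k. norm (\<Sum>i<n. d i k)) F \<le> (\<Sum>i<n. q ^ i * C)"
        by (intro order_trans[OF L2_set_norm_sum_le] sum_mono)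
      also have "\<dots> \<le> (\<Sum>i. q ^ i * C)"
        using sq q C by (intro sum_le_suminf) auto
      also have "\<dots> = C / (1 - q)"
        using q by (subst suminf_mult2[symmetric]) (auto simp: suminf_geometric)
      finally show ?thesis .
    qed
    ultimately show ?thesis by (intro LIMSEQ_le_const2) auto
  qed
  then have L: "(\<Sum>k\<in>F. (norm (\<Sum>i. d i k))\<^sup>2) \<le> (C / (1 - q))\<^sup>2" for F :: "'a set"
    unfolding L2_set_def by (rule sqrt_le_D)
  show "ell2 (\<lambda>k. \<Sum>i. d i k)"
    unfolding ell2_def
    by (rule nonneg_bounded_partial_sums_imp_summable_on[where C = "(C / (1 - q))\<^sup>2"])
      (use L in \<open>auto intro!: eventually_finite_subsets_at_top_weakI\<close>)
qed

text \<open>A summable row combined with the geometric bound, uniform in \<open>l\<close>, makes the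
  double series absolutely convergent, so a matrix may be applied term by term.\<close>

lemma mat_apply_geometric_series:
  fixes d :: "nat \<Rightarrow> 'b \<Rightarrow> complex"
  assumes K: "\<And>m. K m summable_on UNIV"
    and d: "\<And>i l. norm (d i l) \<le> q ^ i * C" and q: "0 \<le> q" "q < 1" and C: "0 \<le> C"
  shows "(\<lambda>i. mat_apply K (d i) m) sums mat_apply K (\<lambda>l. \<Sum>i. d i l) m"
proof -
  have sq: "summable (\<lambda>i. q ^ i * C)"
    using q by (intro summable_mult2 summable_geometric) auto
  then have sq': "(\<lambda>i. q ^ i * C) summable_on UNIV"
    by (rule summable_nonneg_imp_summable_on) (use q C in auto)
  have sd: "summable (\<lambda>i. norm (d i k))" for k
    by (rule summable_comparison_test'[OF sq, of 0]) (use d in auto)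
  then have sd': "(\<Sum>i. d i k) = infsum (\<lambda>i. d i k) UNIV" "(\<lambda>i. d i k) summable_on UNIV" for k
    using norm_summable_imp_has_sum[of "\<lambda>i. d i k" "\<Sum>i. d i k"] summable_norm_cancel[OF sd]
    by (auto simp: has_sum_iff summable_sums)
  have Kn: "(\<lambda>l. norm (K m l)) summable_on UNIV"
    using K[of m] by (simp add: summable_on_iff_abs_summable_on_complex)
  have "(\<lambda>(i, l). norm (K m l) * (q ^ i * C)) summable_on UNIV"
    using q C by (intro summable_on_prod_nonneg)
      (auto simp: infsum_cmult_left' intro!: summable_on_cmult_left summable_on_cmult_right Kn sq')
  then have s: "(\<lambda>(i, l). K m l * d i l) summable_on (UNIV \<times> UNIV)"
    by simp (rule summable_on_norm_le, assumption, use d in \<open>auto simp: norm_mult intro!: mult_left_mono\<close>)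
  have "((\<lambda>i. mat_apply K (d i) m) has_sum infsum (\<lambda>i. mat_apply K (d i) m) UNIV) UNIV"
    using summable_on_Sigma_banach[OF s] by (intro has_sum_infsum) (simp add: mat_apply_def)
  also have "infsum (\<lambda>i. mat_apply K (d i) m) UNIV = infsum (\<lambda>l. infsum (\<lambda>i. K m l * d i l) UNIV) UNIV"
    unfolding mat_apply_def using s by (rule infsum_swap_banach)
  also have "\<dots> = mat_apply K (\<lambda>l. \<Sum>i. d i l) m"
    unfolding mat_apply_def sd' by (intro infsum_cong infsum_cmult_right sd')
  finally show ?thesis by (rule has_sum_imp_sums)
qed

text \<open>The inverse of \<open>1 + K K*\<close> is \<open>\<tau>\<close> times the Neumann series
  of the contraction \<open>x - \<tau> (x + K K* x)\<close>, here started at \<open>f\<close>.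
  Summability of rows and columns allows \<open>K\<close> and its adjoint to be applied termwise, as
  the terms decay geometrically in the supremum norm.\<close>

lemma solve_positive_hs:
  fixes K :: "'a \<Rightarrow> 'b \<Rightarrow> complex"
  assumes K: "hilbert_schmidt K" and rows: "\<And>m. K m summable_on UNIV"
    and cols: "\<And>l. (\<lambda>m. K m l) summable_on UNIV" and f: "ell2 f"
  obtains u where "ell2 u" and "\<And>k. u k + mat_apply K (mat_apply (mat_adj K) u) k = f k"
proof -
  define \<tau> where "\<tau> = 2 / (2 + hs_sq K)"
  define A where "A x = mat_apply K (mat_apply (mat_adj K) x)" for x
  define d where "d i = ((\<lambda>x k. x k - of_real \<tau> * (x k + A x k)) ^^ i) f" for i
  define q where "q = 1 - \<tau>"
  have q: "0 \<le> q" "q < 1" and \<tau>: "0 < \<tau>"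
    using hs_sq_nonneg[of K] by (auto simp: q_def \<tau>_def)
  have dS: "d (Suc i) = (\<lambda>k. d i k - of_real \<tau> * (d i k + A (d i) k))" for i
    by (simp add: d_def)
  have d: "ell2 (d i) \<and> ell2_sq (d i) \<le> (q ^ i * sqrt (ell2_sq f))\<^sup>2" for i
  proof (induction i)
    case (Suc i)
    then have "ell2 (d (Suc i))" "ell2_sq (d (Suc i)) \<le> q\<^sup>2 * ell2_sq (d i)"
      using hs_contraction[OF K, of "d i"] unfolding dS A_def q_def \<tau>_def by auto
    moreover have "q\<^sup>2 * ell2_sq (d i) \<le> q\<^sup>2 * (q ^ i * sqrt (ell2_sq f))\<^sup>2"
      using Suc by (intro mult_left_mono) auto
    ultimately show ?case by (simp add: power_mult_distrib mult.assoc)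
  qed (use f ell2_sq_nonneg[of f] in \<open>simp add: d_def\<close>)
  define C where "C = sqrt (ell2_sq f)"
  have C: "0 \<le> C" by (simp add: C_def ell2_sq_nonneg)
  have d1: "ell2 (d i)" and d2: "ell2_sq (d i) \<le> (q ^ i * C)\<^sup>2" for i
    using d by (auto simp: C_def)
  have dn: "norm (d i k) \<le> q ^ i * C" for i k
    by (rule power2_le_imp_le, rule order_trans[OF ell2_norm_le[OF d1] d2]) (use q C in auto)
  define t where "t i = mat_apply (mat_adj K) (d i)" for i
  define D where "D = sqrt (hs_sq K) * C"
  have D: "0 \<le> D" by (simp add: D_def C hs_sq_nonneg)
  have tn: "norm (t i k) \<le> q ^ i * D" for i k
  proof -
    have "(norm (t i k))\<^sup>2 \<le> ell2_sq (t i)"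
      unfolding t_def by (intro ell2_norm_le mat_apply_ell2 hilbert_schmidt_adj K d1)
    also have "\<dots> \<le> hs_sq K * ell2_sq (d i)"
      unfolding t_def using mat_apply_ell2(2)[OF hilbert_schmidt_adj(1)[OF K] d1] hilbert_schmidt_adj(2)[OF K] by simp
    also have "\<dots> \<le> hs_sq K * (q ^ i * C)\<^sup>2"
      by (intro mult_left_mono d2 hs_sq_nonneg)
    also have "\<dots> = (q ^ i * D)\<^sup>2"
      by (simp add: D_def power_mult_distrib hs_sq_nonneg)
    finally show ?thesis by (rule power2_le_imp_le) (use q D in auto)
  qed
  note s = geometric_ell2_series(1)[OF d1 d2 q C] and u2 = geometric_ell2_series(2)[OF d1 d2 q C]
  define u where "u = (\<lambda>k. of_real \<tau> * (\<Sum>i. d i k))"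
  define s0 where "s0 = (\<lambda>k. \<Sum>i. d i k)"
  have adjrows: "mat_adj K l summable_on UNIV" for l
    using cols[of l] by (simp add: mat_adj_def[abs_def] summable_on_cnj_iff)
  have t_sums: "(\<lambda>i. t i l) sums mat_apply (mat_adj K) s0 l" for l
    unfolding t_def s0_def by (rule mat_apply_geometric_series[OF adjrows dn q C])
  then have "mat_apply (mat_adj K) s0 = (\<lambda>l. \<Sum>i. t i l)"
    by (auto simp: sums_iff)
  then have A_sums: "(\<lambda>i. A (d i) k) sums A s0 k" for k
    using mat_apply_geometric_series[where K = K and m = k, OF rows tn q D] by (simp add: A_def t_def)
  \<comment> \<open>The series of \<open>d (Suc i)\<close> is summed twice, by the recursion and by
    an index shift. The two results differ only in that \<open>d 0 = f\<close> replaces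
    \<open>\<tau> (s0 + A s0)\<close>, which explains the factor \<open>\<tau>\<close> in
    \<open>u\<close>.\<close>
  have eq: "s0 k + A s0 k = f k / of_real \<tau>" for k
  proof -
    have s1: "(\<lambda>i. d i k) sums s0 k"
      unfolding s0_def by (rule summable_sums[OF summable_norm_cancel[OF s]])
    have "(\<lambda>i. d (Suc i) k) sums (s0 k - of_real \<tau> * (s0 k + A s0 k))"
      unfolding dS by (intro sums_diff sums_mult sums_add s1 A_sums)
    moreover have "(\<lambda>i. d (Suc i) k) sums (s0 k - d 0 k)"
      using s1 sums_Suc_iff[of "\<lambda>i. d i k" "s0 k - d 0 k"] by simp
    ultimately have "s0 k - of_real \<tau> * (s0 k + A s0 k) = s0 k - d 0 k"
      by (rule sums_unique2)
    then have "of_real \<tau> * (s0 k + A s0 k) = d 0 k" by simp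
    then have "(s0 k + A s0 k) * of_real \<tau> = f k" by (simp add: d_def mult.commute)
    then show ?thesis using \<tau> by (simp only: nonzero_eq_divide_eq of_real_eq_0_iff less_imp_neq[symmetric] not_False_eq_True)
  qed
  have lin: "mat_apply M (\<lambda>k. c * x k) m = c * mat_apply M x m" for M :: "'x \<Rightarrow> 'y \<Rightarrow> complex" and c x m
  proof -
    have "mat_apply M (\<lambda>k. c * x k) m = infsum (\<lambda>l. c * (M m l * x l)) UNIV"
      unfolding mat_apply_def by (intro infsum_cong) (simp add: mult_ac)
    then show ?thesis by (simp add: mat_apply_def infsum_cmult_right')
  qed
  have lin2: "mat_apply M (\<lambda>k. c * x k) = (\<lambda>m. c * mat_apply M x m)" for M :: "'x \<Rightarrow> 'y \<Rightarrow> complex" and c x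
    by (rule ext) (rule lin)
  have "u k + A u k = f k" for k
  proof -
    have "u k + A u k = of_real \<tau> * (s0 k + A s0 k)"
      unfolding u_def A_def lin2 by (simp add: s0_def distrib_left)
    then show ?thesis unfolding eq using \<tau> by simp
  qed
  moreover have "ell2 u"
    unfolding ell2_def u_def using u2
    by (auto simp: ell2_def norm_mult power_mult_distrib intro!: summable_on_cmult_right)
  ultimately show thesis using that by (auto simp: A_def)
qed

section \<open>Summation over the integers\<close>

lemma bij_int_shift [simp]: "bij (\<lambda>m::int. m + c)" "bij (\<lambda>m::int. m - c)" "bij (\<lambda>m::int. c - m)" "bij (uminus :: int \<Rightarrow> int)"
proof -
  show "bij (\<lambda>m::int. m + c)" by (rule bij_betw_byWitness[where f' = "\<lambda>m. m - c"]) auto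
  show "bij (\<lambda>m::int. m - c)" by (rule bij_betw_byWitness[where f' = "\<lambda>m. m + c"]) auto
  show "bij (\<lambda>m::int. c - m)" by (rule bij_betw_byWitness[where f' = "\<lambda>m. c - m"]) auto
  show "bij (uminus :: int \<Rightarrow> int)" by (rule bij_betw_byWitness[where f' = uminus]) auto
qed

lemma summable_on_int_shift:
  fixes x :: "int \<Rightarrow> 'a::{comm_monoid_add, topological_space}"
  shows "(\<lambda>m. x (m + c)) summable_on UNIV \<longleftrightarrow> x summable_on UNIV"
    and "(\<lambda>m. x (m - c)) summable_on UNIV \<longleftrightarrow> x summable_on UNIV"
    and "(\<lambda>m. x (c - m)) summable_on UNIV \<longleftrightarrow> x summable_on UNIV"
    and "(\<lambda>m. x (- m)) summable_on UNIV \<longleftrightarrow> x summable_on UNIV"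
  using bij_int_shift by (auto intro!: summable_on_reindex_bij_betw)

lemma summable_on_int_split:
  fixes f :: "int \<Rightarrow> 'a::banach"
  assumes "(\<lambda>n. f (int n)) summable_on UNIV" and "(\<lambda>n. f (- int n)) summable_on UNIV"
  shows "f summable_on UNIV"
proof -
  have "f summable_on (range int)"
    using assms(1) by (subst summable_on_reindex) (auto simp: o_def)
  moreover have "f summable_on (range (\<lambda>n. - int n))"
    using assms(2) by (subst summable_on_reindex) (auto simp: o_def inj_on_def)
  then have "f summable_on (range (\<lambda>n. - int n) - range int)"
    by (rule summable_on_subset_banach) auto
  ultimately have "f summable_on (range int \<union> (range (\<lambda>n. - int n) - range int))"
    by (intro summable_on_Un_disjoint) auto
  also have "range int \<union> (range (\<lambda>n. - int n) - range int) = UNIV"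
    by (auto simp: image_iff) (metis int_cases2)
  finally show ?thesis .
qed

subsection \<open>Weighted sequences and convolution\<close>

text \<open>The summand 1 keeps all powers positive and makes the weight submultiplicative, so that
  an index shift costs only a constant factor.\<close>

definition bracket :: "int \<Rightarrow> real" where
  "bracket m = 1 + real_of_int \<bar>m\<bar>"

lemma bracket_pos [simp]: "0 < bracket m" "0 \<le> bracket m" "1 \<le> bracket m" "bracket m \<noteq> 0"
  by (auto simp: bracket_def)

lemma bracket_uminus [simp]: "bracket (- m) = bracket m"
  by (simp add: bracket_def)

lemma bracket_add_le: "bracket (m + l) \<le> bracket m * bracket l"
proof -
  have "real_of_int \<bar>m + l\<bar> \<le> real_of_int \<bar>m\<bar> + real_of_int \<bar>l\<bar>" by linarith
  also have "\<dots> \<le> real_of_int \<bar>m\<bar> + real_of_int \<bar>l\<bar> + real_of_int \<bar>m\<bar> * real_of_int \<bar>l\<bar>" by simp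
  finally show ?thesis by (simp add: bracket_def algebra_simps)
qed

lemma summable_bracket_powr:
  assumes "s < -1"
  shows "(\<lambda>m. bracket m powr s) summable_on UNIV"
proof (rule summable_on_int_split)
  have "summable (\<lambda>n. real n powr s)" using assms by (simp add: summable_real_powr_iff)
  then have "summable (\<lambda>n. real (Suc n) powr s)" by (subst summable_Suc_iff)
  then have "summable (\<lambda>n. bracket (int n) powr s)" by (simp add: bracket_def add.commute)
  then show *: "(\<lambda>n. bracket (int n) powr s) summable_on UNIV"
    by (rule summable_nonneg_imp_summable_on) auto
  then show "(\<lambda>n. bracket (- int n) powr s) summable_on UNIV" by simp
qed

text \<open>For \<open>s = k\<close> this describes the Fourier coefficients of the functions in the
  Sobolev space of order \<open>k\<close> on the circle. Fractional \<open>s\<close> serve as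
  intermediate stages in the gain of regularity.\<close>

definition wt :: "real \<Rightarrow> (int \<Rightarrow> complex) \<Rightarrow> bool" where
  "wt s x \<longleftrightarrow> (\<lambda>m. (bracket m powr s * norm (x m))\<^sup>2) summable_on UNIV"

lemma wt_le:
  assumes "wt t x" and "\<And>m. bracket m powr s * norm (y m) \<le> C * (bracket m powr t * norm (x m))"
  shows "wt s y"
proof -
  have "(\<lambda>m. C\<^sup>2 * (bracket m powr t * norm (x m))\<^sup>2) summable_on UNIV"
    using assms(1) unfolding wt_def by (rule summable_on_cmult_right)
  then show ?thesis
    unfolding wt_def
  proof (rule summable_on_real_le)
    fix m
    have "(bracket m powr s * norm (y m))\<^sup>2 \<le> (C * (bracket m powr t * norm (x m)))\<^sup>2"
      using assms(2) by (rule power_mono) simp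
    then show "(bracket m powr s * norm (y m))\<^sup>2 \<le> C\<^sup>2 * (bracket m powr t * norm (x m))\<^sup>2"
      by (simp add: power_mult_distrib)
  qed simp
qed

lemma wt_norm_le:
  assumes "wt s x" and "\<And>m. norm (y m) \<le> C * norm (x m)"
  shows "wt s y"
proof (rule wt_le[OF assms(1), where C = C])
  fix m
  have "bracket m powr s * norm (y m) \<le> bracket m powr s * (C * norm (x m))"
    using assms(2) by (intro mult_left_mono) auto
  then show "bracket m powr s * norm (y m) \<le> C * (bracket m powr s * norm (x m))"
    by (simp add: mult_ac)
qed

lemma wt_mono:
  assumes "wt s x" and "t \<le> s"
  shows "wt t x"
  by (rule wt_le[OF assms(1), where C = 1]) (auto intro!: mult_right_mono powr_mono assms)

lemma wt_cmult: "wt s x \<Longrightarrow> wt s (\<lambda>m. c * x m)"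
  by (erule wt_norm_le[where C = "norm c"]) (simp add: norm_mult)

lemma wt_uminus: "wt s x \<Longrightarrow> wt s (\<lambda>m. - x m)"
  by (erule wt_norm_le[where C = 1]) simp

lemma wt_cnj: "wt s x \<Longrightarrow> wt s (\<lambda>m. cnj (x m))"
  by (erule wt_norm_le[where C = 1]) simp

lemma wt_if: "wt s x \<Longrightarrow> wt s (\<lambda>m. if P m then x m else 0)"
  by (erule wt_norm_le[where C = 1]) simp

lemma wt_add:
  assumes "wt s x" "wt s y"
  shows "wt s (\<lambda>m. x m + y m)"
proof -
  have "(\<lambda>m. 2 * ((bracket m powr s * norm (x m))\<^sup>2 + (bracket m powr s * norm (y m))\<^sup>2)) summable_on UNIV"
    using assms unfolding wt_def by (intro summable_on_cmult_right summable_on_add)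
  then show ?thesis
    unfolding wt_def
  proof (rule summable_on_real_le)
    fix m
    have "(norm (x m + y m))\<^sup>2 \<le> (norm (x m) + norm (y m))\<^sup>2"
      by (intro power_mono norm_triangle_ineq) auto
    also have "\<dots> \<le> 2 * ((norm (x m))\<^sup>2 + (norm (y m))\<^sup>2)"
      using sum_squares_bound[of "norm (x m)" "norm (y m)"] by (simp add: power2_sum)
    finally have "(bracket m powr s)\<^sup>2 * (norm (x m + y m))\<^sup>2 \<le> (bracket m powr s)\<^sup>2 * (2 * ((norm (x m))\<^sup>2 + (norm (y m))\<^sup>2))"
      by (rule mult_left_mono) simp
    then show "(bracket m powr s * norm (x m + y m))\<^sup>2 \<le> 2 * ((bracket m powr s * norm (x m))\<^sup>2 + (bracket m powr s * norm (y m))\<^sup>2)"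
      by (simp add: power_mult_distrib algebra_simps)
  qed simp
qed

lemma wt_diff: "wt s x \<Longrightarrow> wt s y \<Longrightarrow> wt s (\<lambda>m. x m - y m)"
  using wt_add[of s x "\<lambda>m. - y m"] wt_uminus[of s y] by simp

lemma wt_zero: "wt s (\<lambda>m. 0)"
  by (simp add: wt_def)

lemma wt_sum:
  assumes "\<And>j. j \<in> I \<Longrightarrow> wt s (x j)"
  shows "wt s (\<lambda>m. \<Sum>j\<in>I. x j m)"
  using assms by (induction I rule: infinite_finite_induct) (auto intro: wt_zero wt_add)

lemma wt_delta: "wt s (\<lambda>m. if m = c then e else 0)"
  unfolding wt_def by (rule finite_nonzero_values_imp_summable_on) (rule finite_subset[of _ "{c}"], auto)

lemma wt_shift:
  assumes "wt s x" "0 \<le> s"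
  shows "wt s (\<lambda>m. x (m + c))"
proof -
  have "(\<lambda>m. (bracket (m + c) powr s * norm (x (m + c)))\<^sup>2) summable_on UNIV"
    using assms(1) unfolding wt_def by (subst summable_on_int_shift(1)[where x = "\<lambda>m. (bracket m powr s * norm (x m))\<^sup>2"])
  then have "(\<lambda>m. (bracket c powr s)\<^sup>2 * (bracket (m + c) powr s * norm (x (m + c)))\<^sup>2) summable_on UNIV"
    by (rule summable_on_cmult_right)
  then show ?thesis
    unfolding wt_def
  proof (rule summable_on_real_le)
    fix m
    have "bracket m \<le> bracket c * bracket (m + c)"
      using bracket_add_le[of "m + c" "- c"] by (simp add: mult.commute)
    then have "bracket m powr s \<le> bracket c powr s * bracket (m + c) powr s"
      using assms(2) by (simp add: powr_mono2 flip: powr_mult)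
    then have "bracket m powr s * norm (x (m + c)) \<le> bracket c powr s * bracket (m + c) powr s * norm (x (m + c))"
      by (rule mult_right_mono) simp
    then have "(bracket m powr s * norm (x (m + c)))\<^sup>2 \<le> (bracket c powr s * bracket (m + c) powr s * norm (x (m + c)))\<^sup>2"
      by (rule power_mono) simp
    then show "(bracket m powr s * norm (x (m + c)))\<^sup>2 \<le> (bracket c powr s)\<^sup>2 * (bracket (m + c) powr s * norm (x (m + c)))\<^sup>2"
      by (simp add: power_mult_distrib mult_ac)
  qed simp
qed

lemma wt_reflect:
  assumes "wt s x"
  shows "wt s (\<lambda>m. x (- m))"
  using assms summable_on_int_shift(4)[where x = "\<lambda>m. (bracket m powr s * norm (x m))\<^sup>2"]
  by (simp add: wt_def)

text \<open>Cauchy-Schwarz against \<open>bracket m powr (t - s)\<close>, whose square is summable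
  because \<open>2 * (t - s) < -1\<close>. For \<open>t = 0\<close> this is absolute summability
  above the threshold \<open>1/2\<close>.\<close>

lemma wt_summable_powr:
  assumes "wt s x" and "2 * (s - t) > 1"
  shows "(\<lambda>m. bracket m powr t * norm (x m)) summable_on UNIV"
proof -
  have "(\<lambda>m. (bracket m powr (t - s))\<^sup>2) summable_on UNIV"
    using summable_bracket_powr[of "2 * (t - s)"] assms(2) by (simp add: powr_power mult.commute right_diff_distrib)
  then have "(\<lambda>m. bracket m powr (t - s) * (bracket m powr s * norm (x m))) summable_on UNIV"
    using assms(1) unfolding wt_def by (rule summable_on_square_mult)
  then show ?thesis by (simp add: mult.assoc[symmetric] powr_add[symmetric])
qed

lemma wt_norm_summable:
  assumes "wt s x" and "s > 1/2"
  shows "(\<lambda>m. norm (x m)) summable_on UNIV"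
proof -
  have eq: "bracket m powr 0 = 1" for m using bracket_pos(1)[of m] by simp
  show ?thesis
    using wt_summable_powr[of s x 0] assms by (simp add: eq)
qed

lemma wt_summable:
  assumes "wt s x" and "s > 1/2"
  shows "x summable_on UNIV"
  using wt_norm_summable[OF assms] by (rule abs_summable_summable)

lemma wt_geometric:
  assumes "norm q < 1"
  shows "wt s (\<lambda>m. if 0 \<le> m then q ^ nat m else 0)"
proof -
  define r where "r = norm q"
  have r: "0 \<le> r" "r < 1" using assms by (auto simp: r_def)
  define f where "f n = (bracket (int n) powr s * r ^ n)\<^sup>2" for n
  \<comment> \<open>A ratio strictly between \<open>r\<close> and 1 leaves room for the polynomial
    weight: \<open>(1 + n) powr s * (r / c) ^ n\<close> tends to 0, so \<open>f n\<close> is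
    eventually at most the square of \<open>c ^ n\<close>.\<close>
  obtain c where c: "r < c" "c < 1" using r dense by blast
  have "summable f"
  proof (rule summable_comparison_test_ev)
    show "summable (\<lambda>n. (c ^ n)\<^sup>2)"
    proof -
      have "summable (\<lambda>n. (c\<^sup>2) ^ n)"
        using c r by (intro summable_geometric) (simp add: power_less_one_iff)
      then show ?thesis by (simp add: power2_eq_square power_mult_distrib)
    qed
    have lim: "(\<lambda>n. (1 + real n) powr s * (r / c) ^ n) \<longlonglongrightarrow> 0"
    proof (cases "r = 0")
      case True
      show ?thesis
        by (rule tendsto_eventually, rule eventually_mono[OF eventually_gt_at_top[of 0]]) (use True in simp)
    next
      case False
      define d where "d = - ln (r / c)"
      have d: "d > 0" using False r c by (simp add: d_def)
      have "exp (- d) = r / c" using False r c by (simp add: d_def)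
      then have rc: "(r / c) ^ n = exp (- d * real n)" for n
        using exp_of_nat_mult[of n "- d"] by (simp add: mult.commute)
      have "((\<lambda>x. (1 + x) powr s * exp (- d * x)) \<longlongrightarrow> 0) at_top"
        using d by real_asymp
      then show ?thesis
        unfolding rc by (rule filterlim_compose[OF _ filterlim_real_sequentially])
    qed
    then have "eventually (\<lambda>n. (1 + real n) powr s * (r / c) ^ n < 1) sequentially"
      by (rule order_tendstoD) simp
    then show "eventually (\<lambda>n. norm (f n) \<le> (c ^ n)\<^sup>2) sequentially"
    proof eventually_elim
      case (elim n)
      then have "(1 + real n) powr s * r ^ n \<le> c ^ n"
        using c r by (simp add: power_divide field_simps)
      then have "((1 + real n) powr s * r ^ n)\<^sup>2 \<le> (c ^ n)\<^sup>2"
        using r by (intro power_mono) auto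
      then show ?case by (simp add: f_def bracket_def)
    qed
  qed
  then have "f summable_on UNIV"
    by (rule summable_nonneg_imp_summable_on) (simp add: f_def)
  then show ?thesis
    unfolding wt_def
  proof (intro summable_on_int_split)
    have "(\<lambda>n. (bracket (int n) powr s * norm (if 0 \<le> int n then q ^ nat (int n) else 0))\<^sup>2) = f"
      by (auto simp: f_def r_def norm_power)
    then show "f summable_on UNIV \<Longrightarrow> (\<lambda>n. (bracket (int n) powr s * norm (if 0 \<le> int n then q ^ nat (int n) else 0))\<^sup>2) summable_on UNIV"
      by simp
    show "(\<lambda>n. (bracket (- int n) powr s * norm (if 0 \<le> - int n then q ^ nat (- int n) else 0))\<^sup>2) summable_on UNIV"
      by (rule finite_nonzero_values_imp_summable_on) (rule finite_subset[of _ "{0}"], auto split: if_splits)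
  qed
qed

definition conv :: "(int \<Rightarrow> complex) \<Rightarrow> (int \<Rightarrow> complex) \<Rightarrow> int \<Rightarrow> complex" where
  "conv x y m = infsum (\<lambda>l. x (m - l) * y l) UNIV"

lemma summable_on_bounded_mult:
  fixes x y :: "'a \<Rightarrow> complex"
  assumes "\<And>i. norm (x i) \<le> C" and "y summable_on UNIV"
  shows "(\<lambda>i. x i * y i) summable_on UNIV"
proof (rule summable_on_norm_le)
  show "(\<lambda>i. C * norm (y i)) summable_on UNIV"
    using assms(2) by (intro summable_on_cmult_right) (simp add: summable_on_iff_abs_summable_on_complex)
qed (use assms(1) in \<open>auto simp: norm_mult intro!: mult_right_mono\<close>)

lemma summable_on_norm_bounded:
  fixes x :: "'a \<Rightarrow> complex"
  assumes "x summable_on UNIV"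
  shows "norm (x i) \<le> infsum (\<lambda>i. norm (x i)) UNIV"
  using assms finite_sum_le_infsum[of "\<lambda>i. norm (x i)" UNIV "{i}"]
  by (simp add: summable_on_iff_abs_summable_on_complex)

lemma conv_summable:
  fixes x y :: "int \<Rightarrow> complex"
  assumes "x summable_on UNIV" "y summable_on UNIV"
  shows "(\<lambda>l. x (m - l) * y l) summable_on UNIV"
  using summable_on_norm_bounded[OF assms(1)] assms(2) by (intro summable_on_bounded_mult)

text \<open>Since \<open>bracket m\<close> is at most twice the larger of
  \<open>bracket (m - l)\<close> and \<open>bracket l\<close>, the whole weight can be moved to one
  of the two factors. The other factor is absolutely summable because \<open>s > 1/2\<close>, and
  Young's inequality applies to both resulting sums.\<close>

lemma wt_conv:
  assumes s: "1 \<le> s" and x: "wt s x" and y: "wt s y"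
  shows "wt s (conv x y)"
proof -
  define X where "X m = bracket m powr s * norm (x m)" for m
  define Y where "Y m = bracket m powr s * norm (y m)" for m
  have X2: "(\<lambda>m. (X m)\<^sup>2) summable_on UNIV" and Y2: "(\<lambda>m. (Y m)\<^sup>2) summable_on UNIV"
    using x y by (auto simp: wt_def X_def Y_def)
  have x1: "(\<lambda>m. norm (x m)) summable_on UNIV" and y1: "(\<lambda>m. norm (y m)) summable_on UNIV"
    using x y s by (auto intro: wt_norm_summable)
  define p where "p m = infsum (\<lambda>l. X (m - l) * norm (y l)) UNIV" for m
  define q where "q m = infsum (\<lambda>l. Y (m - l) * norm (x l)) UNIV" for m
  have inj: "inj (\<lambda>m::int. m - l)" for l by (auto simp: inj_on_def)
  note yp = Young_l2_l1[where \<beta> = X and \<xi> = "\<lambda>l. norm (y l)" and \<phi> = "\<lambda>l m. m - l", OF _ X2 _ y1 inj]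
  note yq = Young_l2_l1[where \<beta> = Y and \<xi> = "\<lambda>l. norm (x l)" and \<phi> = "\<lambda>l m. m - l", OF _ Y2 _ x1 inj]
  have ps: "(\<lambda>l. X (m - l) * norm (y l)) summable_on UNIV" and p: "(\<lambda>m. (p m)\<^sup>2) summable_on UNIV" for m
    using yp by (auto simp: X_def p_def)
  have qs: "(\<lambda>l. Y (m - l) * norm (x l)) summable_on UNIV" and q: "(\<lambda>m. (q m)\<^sup>2) summable_on UNIV" for m
    using yq by (auto simp: Y_def q_def)
  have q': "(\<lambda>l. Y l * norm (x (m - l))) summable_on UNIV"
      "infsum (\<lambda>l. Y l * norm (x (m - l))) UNIV = q m" for m
  proof -
    have b: "bij (\<lambda>l. m - l)" by simp
    show "(\<lambda>l. Y l * norm (x (m - l))) summable_on UNIV"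
      using qs[of m] summable_on_reindex_bij_betw[OF b, of "\<lambda>l. Y (m - l) * norm (x l)"] by simp
    show "infsum (\<lambda>l. Y l * norm (x (m - l))) UNIV = q m"
      using infsum_reindex_bij_betw[OF b, of "\<lambda>l. Y (m - l) * norm (x l)"] by (simp add: q_def)
  qed
  have main: "bracket m powr s * norm (conv x y m) \<le> 2 powr s * (p m + q m)" for m
  proof -
    have s1: "(\<lambda>l. 2 powr s * (X (m - l) * norm (y l) + Y l * norm (x (m - l)))) summable_on UNIV"
      by (intro summable_on_cmult_right summable_on_add ps q')
    have "bracket m powr s * norm (conv x y m) = norm (infsum (\<lambda>l. of_real (bracket m powr s) * (x (m - l) * y l)) UNIV)"
      by (simp add: infsum_cmult_right' norm_mult conv_def)
    also have "\<dots> \<le> infsum (\<lambda>l. 2 powr s * (X (m - l) * norm (y l) + Y l * norm (x (m - l)))) UNIV"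
    proof (rule norm_infsum_le_infsum[OF s1])
      fix l
      have "bracket m \<le> bracket (m - l) + bracket l" by (auto simp: bracket_def)
      also have "\<dots> \<le> 2 * max (bracket (m - l)) (bracket l)" by simp
      finally have "bracket m powr s \<le> (2 * max (bracket (m - l)) (bracket l)) powr s"
        using s by (intro powr_mono2) auto
      also have "\<dots> \<le> 2 powr s * max (bracket (m - l) powr s) (bracket l powr s)"
        using s bracket_pos(2)[of "m - l"] bracket_pos(2)[of l]
        by (subst powr_mult) (auto simp: max_def intro!: powr_mono2)
      also have "\<dots> \<le> 2 powr s * (bracket (m - l) powr s + bracket l powr s)"
        by (intro mult_left_mono) auto
      finally have "bracket m powr s * (norm (x (m - l)) * norm (y l))
          \<le> 2 powr s * (bracket (m - l) powr s + bracket l powr s) * (norm (x (m - l)) * norm (y l))"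
        by (rule mult_right_mono) simp
      then show "norm (of_real (bracket m powr s) * (x (m - l) * y l)) \<le> 2 powr s * (X (m - l) * norm (y l) + Y l * norm (x (m - l)))"
        by (simp add: norm_mult X_def Y_def algebra_simps)
    qed
    also have "\<dots> = 2 powr s * (p m + q m)"
      by (simp add: infsum_cmult_right' infsum_add ps q' p_def)
    finally show ?thesis .
  qed
  have "wt 0 (\<lambda>m. of_real (p m))" "wt 0 (\<lambda>m. of_real (q m))"
    using p q bracket_pos(1) by (simp_all add: wt_def less_imp_neq[symmetric])
  then have "wt 0 (\<lambda>m. of_real (p m) + of_real (q m))" by (rule wt_add)
  then show ?thesis
  proof (rule wt_le[where C = "2 powr s"])
    fix m
    have "p m + q m \<le> norm (of_real (p m) + of_real (q m) :: complex)"
      by (metis complex_Re_le_cmod of_real_add Re_complex_of_real)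
    then have "2 powr s * (p m + q m) \<le> 2 powr s * (bracket m powr 0 * norm (of_real (p m) + of_real (q m) :: complex))"
      using bracket_pos(1)[of m] by simp
    then show "bracket m powr s * norm (conv x y m) \<le> 2 powr s * (bracket m powr 0 * norm (complex_of_real (p m) + complex_of_real (q m)))"
      using main[of m] by linarith
  qed
qed

subsection \<open>Laurent series on the unit circle\<close>

text \<open>One formula serves on the unit circle and, for coefficients supported on one side of 0,
  also in the disc or in its exterior.\<close>

definition lser :: "(int \<Rightarrow> complex) \<Rightarrow> complex \<Rightarrow> complex" where
  "lser x z = infsum (\<lambda>m. x m * z powi m) UNIV"

lemma lser_has_sum:
  assumes "x summable_on UNIV" "norm z = 1"
  shows "((\<lambda>m. x m * z powi m) has_sum lser x z) UNIV"
  unfolding lser_def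
proof (rule has_sum_infsum)
  have "norm (z powi m) \<le> 1" for m using assms(2) by (simp add: norm_power_int)
  then have "(\<lambda>m. z powi m * x m) summable_on UNIV"
    using assms(1) by (rule summable_on_bounded_mult)
  then show "(\<lambda>m. x m * z powi m) summable_on UNIV" by (simp add: mult.commute)
qed

lemma lser_add:
  assumes "x summable_on UNIV" "y summable_on UNIV" "norm z = 1"
  shows "lser (\<lambda>m. x m + y m) z = lser x z + lser y z"
  using has_sum_add[OF lser_has_sum[OF assms(1,3)] lser_has_sum[OF assms(2,3)]]
  unfolding lser_def[of "\<lambda>m. x m + y m"] by (simp add: infsumI algebra_simps)

lemma lser_cmult: "lser (\<lambda>m. c * x m) z = c * lser x z"
  by (simp add: lser_def mult.assoc infsum_cmult_right')

lemma lser_zero [simp]: "lser (\<lambda>m. 0) z = 0"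
  by (simp add: lser_def)

lemma lser_sum:
  assumes "\<And>j. j \<in> I \<Longrightarrow> x j summable_on UNIV" "norm z = 1"
  shows "lser (\<lambda>m. \<Sum>j\<in>I. x j m) z = (\<Sum>j\<in>I. lser (x j) z)"
  using assms(1)
  by (induction I rule: infinite_finite_induct) (auto simp: assms(2) lser_add infsum_sum_swap(2))

lemma lser_shift:
  assumes "norm z = 1"
  shows "lser (\<lambda>m. x (m + c)) z = z powi (- c) * lser x z"
proof -
  have z: "z \<noteq> 0" using assms by auto
  have "z powi (- c) * lser x z = infsum (\<lambda>m. x m * z powi (m - c)) UNIV"
    using z by (simp add: lser_def power_int_diff power_int_minus divide_inverse mult_ac flip: infsum_cmult_right')
  also have "\<dots> = infsum (\<lambda>m. x (m + c) * z powi m) UNIV"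
    using infsum_reindex_bij_betw[of "\<lambda>m. m + c" UNIV UNIV "\<lambda>m. x m * z powi (m - c)"] by simp
  finally show ?thesis by (simp add: lser_def)
qed

lemma lser_reflect: "lser (\<lambda>m. x (- m)) (1 / z) = lser x z"
  using infsum_reindex_bij_betw[of uminus UNIV UNIV "\<lambda>m::int. x m * z powi m"]
  by (simp add: lser_def power_int_minus power_int_divide_distrib divide_inverse power_int_inverse)

lemma lser_cnj:
  assumes "norm z = 1"
  shows "cnj (lser x z) = lser (\<lambda>m. cnj (x (- m))) z"
proof -
  have z: "cnj z = 1 / z"
    using assms by (simp add: divide_conv_cnj)
  have "cnj (z powi m) = cnj z powi m" for m
    by (simp add: power_int_def)
  then have "cnj (lser x z) = lser (\<lambda>m. cnj (x m)) (1 / z)"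
    by (simp add: lser_def z flip: infsum_cnj)
  then show ?thesis
    using lser_reflect[of "\<lambda>m. cnj (x (- m))" z] by simp
qed

text \<open>Both claims come from the absolutely summable double series of the product, reindexed by
  its total power \<open>m = (m - l) + l\<close>.\<close>

lemma conv_lser:
  assumes x: "x summable_on UNIV" and y: "y summable_on UNIV"
  shows "conv x y summable_on UNIV"
    and "norm z = 1 \<Longrightarrow> lser (conv x y) z = lser x z * lser y z"
proof -
  have xn: "(\<lambda>m. norm (x m)) summable_on UNIV" and yn: "(\<lambda>m. norm (y m)) summable_on UNIV"
    using x y by (simp_all add: summable_on_iff_abs_summable_on_complex)
  have "(\<lambda>(l, m). norm (x m) * norm (y l)) summable_on UNIV"
    by (rule summable_on_prod_nonneg)
      (use xn yn in \<open>auto simp: infsum_cmult_left' intro!: summable_on_cmult_left summable_on_cmult_right\<close>)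
  have B: "bij_betw (\<lambda>(m, l). (l, m - l)) (UNIV :: (int \<times> int) set) UNIV"
    by (rule bij_betw_byWitness[where f' = "\<lambda>(l, m). (m + l, l)"]) auto
  have key: "((\<lambda>(m, l). x (m - l) * y l * z powi m) has_sum lser x z * lser y z) (UNIV \<times> UNIV)" if z: "norm z = 1" for z
  proof -
    have z0: "z \<noteq> 0" using z by auto
    have X: "((\<lambda>m. x m * z powi m) has_sum lser x z) UNIV" and Y: "((\<lambda>m. y m * z powi m) has_sum lser y z) UNIV"
      using lser_has_sum x y z by auto
    have "(\<lambda>(l, m). norm (x m) * norm (y l)) summable_on (UNIV \<times> UNIV)"
      by simp fact
    then have s: "(\<lambda>(l, m). (x m * z powi m) * (y l * z powi l)) summable_on (UNIV \<times> UNIV)"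
      by (rule summable_on_norm_le) (use z in \<open>auto simp: norm_mult norm_power_int\<close>)
    have "infsum (\<lambda>(l, m). (x m * z powi m) * (y l * z powi l)) (UNIV \<times> UNIV) = lser x z * lser y z"
      using infsum_Sigma'_banach[OF s, symmetric] by (simp add: infsum_cmult_left' infsum_cmult_right' lser_def)
    then have "((\<lambda>(l, m). (x m * z powi m) * (y l * z powi l)) has_sum lser x z * lser y z) UNIV"
      using s by (simp add: has_sum_iff)
    then have "((\<lambda>p. (\<lambda>(l, m). (x m * z powi m) * (y l * z powi l)) ((\<lambda>(m, l). (l, m - l)) p)) has_sum lser x z * lser y z) UNIV"
      by (subst has_sum_reindex_bij_betw[OF B])
    moreover have "z powi (m - l) * z powi l = z powi m" for m l :: int
      using z0 by (simp add: power_int_diff)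
    then have "x (m - l) * z powi (m - l) * (y l * z powi l) = x (m - l) * y l * z powi m" for m l
      by (metis mult.assoc mult.left_commute)
    ultimately show ?thesis by (simp add: case_prod_unfold)
  qed
  \<comment> \<open>At \<open>z = 1\<close> the powers disappear and the double series sums the
    convolution itself.\<close>
  have s1: "(\<lambda>(m, l). x (m - l) * y l * 1 powi m) summable_on (UNIV \<times> UNIV)"
    using key[of 1] by (auto simp: has_sum_imp_summable)
  show "conv x y summable_on UNIV"
    using summable_on_Sigma_banach[OF s1] by (simp add: conv_def[abs_def])
  assume z: "norm z = 1"
  have "infsum (\<lambda>m. infsum (\<lambda>l. x (m - l) * y l * z powi m) UNIV) UNIV = lser x z * lser y z"
    using key[OF z] infsum_Sigma'_banach[of "\<lambda>m l. x (m - l) * y l * z powi m" UNIV "\<lambda>_. UNIV"]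
    by (auto simp: has_sum_iff)
  then show "lser (conv x y) z = lser x z * lser y z"
    by (simp add: lser_def conv_def infsum_cmult_left')
qed

lemma lser_inside:
  assumes x: "x summable_on UNIV" and supp: "\<And>m. m < 0 \<Longrightarrow> x m = 0"
  shows "continuous_on (cball 0 1) (lser x)" and "lser x holomorphic_on ball 0 1"
proof -
  define f where "f m z = x m * z powi m" for m z
  have f: "f m = (if 0 \<le> m then (\<lambda>z. x m * z ^ nat m) else (\<lambda>z. 0))" for m
    by (auto simp: f_def[abs_def] supp power_int_def not_le)
  have "norm (f m z) \<le> norm (x m)" if "z \<in> cball 0 1" for m z
    using that by (auto simp: f norm_mult norm_power intro!: mult_left_le power_le_one)
  then have ul: "uniform_limit (cball 0 1) (\<lambda>X z. \<Sum>m\<in>X. f m z) (\<lambda>z. infsum (\<lambda>m. f m z) UNIV) (finite_subsets_at_top UNIV)"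
    using x by (intro Weierstrass_m_test_general) (auto simp: summable_on_iff_abs_summable_on_complex)
  have c: "continuous_on (cball 0 1) (f m)" "f m holomorphic_on ball 0 1" for m
    by (auto simp: f intro!: continuous_intros holomorphic_intros)
  have ev: "\<forall>\<^sub>F X in finite_subsets_at_top UNIV. continuous_on (cball 0 1) (\<lambda>z. \<Sum>m\<in>X. f m z) \<and> (\<lambda>z. \<Sum>m\<in>X. f m z) holomorphic_on ball 0 1"
    by (intro always_eventually allI conjI continuous_on_sum holomorphic_on_sum c)
  obtain "continuous_on (cball 0 1) (\<lambda>z. infsum (\<lambda>m. f m z) UNIV)" "(\<lambda>z. infsum (\<lambda>m. f m z) UNIV) holomorphic_on ball 0 1"
    using holomorphic_uniform_limit[OF ev ul] by auto
  then show "continuous_on (cball 0 1) (lser x)" and "lser x holomorphic_on ball 0 1"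
    by (simp_all add: lser_def[abs_def] f_def)
qed

lemma lser_at_0:
  assumes supp: "\<And>m. m < 0 \<Longrightarrow> x m = 0"
  shows "lser x 0 = x 0"
proof -
  have "lser x 0 = infsum (\<lambda>m. x m * 0 powi m) {0}"
    unfolding lser_def by (rule infsum_cong_neutral) (auto simp: power_int_0_left_if)
  then show ?thesis by simp
qed

text \<open>Substituting \<open>1 / z\<close> reduces everything to the disc. Infinity becomes 0,
  where the reflected series takes the value \<open>x 0\<close>.\<close>

lemma lser_outside:
  assumes x: "x summable_on UNIV" and supp: "\<And>m. m > 0 \<Longrightarrow> x m = 0"
  shows "continuous_on {z. 1 \<le> norm z} (lser x)" and "lser x holomorphic_on {z. 1 < norm z}"
    and "(lser x \<longlongrightarrow> x 0) at_infinity"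
proof -
  define y where "y m = x (- m)" for m
  have y: "y summable_on UNIV" and supp': "\<And>m. m < 0 \<Longrightarrow> y m = 0"
    using x supp by (auto simp: y_def[abs_def] summable_on_int_shift)
  have eq: "lser x = lser y \<circ> (\<lambda>z. 1 / z)"
    by (auto simp: fun_eq_iff y_def[abs_def] lser_reflect)
  show "continuous_on {z. 1 \<le> norm z} (lser x)"
    unfolding eq by (rule continuous_on_compose) 
      (auto intro!: continuous_intros continuous_on_subset[OF lser_inside(1)[OF y supp']] simp: norm_divide divide_simps)
  show "lser x holomorphic_on {z. 1 < norm z}"
    unfolding eq by (rule holomorphic_on_compose)
      (auto intro!: holomorphic_intros holomorphic_on_subset[OF lser_inside(2)[OF y supp']] simp: norm_divide divide_simps)
  have "isCont (lser y) 0"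
    using lser_inside(2)[OF y supp'] by (intro continuous_on_interior[OF holomorphic_on_imp_continuous_on]) auto
  then have "(lser y \<longlongrightarrow> x 0) (nhds 0)"
    using lser_at_0[of y] supp' by (simp add: isCont_def y_def tendsto_at_iff_tendsto_nhds)
  moreover have "filterlim (\<lambda>z::complex. 1 / z) (nhds 0) at_infinity"
    using tendsto_inverse_0[where 'a = complex] by (simp add: divide_inverse)
  ultimately show "(lser x \<longlongrightarrow> x 0) at_infinity"
    unfolding eq comp_def by (rule filterlim_compose)
qed

text \<open>The Laurent coefficients of \<open>1 / (z - a)\<close> on the unit circle for
  \<open>1 < norm a\<close>.\<close>

definition pole_out :: "complex \<Rightarrow> int \<Rightarrow> complex" where
  "pole_out a m = (if 0 \<le> m then - (inverse a ^ (nat m + 1)) else 0)"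

text \<open>The Laurent coefficients of \<open>1 / (z - b)\<close> on the unit circle for
  \<open>norm b < 1\<close>.\<close>

definition pole_in :: "complex \<Rightarrow> int \<Rightarrow> complex" where
  "pole_in b m = (if m < 0 then b ^ (nat (- m) - 1) else 0)"

lemma pole_out_wt: "1 < norm a \<Longrightarrow> wt s (pole_out a)"
  unfolding pole_out_def[abs_def]
  by (rule wt_norm_le[OF wt_geometric[of "inverse a" s], where C = "norm (inverse a)"])
    (auto simp: norm_inverse norm_mult norm_power inverse_less_1_iff)

lemma pole_in_wt:
  assumes "norm b < 1" "0 \<le> s"
  shows "wt s (pole_in b)"
proof -
  have "wt s (\<lambda>m. if 0 \<le> m + (-1) then b ^ nat (m + (-1)) else 0)"
    using wt_shift[OF wt_geometric[OF assms(1)] assms(2), of "-1"] by simp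
  then have "wt s (\<lambda>m. if 0 \<le> - m + (-1) then b ^ nat (- m + (-1)) else 0)"
    by (rule wt_reflect)
  then show ?thesis
    by (rule wt_norm_le[where C = 1]) (auto simp: pole_in_def nat_diff_distrib)
qed

lemma lser_nat:
  assumes supp: "\<And>m. m < 0 \<Longrightarrow> x m = 0" and "summable (\<lambda>n. norm (x (int n) * z ^ n))"
    and "(\<lambda>n. x (int n) * z ^ n) sums S"
  shows "lser x z = S"
proof -
  have "((\<lambda>n. x (int n) * z ^ n) has_sum S) UNIV"
    using assms(2,3) by (rule norm_summable_imp_has_sum)
  then have "((\<lambda>m. x m * z powi m) has_sum S) (range int)"
    by (subst has_sum_reindex) (auto simp: o_def)
  also have "?this \<longleftrightarrow> ((\<lambda>m. x m * z powi m) has_sum S) UNIV"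
    by (rule has_sum_cong_neutral) (auto simp: supp image_iff, metis nonneg_int_cases not_less supp)
  finally show ?thesis by (simp add: lser_def infsumI)
qed

lemma lser_pole_out:
  assumes "1 < norm a" "norm z \<le> 1"
  shows "lser (pole_out a) z = 1 / (z - a)"
proof (rule lser_nat)
  have a: "a \<noteq> 0" "norm (z / a) < 1" "z \<noteq> a" using assms by (auto simp: norm_divide divide_less_eq)
  have e: "pole_out a (int n) * z ^ n = - inverse a * (z / a) ^ n" for n
    by (auto simp: pole_out_def divide_inverse power_mult_distrib)
  show "summable (\<lambda>n. norm (pole_out a (int n) * z ^ n))"
    unfolding e norm_mult norm_power using a by (intro summable_mult summable_geometric) simp
  have "(\<lambda>n. - inverse a * (z / a) ^ n) sums (- inverse a * (1 / (1 - z / a)))"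
    using a by (intro sums_mult geometric_sums)
  moreover have "- inverse a * (1 / (1 - z / a)) = 1 / (z - a)"
    using a by (simp add: divide_simps)
  ultimately show "(\<lambda>n. pole_out a (int n) * z ^ n) sums (1 / (z - a))"
    unfolding e by simp
qed (simp add: pole_out_def)

lemma lser_pole_in:
  assumes "norm b < 1" "1 \<le> norm z"
  shows "lser (pole_in b) z = 1 / (z - b)"
proof -
  have a: "z \<noteq> 0" "norm (b / z) < 1" "z \<noteq> b" using assms by (auto simp: norm_divide divide_less_eq)
  define f where "f n = pole_in b (- int n) * (1 / z) ^ n" for n
  have e: "f (Suc n) = 1 / z * (b / z) ^ n" for n
    by (simp add: f_def pole_in_def power_divide nat_add_distrib)
  have "lser (\<lambda>m. pole_in b (- m)) (1 / z) = 1 / (z - b)"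
  proof (rule lser_nat)
    have "summable (\<lambda>n. norm (f (Suc n)))"
      unfolding e norm_mult norm_power using a by (intro summable_mult summable_geometric) simp
    then have "summable (\<lambda>n. norm (f n))"
      by (subst (asm) summable_Suc_iff)
    then show "summable (\<lambda>n. norm (pole_in b (- int n) * (1 / z) ^ n))" by (simp add: f_def)
    have "(\<lambda>n. f (Suc n)) sums (1 / z * (1 / (1 - b / z)))"
      unfolding e using a by (intro sums_mult geometric_sums)
    also have "1 / z * (1 / (1 - b / z)) = 1 / (z - b)"
      using a by (simp add: divide_simps)
    finally have "f sums (1 / (z - b) + f 0)"
      by (rule sums_Suc)
    then show "(\<lambda>n. pole_in b (- int n) * (1 / z) ^ n) sums (1 / (z - b))"
      unfolding f_def[symmetric] by (simp add: f_def[of 0] pole_in_def)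
  qed (simp add: pole_in_def)
  then show ?thesis by (simp add: lser_reflect)
qed

subsection \<open>Hankel equations\<close>

text \<open>The matrix \<open>\<alpha> (m - l)\<close> is only used at index pairs of opposite sign, where \<open>\<bar>m - l\<bar> = \<bar>m\<bar> + \<bar>l\<bar>\<close>, so that
  decay of \<open>\<alpha>\<close> can be distributed among both indices.\<close>

lemma hankel_gain:
  assumes \<alpha>: "wt \<sigma> \<alpha>" and t: "0 \<le> t" "t \<le> \<sigma>"
    and x: "(\<lambda>l. bracket l powr (t - \<sigma>) * norm (x l)) summable_on UNIV"
    and y: "\<And>m. norm (y m) \<le> infsum (\<lambda>l. norm (\<alpha> (m - l)) * norm (x l)) UNIV"
    and sgn: "\<And>m l. y m \<noteq> 0 \<Longrightarrow> x l \<noteq> 0 \<Longrightarrow> m * l \<le> 0"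
    and s: "\<And>m. (\<lambda>l. norm (\<alpha> (m - l)) * norm (x l)) summable_on UNIV"
  shows "wt t y"
proof -
  define X where "X m = bracket m powr \<sigma> * norm (\<alpha> m)" for m
  have X2: "(\<lambda>m. (X m)\<^sup>2) summable_on UNIV" using \<alpha> by (auto simp: wt_def X_def)
  have inj: "inj (\<lambda>m::int. m - l)" for l by (auto simp: inj_on_def)
  define p where "p m = infsum (\<lambda>l. X (m - l) * (bracket l powr (t - \<sigma>) * norm (x l))) UNIV" for m
  have ps: "(\<lambda>l. X (m - l) * (bracket l powr (t - \<sigma>) * norm (x l))) summable_on UNIV"
    and p: "(\<lambda>m. (p m)\<^sup>2) summable_on UNIV" for m
    using Young_l2_l1[where \<beta> = X and \<xi> = "\<lambda>l. bracket l powr (t - \<sigma>) * norm (x l)" and \<phi> = "\<lambda>l m. m - l", OF _ X2 _ x inj]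
    by (auto simp: X_def p_def)
  have main: "bracket m powr t * norm (y m) \<le> p m" for m
  proof (cases "y m = 0")
    case True
    then show ?thesis by (auto simp: p_def X_def intro!: infsum_nonneg)
  next
    case False
    have "bracket m powr t * norm (y m) \<le> bracket m powr t * infsum (\<lambda>l. norm (\<alpha> (m - l)) * norm (x l)) UNIV"
      using y by (intro mult_left_mono) auto
    also have "\<dots> = infsum (\<lambda>l. bracket m powr t * (norm (\<alpha> (m - l)) * norm (x l))) UNIV"
      by (simp add: infsum_cmult_right')
    also have "\<dots> \<le> p m"
      unfolding p_def
    proof (intro infsum_mono summable_on_cmult_right s ps)
      fix l
      show "bracket m powr t * (norm (\<alpha> (m - l)) * norm (x l)) \<le> X (m - l) * (bracket l powr (t - \<sigma>) * norm (x l))"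
      proof (cases "x l = 0")
        case nz: False
        have "m * l \<le> 0" using sgn False nz by blast
        then have "\<bar>m - l\<bar> = \<bar>m\<bar> + \<bar>l\<bar>" by (auto simp: mult_le_0_iff)
        then have ge: "bracket m \<le> bracket (m - l)" "bracket l \<le> bracket (m - l)"
          by (auto simp: bracket_def)
        have "bracket m powr t * bracket l powr (\<sigma> - t) \<le> bracket (m - l) powr t * bracket (m - l) powr (\<sigma> - t)"
          using ge t by (intro mult_mono powr_mono2) auto
        also have "\<dots> = bracket (m - l) powr \<sigma>" by (simp flip: powr_add)
        finally have "bracket m powr t * bracket l powr (\<sigma> - t) * bracket l powr (t - \<sigma>) \<le> bracket (m - l) powr \<sigma> * bracket l powr (t - \<sigma>)"
          by (intro mult_right_mono) auto
        then have "bracket m powr t \<le> bracket (m - l) powr \<sigma> * bracket l powr (t - \<sigma>)"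
          by (simp add: mult.assoc flip: powr_add)
        then have "bracket m powr t * (norm (\<alpha> (m - l)) * norm (x l)) \<le> bracket (m - l) powr \<sigma> * bracket l powr (t - \<sigma>) * (norm (\<alpha> (m - l)) * norm (x l))"
          by (intro mult_right_mono) auto
        then show ?thesis by (simp add: X_def mult_ac)
      qed simp
    qed
    finally show ?thesis .
  qed
  show ?thesis
    unfolding wt_def using p by (rule summable_on_real_le) (use main in \<open>auto intro!: power_mono\<close>)
qed


text \<open>For \<open>l < 0 \<le> k\<close> one has \<open>bracket l \<le> bracket (k - l)\<close>,
  so a factor \<open>bracket l powr (-2)\<close> can be split off from the squared entry. Summing
  over \<open>k\<close> then gives a constant independent of \<open>l\<close>, and the split factor
  is summable over \<open>l\<close>.\<close>

lemma hankel_hilbert_schmidt: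
  assumes "wt 1 \<alpha>"
  shows "hilbert_schmidt (\<lambda>k l. if 0 \<le> k \<and> l < 0 then \<alpha> (k - l) else 0)"
proof -
  have A: "(\<lambda>m. (bracket m * norm (\<alpha> m))\<^sup>2) summable_on UNIV"
    using assms by (simp add: wt_def)
  have B: "(\<lambda>l. bracket l powr (-2)) summable_on UNIV"
    by (rule summable_bracket_powr) simp
  have A': "(\<lambda>k. (bracket (k - l) * norm (\<alpha> (k - l)))\<^sup>2) summable_on UNIV"
      "infsum (\<lambda>k. (bracket (k - l) * norm (\<alpha> (k - l)))\<^sup>2) UNIV = infsum (\<lambda>m. (bracket m * norm (\<alpha> m))\<^sup>2) UNIV" for l
    using A summable_on_int_shift(2)[of "\<lambda>m. (bracket m * norm (\<alpha> m))\<^sup>2"]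
      infsum_reindex_bij_betw[of "\<lambda>k. k - l" UNIV UNIV "\<lambda>m. (bracket m * norm (\<alpha> m))\<^sup>2"] by auto
  have "(\<lambda>(l, k). bracket l powr (-2) * (bracket (k - l) * norm (\<alpha> (k - l)))\<^sup>2) summable_on UNIV"
    by (rule summable_on_prod_nonneg)
      (auto intro!: summable_on_cmult_right A' summable_on_cmult_left B simp: infsum_cmult_right' A')
  then have "(\<lambda>(l, k). (norm (if 0 \<le> k \<and> l < 0 then \<alpha> (k - l) else 0))\<^sup>2) summable_on UNIV"
  proof (rule summable_on_real_le)
    fix p :: "int \<times> int"
    obtain l k where p: "p = (l, k)" by (cases p)
    have "(norm (\<alpha> (k - l)))\<^sup>2 \<le> bracket l powr (-2) * (bracket (k - l) * norm (\<alpha> (k - l)))\<^sup>2" if "0 \<le> k" "l < 0"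
    proof -
      have "bracket l \<le> bracket (k - l)" using that by (simp add: bracket_def)
      then have "bracket l * norm (\<alpha> (k - l)) \<le> bracket (k - l) * norm (\<alpha> (k - l))"
        by (rule mult_right_mono) simp
      then have "(bracket l * norm (\<alpha> (k - l)))\<^sup>2 \<le> (bracket (k - l) * norm (\<alpha> (k - l)))\<^sup>2"
        by (rule power_mono) simp
      then show ?thesis
        by (simp add: powr_minus powr_numeral power_mult_distrib field_simps)
    qed
    then show "(case p of (l, k) \<Rightarrow> (norm (if 0 \<le> k \<and> l < 0 then \<alpha> (k - l) else 0))\<^sup>2)
        \<le> (case p of (l, k) \<Rightarrow> bracket l powr (-2) * (bracket (k - l) * norm (\<alpha> (k - l)))\<^sup>2)"
      by (auto simp: p)
  qed auto
  then show ?thesis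
    unfolding hilbert_schmidt_def
    by (subst summable_on_reindex_bij_witness[of _ prod.swap prod.swap UNIV "\<lambda>(l, k). (norm (if 0 \<le> k \<and> l < 0 then \<alpha> (k - l) else 0))\<^sup>2"]) auto
qed

text \<open>Eliminating \<open>w\<close> leaves \<open>u + K K* u = f\<close>, where
  \<open>K\<close> is the block of the matrix \<open>\<alpha> (k - l)\<close> with
  \<open>k \<ge> 0\<close> and \<open>l < 0\<close>. Then \<open>w\<close> is the adjoint block
  applied to \<open>u\<close>, plus \<open>e2\<close> at index 0. The solver yields a square
  summable \<open>u\<close> only; the weight \<open>s\<close> is regained afterwards.\<close>

lemma hankel_solve:
  fixes e1 e2 :: complex
  assumes s: "1 \<le> s" and \<alpha>: "wt s \<alpha>"
  obtains u w where "wt s u" "wt s w" "\<And>m. m < 0 \<Longrightarrow> u m = 0" "\<And>m. 0 < m \<Longrightarrow> w m = 0" "w 0 = e2"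
    and "\<And>m. 0 \<le> m \<Longrightarrow> u m = (if m = 0 then e1 else 0) - conv \<alpha> w m"
    and "\<And>m. m < 0 \<Longrightarrow> w m = conv (\<lambda>m. cnj (\<alpha> (- m))) u m"
proof -
  define K where "K k l = (if 0 \<le> k \<and> l < 0 then \<alpha> (k - l) else 0)" for k l :: int
  \<comment> \<open>The prescribed coefficient \<open>w 0 = e2\<close> belongs to no column of
    \<open>K\<close>; its contribution \<open>e2 * \<alpha> k\<close> to the convolution is moved to
    the right-hand side.\<close>
  define f where "f k = (if 0 \<le> k then (if k = 0 then e1 else 0) - e2 * \<alpha> k else 0)" for k :: int
  have \<alpha>1: "wt 1 \<alpha>" using s \<alpha> by (auto intro: wt_mono)
  have f: "wt s f" unfolding f_def[abs_def] by (intro wt_if wt_diff wt_delta wt_cmult \<alpha>)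
  have an: "(\<lambda>m. norm (\<alpha> m)) summable_on UNIV" using wt_norm_summable[OF \<alpha>1] by simp
  have ell2: "ell2 x \<longleftrightarrow> wt 0 x" for x
    by (simp add: ell2_def wt_def)
  have HS: "hilbert_schmidt K"
    using hankel_hilbert_schmidt[OF \<alpha>1] by (simp add: K_def[abs_def])
  have rows: "K k summable_on UNIV" for k
  proof (rule summable_on_norm_le)
    show "(\<lambda>l. norm (\<alpha> (k - l))) summable_on UNIV"
      using an summable_on_int_shift(3)[of "\<lambda>m. norm (\<alpha> m)" k] by simp
  qed (simp add: K_def)
  have cols: "(\<lambda>k. K k l) summable_on UNIV" for l
  proof (rule summable_on_norm_le)
    show "(\<lambda>k. norm (\<alpha> (k - l))) summable_on UNIV"
      using an summable_on_int_shift(2)[of "\<lambda>m. norm (\<alpha> m)" l] by simp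
  qed (simp add: K_def)
  have "ell2 f" unfolding ell2 using f s by (auto intro: wt_mono)
  then obtain u where u: "ell2 u" and eq: "\<And>k. u k + mat_apply K (mat_apply (mat_adj K) u) k = f k"
    using solve_positive_hs[OF HS rows cols] by blast
  define v where "v = mat_apply (mat_adj K) u"
  define w where "w l = v l + (if l = 0 then e2 else 0)" for l
  have v0: "v l = 0" if "0 \<le> l" for l
    using that by (simp add: v_def mat_apply_def mat_adj_def K_def)
  have u0: "u k = 0" if "k < 0" for k
    using eq[of k] that by (simp add: mat_apply_def K_def f_def)
  have w0: "w l = 0" if "0 < l" for l using that v0[of l] by (simp add: w_def)
  have v_conv: "v m = conv (\<lambda>m. cnj (\<alpha> (- m))) u m" if "m < 0" for m
    unfolding v_def mat_apply_def conv_def mat_adj_def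
    by (intro infsum_cong) (use that u0 in \<open>auto simp: K_def\<close>)
  have w_bdd: "norm (\<alpha> m) \<le> infsum (\<lambda>m. norm (\<alpha> m)) UNIV" for m
    using wt_summable[OF \<alpha>1] by (intro summable_on_norm_bounded) simp
  define \<alpha>' where "\<alpha>' m = cnj (\<alpha> (- m))" for m
  have \<alpha>': "wt s \<alpha>'" "wt 1 \<alpha>'"
    unfolding \<alpha>'_def[abs_def] using \<alpha> \<alpha>1 by (auto intro!: wt_cnj wt_reflect)
  have prod: "(\<lambda>l. norm (a (m - l)) * norm (x l)) summable_on UNIV" if "wt 1 a" "wt 0 x" for a x :: "int \<Rightarrow> complex" and m
  proof (rule summable_on_square_mult)
    have "wt 0 a" using that(1) by (rule wt_mono) simp
    then show "(\<lambda>l. (norm (a (m - l)))\<^sup>2) summable_on UNIV"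
      using summable_on_int_shift(3)[of "\<lambda>l. (norm (a l))\<^sup>2" m] by (simp add: wt_def)
    show "(\<lambda>l. (norm (x l))\<^sup>2) summable_on UNIV" using that by (simp add: wt_def)
  qed
  have v_le: "norm (v m) \<le> infsum (\<lambda>l. norm (\<alpha>' (m - l)) * norm (u l)) UNIV" if "wt 0 u" for m
  proof (cases "m < 0")
    case True
    then show ?thesis
      unfolding v_conv[OF True] conv_def
      by (intro norm_infsum_le_infsum prod \<alpha>' that) (simp add: \<alpha>'_def norm_mult)
  qed (simp add: v0 infsum_nonneg)
  define g where "g k = f k - u k" for k
  have gK: "g = mat_apply K v" using eq by (auto simp: g_def v_def fun_eq_iff algebra_simps)
  have g_le: "norm (g m) \<le> infsum (\<lambda>l. norm (\<alpha> (m - l)) * norm (v l)) UNIV" if "wt 0 v" for m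
    unfolding gK mat_apply_def
    by (intro norm_infsum_le_infsum prod \<alpha>1 that) (simp add: K_def norm_mult)
  have g0: "g m = 0" if "m < 0" for m
    using that by (simp add: g_def f_def u0)
  have u_g: "u = (\<lambda>k. f k - g k)" by (simp add: g_def)
  have gainv: "wt t v" if "wt \<sigma> \<alpha>'" "0 \<le> t" "t \<le> \<sigma>" "(\<lambda>l. bracket l powr (t - \<sigma>) * norm (u l)) summable_on UNIV" "wt 0 u" for t \<sigma>
  proof (rule hankel_gain[OF that(1-4) v_le[OF that(5)] _ prod[OF \<alpha>'(2) that(5)]])
    show "m * l \<le> 0" if "v m \<noteq> 0" "u l \<noteq> 0" for m l
      using that v0[of m] u0[of l] by (force simp: mult_le_0_iff)
  qed
  have gaing: "wt t g" if "wt \<sigma> \<alpha>" "0 \<le> t" "t \<le> \<sigma>" "(\<lambda>l. bracket l powr (t - \<sigma>) * norm (v l)) summable_on UNIV" "wt 0 v" for t \<sigma>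
  proof (rule hankel_gain[OF that(1-4) g_le[OF that(5)] _ prod[OF \<alpha>1 that(5)]])
    show "m * l \<le> 0" if "g m \<noteq> 0" "v l \<noteq> 0" for m l
      using that g0[of m] v0[of l] by (force simp: mult_le_0_iff)
  qed
  have uw0: "wt 0 u" using u by (simp add: ell2)
  \<comment> \<open>Using weight 1 of the symbol, \<open>hankel_gain\<close> reaches every
    \<open>t < 1/2\<close> from square summability, just short of absolute summability. From
    \<open>1/4\<close> a second round reaches every \<open>t < 3/4\<close>, in particular
    \<open>5/8\<close>. This exceeds \<open>1/2\<close>, so \<open>u\<close> becomes absolutely
    summable, and from there the full weight \<open>s\<close> is obtained at once.\<close>
  have v14: "wt (1/4) v"
    by (rule gainv[OF \<alpha>'(2)]) (use uw0 in \<open>auto intro!: wt_summable_powr[OF uw0]\<close>)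
  have v00: "wt 0 v" using v14 by (rule wt_mono) simp
  have "wt (5/8) g"
    by (rule gaing[OF \<alpha>1]) (use v00 in \<open>auto intro!: wt_summable_powr[OF v14]\<close>)
  then have u58: "wt (5/8) u"
    unfolding u_g using f s by (intro wt_diff wt_mono[OF f]) auto
  have vs: "wt s v"
    by (rule gainv[OF \<alpha>'(1)]) (use s uw0 wt_norm_summable[OF u58] in auto)
  have gs: "wt s g"
    by (rule gaing[OF \<alpha>]) (use s v00 wt_norm_summable[OF vs] in auto)
  have us: "wt s u" unfolding u_g by (intro wt_diff f gs)
  have ws: "wt s w" unfolding w_def[abs_def] by (intro wt_add vs wt_delta)
  have "u m = (if m = 0 then e1 else 0) - conv \<alpha> w m" if m: "0 \<le> m" for m
  proof -
    have s1: "(\<lambda>l. \<alpha> (m - l) * v l) summable_on UNIV"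
      using wt_summable[OF \<alpha>1] wt_summable[OF vs] s by (intro conv_summable) auto
    have s2: "((\<lambda>l. \<alpha> (m - l) * (if l = 0 then e2 else 0)) has_sum \<alpha> m * e2) UNIV"
      by (rule has_sum_finite_neutralI[of "{0}"]) auto
    have "conv \<alpha> w m = infsum (\<lambda>l. \<alpha> (m - l) * v l + \<alpha> (m - l) * (if l = 0 then e2 else 0)) UNIV"
      unfolding conv_def w_def by (intro infsum_cong) (simp add: algebra_simps)
    also have "\<dots> = infsum (\<lambda>l. \<alpha> (m - l) * v l) UNIV + \<alpha> m * e2"
      using s1 s2 by (subst infsum_add) (auto simp: has_sum_iff)
    also have "infsum (\<lambda>l. \<alpha> (m - l) * v l) UNIV = g m"
      unfolding gK mat_apply_def by (intro infsum_cong) (use m v0 in \<open>auto simp: K_def\<close>)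
    finally show ?thesis using m by (simp add: g_def f_def)
  qed
  moreover have "w m = conv (\<lambda>m. cnj (\<alpha> (- m))) u m" if "m < 0" for m
    using that v_conv by (simp add: w_def)
  moreover have "w 0 = e2" by (simp add: w_def v0)
  ultimately show thesis using that[of u w] us ws u0 w0 by blast
qed

subsection \<open>Fourier series\<close>

abbreviation L01 :: "real measure" where "L01 \<equiv> lebesgue_on {0..1}"

lemma L01_finite: "finite_measure L01"
  by (rule finite_measure_lebesgue_on) simp

lemma L01_integral_unique:
  fixes f :: "real \<Rightarrow> complex"
  assumes "integrable L01 f" "(f has_integral c) {0..1}"
  shows "integral\<^sup>L L01 f = c"
  by (rule has_integral_unique[OF has_integral_integral_lebesgue_on[OF assms(1)] assms(2)]) simp

definition sqint :: "(real \<Rightarrow> complex) \<Rightarrow> bool" where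
  "sqint g \<longleftrightarrow> g \<in> borel_measurable L01 \<and> integrable L01 (\<lambda>t. (norm (g t))\<^sup>2)"

lemma sqint_mult_integrable:
  assumes "sqint g" "sqint h"
  shows "integrable L01 (\<lambda>t. g t * h t)"
proof (rule Bochner_Integration.integrable_bound)
  show "integrable L01 (\<lambda>t. (norm (g t))\<^sup>2 + (norm (h t))\<^sup>2)"
    using assms by (auto simp: sqint_def)
  show "(\<lambda>t. g t * h t) \<in> borel_measurable L01"
    using assms by (auto simp: sqint_def)
  have "norm (g t * h t) \<le> (norm (g t))\<^sup>2 + (norm (h t))\<^sup>2" for t
  proof -
    have "norm (g t) * norm (h t) \<le> 2 * norm (g t) * norm (h t)" by simp
    also have "\<dots> \<le> (norm (g t))\<^sup>2 + (norm (h t))\<^sup>2" by (rule sum_squares_bound)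
    finally show ?thesis by (simp add: norm_mult)
  qed
  then show "AE t in L01. norm (g t * h t) \<le> norm ((norm (g t))\<^sup>2 + (norm (h t))\<^sup>2)" by simp
qed

lemma sqint_continuous: "continuous_on {0..1} g \<Longrightarrow> sqint g"
  unfolding sqint_def
  by (auto intro!: continuous_imp_measurable_on_sets_lebesgue continuous_imp_integrable_real continuous_intros)

lemma sqint_integrable: "sqint g \<Longrightarrow> integrable L01 g"
  using sqint_mult_integrable[of g "\<lambda>_. 1"] sqint_continuous[of "\<lambda>_. 1"] by simp

lemma sqint_mult_continuous:
  assumes "sqint g" "continuous_on {0..1} h"
  shows "sqint (\<lambda>t. h t * g t)"
proof -
  have "compact (h ` {0..1})" using assms(2) by (intro compact_continuous_image) auto
  then obtain C where C: "\<And>t. t \<in> {0..1} \<Longrightarrow> norm (h t) \<le> C"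
    using compact_imp_bounded bounded_iff by (metis (no_types) imageI)
  have m: "(\<lambda>t. h t * g t) \<in> borel_measurable L01"
    using assms(1) continuous_imp_measurable_on_sets_lebesgue[OF assms(2)] by (auto simp: sqint_def)
  have "integrable L01 (\<lambda>t. C\<^sup>2 * (norm (g t))\<^sup>2)" using assms by (auto simp: sqint_def)
  then have "integrable L01 (\<lambda>t. (norm (h t * g t))\<^sup>2)"
  proof (rule Bochner_Integration.integrable_bound)
    show "AE t in L01. norm ((norm (h t * g t))\<^sup>2) \<le> norm (C\<^sup>2 * (norm (g t))\<^sup>2)"
    proof (rule AE_I2)
      fix t assume "t \<in> space L01"
      then have "norm (h t * g t) \<le> C * norm (g t)"
        using C by (auto simp: norm_mult intro: mult_right_mono)
      then have "(norm (h t * g t))\<^sup>2 \<le> (C * norm (g t))\<^sup>2" by (rule power_mono) simp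
      then show "norm ((norm (h t * g t))\<^sup>2) \<le> norm (C\<^sup>2 * (norm (g t))\<^sup>2)"
        by (simp add: power_mult_distrib)
    qed
  qed (use m in measurable)
  with m show ?thesis by (simp add: sqint_def)
qed

lemma sqint_cnj:
  assumes "sqint g"
  shows "sqint (\<lambda>t. cnj (g t))"
proof -
  have "cnj \<in> borel_measurable borel"
    by (intro borel_measurable_continuous_onI continuous_intros)
  then have "(\<lambda>t. cnj (g t)) \<in> borel_measurable L01"
    using assms unfolding sqint_def by (intro measurable_compose[of g L01 borel cnj borel]) blast
  then show ?thesis using assms by (simp add: sqint_def)
qed

definition expi :: "int \<Rightarrow> real \<Rightarrow> complex" where
  "expi m t = cis (2 * pi * of_int m * t)"

lemma expi_0 [simp]: "expi 0 t = 1" "expi m 0 = 1" "expi m 1 = 1"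
  by (simp_all add: expi_def cis_multiple_2pi)

lemma expi_add: "expi (m + l) t = expi m t * expi l t"
  by (simp add: expi_def cis_mult algebra_simps)

lemma expi_cnj: "cnj (expi m t) = expi (- m) t"
  by (simp add: expi_def cis_cnj)

lemma norm_expi [simp]: "norm (expi m t) = 1"
  by (simp add: expi_def)

lemma continuous_expi [continuous_intros]: "continuous_on A (expi m)"
  unfolding expi_def[abs_def] by (auto intro!: continuous_intros)

lemma expi_deriv: "(expi m has_vector_derivative 2 * pi * \<i> * of_int m * expi m t) (at t within A)"
proof -
  have "((\<lambda>z. exp (\<i> * (2 * pi * of_int m * z))) has_field_derivative
      (2 * pi * \<i> * of_int m * exp (\<i> * (2 * pi * of_int m * of_real t)))) (at (of_real t))"
    by (auto intro!: derivative_eq_intros)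
  from has_vector_derivative_real_field[OF this, of A] show ?thesis
    by (simp add: expi_def[abs_def] cis_conv_exp)
qed

lemma expi_has_integral:
  assumes "m \<noteq> 0" "a \<le> b"
  shows "(expi m has_integral (expi m b - expi m a) / (2 * pi * \<i> * of_int m)) {a..b}"
proof -
  define c where "c = 2 * pi * \<i> * of_int m"
  have c: "c \<noteq> 0" using assms by (simp add: c_def)
  have "((\<lambda>t. inverse c * expi m t) has_vector_derivative inverse c * (c * expi m t)) (at t within {a..b})" for t
    unfolding c_def by (rule has_vector_derivative_mult_right[OF expi_deriv])
  then have "((\<lambda>t. inverse c * (c * expi m t)) has_integral (inverse c * expi m b - inverse c * expi m a)) {a..b}"
    using assms(2) by (intro fundamental_theorem_of_calculus) auto
  moreover have "inverse c * (c * x) = x" for x using c by (simp add: mult.assoc[symmetric])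
  ultimately have "(expi m has_integral (inverse c * expi m b - inverse c * expi m a)) {a..b}" by simp
  moreover have "inverse c * expi m b - inverse c * expi m a = (expi m b - expi m a) / c"
    by (simp only: divide_inverse right_diff_distrib[symmetric] mult.commute)
  ultimately show ?thesis by (simp only: c_def)
qed

lemma integral_expi: "integral\<^sup>L L01 (expi m) = (if m = 0 then 1 else 0)"
proof -
  have i: "integrable L01 (expi m)"
    by (intro continuous_imp_integrable_real continuous_intros)
  have "(expi m has_integral (if m = 0 then 1 else 0)) {0..1}"
  proof (cases "m = 0")
    case True
    then show ?thesis using has_integral_const_real[of "1::complex" 0 1] by (simp add: expi_def[abs_def])
  next
    case False
    then show ?thesis using expi_has_integral[of m 0 1] by simp
  qed
  with i show ?thesis by (rule L01_integral_unique)
qed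

definition fc :: "(real \<Rightarrow> complex) \<Rightarrow> int \<Rightarrow> complex" where
  "fc g m = (LINT t|L01. g t * expi (- m) t)"

lemma integrable_mult_expi:
  assumes "integrable L01 g"
  shows "integrable L01 (\<lambda>t. g t * expi m t)"
proof (rule Bochner_Integration.integrable_bound[OF assms])
  have "expi m \<in> borel_measurable L01"
    by (intro continuous_imp_measurable_on_sets_lebesgue continuous_intros) auto
  then show "(\<lambda>t. g t * expi m t) \<in> borel_measurable L01"
    using assms by auto
qed (simp add: norm_mult)

lemma fc_diff: "integrable L01 g \<Longrightarrow> integrable L01 h \<Longrightarrow> fc (\<lambda>t. g t - h t) m = fc g m - fc h m"
  by (simp add: fc_def left_diff_distrib integrable_mult_expi)

lemma fc_cmult: "fc (\<lambda>t. c * g t) m = c * fc g m"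
  by (simp add: fc_def mult.assoc)

lemma fc_expi: "fc (expi l) m = (if l = m then 1 else 0)"
  by (simp add: fc_def integral_expi flip: expi_add)

lemma trig_poly_integrable: "integrable L01 (\<lambda>t. \<Sum>m\<in>F. x m * expi m t)"
  by (intro continuous_imp_integrable_real continuous_intros)

lemma fc_trig_poly:
  assumes "finite F"
  shows "fc (\<lambda>t. \<Sum>m\<in>F. x m * expi m t) l = (if l \<in> F then x l else 0)"
proof -
  have "fc (\<lambda>t. \<Sum>m\<in>F. x m * expi m t) l = (\<Sum>m\<in>F. fc (\<lambda>t. x m * expi m t) l)"
    unfolding fc_def sum_distrib_right
    by (intro Bochner_Integration.integral_sum integrable_mult_expi continuous_imp_integrable_real continuous_intros)
  also have "\<dots> = (\<Sum>m\<in>F. if m = l then x m else 0)"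
    by (intro sum.cong refl) (simp add: fc_cmult fc_expi)
  finally show ?thesis using assms by simp
qed

lemma norm_fc_le:
  assumes "integrable L01 g"
  shows "norm (fc g m) \<le> (LINT t|L01. norm (g t))"
proof -
  have "norm (fc g m) \<le> (LINT t|L01. norm (g t * expi (- m) t))"
    unfolding fc_def by simp
  then show ?thesis by (simp add: norm_mult)
qed

text \<open>Orthonormality of the exponentials gives the first part. The second is the nonnegativity
  of the integral of the squared distance between \<open>g\<close> and its Fourier partial
  sum.\<close>

lemma fc_parseval_finite:
  assumes g: "sqint g" and F: "finite F"
  shows "(LINT t|L01. (norm (\<Sum>m\<in>F. x m * expi m t))\<^sup>2) = (\<Sum>m\<in>F. (norm (x m))\<^sup>2)"
    and "(\<Sum>m\<in>F. (norm (fc g m))\<^sup>2) \<le> (LINT t|L01. (norm (g t))\<^sup>2)"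
proof -
  have p: "(LINT t|L01. h t * cnj (\<Sum>m\<in>F. x m * expi m t)) = (\<Sum>m\<in>F. fc h m * cnj (x m))" if "integrable L01 h" for h x
  proof -
    have "(LINT t|L01. h t * cnj (\<Sum>m\<in>F. x m * expi m t)) = (LINT t|L01. (\<Sum>m\<in>F. cnj (x m) * (h t * expi (- m) t)))"
      by (intro Bochner_Integration.integral_cong) (auto simp: sum_distrib_left expi_cnj mult_ac)
    also have "\<dots> = (\<Sum>m\<in>F. LINT t|L01. cnj (x m) * (h t * expi (- m) t))"
      by (intro Bochner_Integration.integral_sum integrable_mult_right integrable_mult_expi that)
    finally show ?thesis by (simp add: fc_def mult.commute)
  qed
  have P: "(LINT t|L01. (norm (\<Sum>m\<in>F. x m * expi m t))\<^sup>2) = (\<Sum>m\<in>F. (norm (x m))\<^sup>2)" for x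
  proof -
    have "complex_of_real (LINT t|L01. (norm (\<Sum>m\<in>F. x m * expi m t))\<^sup>2)
        = (LINT t|L01. (\<Sum>m\<in>F. x m * expi m t) * cnj (\<Sum>m\<in>F. x m * expi m t))"
      by (simp only: integral_complex_of_real[symmetric] complex_norm_square)
    also have "\<dots> = (\<Sum>m\<in>F. x m * cnj (x m))"
      using F by (subst p[OF trig_poly_integrable]) (simp add: fc_trig_poly)
    also have "\<dots> = of_real (\<Sum>m\<in>F. (norm (x m))\<^sup>2)"
      unfolding of_real_sum complex_norm_square ..
    finally show ?thesis by (simp only: of_real_eq_iff)
  qed
  show "(LINT t|L01. (norm (\<Sum>m\<in>F. x m * expi m t))\<^sup>2) = (\<Sum>m\<in>F. (norm (x m))\<^sup>2)" by (rule P)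
  let ?S = "\<lambda>t. \<Sum>m\<in>F. fc g m * expi m t"
  have S: "sqint ?S" by (intro sqint_continuous continuous_intros)
  have gi: "integrable L01 (\<lambda>t. (norm (g t))\<^sup>2)" and Si: "integrable L01 (\<lambda>t. (norm (?S t))\<^sup>2)"
    using g S by (auto simp: sqint_def)
  have gS: "integrable L01 (\<lambda>t. g t * cnj (?S t))" by (intro sqint_mult_integrable g sqint_cnj S)
  have nd: "(norm (a - b))\<^sup>2 = (norm a)\<^sup>2 - 2 * Re (a * cnj b) + (norm b)\<^sup>2" for a b :: complex
    unfolding cmod_power2 by (simp add: power2_eq_square algebra_simps)
  have "0 \<le> (LINT t|L01. (norm (g t - ?S t))\<^sup>2)" by (rule Bochner_Integration.integral_nonneg) simp
  also have "\<dots> = (LINT t|L01. (norm (g t))\<^sup>2 - 2 * Re (g t * cnj (?S t)) + (norm (?S t))\<^sup>2)"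
    by (intro Bochner_Integration.integral_cong refl nd)
  also have "\<dots> = (LINT t|L01. (norm (g t))\<^sup>2) - 2 * Re (LINT t|L01. g t * cnj (?S t)) + (LINT t|L01. (norm (?S t))\<^sup>2)"
  proof -
    have lin: "(LINT t|L01. a t - 2 * Re (b t) + d t) = (LINT t|L01. a t) - 2 * Re (LINT t|L01. b t) + (LINT t|L01. d t)"
      if "integrable L01 a" "integrable L01 b" "integrable L01 d" for a d :: "real \<Rightarrow> real" and b
      using that by simp
    show ?thesis by (rule lin[OF gi gS Si])
  qed
  also have "(LINT t|L01. g t * cnj (?S t)) = of_real (\<Sum>m\<in>F. (norm (fc g m))\<^sup>2)"
    unfolding p[OF sqint_integrable[OF g]] of_real_sum complex_norm_square ..
  also have "(LINT t|L01. (norm (?S t))\<^sup>2) = (\<Sum>m\<in>F. (norm (fc g m))\<^sup>2)" by (rule P)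
  finally show "(\<Sum>m\<in>F. (norm (fc g m))\<^sup>2) \<le> (LINT t|L01. (norm (g t))\<^sup>2)" by simp
qed

lemma bessel:
  assumes "sqint g"
  shows "wt 0 (fc g)"
  unfolding wt_def
  by (rule nonneg_bounded_partial_sums_imp_summable_on[where C = "LINT t|L01. (norm (g t))\<^sup>2"])
    (use fc_parseval_finite(2)[OF assms] in \<open>auto intro!: eventually_finite_subsets_at_top_weakI\<close>)

text \<open>As \<open>H\<close> is merely integrable, integration by parts takes the form of
  Fubini's theorem on the triangle \<open>s \<le> t\<close>: the function
  \<open>H s * expi (- m) t\<close> is integrated first over \<open>t\<close>, then first over
  \<open>s\<close>.\<close>

lemma fc_primitive:
  assumes H: "integrable L01 H" and G: "\<And>t. t \<in> {0..1} \<Longrightarrow> (H has_integral (G t - G 0)) {0..t}"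
    and per: "G 1 = G 0"
  shows "fc H m = 2 * pi * \<i> * of_int m * fc G m"
proof -
  define c where "c = - (2 * pi * \<i> * of_int m)"
  have H0: "(LINT t|L01. H t) = 0"
    by (rule L01_integral_unique[OF H]) (use G[of 1] per in simp)
  show ?thesis
  proof (cases "m = 0")
    case True
    then show ?thesis using H0 by (simp add: fc_def)
  next
    case False
    then have c: "c \<noteq> 0" by (simp add: c_def)
    interpret finite_measure L01 by (rule L01_finite)
    interpret pair_sigma_finite L01 L01 ..
    define k where "k s t = (if s \<le> t then H s * expi (- m) t else 0)" for s t :: real
    have Hm: "H \<in> borel_measurable L01" using H by auto
    have em: "expi (- m) \<in> borel_measurable L01"
      by (intro continuous_imp_measurable_on_sets_lebesgue continuous_intros) auto
    have idm: "(\<lambda>x. x) \<in> borel_measurable L01"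
      by (intro continuous_imp_measurable_on_sets_lebesgue continuous_intros) auto
    have km: "case_prod k \<in> borel_measurable (L01 \<Otimes>\<^sub>M L01)"
    proof -
      have "(\<lambda>p. if fst p \<le> snd p then H (fst p) * expi (- m) (snd p) else 0) \<in> borel_measurable (L01 \<Otimes>\<^sub>M L01)"
      proof (rule measurable_If)
        show "(\<lambda>p. H (fst p) * expi (- m) (snd p)) \<in> borel_measurable (L01 \<Otimes>\<^sub>M L01)"
          by (intro borel_measurable_times measurable_compose[OF measurable_fst Hm] measurable_compose[OF measurable_snd em])
        show "{p \<in> space (L01 \<Otimes>\<^sub>M L01). fst p \<le> snd p} \<in> sets (L01 \<Otimes>\<^sub>M L01)"
          by (intro borel_measurable_le measurable_compose[OF measurable_fst idm] measurable_compose[OF measurable_snd idm])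
      qed simp
      then show ?thesis by (simp add: k_def case_prod_unfold)
    qed
    have ki: "integrable L01 (\<lambda>t. if s \<le> t then expi (- m) t else 0)" for s
    proof (rule Bochner_Integration.integrable_bound[where f = "\<lambda>_. 1::real"])
      have "{t \<in> space L01. s \<le> t} \<in> sets L01"
        by (intro borel_measurable_le idm) auto
      then show "(\<lambda>t. if s \<le> t then expi (- m) t else 0) \<in> borel_measurable L01"
        by (intro measurable_If em) auto
    qed auto
    have "integrable (L01 \<Otimes>\<^sub>M L01) (case_prod k)"
    proof (rule Fubini_integrable[OF km])
      have ks: "integrable L01 (\<lambda>t. k s t)" for s
      proof -
        have "k s = (\<lambda>t. H s * (if s \<le> t then expi (- m) t else 0))" by (auto simp: k_def)
        then show ?thesis using integrable_mult_right[OF ki[of s], of "H s"] by simp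
      qed
      then show "AE s in L01. integrable L01 (\<lambda>t. case_prod k (s, t))" by simp
      show "integrable L01 (\<lambda>s. LINT t|L01. norm (case_prod k (s, t)))"
      proof (rule Bochner_Integration.integrable_bound[OF integrable_norm[OF H]])
        show "(\<lambda>s. LINT t|L01. norm (case_prod k (s, t))) \<in> borel_measurable L01"
          using km by measurable
        have "(LINT t|L01. norm (k s t)) \<le> norm (H s)" for s
        proof -
          have "(LINT t|L01. norm (k s t)) \<le> (LINT t|L01. norm (H s))"
            using ks by (intro integral_mono) (auto simp: k_def norm_mult)
          then show ?thesis by (simp add: measure_restrict_space)
        qed
        moreover have "0 \<le> (LINT t|L01. norm (k s t))" for s
          by (rule Bochner_Integration.integral_nonneg) simp
        ultimately show "AE s in L01. norm (LINT t|L01. norm (case_prod k (s, t))) \<le> norm (norm (H s))"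
          by simp
      qed
    qed
    then have fub: "(LINT s|L01. LINT t|L01. k s t) = (LINT t|L01. LINT s|L01. k s t)"
      by (simp add: integral_fst integral_snd)
    have inner1: "(LINT t|L01. k s t) = (H s - H s * expi (- m) s) / c" if s: "s \<in> {0..1}" for s
    proof -
      have "(expi (- m) has_integral (expi (- m) 1 / c - expi (- m) s / c)) {s..1}"
        using expi_has_integral[of "- m" s 1] s False by (simp add: c_def diff_divide_distrib)
      then have "((\<lambda>t. if t \<in> {s..1} then expi (- m) t else 0) has_integral (expi (- m) 1 / c - expi (- m) s / c)) {0..1}"
        by (subst has_integral_restrict) (use s in auto)
      then have "((\<lambda>t. if s \<le> t then expi (- m) t else 0) has_integral (expi (- m) 1 / c - expi (- m) s / c)) {0..1}"
        by (rule has_integral_eq[rotated]) auto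
      then have "(LINT t|L01. (if s \<le> t then expi (- m) t else 0)) = expi (- m) 1 / c - expi (- m) s / c"
        by (rule L01_integral_unique[OF ki])
      moreover have "k s = (\<lambda>t. H s * (if s \<le> t then expi (- m) t else 0))" by (auto simp: k_def)
      then have "(LINT t|L01. k s t) = H s * (LINT t|L01. (if s \<le> t then expi (- m) t else 0))"
        by simp
      ultimately show ?thesis by (simp add: right_diff_distrib diff_divide_distrib)
    qed
    have inner2: "(LINT s|L01. k s t) = (G t - G 0) * expi (- m) t" if t: "t \<in> {0..1}" for t
    proof -
      have Hi: "integrable L01 (\<lambda>s. if s \<le> t then H s else 0)"
      proof (rule Bochner_Integration.integrable_bound[OF H])
        have "{s \<in> space L01. s \<le> t} \<in> sets L01"
          by (intro borel_measurable_le idm) auto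
        then show "(\<lambda>s. if s \<le> t then H s else 0) \<in> borel_measurable L01"
          by (intro measurable_If Hm) auto
      qed auto
      have "((\<lambda>s. if s \<in> {0..t} then H s else 0) has_integral (G t - G 0)) {0..1}"
      proof (subst has_integral_restrict)
        show "{0..t} \<subseteq> {0..1}" using t by simp
      qed (rule G[OF t])
      then have "((\<lambda>s. if s \<le> t then H s else 0) has_integral (G t - G 0)) {0..1}"
        by (rule has_integral_eq[rotated]) simp
      then have "(LINT s|L01. (if s \<le> t then H s else 0)) = G t - G 0"
        by (rule L01_integral_unique[OF Hi])
      moreover have "(\<lambda>s. k s t) = (\<lambda>s. (if s \<le> t then H s else 0) * expi (- m) t)"
        by (auto simp: k_def)
      ultimately show ?thesis by (simp only: Bochner_Integration.integral_mult_left_zero)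
    qed
    have "(LINT s|L01. LINT t|L01. k s t) = (LINT s|L01. (H s - H s * expi (- m) s) / c)"
      by (rule Bochner_Integration.integral_cong[OF refl], rule inner1) simp
    \<comment> \<open>Periodicity enters here: \<open>G 1 = G 0\<close> makes the integral of
      \<open>H\<close> vanish, so the summand \<open>H s\<close> contributes nothing.\<close>
    also have "\<dots> = - fc H m / c"
      using integrable_mult_expi[OF H, of "- m"] H H0 by (simp add: fc_def)
    finally have 1: "(LINT s|L01. LINT t|L01. k s t) = - fc H m / c" .
    have Gc: "continuous_on {0..1} G"
    proof -
      have "H integrable_on {0..1}" using G[of 1] by auto
      then have "continuous_on {0..1} (\<lambda>t. integral {0..t} H)"
        by (rule indefinite_integral_continuous_1)
      then have "continuous_on {0..1} (\<lambda>t. G 0 + integral {0..t} H)"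
        by (intro continuous_intros)
      then show ?thesis
        by (rule continuous_on_eq) (simp add: integral_unique[OF G])
    qed
    have "(LINT t|L01. LINT s|L01. k s t) = (LINT t|L01. (G t - G 0) * expi (- m) t)"
      by (rule Bochner_Integration.integral_cong[OF refl], rule inner2) simp
    also have "\<dots> = fc (\<lambda>t. G t - G 0) m" by (simp add: fc_def)
    also have "\<dots> = fc G m - fc (\<lambda>t. G 0) m"
      by (rule fc_diff[OF continuous_imp_integrable_real[OF Gc]]) simp
    also have "fc (\<lambda>t. G 0) m = G 0 * (LINT t|L01. expi (- m) t)" by (simp add: fc_def)
    also have "fc G m - \<dots> = fc G m" using False by (simp add: integral_expi)
    finally have "- fc H m / c = fc G m" using fub 1 by simp
    then show ?thesis using c by (simp add: c_def field_simps)
  qed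
qed

text \<open>Trigonometric polynomials without explicit coefficients: closure under products and
  orthogonality relations then follow by induction.\<close>

inductive trig :: "(real \<Rightarrow> complex) \<Rightarrow> bool" where
  trig_expi: "trig (\<lambda>t. c * expi m t)"
| trig_add: "trig f \<Longrightarrow> trig g \<Longrightarrow> trig (\<lambda>t. f t + g t)"

lemma trig_const: "trig (\<lambda>t. c)"
  using trig_expi[of c 0] by simp

lemma trig_mult:
  assumes "trig f" "trig g"
  shows "trig (\<lambda>t. f t * g t)"
  using assms(1)
proof induction
  case (trig_expi c m)
  show ?case
    using assms(2)
  proof induction
    case (trig_expi d l)
    have "(\<lambda>t. c * expi m t * (d * expi l t)) = (\<lambda>t. c * d * expi (m + l) t)"
      by (simp add: expi_add mult_ac)
    then show ?case using trig.trig_expi by simp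
  next
    case (trig_add f g)
    then show ?case using trig.trig_add by (simp add: distrib_left)
  qed
next
  case (trig_add f h)
  then show ?case using trig.trig_add by (simp add: distrib_right)
qed

lemma trig_continuous: "trig h \<Longrightarrow> continuous_on A h"
  by (induction rule: trig.induct) (auto intro!: continuous_intros)

lemma trig_annihilated:
  assumes g: "sqint g" and z: "\<And>m. fc g m = 0" and h: "trig h"
  shows "(LINT t|L01. g t * h t) = 0"
  using h
proof induction
  case (trig_expi c m)
  have "(LINT t|L01. g t * (c * expi m t)) = (LINT t|L01. c * (g t * expi m t))"
    by (simp add: mult_ac)
  also have "\<dots> = c * fc g (- m)" by (simp add: fc_def)
  finally show ?case using z by simp
next
  case (trig_add f h)
  have "integrable L01 (\<lambda>t. g t * f t)" "integrable L01 (\<lambda>t. g t * h t)"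
    using trig_add.hyps by (auto intro!: sqint_mult_integrable g sqint_continuous trig_continuous)
  then show ?case using trig_add.IH by (simp add: distrib_left)
qed

lemma trig_real_polynomial:
  fixes q :: "complex \<Rightarrow> real"
  assumes "real_polynomial_function q"
  shows "trig (\<lambda>t. of_real (q (cis (2 * pi * t))))"
  using assms
proof induction
  case (linear f)
  have f: "f z = Re z * f 1 + Im z * f \<i>" for z
  proof -
    have "f z = f (Re z *\<^sub>R 1 + Im z *\<^sub>R \<i>)"
      by (rule arg_cong[of _ _ f]) (simp add: complex_eq_iff)
    also have "\<dots> = Re z *\<^sub>R f 1 + Im z *\<^sub>R f \<i>"
      using linear by (simp add: bounded_linear_def linear_add linear_scale)
    finally show ?thesis by simp
  qed
  \<comment> \<open>With \<open>e = expi 1 t\<close> and \<open>e' = expi (-1) t\<close>, the real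
    and imaginary parts of the point on the circle are \<open>(e + e') / 2\<close> and
    \<open>(e - e') / (2 * \<i>)\<close>.\<close>
  have "(\<lambda>t. of_real (f (cis (2 * pi * t)))) =
      (\<lambda>t. (of_real (f 1) / 2 + of_real (f \<i>) / (2 * \<i>)) * expi 1 t + (of_real (f 1) / 2 - of_real (f \<i>) / (2 * \<i>)) * expi (-1) t)"
    by (rule ext, subst f) (simp add: expi_def complex_eq_iff)
  then show ?case using trig_add[OF trig_expi trig_expi] by simp
next
  case (const c)
  then show ?case by (rule trig_const)
next
  case (add f g)
  then show ?case using trig_add by simp
next
  case (mult f g)
  then show ?case using trig_mult by simp
qed

text \<open>A loop is a continuous function on the unit circle. There the Stone-Weierstrass theorem
  provides a polynomial in the real coordinates, and such a polynomial is trigonometric in the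
  angle.\<close>

lemma trig_dense:
  assumes g: "continuous_on {0..1} g" "g 1 = g 0" and e: "0 < e"
  obtains h where "trig h" "\<And>t. t \<in> {0..1} \<Longrightarrow> norm (g t - h t) < e"
proof -
  define f where "f = g \<circ> (\<lambda>z. Arg2pi z / (2 * pi))"
  \<comment> \<open>The constant homotopy from \<open>g\<close> to itself: a theorem on homotopic
    loops turns it into continuity of \<open>f\<close> on the circle, including the point 1, where
    \<open>Arg2pi\<close> jumps and \<open>g 1 = g 0\<close> matters.\<close>
  have "homotopic_loops UNIV g g"
    using g by (simp add: homotopic_loops_refl path_def pathstart_def pathfinish_def)
  then have cf: "continuous_on (sphere 0 1) f"
    unfolding f_def using homotopic_with_imp_continuous[OF homotopic_loops_imp_homotopic_circlemaps] by blast
  have fg: "f (cis (2 * pi * t)) = g t" if t: "t \<in> {0..1}" for t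
  proof (cases "t = 1")
    case True
    have "Arg2pi 1 = 0" by (simp add: Arg2pi_eq_0)
    then show ?thesis using g(2) True by (simp add: f_def)
  next
    case False
    have "Arg2pi (cis (2 * pi * t)) = 2 * pi * t"
      by (rule Arg2pi_unique[of 1]) (use t False in \<open>auto simp: cis_conv_exp\<close>)
    then show ?thesis by (simp add: f_def)
  qed
  obtain q where q: "polynomial_function q" "\<And>z. z \<in> sphere 0 1 \<Longrightarrow> norm (f z - q z) < e"
    using Stone_Weierstrass_polynomial_function[OF compact_sphere cf e] by blast
  have q12: "real_polynomial_function (\<lambda>z. Re (q z))" "real_polynomial_function (\<lambda>z. Im (q z))"
    using q(1) unfolding polynomial_function_iff_Basis_inner by (auto simp: Basis_complex_def)
  have "trig (\<lambda>t. of_real (Re (q (cis (2 * pi * t)))) + \<i> * of_real (Im (q (cis (2 * pi * t)))))"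
    by (intro trig_add trig_mult trig_const trig_real_polynomial q12)
  then have "trig (\<lambda>t. q (cis (2 * pi * t)))" by (simp add: complex_eq[symmetric])
  moreover have "norm (g t - q (cis (2 * pi * t))) < e" if "t \<in> {0..1}" for t
    using q(2)[of "cis (2 * pi * t)"] fg[OF that] by simp
  ultimately show thesis using that by blast
qed

text \<open>\<open>g\<close> is orthogonal to all trigonometric polynomials. Subtracting one that is
  uniformly close to \<open>cnj g\<close> bounds the integral of the squared modulus of
  \<open>g\<close> by an arbitrarily small multiple of the integral of its modulus; continuity does
  the rest.\<close>

lemma fc_eq_0_imp_0:
  assumes g: "continuous_on {0..1} g" "g 1 = g 0" and z: "\<And>m. fc g m = 0" and t: "t \<in> {0..1}"
  shows "g t = 0"
proof -
  let ?I = "LINT t|L01. norm (g t)"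
  have gs: "sqint g" by (rule sqint_continuous) (rule g)
  have gi: "integrable L01 (\<lambda>t. norm (g t))" using sqint_integrable[OF gs] by simp
  have le: "(LINT t|L01. (norm (g t))\<^sup>2) \<le> e * ?I" if e: "0 < e" for e
  proof -
    have "continuous_on {0..1} (\<lambda>t. cnj (g t))" "cnj (g 1) = cnj (g 0)" using g by (auto intro!: continuous_intros)
    then obtain h where h: "trig h" "\<And>t. t \<in> {0..1} \<Longrightarrow> norm (cnj (g t) - h t) < e"
      using trig_dense[of "\<lambda>t. cnj (g t)" e] e by blast
    have i1: "integrable L01 (\<lambda>t. g t * cnj (g t))" by (intro sqint_mult_integrable gs sqint_cnj)
    have i2: "integrable L01 (\<lambda>t. g t * h t)"
      by (intro sqint_mult_integrable gs sqint_continuous trig_continuous h)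
    have "complex_of_real (LINT t|L01. (norm (g t))\<^sup>2) = (LINT t|L01. of_real ((norm (g t))\<^sup>2))"
      by (rule integral_complex_of_real[symmetric])
    also have "\<dots> = (LINT t|L01. g t * cnj (g t))" by (simp only: complex_norm_square)
    also have "\<dots> = (LINT t|L01. g t * cnj (g t)) - (LINT t|L01. g t * h t)"
      using trig_annihilated[OF gs z h(1)] by simp
    also have "\<dots> = (LINT t|L01. g t * (cnj (g t) - h t))"
      using i1 i2 by (simp add: right_diff_distrib)
    finally have "norm (complex_of_real (LINT t|L01. (norm (g t))\<^sup>2)) = norm (LINT t|L01. g t * (cnj (g t) - h t))" by simp
    also have "\<dots> \<le> (LINT t|L01. norm (g t * (cnj (g t) - h t)))" by simp
    also have "\<dots> \<le> (LINT t|L01. e * norm (g t))"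
    proof (rule integral_mono)
      have "integrable L01 (\<lambda>t. g t * cnj (g t) - g t * h t)" using i1 i2 by simp
      then show "integrable L01 (\<lambda>t. norm (g t * (cnj (g t) - h t)))" by (simp add: right_diff_distrib)
      show "integrable L01 (\<lambda>t. e * norm (g t))" using gi by simp
      fix t assume "t \<in> space L01"
      then have "norm (cnj (g t) - h t) \<le> e" using h(2)[of t] by simp
      then have "norm (g t) * norm (cnj (g t) - h t) \<le> norm (g t) * e" by (rule mult_left_mono) simp
      then show "norm (g t * (cnj (g t) - h t)) \<le> e * norm (g t)" by (simp add: norm_mult mult.commute)
    qed
    also have "\<dots> = e * ?I" by simp
    finally show ?thesis by (simp add: abs_if split: if_splits)
  qed
  have "(LINT t|L01. (norm (g t))\<^sup>2) \<le> 0"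
  proof (rule field_le_epsilon)
    fix d :: real assume d: "0 < d"
    have I: "0 \<le> ?I" by (rule Bochner_Integration.integral_nonneg) simp
    have "d / (1 + I) * I \<le> d" if "0 \<le> I" for I
      using that d by (simp add: pos_divide_le_eq)
    then have "d / (1 + ?I) * ?I \<le> d" using I by blast
    then show "(LINT t|L01. (norm (g t))\<^sup>2) \<le> 0 + d"
      using le[of "d / (1 + ?I)"] d I by auto
  qed
  moreover have "0 \<le> (LINT t|L01. (norm (g t))\<^sup>2)" by (rule Bochner_Integration.integral_nonneg) simp
  ultimately have "(LINT t|L01. (norm (g t))\<^sup>2) = 0" by linarith
  moreover have "((\<lambda>t. (norm (g t))\<^sup>2) has_integral (LINT t|L01. (norm (g t))\<^sup>2)) {0..1}"
    by (rule has_integral_integral_lebesgue_on) (use gs in \<open>auto simp: sqint_def\<close>)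
  ultimately have "((\<lambda>t. (norm (g t))\<^sup>2) has_integral 0) (cbox 0 1)" by simp
  then have "(norm (g t))\<^sup>2 = 0"
    by (rule has_integral_0_cbox_imp_0[rotated 2]) (use g t in \<open>auto intro!: continuous_intros\<close>)
  then show ?thesis by simp
qed

section \<open>Absolutely convergent Fourier series and the Riesz-Fischer theorem\<close>

definition fser :: "(int \<Rightarrow> complex) \<Rightarrow> real \<Rightarrow> complex" where
  "fser x t = infsum (\<lambda>m. x m * expi m t) UNIV"

lemma fser_props:
  assumes x: "x summable_on UNIV"
  shows "continuous_on {0..1} (fser x)" and "fser x 1 = fser x 0" and "fc (fser x) = x"
proof -
  have xn: "(\<lambda>m. norm (x m)) summable_on UNIV"
    using x by (simp add: summable_on_iff_abs_summable_on_complex)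
  have ul: "uniform_limit {0..1} (\<lambda>F t. \<Sum>m\<in>F. x m * expi m t) (fser x) (finite_subsets_at_top UNIV)"
    unfolding fser_def[abs_def] by (rule Weierstrass_m_test_general[OF _ xn]) (simp add: norm_mult)
  show c: "continuous_on {0..1} (fser x)"
  proof (rule uniform_limit_theorem[OF _ ul])
    show "\<forall>\<^sub>F F in finite_subsets_at_top UNIV. continuous_on {0..1} (\<lambda>t. \<Sum>m\<in>F. x m * expi m t)"
      by (intro always_eventually allI continuous_intros)
  qed simp
  show "fser x 1 = fser x 0" by (simp add: fser_def)
  show "fc (fser x) = x"
  proof
    fix l
    have si: "integrable L01 (fser x)" using c by (rule continuous_imp_integrable_real)
    have "norm (fc (fser x) l - x l) \<le> 0"
    proof (rule field_le_epsilon)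
      fix e :: real assume e: "0 < e"
      have "\<forall>\<^sub>F F in finite_subsets_at_top UNIV. \<forall>t\<in>{0..1}. dist (\<Sum>m\<in>F. x m * expi m t) (fser x t) < e"
        using ul e by (rule uniform_limitD)
      then obtain F0 where F0: "finite F0"
        and ev: "\<forall>Y. finite Y \<and> F0 \<subseteq> Y \<and> Y \<subseteq> UNIV \<longrightarrow> (\<forall>t\<in>{0..1}. dist (\<Sum>m\<in>Y. x m * expi m t) (fser x t) < e)"
        unfolding eventually_finite_subsets_at_top by (elim exE conjE)
      \<comment> \<open>Adding \<open>l\<close> to the index set makes the coefficient of index
        \<open>l\<close> of the partial sum exactly \<open>x l\<close>.\<close>
      have "finite (insert l F0) \<and> F0 \<subseteq> insert l F0 \<and> insert l F0 \<subseteq> UNIV" using F0 by blast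
      from mp[OF spec[OF ev] this]
      have F0': "\<forall>t\<in>{0..1}. dist (\<Sum>m\<in>insert l F0. x m * expi m t) (fser x t) < e"
        .
      define F where "F = insert l F0"
      let ?S = "\<lambda>t. \<Sum>m\<in>F. x m * expi m t"
      have F: "finite F" "l \<in> F" using F0 by (auto simp: F_def)
      have d: "norm (fser x t - ?S t) \<le> e" if "t \<in> {0..1}" for t
        using F0'[rule_format, OF that] unfolding F_def[symmetric] dist_norm
        by (simp add: norm_minus_commute)
      have "fc (fser x) l - x l = fc (fser x) l - fc ?S l"
        using F by (simp add: fc_trig_poly)
      also have "\<dots> = fc (\<lambda>t. fser x t - ?S t) l"
        by (rule fc_diff[OF si trig_poly_integrable, symmetric])
      finally have "norm (fc (fser x) l - x l) \<le> (LINT t|L01. norm (fser x t - ?S t))"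
        using norm_fc_le[of "\<lambda>t. fser x t - ?S t" l] Bochner_Integration.integrable_diff[OF si trig_poly_integrable[of x F]] by simp
      also have "\<dots> \<le> (LINT t|L01. e)"
        by (rule integral_mono)
          (use d Bochner_Integration.integrable_diff[OF si trig_poly_integrable[of x F]] in auto)
      also have "\<dots> = e" by (simp add: measure_restrict_space)
      finally show "norm (fc (fser x) l - x l) \<le> 0 + e" by simp
    qed
    then show "fc (fser x) l = x l" by simp
  qed
qed

lemma fser_fc:
  assumes g: "continuous_on {0..1} g" "g 1 = g 0" and s: "fc g summable_on UNIV" and t: "t \<in> {0..1}"
  shows "g t = fser (fc g) t"
proof -
  note f = fser_props[OF s]
  have "g t - fser (fc g) t = 0"
  proof (rule fc_eq_0_imp_0[OF _ _ _ t])
    show "continuous_on {0..1} (\<lambda>t. g t - fser (fc g) t)" by (intro continuous_intros g f)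
    show "fc (\<lambda>t. g t - fser (fc g) t) m = 0" for m
      by (subst fc_diff) (use g f in \<open>auto intro: continuous_imp_integrable_real\<close>)
  qed (use g f in simp)
  then show ?thesis by simp
qed


text \<open>The Riesz-Fischer theorem. The frequencies are grouped into finite blocks of rapidly
  decreasing mean square; the series of block sums then converges absolutely almost everywhere and
  in the mean, and Fatou's lemma shows that its sum is square integrable. It supplies the highest
  derivative of a Sobolev function, which need not have an absolutely convergent series.\<close>

lemma sqint_ex_fc:
  assumes x: "wt 0 x"
  obtains h where "sqint h" "fc h = x"
proof -
  have x2: "(\<lambda>m. (norm (x m))\<^sup>2) summable_on UNIV" using x by (simp add: wt_def)
  define X where "X = infsum (\<lambda>m. (norm (x m))\<^sup>2) UNIV"
  have XF: "(\<Sum>m\<in>F. (norm (x m))\<^sup>2) \<le> X" if "finite F" for F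
    unfolding X_def using x2 that by (intro finite_sum_le_infsum) auto
  have "\<exists>N::nat. \<forall>F. finite F \<and> F \<inter> {- int N..int N} = {} \<longrightarrow> (\<Sum>m\<in>F. (norm (x m))\<^sup>2) \<le> e" if e: "0 < e" for e
  proof -
    have "((\<lambda>m. (norm (x m))\<^sup>2) has_sum X) UNIV" unfolding X_def using x2 by (rule has_sum_infsum)
    then obtain A where A: "finite A" "dist (\<Sum>m\<in>A. (norm (x m))\<^sup>2) X \<le> e"
      using has_sum_finite_approximation[OF _ e] by blast
    define N where "N = nat (Max (insert 0 (abs ` A)))"
    have AN: "A \<subseteq> {- int N..int N}"
    proof
      fix m assume "m \<in> A"
      then have "\<bar>m\<bar> \<le> Max (insert 0 (abs ` A))" using A by (intro Max_ge) auto
      then show "m \<in> {- int N..int N}" by (auto simp: N_def)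
    qed
    have "(\<Sum>m\<in>F. (norm (x m))\<^sup>2) \<le> e" if F: "finite F" "F \<inter> {- int N..int N} = {}" for F
    proof -
      have "(\<Sum>m\<in>A. (norm (x m))\<^sup>2) + (\<Sum>m\<in>F. (norm (x m))\<^sup>2) = (\<Sum>m\<in>A \<union> F. (norm (x m))\<^sup>2)"
        using A F AN by (intro sum.union_disjoint[symmetric]) auto
      also have "\<dots> \<le> X" using A F by (intro XF) auto
      finally show ?thesis using A(2) by (auto simp: dist_real_def)
    qed
    then show ?thesis by blast
  qed
  then have "\<forall>i::nat. \<exists>N::nat. \<forall>F. finite F \<and> F \<inter> {- int N..int N} = {} \<longrightarrow> (\<Sum>m\<in>F. (norm (x m))\<^sup>2) \<le> (1/4) ^ i"
    by simp
  then obtain M where M: "\<And>i F. finite F \<Longrightarrow> F \<inter> {- int (M i)..int (M i)} = {} \<Longrightarrow> (\<Sum>m\<in>F. (norm (x m))\<^sup>2) \<le> (1/4) ^ i"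
    by metis
  \<comment> \<open>The sum over \<open>j\<close> makes the bounds increase and dominate
    \<open>M i\<close>; the summand \<open>i\<close> makes the intervals exhaust the
    integers.\<close>
  define N where "N i = i + (\<Sum>j\<le>i. M j)" for i
  have N: "M i \<le> N i" "i \<le> N i" "N i \<le> N (Suc i)" for i
    using member_le_sum[of i "{..i}" M] by (auto simp: N_def)
  define A where "A i = {- int (N i)..int (N i)}" for i
  have A_Suc: "A i \<subseteq> A (Suc i)" for i
    using N(3)[of i] by (auto simp: A_def)
  then have A_mono: "A i \<subseteq> A j" if "i \<le> j" for i j
    using that by (rule lift_Suc_mono_le)
  define B where "B i = (if i = 0 then A 0 else A i - A (i - 1))" for i
  have B_fin: "finite (B i)" for i by (simp add: B_def A_def)
  have B_disj: "B i \<inter> B j = {}" if "i \<noteq> j" for i j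
  proof -
    have "B i \<inter> B j = {}" if "i < j" for i j
    proof -
      have "i \<le> j - 1" using that by simp
      then have "A i \<subseteq> A (j - 1)" by (rule A_mono)
      then show ?thesis using that unfolding B_def by auto
    qed
    then show ?thesis using that by (metis Int_commute linorder_neqE_nat)
  qed
  have B_cov: "\<exists>i. m \<in> B i" for m
  proof -
    have "m \<in> A (nat \<bar>m\<bar>)" using N(2)[of "nat \<bar>m\<bar>"] by (auto simp: A_def)
    then have ex: "\<exists>i. m \<in> A i" by blast
    define i where "i = (LEAST i. m \<in> A i)"
    have "m \<in> A i" unfolding i_def using ex by (rule LeastI_ex)
    moreover have "m \<notin> A (i - 1)" if "i \<noteq> 0"
      using not_less_Least[of "i - 1" "\<lambda>i. m \<in> A i"] that by (simp add: i_def)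
    ultimately show ?thesis by (auto simp: B_def intro!: exI[of _ i])
  qed
  define d where "d i t = (\<Sum>m\<in>B i. x m * expi m t)" for i t
  have d_cont: "continuous_on {0..1} (d i)" for i
    unfolding d_def[abs_def] by (intro continuous_intros)
  have di: "integrable L01 (d i)" for i by (rule continuous_imp_integrable_real) (rule d_cont)
  have dm: "d i \<in> borel_measurable L01" for i using di by auto
  have sq0: "sqint (\<lambda>t. 0)" by (rule sqint_continuous) simp
  have d1: "(LINT t|L01. norm (d (Suc i) t)) \<le> 2 * (1/2) ^ i" for i
  proof -
    have "(LINT t|L01. (norm (d (Suc i) t))\<^sup>2) = (\<Sum>m\<in>B (Suc i). (norm (x m))\<^sup>2)"
      unfolding d_def by (rule fc_parseval_finite(1)[OF sq0 B_fin])
    also have "\<dots> \<le> (1/4) ^ i"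
      using N(1)[of i] by (intro M B_fin) (auto simp: B_def A_def)
    finally have 1: "(LINT t|L01. (norm (d (Suc i) t))\<^sup>2) \<le> (1/4) ^ i" .
    have i2: "integrable L01 (\<lambda>t. (norm (d (Suc i) t))\<^sup>2)"
      using sqint_continuous[OF d_cont] by (simp add: sqint_def)
    have "(LINT t|L01. norm (d (Suc i) t)) \<le> (LINT t|L01. (1/2) ^ i + 2 ^ i * (norm (d (Suc i) t))\<^sup>2)"
    proof (rule integral_mono)
      show "integrable L01 (\<lambda>t. norm (d (Suc i) t))" using di by simp
      show "integrable L01 (\<lambda>t. (1/2) ^ i + 2 ^ i * (norm (d (Suc i) t))\<^sup>2)" using i2 by simp
      fix t
      \<comment> \<open>Replaces Cauchy-Schwarz: with \<open>p = 2 ^ i\<close> the bound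
        \<open>(1/4) ^ i\<close> for the mean square becomes a bound \<open>2 * (1/2) ^ i\<close>
        for the mean modulus.\<close>
      have "a \<le> 1 / p + p * a\<^sup>2" if "0 < p" "0 \<le> a" for a p :: real
      proof -
        have "2 * (p * a) \<le> 1 + (p * a)\<^sup>2"
          using sum_squares_bound[of 1 "p * a"] by simp
        moreover have "0 \<le> p * a" using that by simp
        ultimately have "p * a \<le> 1 + (p * a)\<^sup>2" by linarith
        then show ?thesis using that by (simp add: field_simps power2_eq_square)
      qed
      from this[of "2 ^ i" "norm (d (Suc i) t)"]
      show "norm (d (Suc i) t) \<le> (1/2) ^ i + 2 ^ i * (norm (d (Suc i) t))\<^sup>2"
        by (simp add: power_one_over)
    qed
    also have "\<dots> = (1/2) ^ i + 2 ^ i * (LINT t|L01. (norm (d (Suc i) t))\<^sup>2)"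
      using i2 by (simp add: measure_restrict_space)
    also have "\<dots> \<le> (1/2) ^ i + 2 ^ i * (1/4) ^ i"
      using 1 by (intro add_left_mono mult_left_mono) auto
    also have "(2::real) ^ i * (1/4) ^ i = (1/2) ^ i" by (simp flip: power_mult_distrib)
    finally show ?thesis by simp
  qed
  have sum1: "summable (\<lambda>i. LINT t|L01. norm (d i t))"
  proof -
    have "summable (\<lambda>i. LINT t|L01. norm (d (Suc i) t))"
    proof (rule summable_comparison_test')
      show "summable (\<lambda>i. 2 * (1/2::real) ^ i)" by (intro summable_mult summable_geometric) simp
      show "norm (LINT t|L01. norm (d (Suc i) t)) \<le> 2 * (1/2) ^ i" for i
        using d1[of i] by (simp add: Bochner_Integration.integral_nonneg)
    qed
    then show ?thesis by (subst (asm) summable_Suc_iff)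
  qed
  have AEs: "AE t in L01. summable (\<lambda>i. norm (d i t))"
  proof -
    have "(\<integral>\<^sup>+t. (\<Sum>i. ennreal (norm (d i t))) \<partial>L01) = (\<Sum>i. \<integral>\<^sup>+t. ennreal (norm (d i t)) \<partial>L01)"
      using dm by (intro nn_integral_suminf) measurable
    also have "\<dots> = (\<Sum>i. ennreal (LINT t|L01. norm (d i t)))"
      using di by (intro suminf_cong nn_integral_eq_integral) auto
    also have "\<dots> \<noteq> \<infinity>"
      using sum1 by (subst suminf_ennreal2) (auto intro!: Bochner_Integration.integral_nonneg)
    finally have ni: "(\<integral>\<^sup>+t. (\<Sum>i. ennreal (norm (d i t))) \<partial>L01) \<noteq> \<infinity>" .
    have "(\<lambda>t. \<Sum>i. ennreal (norm (d i t))) \<in> borel_measurable L01"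
      using dm by measurable
    then have "AE t in L01. (\<Sum>i. ennreal (norm (d i t))) \<noteq> \<infinity>"
      using ni by (rule nn_integral_PInf_AE)
    then show ?thesis
      by eventually_elim (auto intro!: summable_suminf_not_top)
  qed
  define h where "h t = (\<Sum>i. d i t)" for t
  have hi: "integrable L01 h"
    unfolding h_def[abs_def] by (rule integrable_suminf[OF di AEs sum1])
  then have hm: "h \<in> borel_measurable L01" by auto
  have "fc h l = x l" for l
  proof -
    obtain j where j: "l \<in> B j" using B_cov by blast
    have "(\<lambda>i. LINT t|L01. d i t * expi (- l) t) sums (LINT t|L01. (\<Sum>i. d i t * expi (- l) t))"
    proof (rule sums_integral)
      show "AE t in L01. summable (\<lambda>i. norm (d i t * expi (- l) t))" using AEs by (simp add: norm_mult)
      show "summable (\<lambda>i. LINT t|L01. norm (d i t * expi (- l) t))" using sum1 by (simp add: norm_mult)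
    qed (rule integrable_mult_expi[OF di])
    also have "(\<lambda>i. LINT t|L01. d i t * expi (- l) t) = (\<lambda>i. if i = j then x l else 0)"
    proof
      fix i
      have "(LINT t|L01. d i t * expi (- l) t) = (if l \<in> B i then x l else 0)"
        using fc_trig_poly[OF B_fin[of i], of x l] by (simp add: fc_def d_def)
      then show "(LINT t|L01. d i t * expi (- l) t) = (if i = j then x l else 0)"
        using j B_disj[of i j] by auto
    qed
    finally have "(LINT t|L01. (\<Sum>i. d i t * expi (- l) t)) = x l"
      using sums_single[of j "\<lambda>_. x l"] by (rule sums_unique2)
    moreover have "fc h l = (LINT t|L01. (\<Sum>i. d i t * expi (- l) t))"
      unfolding fc_def
    proof (rule integral_cong_AE)
      show "(\<lambda>t. h t * expi (- l) t) \<in> borel_measurable L01" using integrable_mult_expi[OF hi] by auto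
      show "(\<lambda>t. \<Sum>i. d i t * expi (- l) t) \<in> borel_measurable L01"
        using integrable_mult_expi[OF di] by (intro borel_measurable_suminf) auto
      show "AE t in L01. h t * expi (- l) t = (\<Sum>i. d i t * expi (- l) t)"
        using AEs by eventually_elim (simp add: h_def suminf_mult2 summable_norm_cancel)
    qed
    ultimately show ?thesis by simp
  qed
  moreover have "sqint h"
  proof -
    define S where "S n t = (\<Sum>i<n. d i t)" for n t
    have Sb: "(\<integral>\<^sup>+t. ennreal ((norm (S n t))\<^sup>2) \<partial>L01) \<le> ennreal X" for n
    proof -
      define C where "C = (\<Union>i<n. B i)"
      have C: "finite C" using B_fin by (auto simp: C_def)
      have SC: "S n t = (\<Sum>m\<in>C. x m * expi m t)" for t
        unfolding S_def d_def C_def using B_fin B_disj by (intro sum.UNION_disjoint[symmetric]) auto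
      have Sc: "continuous_on {0..1} (S n)" unfolding S_def[abs_def] by (intro continuous_intros d_cont)
      have "(\<integral>\<^sup>+t. ennreal ((norm (S n t))\<^sup>2) \<partial>L01) = ennreal (LINT t|L01. (norm (S n t))\<^sup>2)"
        using sqint_continuous[OF Sc] by (intro nn_integral_eq_integral) (auto simp: sqint_def)
      also have "(LINT t|L01. (norm (S n t))\<^sup>2) = (\<Sum>m\<in>C. (norm (x m))\<^sup>2)"
        unfolding SC by (rule fc_parseval_finite(1)[OF sq0 C])
      also have "\<dots> \<le> X" by (rule XF[OF C])
      finally show ?thesis by (simp add: ennreal_leI)
    qed
    \<comment> \<open>Fatou's lemma: almost everywhere \<open>h\<close> is the limit of the
      \<open>S n\<close>, whose mean squares are bounded by \<open>X\<close>.\<close>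
    have "(\<integral>\<^sup>+t. ennreal ((norm (h t))\<^sup>2) \<partial>L01) = (\<integral>\<^sup>+t. liminf (\<lambda>n. ennreal ((norm (S n t))\<^sup>2)) \<partial>L01)"
    proof (rule nn_integral_cong_AE)
      show "AE t in L01. ennreal ((norm (h t))\<^sup>2) = liminf (\<lambda>n. ennreal ((norm (S n t))\<^sup>2))"
        using AEs
      proof eventually_elim
        case (elim t)
        have "(\<lambda>n. S n t) \<longlonglongrightarrow> h t"
          unfolding S_def h_def by (rule summable_LIMSEQ[OF summable_norm_cancel[OF elim]])
        then have "(\<lambda>n. ennreal ((norm (S n t))\<^sup>2)) \<longlonglongrightarrow> ennreal ((norm (h t))\<^sup>2)"
          by (intro tendsto_ennrealI tendsto_intros)
        then show ?case by (rule lim_imp_Liminf[OF sequentially_bot, symmetric])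
      qed
    qed
    also have "\<dots> \<le> liminf (\<lambda>n. \<integral>\<^sup>+t. ennreal ((norm (S n t))\<^sup>2) \<partial>L01)"
      unfolding S_def using dm by (intro nn_integral_liminf) measurable
    also have "\<dots> \<le> ennreal X"
      using Sb by (intro Liminf_le) auto
    also have "\<dots> < \<infinity>" by simp
    finally have "integrable L01 (\<lambda>t. (norm (h t))\<^sup>2)"
      using hm by (intro integrableI_bounded) auto
    then show ?thesis using hm by (simp add: sqint_def)
  qed
  ultimately show thesis using that by blast
qed

subsection \<open>Sobolev functions on curves\<close>

definition regular_speed :: "(real \<Rightarrow> complex) \<Rightarrow> bool" where
  "regular_speed \<gamma> \<longleftrightarrow> continuous_on {0..1} (speed \<gamma>) \<and> (\<forall>t\<in>{0..1}. 0 < speed \<gamma> t)"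

lemma regular_speed_bounds:
  assumes "regular_speed \<gamma>"
  obtains a b where "0 < a" "\<And>t. t \<in> {0..1} \<Longrightarrow> a \<le> speed \<gamma> t" "\<And>t. t \<in> {0..1} \<Longrightarrow> speed \<gamma> t \<le> b"
proof -
  have c: "continuous_on {0..1} (speed \<gamma>)" and p: "\<And>t. t \<in> {0..1} \<Longrightarrow> 0 < speed \<gamma> t"
    using assms by (auto simp: regular_speed_def)
  have "\<exists>t0\<in>{0..1}. \<forall>t\<in>{0..1}. speed \<gamma> t0 \<le> speed \<gamma> t"
    by (rule continuous_attains_inf[OF _ _ c]) auto
  then obtain t0 where "t0 \<in> {0..1}" "\<forall>t\<in>{0..1}. speed \<gamma> t0 \<le> speed \<gamma> t" by blast
  moreover have "\<exists>t1\<in>{0..1}. \<forall>t\<in>{0..1}. speed \<gamma> t \<le> speed \<gamma> t1"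
    by (rule continuous_attains_sup[OF _ _ c]) auto
  then obtain t1 where "\<forall>t\<in>{0..1}. speed \<gamma> t \<le> speed \<gamma> t1" by blast
  ultimately show thesis using that p by blast
qed

text \<open>By compactness the speed lies between two positive constants, so the arclength measure
  and the parameter measure have the same square integrable functions.\<close>

lemma L2_along_iff:
  fixes g :: "real \<Rightarrow> 'a::euclidean_space"
  assumes "regular_speed \<gamma>"
  shows "L2_along \<gamma> g \<longleftrightarrow> g \<in> borel_measurable L01 \<and> integrable L01 (\<lambda>t. (norm (g t))\<^sup>2)"
proof -
  obtain a b where ab: "0 < a" "\<And>t. t \<in> {0..1} \<Longrightarrow> a \<le> speed \<gamma> t" "\<And>t. t \<in> {0..1} \<Longrightarrow> speed \<gamma> t \<le> b"
    by (rule regular_speed_bounds[OF assms]) blast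
  have sm: "speed \<gamma> \<in> borel_measurable L01"
    using assms by (intro continuous_imp_measurable_on_sets_lebesgue) (auto simp: regular_speed_def)
  have "integrable L01 (\<lambda>t. speed \<gamma> t * (norm (g t))\<^sup>2) \<longleftrightarrow> integrable L01 (\<lambda>t. (norm (g t))\<^sup>2)"
    if g: "g \<in> borel_measurable L01"
  proof
    assume "integrable L01 (\<lambda>t. speed \<gamma> t * (norm (g t))\<^sup>2)"
    then have "integrable L01 (\<lambda>t. 1 / a * (speed \<gamma> t * (norm (g t))\<^sup>2))" by simp
    then show "integrable L01 (\<lambda>t. (norm (g t))\<^sup>2)"
    proof (rule Bochner_Integration.integrable_bound)
      show "AE t in L01. norm ((norm (g t))\<^sup>2) \<le> norm (1 / a * (speed \<gamma> t * (norm (g t))\<^sup>2))"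
      proof (rule AE_I2)
        fix t assume "t \<in> space L01"
        then have "a * (norm (g t))\<^sup>2 \<le> speed \<gamma> t * (norm (g t))\<^sup>2" using ab by (intro mult_right_mono) auto
        then show "norm ((norm (g t))\<^sup>2) \<le> norm (1 / a * (speed \<gamma> t * (norm (g t))\<^sup>2))"
          using ab(1) abs_ge_self[of "speed \<gamma> t"] by (simp add: abs_mult field_simps speed_def)
      qed
    qed (use g in measurable)
  next
    assume "integrable L01 (\<lambda>t. (norm (g t))\<^sup>2)"
    then have "integrable L01 (\<lambda>t. b * (norm (g t))\<^sup>2)" by simp
    then show "integrable L01 (\<lambda>t. speed \<gamma> t * (norm (g t))\<^sup>2)"
    proof (rule Bochner_Integration.integrable_bound)
      show "(\<lambda>t. speed \<gamma> t * (norm (g t))\<^sup>2) \<in> borel_measurable L01"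
        using g sm by measurable
      show "AE t in L01. norm (speed \<gamma> t * (norm (g t))\<^sup>2) \<le> norm (b * (norm (g t))\<^sup>2)"
      proof (rule AE_I2)
        fix t assume t: "t \<in> space L01"
        then have "speed \<gamma> t * (norm (g t))\<^sup>2 \<le> b * (norm (g t))\<^sup>2" using ab by (intro mult_right_mono) auto
        moreover have "0 \<le> speed \<gamma> t" by (simp add: speed_def)
        moreover have "0 \<le> b" using ab(3)[of t] \<open>0 \<le> speed \<gamma> t\<close> t by simp
        ultimately show "norm (speed \<gamma> t * (norm (g t))\<^sup>2) \<le> norm (b * (norm (g t))\<^sup>2)"
          by (simp add: abs_mult)
      qed
    qed
  qed
  then show ?thesis unfolding L2_along_def by blast
qed

lemma L2_along_sqint: "regular_speed \<gamma> \<Longrightarrow> L2_along \<gamma> g \<longleftrightarrow> sqint g"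
  by (simp add: L2_along_iff sqint_def)

lemma L2_along_bounded_linear:
  fixes g :: "real \<Rightarrow> 'a::euclidean_space" and f :: "'a \<Rightarrow> 'b::euclidean_space"
  assumes \<gamma>: "regular_speed \<gamma>" and f: "bounded_linear f" and g: "L2_along \<gamma> g"
  shows "L2_along \<gamma> (\<lambda>t. f (g t))"
proof -
  obtain K where K: "\<And>x. norm (f x) \<le> norm x * K" using bounded_linear.bounded[OF f] by blast
  have m: "g \<in> borel_measurable L01" and i: "integrable L01 (\<lambda>t. (norm (g t))\<^sup>2)"
    using g by (auto simp: L2_along_iff[OF \<gamma>])
  have "f \<in> borel_measurable borel"
    using f by (intro borel_measurable_continuous_onI linear_continuous_on)
  with m have fm: "(\<lambda>t. f (g t)) \<in> borel_measurable L01" by (rule measurable_compose)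
  have "integrable L01 (\<lambda>t. K\<^sup>2 * (norm (g t))\<^sup>2)" using i by simp
  then have "integrable L01 (\<lambda>t. (norm (f (g t)))\<^sup>2)"
  proof (rule Bochner_Integration.integrable_bound)
    show "AE t in L01. norm ((norm (f (g t)))\<^sup>2) \<le> norm (K\<^sup>2 * (norm (g t))\<^sup>2)"
    proof (rule AE_I2)
      fix t
      have "(norm (f (g t)))\<^sup>2 \<le> (norm (g t) * K)\<^sup>2" using K by (intro power_mono) auto
      then show "norm ((norm (f (g t)))\<^sup>2) \<le> norm (K\<^sup>2 * (norm (g t))\<^sup>2)" by (simp add: power_mult_distrib mult.commute)
    qed
  qed (use fm in measurable)
  with fm show ?thesis by (simp add: L2_along_iff[OF \<gamma>])
qed

lemma L2_along_add:
  fixes g h :: "real \<Rightarrow> 'a::euclidean_space"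
  assumes \<gamma>: "regular_speed \<gamma>" and g: "L2_along \<gamma> g" and h: "L2_along \<gamma> h"
  shows "L2_along \<gamma> (\<lambda>t. g t + h t)"
proof -
  have m: "(\<lambda>t. g t + h t) \<in> borel_measurable L01"
    and i: "integrable L01 (\<lambda>t. 2 * ((norm (g t))\<^sup>2 + (norm (h t))\<^sup>2))"
    using g h by (auto simp: L2_along_iff[OF \<gamma>])
  from i have "integrable L01 (\<lambda>t. (norm (g t + h t))\<^sup>2)"
  proof (rule Bochner_Integration.integrable_bound)
    show "AE t in L01. norm ((norm (g t + h t))\<^sup>2) \<le> norm (2 * ((norm (g t))\<^sup>2 + (norm (h t))\<^sup>2))"
    proof (rule AE_I2)
      fix t
      have "(norm (g t + h t))\<^sup>2 \<le> (norm (g t) + norm (h t))\<^sup>2"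
        by (intro power_mono norm_triangle_ineq) auto
      also have "\<dots> \<le> 2 * ((norm (g t))\<^sup>2 + (norm (h t))\<^sup>2)"
        using sum_squares_bound[of "norm (g t)" "norm (h t)"] by (simp add: power2_sum)
      finally show "norm ((norm (g t + h t))\<^sup>2) \<le> norm (2 * ((norm (g t))\<^sup>2 + (norm (h t))\<^sup>2))" by simp
    qed
  qed (use m in measurable)
  with m show ?thesis by (simp add: L2_along_iff[OF \<gamma>])
qed

lemma L2_along_continuous:
  fixes g :: "real \<Rightarrow> 'a::euclidean_space"
  assumes "regular_speed \<gamma>" "continuous_on {0..1} g"
  shows "L2_along \<gamma> g"
  unfolding L2_along_iff[OF assms(1)] using assms(2)
  by (auto intro!: continuous_imp_measurable_on_sets_lebesgue continuous_imp_integrable_real continuous_intros)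

section \<open>Stability of Sobolev functions under linear operations, and reduction to matrix
  entries\<close>

lemma sobolev_param_bounded_linear:
  fixes g :: "real \<Rightarrow> 'a::euclidean_space" and f :: "'a \<Rightarrow> 'b::euclidean_space"
  assumes \<gamma>: "regular_speed \<gamma>" and f: "bounded_linear f" and g: "sobolev_param k \<gamma> g"
  shows "sobolev_param k \<gamma> (\<lambda>t. f (g t))"
  using g
proof (induction k arbitrary: g)
  case 0
  then show ?case using L2_along_bounded_linear[OF \<gamma> f] by simp
next
  case (Suc k)
  then obtain h where h: "sobolev_param k \<gamma> h"
    "\<And>t. t \<in> {0..1} \<Longrightarrow> ((\<lambda>s. speed \<gamma> s *\<^sub>R h s) has_integral (g t - g 0)) {0..t}"
    by auto
  have "((\<lambda>s. speed \<gamma> s *\<^sub>R f (h s)) has_integral (f (g t) - f (g 0))) {0..t}" if "t \<in> {0..1}" for t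
    using has_integral_linear[OF h(2)[OF that] f] f
    by (simp add: o_def bounded_linear.linear linear_scale linear_diff)
  moreover have "L2_along \<gamma> (\<lambda>t. f (g t))" "g 1 = g 0"
    using Suc.prems L2_along_bounded_linear[OF \<gamma> f] by auto
  ultimately show ?case using Suc.IH[OF h(1)] by auto
qed

lemma sobolev_param_add:
  fixes g h :: "real \<Rightarrow> 'a::euclidean_space"
  assumes \<gamma>: "regular_speed \<gamma>" and "sobolev_param k \<gamma> g" "sobolev_param k \<gamma> h"
  shows "sobolev_param k \<gamma> (\<lambda>t. g t + h t)"
  using assms(2,3)
proof (induction k arbitrary: g h)
  case 0
  then show ?case using L2_along_add[OF \<gamma>] by simp
next
  case (Suc k)
  obtain g' where g': "sobolev_param k \<gamma> g'"
    "\<And>t. t \<in> {0..1} \<Longrightarrow> ((\<lambda>s. speed \<gamma> s *\<^sub>R g' s) has_integral (g t - g 0)) {0..t}"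
    using Suc.prems(1) by auto
  obtain h' where h': "sobolev_param k \<gamma> h'"
    "\<And>t. t \<in> {0..1} \<Longrightarrow> ((\<lambda>s. speed \<gamma> s *\<^sub>R h' s) has_integral (h t - h 0)) {0..t}"
    using Suc.prems(2) by auto
  have "((\<lambda>s. speed \<gamma> s *\<^sub>R (g' s + h' s)) has_integral ((g t + h t) - (g 0 + h 0))) {0..t}" if "t \<in> {0..1}" for t
    using has_integral_add[OF g'(2)[OF that] h'(2)[OF that]] by (simp add: algebra_simps)
  moreover have "L2_along \<gamma> (\<lambda>t. g t + h t)" "g 1 = g 0" "h 1 = h 0"
    using Suc.prems L2_along_add[OF \<gamma>] by auto
  ultimately show ?case using Suc.IH[OF g'(1) h'(1)] by auto
qed

lemma sobolev_param_const:
  "regular_speed \<gamma> \<Longrightarrow> sobolev_param k \<gamma> (\<lambda>t. c :: 'a::euclidean_space)"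
proof (induction k arbitrary: c)
  case (Suc k)
  have "((\<lambda>s. speed \<gamma> s *\<^sub>R 0) has_integral (c - c)) {0..t}" for t by simp
  then show ?case using Suc L2_along_continuous[OF Suc.prems, of "\<lambda>_. c"] by (auto intro!: exI[of _ "\<lambda>_. 0"])
qed (simp add: L2_along_continuous)

lemma sobolev_param_diff:
  fixes g h :: "real \<Rightarrow> 'a::euclidean_space"
  assumes \<gamma>: "regular_speed \<gamma>" and "sobolev_param k \<gamma> g" "sobolev_param k \<gamma> h"
  shows "sobolev_param k \<gamma> (\<lambda>t. g t - h t)"
  using sobolev_param_add[OF \<gamma> assms(2) sobolev_param_bounded_linear[OF \<gamma> bounded_linear_minus[OF bounded_linear_ident] assms(3)]]
  by simp

lemma sobolev_param_cong:
  fixes g h :: "real \<Rightarrow> 'a::euclidean_space"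
  assumes "\<And>t. t \<in> {0..1} \<Longrightarrow> g t = h t" and "sobolev_param k \<gamma> g"
  shows "sobolev_param k \<gamma> h"
proof -
  have L: "L2_along \<gamma> h" if "L2_along \<gamma> g"
  proof -
    have "g \<in> borel_measurable L01 \<longleftrightarrow> h \<in> borel_measurable L01"
      by (rule measurable_cong) (use assms in simp)
    moreover have "integrable L01 (\<lambda>t. speed \<gamma> t * (norm (g t))\<^sup>2) \<longleftrightarrow> integrable L01 (\<lambda>t. speed \<gamma> t * (norm (h t))\<^sup>2)"
      by (rule Bochner_Integration.integrable_cong) (use assms in simp_all)
    ultimately show ?thesis using that by (simp add: L2_along_def)
  qed
  show ?thesis
  proof (cases k)
    case 0
    then show ?thesis using assms L by simp
  next
    case (Suc j)
    have "g t = h t" if "t \<in> {0..1}" for t using assms(1) that by blast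
    moreover from this have "g 0 = h 0" "g 1 = h 1" by simp_all
    ultimately show ?thesis using assms(2) L unfolding Suc by auto
  qed
qed

lemma sobolev_param_vec_nth:
  fixes g :: "real \<Rightarrow> 'a::euclidean_space^'n"
  assumes \<gamma>: "regular_speed \<gamma>"
  shows "sobolev_param k \<gamma> g \<longleftrightarrow> (\<forall>i. sobolev_param k \<gamma> (\<lambda>t. g t $ i))"
proof
  assume "sobolev_param k \<gamma> g"
  then show "\<forall>i. sobolev_param k \<gamma> (\<lambda>t. g t $ i)"
    using sobolev_param_bounded_linear[OF \<gamma> bounded_linear_vec_nth] by blast
next
  assume *: "\<forall>i. sobolev_param k \<gamma> (\<lambda>t. g t $ i)"
  have bl: "bounded_linear (axis i :: 'a \<Rightarrow> 'a^'n)" for i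
    by (rule linear_conv_bounded_linear[THEN iffD1], rule linearI) (auto simp: axis_def vec_eq_iff)
  have "sobolev_param k \<gamma> (\<lambda>t. \<Sum>i\<in>I. axis i (g t $ i))" if "finite I" for I
    using that
  proof induction
    case empty
    then show ?case using sobolev_param_const[OF \<gamma>, of k "0::'a^'n"] by simp
  next
    case (insert i I)
    then show ?case using sobolev_param_add[OF \<gamma> sobolev_param_bounded_linear[OF \<gamma> bl *[rule_format, of i]] insert.IH] by simp
  qed
  from this[of UNIV] show "sobolev_param k \<gamma> g"
    by (rule sobolev_param_cong[rotated]) (simp_all add: vec_eq_iff axis_def if_distrib sum.delta cong: if_cong)
qed

lemma sobolev_param_matrix:
  fixes g :: "real \<Rightarrow> complex^2^2"
  assumes "regular_speed \<gamma>"
  shows "sobolev_param k \<gamma> g \<longleftrightarrow> (\<forall>i l. sobolev_param k \<gamma> (\<lambda>t. g t $ i $ l))"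
  by (simp add: sobolev_param_vec_nth[OF assms])

lemma sobolev_param_mono:
  fixes g :: "real \<Rightarrow> 'a::euclidean_space"
  shows "sobolev_param k \<gamma> g \<Longrightarrow> j \<le> k \<Longrightarrow> sobolev_param j \<gamma> g"
proof (induction k arbitrary: g j)
  case (Suc k)
  show ?case
  proof (cases j)
    case 0
    then show ?thesis using Suc.prems by simp
  next
    case (Suc i)
    then show ?thesis using Suc.prems Suc.IH[of _ i] by auto
  qed
qed simp

text \<open>The inverted circles have nonconstant speed. Derivatives along such a curve of a holomorphic function
  are again holomorphic functions because the unit tangent field extends to a holomorphic \<open>T\<close>.\<close>

definition tangent_loop :: "(real \<Rightarrow> complex) \<Rightarrow> (complex \<Rightarrow> complex) \<Rightarrow> bool" where
  "tangent_loop \<gamma> T \<longleftrightarrow> regular_speed \<gamma> \<and> \<gamma> 1 = \<gamma> 0 \<and> T holomorphic_on UNIV \<and>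
     (\<forall>t\<in>{0..1}. (\<gamma> has_vector_derivative (of_real (speed \<gamma> t) * T (\<gamma> t))) (at t within {0..1}))"

lemma sobolev_param_holomorphic:
  assumes \<gamma>: "tangent_loop \<gamma> T" and U: "open U" "path_image \<gamma> \<subseteq> U" and f: "f holomorphic_on U"
  shows "sobolev_param k \<gamma> (f \<circ> \<gamma>)"
proof -
  have rs: "regular_speed \<gamma>" using \<gamma> by (simp add: tangent_loop_def)
  have d: "(\<gamma> has_vector_derivative (of_real (speed \<gamma> t) * T (\<gamma> t))) (at t within {0..1})" if "t \<in> {0..1}" for t
    using \<gamma> that by (simp add: tangent_loop_def)
  have c: "continuous_on {0..1} \<gamma>"
    unfolding continuous_on_eq_continuous_within using has_vector_derivative_continuous[OF d] by blast
  have L: "L2_along \<gamma> (f \<circ> \<gamma>)" if "f holomorphic_on U" for f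
    by (intro L2_along_continuous[OF rs] continuous_on_compose c
        continuous_on_subset[OF holomorphic_on_imp_continuous_on[OF that]]) (use U(2) in \<open>simp add: path_image_def\<close>)
  note L = L[unfolded o_def]
  show ?thesis
    using f
  proof (induction k arbitrary: f)
    case 0
    then show ?case using L[of f] by (simp add: o_def)
  next
    case (Suc k)
    define h where "h z = deriv f z * T z" for z
    have "T holomorphic_on U" using \<gamma> by (auto simp: tangent_loop_def intro: holomorphic_on_subset)
    then have h: "h holomorphic_on U"
      unfolding h_def[abs_def] using Suc.prems U(1) by (intro holomorphic_intros)
    have "((\<lambda>s. speed \<gamma> s *\<^sub>R (h \<circ> \<gamma>) s) has_integral ((f \<circ> \<gamma>) t - (f \<circ> \<gamma>) 0)) {0..t}" if t: "t \<in> {0..1}" for t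
    proof (rule fundamental_theorem_of_calculus)
      fix s assume s: "s \<in> {0..t}"
      then have s1: "s \<in> {0..1}" using t by simp
      then have "\<gamma> s \<in> U" using U(2) by (auto simp: path_image_def)
      then have "(f has_field_derivative deriv f (\<gamma> s)) (at (\<gamma> s))"
        using Suc.prems U(1) by (simp add: holomorphic_derivI)
      from field_vector_diff_chain_within[OF d[OF s1] has_field_derivative_at_within[OF this]]
      have "(f \<circ> \<gamma> has_vector_derivative of_real (speed \<gamma> s) * T (\<gamma> s) * deriv f (\<gamma> s)) (at s within {0..1})" .
      then have "(f \<circ> \<gamma> has_vector_derivative speed \<gamma> s *\<^sub>R (h \<circ> \<gamma>) s) (at s within {0..1})"
        by (simp add: h_def scaleR_conv_of_real mult_ac)
      then show "(f \<circ> \<gamma> has_vector_derivative speed \<gamma> s *\<^sub>R (h \<circ> \<gamma>) s) (at s within {0..t})"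
        by (rule has_vector_derivative_within_subset) (use t in auto)
    qed (use t in simp)
    moreover have "\<gamma> 1 = \<gamma> 0" using \<gamma> by (simp add: tangent_loop_def)
    ultimately show ?case using L[OF Suc.prems] Suc.IH[OF h] by auto
  qed
qed

text \<open>One derivative in the mean square sense already gives the coefficients weight 1, hence
  absolute summability. A nonconstant speed does no harm at this order, as multiplication by a
  continuous function preserves square integrability.\<close>

lemma sobolev_param_fser:
  assumes \<gamma>: "regular_speed \<gamma>" and g: "sobolev_param k \<gamma> g" and k: "1 \<le> k"
  shows "fc g summable_on UNIV" and "t \<in> {0..1} \<Longrightarrow> g t = fser (fc g) t"
proof -
  have "sobolev_param (Suc 0) \<gamma> g" by (rule sobolev_param_mono[OF g]) (use k in simp)
  then obtain h where h: "L2_along \<gamma> h" and g1: "g 1 = g 0" "L2_along \<gamma> g"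
    and gh: "\<And>t. t \<in> {0..1} \<Longrightarrow> ((\<lambda>s. speed \<gamma> s *\<^sub>R h s) has_integral (g t - g 0)) {0..t}"
    by auto
  define H where "H s = of_real (speed \<gamma> s) * h s" for s
  have H: "sqint H"
    unfolding H_def[abs_def] using h \<gamma>
    by (intro sqint_mult_continuous) (auto simp: L2_along_sqint regular_speed_def intro!: continuous_intros)
  have gH: "(H has_integral (g t - g 0)) {0..t}" if "t \<in> {0..1}" for t
    using gh[OF that] by (simp add: H_def[abs_def] scaleR_conv_of_real)
  have p: "fc H m = 2 * pi * \<i> * of_int m * fc g m" for m
    by (rule fc_primitive[OF sqint_integrable[OF H] gH g1(1)])
  \<comment> \<open>The derivative carries no information about the mean value, so the coefficient
    of index 0 is split off.\<close>
  have "wt 1 (\<lambda>m. (if m = 0 then fc g 0 else 0) + (if m \<noteq> 0 then fc g m else 0))"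
  proof (intro wt_add wt_delta wt_le[OF bessel[OF H], where C = 1])
    fix m
    show "bracket m powr 1 * norm (if m \<noteq> 0 then fc g m else 0) \<le> 1 * (bracket m powr 0 * norm (fc H m))"
    proof (cases "m = 0")
      case False
      then have "bracket m \<le> 2 * real_of_int \<bar>m\<bar>" by (simp add: bracket_def)
      also have "\<dots> \<le> 2 * pi * real_of_int \<bar>m\<bar>" using pi_gt3 False by (intro mult_right_mono) auto
      finally have "bracket m * norm (fc g m) \<le> 2 * pi * real_of_int \<bar>m\<bar> * norm (fc g m)"
        by (rule mult_right_mono) simp
      then show ?thesis using False by (simp add: p norm_mult)
    qed simp
  qed
  then have "wt 1 (fc g)" by (rule wt_norm_le[where C = 1]) simp
  then show s: "fc g summable_on UNIV" by (rule wt_summable) simp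
  have gc: "continuous_on {0..1} g"
  proof -
    have "H integrable_on {0..1}" using gH[of 1] by auto
    then have "continuous_on {0..1} (\<lambda>t. integral {0..t} H)"
      by (rule indefinite_integral_continuous_1)
    then have "continuous_on {0..1} (\<lambda>t. g 0 + integral {0..t} H)"
      by (intro continuous_intros)
    then show ?thesis
      by (rule continuous_on_eq) (simp add: integral_unique[OF gH])
  qed
  show "t \<in> {0..1} \<Longrightarrow> g t = fser (fc g) t"
    by (rule fser_fc[OF gc g1(1) s])
qed

text \<open>At constant speed \<open>\<sigma>\<close>, differentiation by arclength multiplies the
  coefficient of index \<open>m\<close> by \<open>2 * pi * \<i> * m / \<sigma>\<close>. Each
  derivative therefore yields one power of \<open>bracket m\<close>.\<close>

lemma sobolev_param_imp_wt:
  assumes \<gamma>: "\<And>t. t \<in> {0..1} \<Longrightarrow> speed \<gamma> t = \<sigma>" "0 < \<sigma>" and g: "sobolev_param k \<gamma> g"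
  shows "wt (real k) (fc g)"
proof -
  have rs: "regular_speed \<gamma>"
    unfolding regular_speed_def using \<gamma> continuous_on_cong[OF refl, of "{0..1}" "speed \<gamma>" "\<lambda>_. \<sigma>"] by simp
  show ?thesis
    using g
  proof (induction k arbitrary: g)
    case 0
    then show ?case using bessel[of g] by (simp add: L2_along_sqint[OF rs])
  next
    case (Suc k)
    obtain h where h: "sobolev_param k \<gamma> h" and g1: "g 1 = g 0"
      and gh: "\<And>t. t \<in> {0..1} \<Longrightarrow> ((\<lambda>s. speed \<gamma> s *\<^sub>R h s) has_integral (g t - g 0)) {0..t}"
      using Suc.prems by auto
    have "L2_along \<gamma> h" using sobolev_param_mono[OF h, of 0] by simp
    then have hs: "integrable L01 (\<lambda>s. of_real \<sigma> * h s)" using sqint_integrable L2_along_sqint[OF rs] by simp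
    have gH: "((\<lambda>s. of_real \<sigma> * h s) has_integral (g t - g 0)) {0..t}" if t: "t \<in> {0..1}" for t
      using gh[OF t] by (rule has_integral_eq[rotated]) (use t \<gamma> in \<open>auto simp: scaleR_conv_of_real\<close>)
    have p: "of_real \<sigma> * fc h m = 2 * pi * \<i> * of_int m * fc g m" for m
      using fc_primitive[OF hs gH g1, of m] by (simp add: fc_cmult)
    have "wt (real (Suc k)) (\<lambda>m. (if m = 0 then fc g 0 else 0) + (if m \<noteq> 0 then fc g m else 0))"
    proof (intro wt_add wt_delta wt_le[OF Suc.IH[OF h], where C = \<sigma>])
      fix m
      show "bracket m powr real (Suc k) * norm (if m \<noteq> 0 then fc g m else 0) \<le> \<sigma> * (bracket m powr real k * norm (fc h m))"
      proof (cases "m = 0")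
        case False
        then have "bracket m \<le> 2 * real_of_int \<bar>m\<bar>" by (simp add: bracket_def)
        also have "\<dots> \<le> 2 * pi * real_of_int \<bar>m\<bar>" using pi_gt3 False by (intro mult_right_mono) auto
        finally have "bracket m * norm (fc g m) \<le> 2 * pi * real_of_int \<bar>m\<bar> * norm (fc g m)"
          by (rule mult_right_mono) simp
        also have "\<dots> = norm (of_real \<sigma> * fc h m)" by (simp add: p norm_mult)
        also have "\<dots> = \<sigma> * norm (fc h m)" using \<gamma>(2) by (simp add: norm_mult)
        finally have "bracket m powr real k * (bracket m * norm (fc g m)) \<le> bracket m powr real k * (\<sigma> * norm (fc h m))"
          by (rule mult_left_mono) simp
        then show ?thesis using False by (simp add: powr_add mult_ac)
      qed (use \<gamma>(2) in simp)
    qed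
    then show ?case by (rule wt_norm_le[where C = 1]) simp
  qed
qed

text \<open>Induction through the derivative: its coefficients have weight one less, and a function
  with these coefficients is integrated to recover \<open>fser x\<close>. At order 0 the function
  comes from \<open>sqint_ex_fc\<close>, hence the implication in the last conjunct.\<close>

lemma wt_imp_sobolev_param:
  assumes \<gamma>: "\<And>t. t \<in> {0..1} \<Longrightarrow> speed \<gamma> t = \<sigma>" "0 < \<sigma>" and x: "wt (real k) x"
  shows "\<exists>h. sobolev_param k \<gamma> h \<and> fc h = x \<and> (1 \<le> k \<longrightarrow> h = fser x)"
proof -
  have rs: "regular_speed \<gamma>"
    unfolding regular_speed_def using \<gamma> continuous_on_cong[OF refl, of "{0..1}" "speed \<gamma>" "\<lambda>_. \<sigma>"] by simp
  show ?thesis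
    using x
  proof (induction k arbitrary: x)
    case 0
    then obtain h where "sqint h" "fc h = x" using sqint_ex_fc[of x] by auto
    then show ?case using L2_along_sqint[OF rs] by auto
  next
    case (Suc k)
    define y where "y m = 2 * pi * \<i> * of_int m / of_real \<sigma> * x m" for m
    have "wt (real k) y"
    proof (rule wt_le[OF Suc.prems, where C = "2 * pi / \<sigma>"])
      fix m
      have "norm (y m) = 2 * pi / \<sigma> * (real_of_int \<bar>m\<bar> * norm (x m))"
        using \<gamma>(2) by (simp add: y_def norm_mult norm_divide)
      also have "\<dots> \<le> 2 * pi / \<sigma> * (bracket m * norm (x m))"
        using \<gamma>(2) by (intro mult_left_mono mult_right_mono) (auto simp: bracket_def)
      finally have "bracket m powr real k * norm (y m) \<le> bracket m powr real k * (2 * pi / \<sigma> * (bracket m * norm (x m)))"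
        by (rule mult_left_mono) simp
      then show "bracket m powr real k * norm (y m) \<le> 2 * pi / \<sigma> * (bracket m powr real (Suc k) * norm (x m))"
        by (simp add: powr_add mult_ac)
    qed
    then obtain h where h: "sobolev_param k \<gamma> h" "fc h = y" using Suc.IH by blast
    have "L2_along \<gamma> h" using sobolev_param_mono[OF h(1), of 0] by simp
    then have hs: "integrable L01 (\<lambda>s. of_real \<sigma> * h s)" using sqint_integrable L2_along_sqint[OF rs] by simp
    have xs: "x summable_on UNIV" using Suc.prems by (rule wt_summable) simp
    note X = fser_props[OF xs]
    have hI: "(\<lambda>s. of_real \<sigma> * h s) integrable_on {0..1}" using hs by (rule integrable_on_lebesgue_on) simp
    \<comment> \<open>The initial value \<open>fser x 0\<close> settles the constant of integration;
      \<open>fc_primitive\<close> determines all coefficients of \<open>G\<close> other than that of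
      index 0.\<close>
    define G where "G t = fser x 0 + integral {0..t} (\<lambda>s. of_real \<sigma> * h s)" for t
    have G0: "G 0 = fser x 0" by (simp add: G_def)
    have Gi: "((\<lambda>s. of_real \<sigma> * h s) has_integral (G t - G 0)) {0..t}" if "t \<in> {0..1}" for t
    proof -
      have "(\<lambda>s. of_real \<sigma> * h s) integrable_on {0..t}"
        by (rule integrable_on_subinterval[OF hI]) (use that in auto)
      from integrable_integral[OF this] show ?thesis
        by (simp only: G_def add_diff_cancel_left' integral_singleton atLeastAtMost_singleton add_0_right)
    qed
    have Gc: "continuous_on {0..1} G"
      unfolding G_def[abs_def] by (intro continuous_intros indefinite_integral_continuous_1 hI)
    have G1: "G 1 = G 0"
    proof -
      have "integral\<^sup>L L01 (\<lambda>s. of_real \<sigma> * h s) = G 1 - G 0"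
        by (rule L01_integral_unique[OF hs Gi]) simp
      moreover have "integral\<^sup>L L01 (\<lambda>s. of_real \<sigma> * h s) = of_real \<sigma> * fc h 0" by (simp add: fc_def)
      ultimately show ?thesis using h(2) by (simp add: y_def)
    qed
    have p: "of_real \<sigma> * y m = 2 * pi * \<i> * of_int m * fc G m" for m
      using fc_primitive[OF hs Gi G1, of m] h(2) by (simp add: fc_cmult)
    have Gx: "fc G m = x m" if "m \<noteq> 0" for m
      using p[of m] that \<gamma>(2) by (simp add: y_def)
    define c where "c = fc G 0 - x 0"
    have Gi01: "integrable L01 G" and xi01: "integrable L01 (fser x)"
      using Gc X(1) by (auto intro: continuous_imp_integrable_real)
    have "G t - fser x t - c = 0" if t: "t \<in> {0..1}" for t
    proof (rule fc_eq_0_imp_0[OF _ _ _ t])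
      show "continuous_on {0..1} (\<lambda>t. G t - fser x t - c)" by (intro continuous_intros Gc X)
      show "G 1 - fser x 1 - c = G 0 - fser x 0 - c" using G1 X by simp
      fix m
      have cc: "fc (\<lambda>t. c) m = (if m = 0 then c else 0)"
        using fc_cmult[of c "expi 0" m] by (simp add: fc_expi)
      have "fc (\<lambda>t. G t - fser x t - c) m = fc G m - x m - (if m = 0 then c else 0)"
        using Gi01 xi01 X(3) by (subst fc_diff, simp, simp, subst fc_diff) (auto simp: cc)
      then show "fc (\<lambda>t. G t - fser x t - c) m = 0" using Gx[of m] by (simp add: c_def)
    qed
    then have eq: "G t = fser x t + c" if "t \<in> {0..1}" for t
      using that by (simp add: algebra_simps)
    \<comment> \<open>\<open>G\<close> and \<open>fser x\<close> differ by the constant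
      \<open>c\<close> and agree at 0 by the choice of the initial value.\<close>
    then have "c = 0" using G0 by (auto simp: eq[of 0])
    then have eq': "G t = fser x t" if "t \<in> {0..1}" for t using eq[OF that] by simp
    have "((\<lambda>s. speed \<gamma> s *\<^sub>R h s) has_integral (fser x t - fser x 0)) {0..t}" if t: "t \<in> {0..1}" for t
      using Gi[OF t] unfolding eq'[OF t] G0
      by (rule has_integral_eq[rotated]) (use t \<gamma> in \<open>auto simp: scaleR_conv_of_real\<close>)
    then have "sobolev_param (Suc k) \<gamma> (fser x)"
      using L2_along_continuous[OF rs X(1)] X(2) h(1) by auto
    then show ?case using X(3) by blast
  qed
qed

subsection \<open>Circles and their images under inversion\<close>

lemma pole_circle_expi: "pole_circle a \<rho> t = a + of_real \<rho> * expi (-1) t"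
proof -
  have "exp (2 * of_real pi * \<i> * of_real (1 - t)) = expi 1 (1 - t)"
    by (simp add: expi_def cis_conv_exp mult_ac)
  also have "\<dots> = cis (2 * pi + - (2 * pi * t))" by (simp add: expi_def algebra_simps)
  also have "\<dots> = expi (-1) t" by (simp only: cis_mult[symmetric] cis_2pi) (simp add: expi_def)
  finally show ?thesis
    by (simp add: pole_circle_def reversepath_def circlepath_def part_circlepath_def linepath_def mult_ac)
qed

lemma unit_circle_eq: "unit_circle = pole_circle 0 1"
  by (simp add: unit_circle_def pole_circle_def)

lemma unit_circle_expi: "unit_circle t = expi (-1) t"
  by (simp add: unit_circle_eq pole_circle_expi)

lemma pole_circle_derivative:
  "(pole_circle a \<rho> has_vector_derivative (- 2 * pi * \<i> * (pole_circle a \<rho> t - a))) (at t within A)"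
proof -
  have "((\<lambda>t. a + of_real \<rho> * expi (-1) t) has_vector_derivative (0 + of_real \<rho> * (2 * pi * \<i> * of_int (-1) * expi (-1) t))) (at t within A)"
    by (intro has_vector_derivative_add has_vector_derivative_const has_vector_derivative_mult_right expi_deriv)
  then show ?thesis
    by (simp add: pole_circle_expi[abs_def] mult_ac)
qed

lemma norm_pole_circle: "0 < \<rho> \<Longrightarrow> norm (pole_circle a \<rho> t - a) = \<rho>"
  by (simp add: pole_circle_expi norm_mult)

lemma path_image_pole_circle: "0 < \<rho> \<Longrightarrow> path_image (pole_circle a \<rho>) = sphere a \<rho>"
  by (simp add: pole_circle_def)

lemma speed_eq:
  assumes "(\<gamma> has_vector_derivative d) (at t within {0..1})" "t \<in> {0..1}"
  shows "speed \<gamma> t = norm d"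
  unfolding speed_def using vector_derivative_within_cbox[of 0 1 t \<gamma> d] assms by simp

lemma speed_pole_circle:
  assumes "0 < \<rho>" "t \<in> {0..1}"
  shows "speed (pole_circle a \<rho>) t = 2 * pi * \<rho>"
  using speed_eq[OF pole_circle_derivative[of a \<rho> t "{0..1}"] assms(2)] assms(1) norm_pole_circle[of \<rho> a t]
  by (simp add: norm_mult)

lemma tangent_loop_pole_circle:
  assumes \<rho>: "0 < \<rho>"
  shows "tangent_loop (pole_circle a \<rho>) (\<lambda>z. - \<i> * (z - a) / of_real \<rho>)"
  unfolding tangent_loop_def regular_speed_def
proof (intro conjI ballI)
  show "continuous_on {0..1} (speed (pole_circle a \<rho>))"
    using continuous_on_cong[OF refl, of "{0..1}" "speed (pole_circle a \<rho>)" "\<lambda>_. 2 * pi * \<rho>"] speed_pole_circle[OF \<rho>] by simp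
  show "0 < speed (pole_circle a \<rho>) t" if "t \<in> {0..1}" for t
    using speed_pole_circle[OF \<rho> that] \<rho> by simp
  show "pole_circle a \<rho> 1 = pole_circle a \<rho> 0" by (simp add: pole_circle_expi)
  show "(\<lambda>z. - \<i> * (z - a) / of_real \<rho>) holomorphic_on UNIV" using \<rho> by (intro holomorphic_intros) auto
  show "(pole_circle a \<rho> has_vector_derivative of_real (speed (pole_circle a \<rho>) t) * (- \<i> * (pole_circle a \<rho> t - a) / of_real \<rho>)) (at t within {0..1})"
    if "t \<in> {0..1}" for t
    using pole_circle_derivative[of a \<rho> t "{0..1}"] \<rho> by (simp add: speed_pole_circle[OF \<rho> that] mult.assoc)
qed

lemma regular_speed_pole_circle: "0 < \<rho> \<Longrightarrow> regular_speed (pole_circle a \<rho>)"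
  using tangent_loop_pole_circle by (auto simp: tangent_loop_def)

text \<open>The left-hand side is the power of the image point with respect to the image circle; it
  equals the power of \<open>z\<close> with respect to the original circle up to the factor
  \<open>1 / (D * (norm z)\<^sup>2)\<close>. For \<open>D > 0\<close> signs are preserved, so circle
  goes to circle and interior to interior.\<close>

lemma inversion_identity:
  fixes z a :: complex
  assumes "z \<noteq> 0" and D: "D = (norm a)\<^sup>2 - \<rho>\<^sup>2" "D \<noteq> 0"
  shows "(norm (1 / cnj z - a / of_real D))\<^sup>2 - (\<rho> / D)\<^sup>2 = ((norm (z - a))\<^sup>2 - \<rho>\<^sup>2) / (D * (norm z)\<^sup>2)"
proof -
  define N where "N = (norm z)\<^sup>2"
  have N1: "N > 0" using assms(1) by (simp add: N_def)
  have N2: "N = Re z * Re z + Im z * Im z" by (simp only: N_def cmod_power2) (simp only: power2_eq_square)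
  note N = N1 N2
  have a2: "(norm a)\<^sup>2 = Re a * Re a + Im a * Im a" by (simp only: cmod_power2) (simp only: power2_eq_square)
  have e: "1 / cnj z - a / of_real D = of_real (1 / (D * N)) * (of_real D * z - of_real N * a)"
  proof -
    have "z * cnj z = of_real N" by (simp only: N_def complex_norm_square)
    then have "of_real (1 / (D * N)) * (of_real D * z - of_real N * a) = 1 / (of_real D * (z * cnj z)) * (of_real D * z - z * cnj z * a)"
      by simp
    also have "\<dots> = 1 / cnj z - a / of_real D" using D(2) assms(1) by (simp add: divide_simps) (simp add: algebra_simps)
    finally show ?thesis ..
  qed
  have "(norm (1 / cnj z - a / of_real D))\<^sup>2 = (norm (of_real D * z - of_real N * a))\<^sup>2 / (D * N)\<^sup>2"
    unfolding e norm_mult power_mult_distrib norm_of_real power2_abs by (simp add: power_divide power_mult_distrib)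
  also have "(norm (of_real D * z - of_real N * a))\<^sup>2 = D\<^sup>2 * N - 2 * D * N * (Re z * Re a + Im z * Im a) + N\<^sup>2 * (norm a)\<^sup>2"
    unfolding cmod_power2 by (simp add: N(2) power2_eq_square algebra_simps)
  also have "\<dots> = N * (D\<^sup>2 - 2 * D * (Re z * Re a + Im z * Im a) + N * (D + \<rho>\<^sup>2))"
    using D(1) by (simp add: power2_eq_square algebra_simps)
  finally have 1: "(norm (1 / cnj z - a / of_real D))\<^sup>2 = N * (D\<^sup>2 - 2 * D * (Re z * Re a + Im z * Im a) + N * (D + \<rho>\<^sup>2)) / (D * N)\<^sup>2" .
  have S: "(norm (z - a))\<^sup>2 - \<rho>\<^sup>2 = N - 2 * (Re z * Re a + Im z * Im a) + D"
    unfolding D(1) a2 N(2) unfolding cmod_power2 by (simp add: power2_eq_square algebra_simps)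
  have "N * (D\<^sup>2 - 2 * D * t + N * (D + \<rho>\<^sup>2)) / (D * N)\<^sup>2 - (\<rho> / D)\<^sup>2 = (N - 2 * t + D) / (D * N)" for t
    using N(1) D(2) by (simp add: field_simps power2_eq_square)
  then show ?thesis
    unfolding 1 S N_def[symmetric] .
qed

text \<open>The centre of the image circle. It differs from \<open>1 / cnj a\<close>, the image of
  the centre: inversion preserves circles but not their centres.\<close>

definition inv_center :: "complex \<Rightarrow> real \<Rightarrow> complex" where
  "inv_center a \<rho> = a / of_real ((norm a)\<^sup>2 - \<rho>\<^sup>2)"

definition inv_radius :: "complex \<Rightarrow> real \<Rightarrow> real" where
  "inv_radius a \<rho> = \<rho> / ((norm a)\<^sup>2 - \<rho>\<^sup>2)"

lemma sq_sign:
  assumes "x\<^sup>2 - y\<^sup>2 = (u\<^sup>2 - v\<^sup>2) / d" "0 \<le> x" "0 \<le> y" "0 \<le> u" "0 \<le> v" "(0::real) < d"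
  shows "x < y \<longleftrightarrow> u < v" and "x = y \<longleftrightarrow> u = v"
proof -
  have "x < y \<longleftrightarrow> x\<^sup>2 - y\<^sup>2 < 0" "u < v \<longleftrightarrow> u\<^sup>2 - v\<^sup>2 < 0"
    using assms(2-5) by (auto simp: power2_less_imp_less intro: power_strict_mono power_less_imp_less_base)
  then show "x < y \<longleftrightarrow> u < v" using assms(1,6) by (simp add: divide_less_0_iff)
  have "x = y \<longleftrightarrow> x\<^sup>2 - y\<^sup>2 = 0" "u = v \<longleftrightarrow> u\<^sup>2 - v\<^sup>2 = 0"
    using assms(2-5) by auto
  then show "x = y \<longleftrightarrow> u = v" using assms(1,6) by simp
qed

lemma inversion_circle:
  assumes \<rho>: "0 < \<rho>" "\<rho> < norm a" and z: "z \<noteq> 0"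
  shows "0 < inv_radius a \<rho>"
    and "norm (1 / cnj z - inv_center a \<rho>) < inv_radius a \<rho> \<longleftrightarrow> norm (z - a) < \<rho>"
    and "norm (1 / cnj z - inv_center a \<rho>) = inv_radius a \<rho> \<longleftrightarrow> norm (z - a) = \<rho>"
proof -
  define D where "D = (norm a)\<^sup>2 - \<rho>\<^sup>2"
  have D: "0 < D" using \<rho> by (simp add: D_def power_strict_mono)
  show r: "0 < inv_radius a \<rho>" using D \<rho> by (simp add: inv_radius_def D_def)
  have eq: "(norm (1 / cnj z - inv_center a \<rho>))\<^sup>2 - (inv_radius a \<rho>)\<^sup>2 = ((norm (z - a))\<^sup>2 - \<rho>\<^sup>2) / (D * (norm z)\<^sup>2)"
    unfolding inv_center_def inv_radius_def D_def[symmetric]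
    by (rule inversion_identity) (use z D in \<open>auto simp: D_def\<close>)
  have d: "0 < D * (norm z)\<^sup>2" using D z by simp
  show "norm (1 / cnj z - inv_center a \<rho>) < inv_radius a \<rho> \<longleftrightarrow> norm (z - a) < \<rho>"
    "norm (1 / cnj z - inv_center a \<rho>) = inv_radius a \<rho> \<longleftrightarrow> norm (z - a) = \<rho>"
    using sq_sign[OF eq _ _ _ _ d] r \<rho> by simp_all
qed

lemma path_image_pole_circle_sharp:
  assumes \<rho>: "0 < \<rho>" "\<rho> < norm a"
  shows "path_image (pole_circle_sharp a \<rho>) = sphere (inv_center a \<rho>) (inv_radius a \<rho>)"
proof -
  have nz: "0 \<notin> sphere a \<rho>" using \<rho> by (auto simp: dist_norm)
  have nb: "inv_radius a \<rho> < norm (inv_center a \<rho>)"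
  proof -
    define D where "D = (norm a)\<^sup>2 - \<rho>\<^sup>2"
    have "0 < D" using \<rho> by (simp add: D_def power_strict_mono)
    then show ?thesis
      unfolding inv_radius_def inv_center_def D_def[symmetric] using \<rho> by (simp add: norm_divide divide_strict_right_mono)
  qed
  have "path_image (pole_circle_sharp a \<rho>) = (\<lambda>z. 1 / cnj z) ` path_image (pole_circle a \<rho>)"
    by (auto simp: path_image_def pole_circle_sharp_def image_iff)
  also have "\<dots> = (\<lambda>z. 1 / cnj z) ` sphere a \<rho>" by (simp add: path_image_pole_circle \<rho>)
  also have "\<dots> = sphere (inv_center a \<rho>) (inv_radius a \<rho>)"
  proof (intro equalityI subsetI)
    fix w assume "w \<in> (\<lambda>z. 1 / cnj z) ` sphere a \<rho>"
    then obtain z where "z \<in> sphere a \<rho>" "w = 1 / cnj z" by auto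
    moreover from this have "z \<noteq> 0" using nz by blast
    ultimately show "w \<in> sphere (inv_center a \<rho>) (inv_radius a \<rho>)"
      using inversion_circle(3)[OF \<rho>, of z] by (simp add: dist_norm norm_minus_commute)
  next
    fix w assume w: "w \<in> sphere (inv_center a \<rho>) (inv_radius a \<rho>)"
    then have w0: "w \<noteq> 0" using nb by (auto simp: dist_norm)
    define z where "z = 1 / cnj w"
    have z: "z \<noteq> 0" "w = 1 / cnj z" using w0 by (auto simp: z_def)
    have "norm (z - a) = \<rho>"
      using inversion_circle(3)[OF \<rho> z(1)] w z(2) by (simp add: dist_norm norm_minus_commute)
    then show "w \<in> (\<lambda>z. 1 / cnj z) ` sphere a \<rho>"
      using z(2) by (auto simp: dist_norm norm_minus_commute)
  qed
  finally show ?thesis .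
qed

lemma pole_circle_sharp_at: "pole_circle_sharp a \<rho> t = 1 / cnj (pole_circle a \<rho> t)"
  by (simp add: pole_circle_sharp_def)

lemma pole_circle_nonzero: "0 < \<rho> \<Longrightarrow> \<rho> < norm a \<Longrightarrow> pole_circle a \<rho> t \<noteq> 0"
  using norm_pole_circle[of \<rho> a t] by auto

lemma pole_circle_sharp_derivative:
  assumes \<rho>: "0 < \<rho>" "\<rho> < norm a"
  shows "(pole_circle_sharp a \<rho> has_vector_derivative
     (- cnj (- 2 * pi * \<i> * (pole_circle a \<rho> t - a)) / (cnj (pole_circle a \<rho> t))\<^sup>2)) (at t within A)"
proof -
  have "((\<lambda>t. cnj (pole_circle a \<rho> t)) has_vector_derivative cnj (- 2 * pi * \<i> * (pole_circle a \<rho> t - a))) (at t within A)"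
    by (rule has_vector_derivative_cnj[OF pole_circle_derivative])
  moreover have "((\<lambda>w. 1 / w) has_field_derivative (- 1 / (cnj (pole_circle a \<rho> t))\<^sup>2)) (at (cnj (pole_circle a \<rho> t)))"
    using pole_circle_nonzero[OF \<rho>] by (auto intro!: derivative_eq_intros simp: power2_eq_square)
  ultimately have "((\<lambda>w. 1 / w) \<circ> (\<lambda>t. cnj (pole_circle a \<rho> t)) has_vector_derivative
      cnj (- 2 * pi * \<i> * (pole_circle a \<rho> t - a)) * (- 1 / (cnj (pole_circle a \<rho> t))\<^sup>2)) (at t within A)"
    by (rule field_vector_diff_chain_within[OF _ has_field_derivative_at_within])
  then show ?thesis by (simp add: pole_circle_sharp_def[abs_def] o_def)
qed

text \<open>The unit tangent of a circle is the normalized radius vector turned by a right angle.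
  The factor is \<open>\<i>\<close> instead of \<open>- \<i>\<close>, since inversion has turned the
  clockwise curve into a counterclockwise one.\<close>

lemma tangent_loop_pole_circle_sharp:
  assumes \<rho>: "0 < \<rho>" "\<rho> < norm a"
  shows "tangent_loop (pole_circle_sharp a \<rho>) (\<lambda>w. \<i> * (w - inv_center a \<rho>) / of_real (inv_radius a \<rho>))"
proof -
  define D where "D = (norm a)\<^sup>2 - \<rho>\<^sup>2"
  have D: "0 < D" using \<rho> by (simp add: D_def power_strict_mono)
  let ?g = "pole_circle a \<rho>"
  have nz: "?g t \<noteq> 0" for t by (rule pole_circle_nonzero[OF \<rho>])
  have sp: "speed (pole_circle_sharp a \<rho>) t = 2 * pi * \<rho> / (norm (?g t))\<^sup>2" if "t \<in> {0..1}" for t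
    using speed_eq[OF pole_circle_sharp_derivative[OF \<rho>] that] norm_pole_circle[OF \<rho>(1), of a t]
    by (simp add: norm_mult norm_divide norm_power flip: complex_cnj_diff)
  have T: "- cnj (- 2 * pi * \<i> * (z - a)) / (cnj z)\<^sup>2 = of_real (2 * pi * \<rho> / (norm z)\<^sup>2) * (\<i> * (1 / cnj z - inv_center a \<rho>) / of_real (inv_radius a \<rho>))"
    if z: "norm (z - a) = \<rho>" "z \<noteq> 0" for z
  proof -
    have "(norm (z - a))\<^sup>2 = \<rho>\<^sup>2" using z by simp
    then have "(z - a) * cnj (z - a) = of_real (\<rho>\<^sup>2)" by (simp only: complex_norm_square[symmetric])
    moreover have "a * cnj a = of_real ((norm a)\<^sup>2)" by (simp only: complex_norm_square)
    ultimately have "z * cnj z - z * cnj a - a * cnj z + of_real D = 0"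
      by (simp add: D_def algebra_simps)
    \<comment> \<open>The equation of the circle in a form in which \<open>z\<close> splits off as a
      factor; this turns the radius vector of the image circle into the derivative computed by the
      chain rule.\<close>
    then have k: "of_real D - a * cnj z = z * cnj a - z * cnj z" by (simp add: algebra_simps)
    have "of_real (2 * pi * \<rho> / (norm z)\<^sup>2) * (\<i> * (1 / cnj z - inv_center a \<rho>) / of_real (inv_radius a \<rho>))
       = 2 * pi * \<i> / of_real ((norm z)\<^sup>2) * ((of_real D - a * cnj z) / cnj z)"
      unfolding inv_center_def inv_radius_def D_def[symmetric] using \<rho> D z(2) by (simp add: field_simps)
    also have "of_real ((norm z)\<^sup>2) = z * cnj z" by (simp only: complex_norm_square)
    also have "2 * pi * \<i> / (z * cnj z) * ((of_real D - a * cnj z) / cnj z) = - cnj (- 2 * pi * \<i> * (z - a)) / (cnj z)\<^sup>2"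
      unfolding k using z(2) by (simp add: field_simps power2_eq_square)
    finally show ?thesis by simp
  qed
  show ?thesis
    unfolding tangent_loop_def regular_speed_def
  proof (intro conjI ballI)
    have "continuous_on {0..1} (\<lambda>t. 2 * pi * \<rho> / (norm (?g t))\<^sup>2)"
      using nz by (auto simp: pole_circle_expi intro!: continuous_intros)
    then show "continuous_on {0..1} (speed (pole_circle_sharp a \<rho>))"
      by (rule continuous_on_eq) (simp add: sp)
    show "0 < speed (pole_circle_sharp a \<rho>) t" if "t \<in> {0..1}" for t
      using sp[OF that] \<rho> nz[of t] by simp
    show "pole_circle_sharp a \<rho> 1 = pole_circle_sharp a \<rho> 0" by (simp add: pole_circle_sharp_def pole_circle_expi)
    show "(\<lambda>w. \<i> * (w - inv_center a \<rho>) / of_real (inv_radius a \<rho>)) holomorphic_on UNIV"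
      using inversion_circle(1)[OF \<rho>, of 1] by (intro holomorphic_intros) auto
    show "(pole_circle_sharp a \<rho> has_vector_derivative of_real (speed (pole_circle_sharp a \<rho>) t) *
       (\<i> * (pole_circle_sharp a \<rho> t - inv_center a \<rho>) / of_real (inv_radius a \<rho>))) (at t within {0..1})"
      if "t \<in> {0..1}" for t
      using pole_circle_sharp_derivative[OF \<rho>, of t "{0..1}"]
      unfolding T[OF norm_pole_circle[OF \<rho>(1)] nz] sp[OF that] pole_circle_sharp_at .
  qed
qed

text \<open>\<open>Fi\<close> and \<open>Fo\<close> represent the Cauchy integral inside and outside
  the circle, with continuity up to the circle included, so that unrestricted one-sided limits are
  available. \<open>cw\<close> marks a clockwise curve: its left-hand side is the exterior, which
  reverses the sign of the jump.\<close>

definition cauchy_pair ::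
  "(real \<Rightarrow> complex) \<Rightarrow> complex \<Rightarrow> real \<Rightarrow> bool \<Rightarrow> (complex \<Rightarrow> complex) \<Rightarrow> (complex \<Rightarrow> complex) \<Rightarrow> (complex \<Rightarrow> complex) \<Rightarrow> bool" where
  "cauchy_pair \<gamma> a \<rho> cw f Fi Fo \<longleftrightarrow>
     continuous_on (cball a \<rho>) Fi \<and> Fi holomorphic_on ball a \<rho> \<and>
     continuous_on (- ball a \<rho>) Fo \<and> Fo holomorphic_on - cball a \<rho> \<and> (Fo \<longlongrightarrow> 0) at_infinity \<and>
     (\<forall>z\<in>ball a \<rho>. contour_integral \<gamma> (\<lambda>w. f w / (w - z)) = 2 * pi * \<i> * Fi z) \<and>
     (\<forall>z\<in>- cball a \<rho>. contour_integral \<gamma> (\<lambda>w. f w / (w - z)) = 2 * pi * \<i> * Fo z) \<and>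
     (\<forall>z\<in>sphere a \<rho>. f z = (if cw then Fo z - Fi z else Fi z - Fo z))"

definition plemelj :: "(real \<Rightarrow> complex) \<Rightarrow> complex \<Rightarrow> real \<Rightarrow> bool \<Rightarrow> bool" where
  "plemelj \<gamma> a \<rho> cw \<longleftrightarrow>
     (\<forall>f :: complex \<Rightarrow> complex. sobolev_param 1 \<gamma> (f \<circ> \<gamma>) \<longrightarrow> (\<exists>Fi Fo. cauchy_pair \<gamma> a \<rho> cw f Fi Fo))"

lemma integral_lser_expi:
  assumes "X summable_on UNIV"
  shows "((\<lambda>t. lser X (expi (-1) t)) has_integral X 0) {0..1}"
proof -
  define Y where "Y m = X (- m)" for m
  have Y: "Y summable_on UNIV" using assms by (simp add: Y_def[abs_def] summable_on_int_shift)
  note f = fser_props[OF Y]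
  have e: "lser X (expi (-1) t) = fser Y t" for t
  proof -
    have "expi (-1) t powi m = expi (- m) t" for m
      by (simp add: expi_def cis_power_int mult_ac)
    then have "lser X (expi (-1) t) = infsum (\<lambda>m. X m * expi (- m) t) UNIV" by (simp add: lser_def)
    also have "\<dots> = infsum (\<lambda>m. X (- m) * expi m t) UNIV"
      using infsum_reindex_bij_betw[of uminus UNIV UNIV "\<lambda>m::int. X (- m) * expi m t"] by simp
    finally show ?thesis by (simp add: fser_def Y_def)
  qed
  have i: "integrable L01 (fser Y)" using f(1) by (rule continuous_imp_integrable_real)
  have "integral\<^sup>L L01 (fser Y) = fc (fser Y) 0" by (simp add: fc_def)
  also have "\<dots> = X 0" using f(3) by (simp add: Y_def)
  finally show ?thesis
    using has_integral_integral_lebesgue_on[OF i] by (simp add: e)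
qed

lemma sobolev_pole_circle_lser:
  fixes f :: "complex \<Rightarrow> complex"
  assumes \<rho>: "0 < \<rho>" and f: "sobolev_param k (pole_circle a \<rho>) (f \<circ> pole_circle a \<rho>)" and k: "1 \<le> k"
  obtains y where "wt (real k) y" "y summable_on UNIV" "\<And>z. norm z = 1 \<Longrightarrow> f (a + of_real \<rho> * z) = lser y z"
proof -
  define g where "g = f \<circ> pole_circle a \<rho>"
  \<comment> \<open>The circle is run clockwise, so the frequency \<open>m\<close> in the parameter
    corresponds to the power \<open>- m\<close> on the circle.\<close>
  define y where "y m = fc g (- m)" for m
  have "wt (real k) (fc g)"
    unfolding g_def by (rule sobolev_param_imp_wt[OF speed_pole_circle[OF \<rho>] _ f]) (use \<rho> in auto)
  then have w: "wt (real k) y" unfolding y_def[abs_def] by (rule wt_reflect)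
  then have y: "y summable_on UNIV" by (rule wt_summable) (use k in simp)
  have "f (a + of_real \<rho> * z) = lser y z" if z: "norm z = 1" for z
  proof -
    have "a + of_real \<rho> * z \<in> path_image (pole_circle a \<rho>)"
      using z \<rho> by (simp add: path_image_pole_circle dist_norm norm_mult)
    then obtain t where t: "t \<in> {0..1}" "a + of_real \<rho> * z = pole_circle a \<rho> t"
      by (auto simp: path_image_def)
    then have z: "z = expi (-1) t" using \<rho> by (simp add: pole_circle_expi)
    have "f (a + of_real \<rho> * z) = g t" using t by (simp add: g_def)
    also have "\<dots> = fser (fc g) t"
      unfolding g_def by (rule sobolev_param_fser(2)[OF regular_speed_pole_circle[OF \<rho>] f k t(1)])
    also have "\<dots> = infsum (\<lambda>m. y m * expi (- m) t) UNIV"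
      using infsum_reindex_bij_betw[of uminus UNIV UNIV "\<lambda>m::int. fc g m * expi m t"]
      by (simp add: fser_def y_def)
    also have "\<dots> = lser y z"
      by (simp add: lser_def z expi_def cis_power_int mult_ac)
    finally show ?thesis .
  qed
  then show thesis using that w y by blast
qed

text \<open>On the circle \<open>f\<close> is a Laurent series in \<open>(z - a) / \<rho>\<close>.
  Its nonnegative powers extend inwards and its negative powers outwards; expanding the Cauchy
  kernel by \<open>pole_in\<close> or \<open>pole_out\<close> shows that the integral selects
  exactly one of these halves.\<close>

lemma plemelj_pole_circle:
  assumes \<rho>: "0 < \<rho>"
  shows "plemelj (pole_circle a \<rho>) a \<rho> True"
  unfolding plemelj_def
proof (intro allI impI)
  fix f :: "complex \<Rightarrow> complex"
  assume f: "sobolev_param 1 (pole_circle a \<rho>) (f \<circ> pole_circle a \<rho>)"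
  obtain y where y: "y summable_on UNIV" and fy: "\<And>z. norm z = 1 \<Longrightarrow> f (a + of_real \<rho> * z) = lser y z"
    using sobolev_pole_circle_lser[OF \<rho> f] by auto
  define yp where "yp m = (if 0 \<le> m then y m else 0)" for m
  define ym where "ym m = (if m < 0 then y m else 0)" for m
  have yn: "(\<lambda>m. norm (y m)) summable_on UNIV" using y by (simp add: summable_on_iff_abs_summable_on_complex)
  have yp: "yp summable_on UNIV" and ym: "ym summable_on UNIV"
    by (auto intro!: summable_on_norm_le[OF yn] simp: yp_def ym_def)
  have yp0: "\<And>m. m < 0 \<Longrightarrow> yp m = 0" and ym0: "\<And>m. 0 < m \<Longrightarrow> ym m = 0" "ym 0 = 0" by (auto simp: yp_def ym_def)
  define s where "s z = (z - a) / of_real \<rho>" for z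
  have s: "continuous_on A s" "s holomorphic_on A" for A
    unfolding s_def[abs_def] using \<rho> by (auto intro!: continuous_intros holomorphic_intros)
  have ns: "norm (s z) = norm (z - a) / \<rho>" for z using \<rho> by (simp add: s_def norm_divide)
  \<comment> \<open>The sign comes from the clockwise orientation.\<close>
  define Fi where "Fi z = - lser yp (s z)" for z
  define Fo where "Fo z = lser ym (s z)" for z
  have "continuous_on (cball a \<rho>) Fi"
    unfolding Fi_def[abs_def] using \<rho>
    by (intro continuous_intros continuous_on_compose2[OF lser_inside(1)[OF yp yp0] s(1)])
      (auto simp: ns dist_norm norm_minus_commute)
  moreover have "Fi holomorphic_on ball a \<rho>"
  proof -
    have "(lser yp \<circ> s) holomorphic_on ball a \<rho>"
      by (rule holomorphic_on_compose_gen[OF s(2) lser_inside(2)[OF yp yp0]])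
        (use \<rho> in \<open>auto simp: ns dist_norm norm_minus_commute\<close>)
    then show ?thesis unfolding Fi_def[abs_def] by (intro holomorphic_on_minus) (simp add: o_def)
  qed
  moreover have "continuous_on (- ball a \<rho>) Fo"
    unfolding Fo_def[abs_def] using \<rho>
    by (intro continuous_on_compose2[OF lser_outside(1)[OF ym ym0(1)] s(1)])
      (auto simp: ns dist_norm norm_minus_commute)
  moreover have "Fo holomorphic_on - cball a \<rho>"
  proof -
    have "(lser ym \<circ> s) holomorphic_on - cball a \<rho>"
      by (rule holomorphic_on_compose_gen[OF s(2) lser_outside(2)[OF ym ym0(1)]])
        (use \<rho> in \<open>auto simp: ns dist_norm norm_minus_commute\<close>)
    then show ?thesis unfolding Fo_def[abs_def] by (simp add: o_def)
  qed
  moreover have "(Fo \<longlongrightarrow> 0) at_infinity"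
  proof -
    have "filterlim s at_infinity at_infinity"
    proof -
      have "filterlim (\<lambda>z. z + (- a)) at_infinity at_infinity"
        by (rule tendsto_add_filterlim_at_infinity'[OF filterlim_ident tendsto_const])
      then have "filterlim (\<lambda>z. inverse (of_real \<rho>) * (z + (- a))) at_infinity at_infinity"
        by (rule tendsto_mult_filterlim_at_infinity[OF tendsto_const, rotated]) (use \<rho> in simp)
      then show ?thesis by (simp add: s_def[abs_def] divide_inverse mult.commute)
    qed
    then show ?thesis
      unfolding Fo_def[abs_def] using lser_outside(3)[OF ym ym0(1)] ym0(2) by (auto intro: filterlim_compose)
  qed
  \<comment> \<open>The derivative of the parametrization contains a factor \<open>w - a\<close>,
    which is absorbed into the shifted coefficients \<open>y'\<close>. With the kernel expanded by
    \<open>q\<close>, the integral over one period is the coefficient of index 0 of a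
    convolution.\<close>
  moreover have I: "contour_integral (pole_circle a \<rho>) (\<lambda>w. f w / (w - z)) = - (2 * pi * \<i>) * X"
    if q: "q summable_on UNIV" "\<And>\<zeta>. norm \<zeta> = 1 \<Longrightarrow> lser q \<zeta> = 1 / (\<zeta> - s z)" and z: "norm (s z) \<noteq> 1"
      and X: "X = infsum (\<lambda>l. y (- l - 1) * q l) UNIV" for q z X
  proof -
    define y' where "y' m = y (m + (-1))" for m
    have y': "y' summable_on UNIV" unfolding y'_def using y by (subst summable_on_int_shift)
    have "contour_integral (pole_circle a \<rho>) (\<lambda>w. f w / (w - z))
        = integral {0..1} (\<lambda>t. f (pole_circle a \<rho> t) / (pole_circle a \<rho> t - z) * vector_derivative (pole_circle a \<rho>) (at t))"
      by (rule contour_integral_integral)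
    also have "\<dots> = integral {0..1} (\<lambda>t. - (2 * pi * \<i>) * lser (conv y' q) (expi (-1) t))"
    proof (rule integral_cong)
      fix t
      let ?\<zeta> = "expi (-1) t"
      have n: "norm ?\<zeta> = 1" by simp
      have zs: "z = a + of_real \<rho> * s z" using \<rho> by (simp add: s_def)
      have vd: "vector_derivative (pole_circle a \<rho>) (at t) = - (2 * pi * \<i>) * (of_real \<rho> * ?\<zeta>)"
        using vector_derivative_at[OF pole_circle_derivative[of a \<rho> t UNIV]] by (simp add: pole_circle_expi)
      have c: "lser (conv y' q) ?\<zeta> = ?\<zeta> * lser y ?\<zeta> * (1 / (?\<zeta> - s z))"
        using conv_lser(2)[OF y' q(1) n] lser_shift[OF n, of y "-1"] q(2)[OF n] by (simp add: y'_def[abs_def])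
      have d: "pole_circle a \<rho> t - z = of_real \<rho> * (?\<zeta> - s z)"
        using zs by (simp add: pole_circle_expi algebra_simps)
      have nz: "?\<zeta> - s z \<noteq> 0"
      proof
        assume "?\<zeta> - s z = 0"
        then have "s z = ?\<zeta>" by simp
        then show False using z by simp
      qed
      have fp: "f (pole_circle a \<rho> t) = lser y ?\<zeta>" using fy[OF n] by (simp add: pole_circle_expi)
      show "f (pole_circle a \<rho> t) / (pole_circle a \<rho> t - z) * vector_derivative (pole_circle a \<rho>) (at t) = - (2 * pi * \<i>) * lser (conv y' q) ?\<zeta>"
        unfolding fp d vd c using nz \<rho> by (simp add: field_simps)
    qed
    also have "\<dots> = - (2 * pi * \<i>) * conv y' q 0"
      by (intro integral_unique has_integral_mult_right integral_lser_expi conv_lser y' q)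
    also have "conv y' q 0 = X" by (simp add: conv_def X y'_def)
    finally show ?thesis .
  qed
  moreover have "\<forall>z\<in>ball a \<rho>. contour_integral (pole_circle a \<rho>) (\<lambda>w. f w / (w - z)) = 2 * pi * \<i> * Fi z"
  proof
    fix z assume "z \<in> ball a \<rho>"
    then have z: "norm (s z) < 1" using \<rho> by (simp add: ns dist_norm norm_minus_commute)
    have "infsum (\<lambda>l. y (- l - 1) * pole_in (s z) l) UNIV = infsum (\<lambda>k. yp k * s z powi k) UNIV"
      by (rule infsum_reindex_bij_witness[of _ "\<lambda>k. - k - 1" "\<lambda>l. - l - 1"])
        (auto simp: yp_def pole_in_def power_int_def nat_diff_distrib)
    then have X: "lser yp (s z) = infsum (\<lambda>l. y (- l - 1) * pole_in (s z) l) UNIV" by (simp add: lser_def)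
    have "pole_in (s z) summable_on UNIV" using pole_in_wt[OF z, of 1] by (intro wt_summable[of 1]) auto
    from I[OF this lser_pole_in[OF z] _ X] z
    show "contour_integral (pole_circle a \<rho>) (\<lambda>w. f w / (w - z)) = 2 * pi * \<i> * Fi z"
      by (simp add: Fi_def)
  qed
  moreover have "\<forall>z\<in>- cball a \<rho>. contour_integral (pole_circle a \<rho>) (\<lambda>w. f w / (w - z)) = 2 * pi * \<i> * Fo z"
  proof
    fix z assume "z \<in> - cball a \<rho>"
    then have z: "norm (s z) > 1" using \<rho> by (simp add: ns dist_norm norm_minus_commute)
    then have s0: "s z \<noteq> 0" by auto
    have "infsum (\<lambda>l. y (- l - 1) * pole_out (s z) l) UNIV = infsum (\<lambda>k. - (ym k * s z powi k)) UNIV"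
      by (rule infsum_reindex_bij_witness[of _ "\<lambda>k. - k - 1" "\<lambda>l. - l - 1"])
        (use s0 in \<open>auto simp: ym_def pole_out_def power_int_def nat_add_distrib field_simps\<close>)
    then have X: "- lser ym (s z) = infsum (\<lambda>l. y (- l - 1) * pole_out (s z) l) UNIV" by (simp add: lser_def infsum_uminus)
    have "pole_out (s z) summable_on UNIV" using pole_out_wt[OF z, of 1] by (intro wt_summable[of 1]) auto
    from I[OF this lser_pole_out[OF z] _ X] z
    show "contour_integral (pole_circle a \<rho>) (\<lambda>w. f w / (w - z)) = 2 * pi * \<i> * Fo z"
      by (simp add: Fo_def)
  qed
  moreover have "\<forall>z\<in>sphere a \<rho>. f z = Fo z - Fi z"
  proof
    fix z assume "z \<in> sphere a \<rho>"
    then have n: "norm (s z) = 1" using \<rho> by (simp add: ns dist_norm norm_minus_commute)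
    have "z = a + of_real \<rho> * s z" using \<rho> by (simp add: s_def)
    then have "f z = lser y (s z)" using fy[OF n] by simp
    also have "y = (\<lambda>m. ym m + yp m)" by (auto simp: yp_def ym_def)
    finally show "f z = Fo z - Fi z" by (simp add: lser_add[OF ym yp n] Fo_def Fi_def)
  qed
  ultimately show "\<exists>Fi Fo. cauchy_pair (pole_circle a \<rho>) a \<rho> True f Fi Fo"
    unfolding cauchy_pair_def by (intro exI[of _ Fi] exI[of _ Fo] conjI) simp_all
qed


text \<open>Reflection \<open>z \<mapsto> 1 / cnj z\<close> takes the curve to
  \<open>pole_circle a \<rho>\<close>, whose constant speed makes Fourier series effective. Under it
  the Cauchy kernel at \<open>z\<close> becomes the conjugate of the kernel at
  \<open>1 / cnj z\<close> minus the kernel at 0; this is why \<open>Go 0\<close> is subtracted in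
  \<open>Fi\<close> and \<open>Fo\<close>.\<close>

lemma plemelj_pole_circle_sharp:
  assumes \<rho>: "0 < \<rho>" "\<rho> < norm a"
  shows "plemelj (pole_circle_sharp a \<rho>) (inv_center a \<rho>) (inv_radius a \<rho>) False"
  unfolding plemelj_def
proof (intro allI impI)
  fix f :: "complex \<Rightarrow> complex"
  assume f: "sobolev_param 1 (pole_circle_sharp a \<rho>) (f \<circ> pole_circle_sharp a \<rho>)"
  define g where "g z = cnj (f (1 / cnj z))" for z
  let ?\<gamma> = "pole_circle a \<rho>" and ?\<gamma>' = "pole_circle_sharp a \<rho>"
  let ?b = "inv_center a \<rho>" and ?\<sigma> = "inv_radius a \<rho>"
  have rs: "regular_speed ?\<gamma>'" using tangent_loop_pole_circle_sharp[OF \<rho>] by (simp add: tangent_loop_def)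
  have nz: "?\<gamma> t \<noteq> 0" for t by (rule pole_circle_nonzero[OF \<rho>])
  have gf: "g (?\<gamma> t) = cnj (f (?\<gamma>' t))" for t by (simp add: g_def pole_circle_sharp_at)
  have "sobolev_param 1 ?\<gamma> (g \<circ> ?\<gamma>)"
  proof -
    have c1: "sobolev_param 1 ?\<gamma>' (\<lambda>t. cnj ((f \<circ> ?\<gamma>') t))"
      by (rule sobolev_param_bounded_linear[OF rs bounded_linear_cnj f])
    obtain h where h: "L2_along ?\<gamma>' h"
      and gh: "\<And>t. t \<in> {0..1} \<Longrightarrow> ((\<lambda>s. speed ?\<gamma>' s *\<^sub>R h s) has_integral (cnj (f (?\<gamma>' t)) - cnj (f (?\<gamma>' 0)))) {0..t}"
      and L: "L2_along ?\<gamma>' (\<lambda>t. cnj (f (?\<gamma>' t)))" and p: "cnj (f (?\<gamma>' 1)) = cnj (f (?\<gamma>' 0))"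
      using c1 by auto
    \<comment> \<open>The ratio of the two speeds converts the arclength derivative along
      \<open>?\<gamma>'\<close> into the one along \<open>?\<gamma>\<close>. Being continuous, it
      preserves square integrability.\<close>
    define q where "q s = complex_of_real (speed ?\<gamma>' s / (2 * pi * \<rho>))" for s
    have "continuous_on {0..1} q"
      using rs \<rho> unfolding q_def[abs_def] regular_speed_def by (intro continuous_intros) auto
    then have "sqint (\<lambda>s. q s * h s)"
      using h by (intro sqint_mult_continuous) (simp_all add: L2_along_sqint[OF rs])
    then have qh: "L2_along ?\<gamma> (\<lambda>s. q s * h s)" by (simp add: L2_along_sqint[OF regular_speed_pole_circle[OF \<rho>(1)]])
    have "((\<lambda>s. speed ?\<gamma> s *\<^sub>R (q s * h s)) has_integral (g (?\<gamma> t) - g (?\<gamma> 0))) {0..t}" if t: "t \<in> {0..1}" for t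
      using gh[OF t] unfolding gf
    proof (rule has_integral_eq[rotated])
      fix s assume "s \<in> {0..t}"
      then have "s \<in> {0..1}" using t by simp
      then show "speed ?\<gamma>' s *\<^sub>R h s = speed ?\<gamma> s *\<^sub>R (q s * h s)"
        using \<rho>(1) by (simp add: speed_pole_circle[OF \<rho>(1)] q_def scaleR_conv_of_real)
    qed
    moreover have "L2_along ?\<gamma> (\<lambda>t. g (?\<gamma> t))"
      using L by (simp add: gf L2_along_sqint[OF regular_speed_pole_circle[OF \<rho>(1)]] L2_along_sqint[OF rs])
    ultimately show ?thesis using qh p by (auto simp: gf o_def)
  qed
  then obtain Gi Go where "cauchy_pair ?\<gamma> a \<rho> True g Gi Go"
    using plemelj_pole_circle[OF \<rho>(1), of a] unfolding plemelj_def by blast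
  then have
    Gi: "continuous_on (cball a \<rho>) Gi" "Gi holomorphic_on ball a \<rho>" and
    Go: "continuous_on (- ball a \<rho>) Go" "Go holomorphic_on - cball a \<rho>" "(Go \<longlongrightarrow> 0) at_infinity" and
    Ii: "\<And>z. z \<in> ball a \<rho> \<Longrightarrow> contour_integral ?\<gamma> (\<lambda>w. g w / (w - z)) = 2 * pi * \<i> * Gi z" and
    Io: "\<And>z. z \<in> - cball a \<rho> \<Longrightarrow> contour_integral ?\<gamma> (\<lambda>w. g w / (w - z)) = 2 * pi * \<i> * Go z" and
    jump: "\<And>z. z \<in> sphere a \<rho> \<Longrightarrow> g z = Go z - Gi z"
    unfolding cauchy_pair_def by simp_all
  have o0: "0 \<in> - cball a \<rho>" using \<rho> by (simp add: dist_norm)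
  define iv where "iv z = 1 / cnj z" for z :: complex
  have iv: "iv (iv z) = z" for z by (simp add: iv_def)
  have sig: "0 < ?\<sigma>" using inversion_circle(1)[OF \<rho>, of 1] by simp
  have in_iff: "iv z \<in> ball a \<rho> \<longleftrightarrow> z \<in> ball ?b ?\<sigma>" "iv z \<in> sphere a \<rho> \<longleftrightarrow> z \<in> sphere ?b ?\<sigma>" if "z \<noteq> 0" for z
  proof -
    have n: "iv z \<noteq> 0" using that by (simp add: iv_def)
    have "1 / cnj (iv z) = z" by (simp add: iv_def)
    then show "iv z \<in> ball a \<rho> \<longleftrightarrow> z \<in> ball ?b ?\<sigma>" "iv z \<in> sphere a \<rho> \<longleftrightarrow> z \<in> sphere ?b ?\<sigma>"
      using inversion_circle(2,3)[OF \<rho> n] by (auto simp: dist_norm norm_minus_commute)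
  qed
  have nb: "0 \<notin> cball ?b ?\<sigma>"
  proof -
    define D where "D = (norm a)\<^sup>2 - \<rho>\<^sup>2"
    have "0 < D" using \<rho> by (simp add: D_def power_strict_mono)
    then have "?\<sigma> < norm ?b"
      unfolding inv_radius_def inv_center_def D_def[symmetric] using \<rho> by (simp add: norm_divide divide_strict_right_mono)
    then show ?thesis by (simp add: dist_norm)
  qed
  have cb_iff: "iv z \<in> cball a \<rho> \<longleftrightarrow> z \<in> cball ?b ?\<sigma>" if "z \<noteq> 0" for z
    using in_iff[OF that] by (auto simp: le_less)
  have cb1: "iv z \<in> cball a \<rho>" if "z \<in> cball ?b ?\<sigma>" for z using that cb_iff nb by metis
  have b1: "iv z \<in> ball a \<rho>" if "z \<in> ball ?b ?\<sigma>" for z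
    using that in_iff nb ball_subset_cball by (metis subsetD)
  define Fi where "Fi z = - cnj (Gi (iv z) - Go 0)" for z
  \<comment> \<open>Reflection interchanges 0 and infinity. As \<open>Go\<close> vanishes at
    infinity, the second branch tends to \<open>cnj (Go 0)\<close> at 0, and this value is filled
    in.\<close>
  define Fo where "Fo z = (if z = 0 then cnj (Go 0) else - cnj (Go (iv z) - Go 0))" for z
  have ivc: "continuous_on A iv" if "0 \<notin> A" for A
    unfolding iv_def[abs_def] using that by (intro continuous_intros) auto
  have hol: "(\<lambda>z. cnj (G (iv z))) holomorphic_on A" if G: "G holomorphic_on B" "open B" and A: "0 \<notin> A" "\<And>z. z \<in> A \<Longrightarrow> iv z \<in> B" for G A B
  proof -
    have "cnj ` B = cnj -` B"
    proof (intro equalityI subsetI)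
      fix x assume "x \<in> cnj -` B"
      then have "x = cnj (cnj x)" "cnj x \<in> B" by auto
      then show "x \<in> cnj ` B" by blast
    qed auto
    then have "open (cnj ` B)" using G(2) by (simp add: open_vimage continuous_intros)
    then have "(cnj \<circ> G \<circ> cnj) holomorphic_on cnj ` B"
      by (intro holomorphic_on_compose_cnj_cnj) (use G in \<open>auto simp: image_image\<close>)
    moreover have "(\<lambda>z. 1 / z) holomorphic_on A" using A(1) by (intro holomorphic_intros) auto
    moreover have "(\<lambda>z. 1 / z) ` A \<subseteq> cnj ` B"
    proof
      fix w assume "w \<in> (\<lambda>z. 1 / z) ` A"
      then obtain z where "z \<in> A" "w = 1 / z" by auto
      then have "w = cnj (iv z)" "iv z \<in> B" using A(2) by (auto simp: iv_def)
      then show "w \<in> cnj ` B" by blast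
    qed
    ultimately have "((cnj \<circ> G \<circ> cnj) \<circ> (\<lambda>z. 1 / z)) holomorphic_on A"
      by (intro holomorphic_on_compose_gen[of "\<lambda>z. 1 / z" A "cnj \<circ> G \<circ> cnj" "cnj ` B"])
    then show ?thesis by (simp add: o_def iv_def)
  qed
  have gc: "continuous_on {0..1} (\<lambda>t. g (?\<gamma> t))"
  proof -
    have "continuous_on (sphere a \<rho>) (\<lambda>z. Go z - Gi z)"
      by (intro continuous_intros continuous_on_subset[OF Gi(1)] continuous_on_subset[OF Go(1)]) auto
    then have "continuous_on (sphere a \<rho>) g"
      by (rule continuous_on_eq) (simp add: jump)
    moreover have "continuous_on {0..1} ?\<gamma>" unfolding pole_circle_expi[abs_def] by (intro continuous_intros)
    moreover have "?\<gamma> ` {0..1} \<subseteq> sphere a \<rho>"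
      using path_image_pole_circle[OF \<rho>(1), of a] by (simp add: path_image_def)
    ultimately show ?thesis by (rule continuous_on_compose2)
  qed
  define d where "d t = - 2 * pi * \<i> * (?\<gamma> t - a)" for t
  have vd: "vector_derivative ?\<gamma> (at t) = d t" for t
    using vector_derivative_at[OF pole_circle_derivative[of a \<rho> t UNIV]] by (simp add: d_def)
  have vd': "vector_derivative ?\<gamma>' (at t) = - cnj (d t) / (cnj (?\<gamma> t))\<^sup>2" for t
    using vector_derivative_at[OF pole_circle_sharp_derivative[OF \<rho>, of t UNIV]] by (simp add: d_def)
  have dc: "continuous_on {0..1} d"
    unfolding d_def[abs_def] pole_circle_expi[abs_def] by (intro continuous_intros)
  have ki: "(\<lambda>t. g (?\<gamma> t) / (?\<gamma> t - \<zeta>) * d t) integrable_on {0..1}" if "\<zeta> \<notin> sphere a \<rho>" for \<zeta>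
  proof (rule integrable_continuous_real)
    have "?\<gamma> t \<noteq> \<zeta>" if "t \<in> {0..1}" for t
      using \<open>\<zeta> \<notin> sphere a \<rho>\<close> norm_pole_circle[OF \<rho>(1), of a t] by (auto simp: dist_norm norm_minus_commute)
    then show "continuous_on {0..1} (\<lambda>t. g (?\<gamma> t) / (?\<gamma> t - \<zeta>) * d t)"
      using gc dc by (intro continuous_intros) (auto simp: pole_circle_expi intro!: continuous_intros)
  qed
  have I: "contour_integral ?\<gamma>' (\<lambda>w. f w / (w - z)) = cnj (contour_integral ?\<gamma> (\<lambda>w. g w / (w - iv z)) - contour_integral ?\<gamma> (\<lambda>w. g w / (w - 0)))"
    if z: "z \<noteq> 0" "z \<notin> sphere ?b ?\<sigma>" for z
  proof -
    have iz: "iv z \<notin> sphere a \<rho>" "0 \<notin> sphere a \<rho>" using z in_iff o0 by auto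
    have "contour_integral ?\<gamma>' (\<lambda>w. f w / (w - z)) = integral {0..1} (\<lambda>t. cnj (g (?\<gamma> t) / (?\<gamma> t - iv z) * d t - g (?\<gamma> t) / (?\<gamma> t - 0) * d t))"
      unfolding contour_integral_integral
    proof (rule integral_cong)
      fix t assume "t \<in> {0..1::real}"
      have fg: "f (1 / cnj (?\<gamma> t)) = cnj (g (?\<gamma> t))" by (simp add: g_def)
      have ne: "?\<gamma> t \<noteq> iv z"
        using iz norm_pole_circle[OF \<rho>(1), of a t] by (auto simp: dist_norm norm_minus_commute)
      \<comment> \<open>The transformation of the kernel: with \<open>u\<close> the conjugate of the
        point on \<open>?\<gamma>\<close> and \<open>e\<close> that of the velocity, partial
        fractions produce the kernels at \<open>1 / z\<close> and at 0.\<close>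
      have alg: "G / (1 / u - z) * (- e / u\<^sup>2) = G / (u - 1 / z) * e - G / u * e"
        if "u \<noteq> 0" "z * u \<noteq> 1" for G u e :: complex
      proof -
        have "1 / u - z = (1 - z * u) / u" "u - 1 / z = (z * u - 1) / z" using that z(1) by (auto simp: field_simps)
        moreover have "1 - z * u \<noteq> 0" "z * u - 1 \<noteq> 0" using that by auto
        ultimately show ?thesis using that z(1) by (simp add: field_simps power2_eq_square)
      qed
      have "z * cnj (?\<gamma> t) \<noteq> 1"
      proof
        assume "z * cnj (?\<gamma> t) = 1"
        then have "cnj (z * cnj (?\<gamma> t)) = 1" by simp
        then have "?\<gamma> t = iv z" using z(1) by (simp add: iv_def field_simps)
        then show False using ne by simp
      qed
      then show "f (?\<gamma>' t) / (?\<gamma>' t - z) * vector_derivative ?\<gamma>' (at t) =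
          cnj (g (?\<gamma> t) / (?\<gamma> t - iv z) * d t - g (?\<gamma> t) / (?\<gamma> t - 0) * d t)"
        unfolding vd' pole_circle_sharp_at fg using alg[of "cnj (?\<gamma> t)" "cnj (g (?\<gamma> t))" "cnj (d t)"] nz[of t]
        by (simp add: iv_def)
    qed
    also have "\<dots> = cnj (integral {0..1} (\<lambda>t. g (?\<gamma> t) / (?\<gamma> t - iv z) * d t - g (?\<gamma> t) / (?\<gamma> t - 0) * d t))"
      by (rule integral_cnj[symmetric])
    also have "integral {0..1} (\<lambda>t. g (?\<gamma> t) / (?\<gamma> t - iv z) * d t - g (?\<gamma> t) / (?\<gamma> t - 0) * d t) =
        contour_integral ?\<gamma> (\<lambda>w. g w / (w - iv z)) - contour_integral ?\<gamma> (\<lambda>w. g w / (w - 0))"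
      unfolding contour_integral_integral vd by (intro integral_diff ki iz)
    finally show ?thesis .
  qed
  have I0: "contour_integral ?\<gamma>' (\<lambda>w. f w / (w - 0)) = - cnj (contour_integral ?\<gamma> (\<lambda>w. g w / (w - 0)))"
  proof -
    have "contour_integral ?\<gamma>' (\<lambda>w. f w / (w - 0)) = integral {0..1} (\<lambda>t. cnj (- (g (?\<gamma> t) / (?\<gamma> t - 0) * d t)))"
      unfolding contour_integral_integral
    proof (rule integral_cong)
      fix t assume "t \<in> {0..1::real}"
      have fg: "f (1 / cnj (?\<gamma> t)) = cnj (g (?\<gamma> t))" by (simp add: g_def)
      show "f (?\<gamma>' t) / (?\<gamma>' t - 0) * vector_derivative ?\<gamma>' (at t) = cnj (- (g (?\<gamma> t) / (?\<gamma> t - 0) * d t))"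
        unfolding vd' pole_circle_sharp_at fg using nz[of t] by (simp add: field_simps power2_eq_square)
    qed
    also have "\<dots> = cnj (integral {0..1} (\<lambda>t. - (g (?\<gamma> t) / (?\<gamma> t - 0) * d t)))"
      by (rule integral_cnj[symmetric])
    also have "integral {0..1} (\<lambda>t. - (g (?\<gamma> t) / (?\<gamma> t - 0) * d t)) = - contour_integral ?\<gamma> (\<lambda>w. g w / (w - 0))"
      unfolding contour_integral_integral vd by (rule integral_neg)
    finally show ?thesis by simp
  qed
  have FiC: "continuous_on (cball ?b ?\<sigma>) Fi"
    unfolding Fi_def[abs_def]
    by (intro continuous_intros continuous_on_compose2[OF Gi(1) ivc[OF nb]] image_subsetI cb1)
  have FiH: "Fi holomorphic_on ball ?b ?\<sigma>"
  proof -
    have "(\<lambda>z. cnj (Gi (iv z))) holomorphic_on ball ?b ?\<sigma>"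
      by (rule hol[OF Gi(2) open_ball _ b1]) (use nb in auto)
    then have "(\<lambda>z. - (cnj (Gi (iv z)) - cnj (Go 0))) holomorphic_on ball ?b ?\<sigma>" by (intro holomorphic_intros)
    then show ?thesis by (simp add: Fi_def[abs_def])
  qed
  have Fo0: "(Fo \<longlongrightarrow> Fo 0) (at 0)"
  proof -
    have "filterlim (\<lambda>z. cnj z) (at 0) (at 0)"
      by (rule filterlim_atI) (auto intro!: tendsto_eq_intros eventually_at_filter[THEN iffD2])
    then have "filterlim iv at_infinity (at 0)"
      unfolding iv_def[abs_def] using filterlim_compose[OF filterlim_inverse_at_infinity] by (simp add: divide_inverse)
    then have "((\<lambda>z. Go (iv z)) \<longlongrightarrow> 0) (at 0)" by (rule filterlim_compose[OF Go(3)])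
    then have "((\<lambda>z. - cnj (Go (iv z) - Go 0)) \<longlongrightarrow> - cnj (0 - Go 0)) (at 0)" by (intro tendsto_intros)
    then have "((\<lambda>z. - cnj (Go (iv z) - Go 0)) \<longlongrightarrow> Fo 0) (at 0)" by (simp add: Fo_def)
    then show ?thesis
      by (rule Lim_transform_eventually) (simp add: eventually_at_filter Fo_def)
  qed
  \<comment> \<open>The point 0 lies in the exterior domain and is a removable singularity by
    \<open>Fo0\<close>.\<close>
  have FoH: "Fo holomorphic_on - cball ?b ?\<sigma>"
  proof (rule no_isolated_singularity'[of "{0}"])
    show "(Fo \<longlongrightarrow> Fo z) (at z within - cball ?b ?\<sigma>)" if "z \<in> {0}" for z
      using that Fo0 by (auto intro: tendsto_within_subset)
    have "(\<lambda>z. cnj (Go (iv z))) holomorphic_on (- cball ?b ?\<sigma> - {0})"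
      by (rule hol[OF Go(2)]) (use cb_iff in auto)
    then have "(\<lambda>z. - (cnj (Go (iv z)) - cnj (Go 0))) holomorphic_on (- cball ?b ?\<sigma> - {0})" by (intro holomorphic_intros)
    then show "Fo holomorphic_on (- cball ?b ?\<sigma> - {0})"
      by (rule holomorphic_transform) (simp add: Fo_def)
  qed auto
  have FoC: "continuous_on (- ball ?b ?\<sigma>) Fo"
  proof -
    have bb: "iv z \<notin> ball a \<rho>" if "z \<notin> ball ?b ?\<sigma>" "z \<noteq> 0" for z using that in_iff by auto
    have "continuous_on (- ball ?b ?\<sigma> - {0}) (\<lambda>z. - cnj (Go (iv z) - Go 0))"
      by (intro continuous_intros continuous_on_compose2[OF Go(1) ivc]) (use bb in auto)
    then have 1: "continuous_on (- ball ?b ?\<sigma> - {0}) Fo" by (rule continuous_on_eq) (simp add: Fo_def)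
    have 2: "continuous_on (- cball ?b ?\<sigma>) Fo" by (rule holomorphic_on_imp_continuous_on[OF FoH])
    \<comment> \<open>Continuity is glued from two relatively open pieces: one omits 0, where the
      formula changes, the other omits the circle.\<close>
    have eq: "- ball ?b ?\<sigma> = (- ball ?b ?\<sigma> - {0}) \<union> (- cball ?b ?\<sigma>)" using nb by auto
    have "openin (top_of_set (- ball ?b ?\<sigma>)) (- ball ?b ?\<sigma> - {0})" "openin (top_of_set (- ball ?b ?\<sigma>)) (- cball ?b ?\<sigma>)"
      unfolding openin_open by (rule exI[of _ "- {0}"], force, rule exI[of _ "- cball ?b ?\<sigma>"], force)
    then show ?thesis
      using continuous_on_Un_local_open[of "- ball ?b ?\<sigma> - {0}" "- cball ?b ?\<sigma>" Fo] 1 2 eq by simp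
  qed
  have FoI: "(Fo \<longlongrightarrow> 0) at_infinity"
  proof -
    have "isCont Go 0"
    proof (rule continuous_on_interior[OF holomorphic_on_imp_continuous_on[OF Go(2)]])
      show "0 \<in> interior (- cball a \<rho>)" using o0 by (subst interior_open) auto
    qed
    moreover have "(iv \<longlongrightarrow> 0) at_infinity"
    proof -
      have "((\<lambda>z. cnj (inverse z)) \<longlongrightarrow> cnj 0) at_infinity" by (intro tendsto_intros tendsto_inverse_0)
      then show ?thesis by (simp add: iv_def[abs_def] divide_inverse)
    qed
    ultimately have "((\<lambda>z. Go (iv z)) \<longlongrightarrow> Go 0) at_infinity" by (rule isCont_tendsto_compose)
    then have "((\<lambda>z. - cnj (Go (iv z) - Go 0)) \<longlongrightarrow> - cnj (Go 0 - Go 0)) at_infinity" by (intro tendsto_intros)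
    then have "((\<lambda>z. - cnj (Go (iv z) - Go 0)) \<longlongrightarrow> 0) at_infinity" by simp
    moreover have "\<forall>\<^sub>F z in at_infinity. - cnj (Go (iv z) - Go 0) = Fo z"
      unfolding eventually_at_infinity by (rule exI[of _ 1]) (auto simp: Fo_def)
    ultimately show ?thesis by (rule Lim_transform_eventually)
  qed
  have B: "contour_integral ?\<gamma> (\<lambda>w. g w / (w - 0)) = 2 * pi * \<i> * Go 0" by (rule Io[OF o0])
  have "cauchy_pair ?\<gamma>' ?b ?\<sigma> False f Fi Fo"
    unfolding cauchy_pair_def
  proof (intro conjI ballI FiC FiH FoC FoH FoI)
    fix z assume z: "z \<in> ball ?b ?\<sigma>"
    have z0: "z \<noteq> 0" using z nb by auto
    have ns: "z \<notin> sphere ?b ?\<sigma>" using z by auto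
    have "iv z \<in> ball a \<rho>" using in_iff z0 z by blast
    then show "contour_integral ?\<gamma>' (\<lambda>w. f w / (w - z)) = 2 * pi * \<i> * Fi z"
      unfolding I[OF z0 ns] B by (simp add: Ii Fi_def algebra_simps)
  next
    fix z assume z: "z \<in> - cball ?b ?\<sigma>"
    show "contour_integral ?\<gamma>' (\<lambda>w. f w / (w - z)) = 2 * pi * \<i> * Fo z"
    proof (cases "z = 0")
      case True
      show ?thesis unfolding True I0 B by (simp add: Fo_def)
    next
      case False
      have ns: "z \<notin> sphere ?b ?\<sigma>" using z by auto
      have "iv z \<in> - cball a \<rho>" using cb_iff False z by blast
      then show ?thesis
        unfolding I[OF False ns] B using False by (simp add: Io Fo_def algebra_simps del: ComplD)
    qed
  next
    fix z assume z: "z \<in> sphere ?b ?\<sigma>"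
    have z0: "z \<noteq> 0" using z nb by auto
    then have "iv z \<in> sphere a \<rho>" using in_iff z by blast
    then have "g (iv z) = Go (iv z) - Gi (iv z)" by (rule jump)
    moreover have "g (iv z) = cnj (f z)" by (simp add: g_def iv_def)
    ultimately have "f z = cnj (Go (iv z) - Gi (iv z))" by (metis complex_cnj_cnj)
    then show "f z = (if False then Fo z - Fi z else Fi z - Fo z)" using z0 by (simp add: Fi_def Fo_def)
  qed
  then show "\<exists>Fi Fo. cauchy_pair ?\<gamma>' ?b ?\<sigma> False f Fi Fo" by blast
qed

subsection \<open>Contours made of circles\<close>

text \<open>Annuli of width \<open>\<delta>\<close> on either side of the circle lie entirely in
  \<open>P\<close> or in \<open>minus_side \<Gamma> P\<close>, so that near this component the two
  sides of the contour are the two sides of a single circle. For a clockwise curve \<open>P\<close>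
  is the outer one.\<close>

definition circle_side ::
  "(real \<Rightarrow> complex) set \<Rightarrow> complex set \<Rightarrow> (real \<Rightarrow> complex) \<Rightarrow> complex \<Rightarrow> real \<Rightarrow> bool \<Rightarrow> real \<Rightarrow> bool" where
  "circle_side \<Gamma> P \<gamma> a \<rho> cw \<delta> \<longleftrightarrow> 0 < \<rho> \<and> 0 < \<delta> \<and> path_image \<gamma> = sphere a \<rho> \<and> (\<exists>T. tangent_loop \<gamma> T) \<and>
     plemelj \<gamma> a \<rho> cw \<and>
     (\<forall>z. \<rho> < norm (z - a) \<and> norm (z - a) < \<rho> + \<delta> \<longrightarrow> z \<in> (if cw then P else minus_side \<Gamma> P)) \<and>
     (\<forall>z. \<rho> - \<delta> < norm (z - a) \<and> norm (z - a) < \<rho> \<longrightarrow> z \<in> (if cw then minus_side \<Gamma> P else P))"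

lemma tendsto_within_eventually:
  assumes "(f \<longlongrightarrow> l) (at z within S)" and "eventually (\<lambda>w. w \<in> S) (at z within A)"
  shows "(f \<longlongrightarrow> l) (at z within A)"
proof (rule topological_tendstoI)
  fix U assume "open U" "l \<in> U"
  then have "\<forall>\<^sub>F w in at z within S. f w \<in> U" by (rule topological_tendstoD[OF assms(1)])
  with assms(2) show "\<forall>\<^sub>F w in at z within A. f w \<in> U"
    unfolding eventually_at_filter by eventually_elim blast
qed

lemma mat_tendsto_iff:
  fixes m :: "'a \<Rightarrow> complex^2^2"
  shows "(m \<longlongrightarrow> M) F \<longleftrightarrow> (\<forall>i l. ((\<lambda>z. m z $ i $ l) \<longlongrightarrow> M $ i $ l) F)"
proof
  assume "(m \<longlongrightarrow> M) F"
  then show "\<forall>i l. ((\<lambda>z. m z $ i $ l) \<longlongrightarrow> M $ i $ l) F"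
    by (intro allI tendsto_vec_nth[OF tendsto_vec_nth])
next
  assume *: "\<forall>i l. ((\<lambda>z. m z $ i $ l) \<longlongrightarrow> M $ i $ l) F"
  show "(m \<longlongrightarrow> M) F"
    by (intro vec_tendstoI) (rule *[rule_format])
qed

text \<open>What the boundary value theory requires of the contour: finitely many disjoint circles,
  each separating \<open>P\<close> from \<open>minus_side \<Gamma> P\<close> locally and each
  admitting Plemelj's formula.\<close>

locale circle_system =
  fixes \<Gamma> :: "(real \<Rightarrow> complex) set" and P :: "complex set"
  assumes fin: "finite \<Gamma>" and openP: "open P" and openQ: "open (minus_side \<Gamma> P)"
    and PS: "P \<inter> contour_trace \<Gamma> = {}"
    and side: "\<And>\<gamma>. \<gamma> \<in> \<Gamma> \<Longrightarrow> \<exists>a \<rho> cw \<delta>. circle_side \<Gamma> P \<gamma> a \<rho> cw \<delta>"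
    and disj: "\<And>\<gamma> \<gamma>'. \<gamma> \<in> \<Gamma> \<Longrightarrow> \<gamma>' \<in> \<Gamma> \<Longrightarrow> \<gamma> \<noteq> \<gamma>' \<Longrightarrow> path_image \<gamma> \<inter> path_image \<gamma>' = {}"
begin

abbreviation "\<Sigma> \<equiv> contour_trace \<Gamma>"
abbreviation "Q \<equiv> minus_side \<Gamma> P"

lemma PQ: "P \<union> Q = - \<Sigma>" "P \<inter> Q = {}" "Q \<inter> \<Sigma> = {}"
  using PS by (auto simp: minus_side_def)

lemma compact_trace: "compact \<Sigma>"
proof -
  have "compact (path_image \<gamma>)" if "\<gamma> \<in> \<Gamma>" for \<gamma>
    using side[OF that] by (auto simp: circle_side_def)
  then show ?thesis unfolding contour_trace_def using fin by auto
qed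

lemma open_compl: "open (- \<Sigma>)"
  using compact_trace by (simp add: compact_imp_closed open_Compl)

lemma regular: "\<gamma> \<in> \<Gamma> \<Longrightarrow> regular_speed \<gamma>"
  using side[of \<gamma>] by (auto simp: circle_side_def tangent_loop_def)

lemma side_eventually:
  assumes \<gamma>: "circle_side \<Gamma> P \<gamma> a \<rho> cw \<delta>" "\<gamma> \<in> \<Gamma>" and z: "z \<in> sphere a \<rho>"
  shows "eventually (\<lambda>w. w \<in> - cball a \<rho>) (at z within (if cw then P else Q))"
    and "eventually (\<lambda>w. w \<in> ball a \<rho>) (at z within (if cw then Q else P))"
proof -
  have S: "sphere a \<rho> \<subseteq> \<Sigma>" using \<gamma> by (auto simp: circle_side_def contour_trace_def)
  have d: "0 < \<delta>" using \<gamma> by (simp add: circle_side_def)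
  have near: "\<rho> - \<delta> < norm (w - a) \<and> norm (w - a) < \<rho> + \<delta>" if "dist w z < \<delta>" for w
  proof -
    have "\<bar>norm (w - a) - norm (z - a)\<bar> \<le> norm (w - z)"
      using norm_triangle_ineq3[of "w - a" "z - a"] by simp
    moreover have "norm (z - a) = \<rho>" using z by (simp add: dist_norm norm_minus_commute)
    ultimately show ?thesis using that by (simp add: dist_norm abs_le_iff)
  qed
  have ev: "eventually (\<lambda>w. dist w z < \<delta> \<and> w \<in> A) (at z within A)" for A
    using d by (auto simp: eventually_at)
  show "eventually (\<lambda>w. w \<in> - cball a \<rho>) (at z within (if cw then P else Q))"
    using ev
  proof (rule eventually_mono)
    fix w assume w: "dist w z < \<delta> \<and> w \<in> (if cw then P else Q)"
    then have "w \<notin> \<Sigma>" using PQ PS by (auto split: if_splits)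
    then have "norm (w - a) \<noteq> \<rho>" using S by (auto simp: dist_norm norm_minus_commute)
    moreover have "\<not> norm (w - a) < \<rho>"
      using \<gamma>(1) near[of w] w PQ by (auto simp: circle_side_def split: if_splits)
    ultimately show "w \<in> - cball a \<rho>" by (simp add: dist_norm norm_minus_commute)
  qed
  show "eventually (\<lambda>w. w \<in> ball a \<rho>) (at z within (if cw then Q else P))"
    using ev
  proof (rule eventually_mono)
    fix w assume w: "dist w z < \<delta> \<and> w \<in> (if cw then Q else P)"
    then have "w \<notin> \<Sigma>" using PQ PS by (auto split: if_splits)
    then have "norm (w - a) \<noteq> \<rho>" using S by (auto simp: dist_norm norm_minus_commute)
    moreover have "\<not> norm (w - a) > \<rho>"
      using \<gamma>(1) near[of w] w PQ by (auto simp: circle_side_def split: if_splits)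
    ultimately show "w \<in> ball a \<rho>" by (simp add: dist_norm norm_minus_commute)
  qed
qed

text \<open>Uniqueness of nontangential limits depends on this. Points \<open>w\<close> on the
  normal through \<open>z\<close> are as far from the contour as from \<open>z\<close>, as soon as
  they are close enough, so they belong to every approach region of aperture above 1.\<close>

lemma nt_region_nontrivial:
  assumes z: "z \<in> \<Sigma>" and A: "A = P \<or> A = Q"
  shows "at z within {w\<in>A. dist w z < 2 * infdist w \<Sigma>} \<noteq> bot"
proof -
  obtain \<gamma> where \<gamma>: "\<gamma> \<in> \<Gamma>" "z \<in> path_image \<gamma>" using z by (auto simp: contour_trace_def)
  obtain a \<rho> cw \<delta> where c: "circle_side \<Gamma> P \<gamma> a \<rho> cw \<delta>" using side[OF \<gamma>(1)] by blast
  have p: "0 < \<rho>" "0 < \<delta>" "path_image \<gamma> = sphere a \<rho>" using c by (auto simp: circle_side_def)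
  have zr: "norm (z - a) = \<rho>" using \<gamma> p by (simp add: dist_norm norm_minus_commute)
  define K where "K = (\<Union>\<gamma>'\<in>\<Gamma> - {\<gamma>}. path_image \<gamma>')"
  have "compact (path_image \<gamma>')" if "\<gamma>' \<in> \<Gamma>" for \<gamma>'
    using side[OF that] by (auto simp: circle_side_def)
  then have "compact K" unfolding K_def using fin by auto
  moreover have "z \<notin> K" using disj[OF \<gamma>(1)] \<gamma> by (auto simp: K_def)
  ultimately obtain \<eta> where \<eta>: "0 < \<eta>" "\<And>y. y \<in> K \<Longrightarrow> \<eta> \<le> dist z y"
    using separate_point_closed[of K z] by (auto simp: compact_imp_closed)
  have SK: "\<Sigma> = sphere a \<rho> \<union> K" using \<gamma>(1) p(3) by (auto simp: contour_trace_def K_def)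
  define s :: real where "s = (if (A = P) = cw then 1 else -1)"
  have "z islimpt {w\<in>A. dist w z < 2 * infdist w \<Sigma>}"
    unfolding islimpt_approachable
  proof (intro allI impI)
    fix e :: real assume e: "0 < e"
    \<comment> \<open>The half of \<open>\<delta>\<close> keeps \<open>w\<close> in the annulus,
      that of \<open>\<rho>\<close> keeps it away from the centre. With
      \<open>r \<le> \<eta> / 2\<close> the other circles stay at distance at least
      \<open>\<eta> - r \<ge> r\<close> from \<open>w\<close>.\<close>
    define r where "r = Min {e / 2, \<delta> / 2, \<eta> / 2, \<rho> / 2}"
    have r: "0 < r" "r < e" "r < \<delta>" "r \<le> \<eta> / 2" "r < \<rho>"
      using e p \<eta>(1) by (auto simp: r_def min_def)
    define w where "w = z + of_real (s * r / \<rho>) * (z - a)"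
    have dw: "dist w z = r"
    proof -
      have "dist w z = norm (of_real (s * r / \<rho>) * (z - a))" by (simp add: w_def dist_norm)
      also have "\<dots> = \<bar>s * r / \<rho>\<bar> * \<rho>" by (simp only: norm_mult norm_of_real zr)
      also have "\<bar>s * r / \<rho>\<bar> = r / \<rho>" using p r by (simp add: s_def abs_mult)
      finally show ?thesis using p by simp
    qed
    have "w - a = of_real (1 + s * r / \<rho>) * (z - a)" by (simp add: w_def algebra_simps)
    then have "norm (w - a) = \<bar>1 + s * r / \<rho>\<bar> * \<rho>" by (simp only: norm_mult norm_of_real zr)
    also have "\<bar>1 + s * r / \<rho>\<bar> = 1 + s * r / \<rho>" using r p by (auto simp: s_def field_simps)
    also have "(1 + s * r / \<rho>) * \<rho> = \<rho> + s * r" using p by (simp add: distrib_right)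
    finally have wa: "norm (w - a) = \<rho> + s * r" .
    have wA: "w \<in> A"
      using c A r wa PQ by (cases cw) (auto simp: circle_side_def s_def split: if_splits)
    have "r \<le> dist w y" if y: "y \<in> \<Sigma>" for y
    proof (cases "y \<in> sphere a \<rho>")
      case True
      have "\<bar>norm (w - a) - norm (y - a)\<bar> \<le> norm (w - y)"
        using norm_triangle_ineq3[of "w - a" "y - a"] by simp
      moreover have "norm (y - a) = \<rho>" using True by (simp add: dist_norm norm_minus_commute)
      ultimately show ?thesis using wa r by (auto simp: s_def dist_norm split: if_splits)
    next
      case False
      then have "y \<in> K" using y SK by auto
      then have "\<eta> \<le> dist z y" by (rule \<eta>)
      also have "\<dots> \<le> dist z w + dist w y" by (rule dist_triangle)
      finally show ?thesis using dw r by (simp add: dist_commute)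
    qed
    then have "r \<le> infdist w \<Sigma>"
      unfolding infdist_def using z by (auto intro!: cINF_greatest)
    then have "dist w z < 2 * infdist w \<Sigma>" using dw r by simp
    moreover have "w \<noteq> z" using dw r by auto
    ultimately show "\<exists>x'\<in>{w\<in>A. dist w z < 2 * infdist w \<Sigma>}. x' \<noteq> z \<and> dist x' z < e"
      using wA dw r by auto
  qed
  then show ?thesis by (simp add: trivial_limit_within)
qed

lemma side_nontrivial:
  assumes "z \<in> \<Sigma>" "A = P \<or> A = Q"
  shows "at z within A \<noteq> bot"
  using nt_region_nontrivial[OF assms] at_le[of "{w\<in>A. dist w z < 2 * infdist w \<Sigma>}" A z] bot.extremum_uniqueI
  by fastforce

lemma nt_limit_eqI:
  fixes m :: "complex \<Rightarrow> 'a::t2_space"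
  assumes "z \<in> \<Sigma>" "A = P \<or> A = Q" "has_nt_limit \<Sigma> A m z L"
  shows "nt_limit \<Sigma> A m z = L"
proof -
  have uniq: "L' = L" if "has_nt_limit \<Sigma> A m z L'" for L'
  proof -
    have *: "(m \<longlongrightarrow> K) (at z within {w \<in> A. dist w z < 2 * infdist w \<Sigma>})" if "has_nt_limit \<Sigma> A m z K" for K
      using that unfolding has_nt_limit_def by simp
    show ?thesis
      by (rule tendsto_unique[OF nt_region_nontrivial[OF assms(1,2)] *[OF that] *[OF assms(3)]])
  qed
  show ?thesis unfolding nt_limit_def by (rule the_equality) (rule assms(3), rule uniq)
qed

text \<open>The boundary values constructed below are unrestricted one-sided limits; this is the
  passage to the nontangential ones.\<close>

lemma has_nt_limitI:
  "(m \<longlongrightarrow> L) (at z within A) \<Longrightarrow> has_nt_limit \<Sigma> A m z L"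
  unfolding has_nt_limit_def by (intro allI impI, erule tendsto_within_subset) blast

lemma cauchy_single:
  fixes f :: "complex \<Rightarrow> complex"
  assumes \<gamma>: "\<gamma> \<in> \<Gamma>" and f: "sobolev_param 1 \<gamma> (f \<circ> \<gamma>)"
  defines "I \<equiv> \<lambda>z. contour_integral \<gamma> (\<lambda>w. f w / (w - z))"
  shows "I holomorphic_on - path_image \<gamma>" and "(I \<longlongrightarrow> 0) at_infinity"
    and "\<exists>lp lm. \<forall>z\<in>path_image \<gamma>. (I \<longlongrightarrow> lp z) (at z within P) \<and> (I \<longlongrightarrow> lm z) (at z within Q) \<and>
       2 * pi * \<i> * f z = lp z - lm z"
proof -
  obtain a \<rho> cw \<delta> where c: "circle_side \<Gamma> P \<gamma> a \<rho> cw \<delta>" using side[OF \<gamma>] by blast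
  then have pi: "path_image \<gamma> = sphere a \<rho>" and \<rho>: "0 < \<rho>" and "plemelj \<gamma> a \<rho> cw" by (auto simp: circle_side_def)
  then obtain Fi Fo where F: "cauchy_pair \<gamma> a \<rho> cw f Fi Fo" using f unfolding plemelj_def by blast
  define c0 where "c0 = 2 * pi * \<i>"
  have Ii: "c0 * Fi z = I z" if "z \<in> ball a \<rho>" for z using F that by (simp add: cauchy_pair_def I_def c0_def)
  have Io: "c0 * Fo z = I z" if "z \<in> - cball a \<rho>" for z using F that by (simp add: cauchy_pair_def I_def c0_def)
  have "I holomorphic_on ball a \<rho>"
    by (rule holomorphic_transform[of "\<lambda>z. c0 * Fi z"]) (use F Ii in \<open>auto simp: cauchy_pair_def intro!: holomorphic_intros\<close>)
  moreover have "I holomorphic_on - cball a \<rho>"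
    by (rule holomorphic_transform[of "\<lambda>z. c0 * Fo z"]) (use F Io in \<open>auto simp: cauchy_pair_def intro!: holomorphic_intros\<close>)
  ultimately have "I holomorphic_on (ball a \<rho> \<union> - cball a \<rho>)"
    by (intro holomorphic_on_Un) auto
  also have "ball a \<rho> \<union> - cball a \<rho> = - path_image \<gamma>" by (auto simp: pi)
  finally show "I holomorphic_on - path_image \<gamma>" .
  have "((\<lambda>z. c0 * Fo z) \<longlongrightarrow> c0 * 0) at_infinity"
    using F by (intro tendsto_intros) (simp add: cauchy_pair_def)
  then have "((\<lambda>z. c0 * Fo z) \<longlongrightarrow> 0) at_infinity" by simp
  moreover have "\<forall>\<^sub>F z in at_infinity. c0 * Fo z = I z"
    unfolding eventually_at_infinity
  proof (intro exI[of _ "norm a + \<rho> + 1"] allI impI)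
    fix z :: complex assume "norm a + \<rho> + 1 \<le> norm z"
    then have "z \<in> - cball a \<rho>" using norm_triangle_sub[of z a] by (simp add: dist_norm norm_minus_commute)
    then show "c0 * Fo z = I z" by (rule Io)
  qed
  ultimately show "(I \<longlongrightarrow> 0) at_infinity" by (rule Lim_transform_eventually)
  have lo: "(I \<longlongrightarrow> c0 * Fo z) (at z within (if cw then P else Q))" if z: "z \<in> sphere a \<rho>" for z
  proof -
    have ev: "eventually (\<lambda>w. w \<in> - cball a \<rho>) (at z within (if cw then P else Q))"
      by (rule side_eventually(1)[OF c \<gamma> z])
    have "continuous_on (- ball a \<rho>) Fo" using F by (simp add: cauchy_pair_def)
    then have "(Fo \<longlongrightarrow> Fo z) (at z within - ball a \<rho>)" using z by (simp add: continuous_on_def)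
    then have "(Fo \<longlongrightarrow> Fo z) (at z within (if cw then P else Q))"
      by (rule tendsto_within_eventually) (rule eventually_mono[OF ev], auto)
    then have "((\<lambda>w. c0 * Fo w) \<longlongrightarrow> c0 * Fo z) (at z within (if cw then P else Q))" by (intro tendsto_intros)
    then show ?thesis by (rule Lim_transform_eventually) (rule eventually_mono[OF ev], rule Io)
  qed
  have li: "(I \<longlongrightarrow> c0 * Fi z) (at z within (if cw then Q else P))" if z: "z \<in> sphere a \<rho>" for z
  proof -
    have ev: "eventually (\<lambda>w. w \<in> ball a \<rho>) (at z within (if cw then Q else P))"
      by (rule side_eventually(2)[OF c \<gamma> z])
    have "continuous_on (cball a \<rho>) Fi" using F by (simp add: cauchy_pair_def)
    then have "(Fi \<longlongrightarrow> Fi z) (at z within cball a \<rho>)" using z by (simp add: continuous_on_def)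
    then have "(Fi \<longlongrightarrow> Fi z) (at z within (if cw then Q else P))"
      by (rule tendsto_within_eventually) (rule eventually_mono[OF ev], auto)
    then have "((\<lambda>w. c0 * Fi w) \<longlongrightarrow> c0 * Fi z) (at z within (if cw then Q else P))" by (intro tendsto_intros)
    then show ?thesis by (rule Lim_transform_eventually) (rule eventually_mono[OF ev], rule Ii)
  qed
  have J: "f z = (if cw then Fo z - Fi z else Fi z - Fo z)" if "z \<in> sphere a \<rho>" for z
    using F that by (simp add: cauchy_pair_def)
  show "\<exists>lp lm. \<forall>z\<in>path_image \<gamma>. (I \<longlongrightarrow> lp z) (at z within P) \<and> (I \<longlongrightarrow> lm z) (at z within Q) \<and>
       2 * pi * \<i> * f z = lp z - lm z"
  proof (cases cw)
    case True
    show ?thesis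
      by (rule exI[of _ "\<lambda>z. c0 * Fo z"], rule exI[of _ "\<lambda>z. c0 * Fi z"])
        (use lo li J True in \<open>simp add: pi c0_def right_diff_distrib\<close>)
  next
    case False
    show ?thesis
      by (rule exI[of _ "\<lambda>z. c0 * Fi z"], rule exI[of _ "\<lambda>z. c0 * Fo z"])
        (use lo li J False in \<open>simp add: pi c0_def right_diff_distrib\<close>)
  qed
qed

text \<open>At a point of one circle the integrals over all other circles are continuous, so they
  contribute the same amount from both sides and cancel in the jump.\<close>

lemma cauchy_sum:
  fixes f :: "complex \<Rightarrow> complex"
  assumes f: "\<And>\<gamma>. \<gamma> \<in> \<Gamma> \<Longrightarrow> sobolev_param 1 \<gamma> (f \<circ> \<gamma>)"
  defines "C \<equiv> \<lambda>z. 1 / (2 * of_real pi * \<i>) * (\<Sum>\<gamma>\<in>\<Gamma>. contour_integral \<gamma> (\<lambda>w. f w / (w - z)))"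
  shows "C holomorphic_on - \<Sigma>" and "(C \<longlongrightarrow> 0) at_infinity"
    and "\<exists>lp lm. \<forall>z\<in>\<Sigma>. (C \<longlongrightarrow> lp z) (at z within P) \<and> (C \<longlongrightarrow> lm z) (at z within Q) \<and> f z = lp z - lm z"
proof -
  define I where "I \<gamma> z = contour_integral \<gamma> (\<lambda>w. f w / (w - z))" for \<gamma> z
  have C: "C = (\<lambda>z. 1 / (2 * of_real pi * \<i>) * (\<Sum>\<gamma>\<in>\<Gamma>. I \<gamma> z))" by (simp add: C_def I_def)
  note single = cauchy_single[OF _ f, folded I_def[abs_def]]
  have hol: "I \<gamma> holomorphic_on - path_image \<gamma>" and inf: "(I \<gamma> \<longlongrightarrow> 0) at_infinity" if "\<gamma> \<in> \<Gamma>" for \<gamma>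
    using single(1,2)[OF that that] by (simp_all add: I_def[abs_def])
  have "(\<Sum>\<gamma>\<in>\<Gamma>. I \<gamma> z) = (\<Sum>\<gamma>\<in>\<Gamma>. I \<gamma> z)" for z ..
  have holS: "I \<gamma> holomorphic_on - \<Sigma>" if "\<gamma> \<in> \<Gamma>" for \<gamma>
    by (rule holomorphic_on_subset[OF hol[OF that]]) (use that in \<open>auto simp: contour_trace_def\<close>)
  show "C holomorphic_on - \<Sigma>" unfolding C by (intro holomorphic_intros holS)
  have "(C \<longlongrightarrow> 1 / (2 * of_real pi * \<i>) * (\<Sum>\<gamma>\<in>\<Gamma>. 0)) at_infinity"
    unfolding C by (intro tendsto_intros inf)
  then show "(C \<longlongrightarrow> 0) at_infinity" by simp
  have "\<forall>z\<in>\<Sigma>. \<exists>p m. (C \<longlongrightarrow> p) (at z within P) \<and> (C \<longlongrightarrow> m) (at z within Q) \<and> f z = p - m"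
  proof
    fix z assume "z \<in> \<Sigma>"
    then obtain \<gamma> where \<gamma>: "\<gamma> \<in> \<Gamma>" "z \<in> path_image \<gamma>" by (auto simp: contour_trace_def)
    obtain p m where pm: "(I \<gamma> \<longlongrightarrow> p) (at z within P)" "(I \<gamma> \<longlongrightarrow> m) (at z within Q)" "2 * pi * \<i> * f z = p - m"
      using single(3)[OF \<gamma>(1) \<gamma>(1)] \<gamma>(2) by (auto simp: I_def[abs_def])
    have other: "(I \<gamma>' \<longlongrightarrow> I \<gamma>' z) (at z within A)" if "\<gamma>' \<in> \<Gamma> - {\<gamma>}" for \<gamma>' A
    proof -
      have "z \<in> - path_image \<gamma>'" using disj[of \<gamma> \<gamma>'] \<gamma> that by auto
      moreover have "open (- path_image \<gamma>')" using side[of \<gamma>'] that by (auto simp: circle_side_def)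
      ultimately have "isCont (I \<gamma>') z"
        using hol[of \<gamma>'] that by (metis DiffD1 continuous_on_eq_continuous_at holomorphic_on_imp_continuous_on)
      then show ?thesis by (auto simp: isCont_def intro: tendsto_within_subset)
    qed
    define R where "R = (\<Sum>\<gamma>'\<in>\<Gamma> - {\<gamma>}. I \<gamma>' z)"
    have C': "C = (\<lambda>z. 1 / (2 * of_real pi * \<i>) * (I \<gamma> z + (\<Sum>\<gamma>'\<in>\<Gamma> - {\<gamma>}. I \<gamma>' z)))"
      unfolding C by (rule ext) (simp only: sum.remove[OF fin \<gamma>(1)])
    have "(C \<longlongrightarrow> 1 / (2 * of_real pi * \<i>) * (p + R)) (at z within P)"
      "(C \<longlongrightarrow> 1 / (2 * of_real pi * \<i>) * (m + R)) (at z within Q)"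
      unfolding C' R_def by (intro tendsto_intros pm other; assumption)+
    moreover have "f z = 1 / (2 * of_real pi * \<i>) * (p + R) - 1 / (2 * of_real pi * \<i>) * (m + R)"
    proof -
      have "1 / (2 * of_real pi * \<i>) * (p + R) - 1 / (2 * of_real pi * \<i>) * (m + R) = 1 / (2 * of_real pi * \<i>) * (p - m)"
        by (simp only: right_diff_distrib[symmetric]) simp
      also have "\<dots> = f z" unfolding pm(3)[symmetric] by simp
      finally show ?thesis ..
    qed
    ultimately show "\<exists>p m. (C \<longlongrightarrow> p) (at z within P) \<and> (C \<longlongrightarrow> m) (at z within Q) \<and> f z = p - m" by blast
  qed
  then show "\<exists>lp lm. \<forall>z\<in>\<Sigma>. (C \<longlongrightarrow> lp z) (at z within P) \<and> (C \<longlongrightarrow> lm z) (at z within Q) \<and> f z = lp z - lm z"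
    by metis
qed

end

text \<open>The chart \<open>a + (z0 - a) * exp \<zeta>\<close> straightens the circle to the
  imaginary axis, where continuity across a line suffices for holomorphy. For
  \<open>r \<le> norm (z0 - a)\<close> the quotient \<open>(z - a) / (z0 - a)\<close> stays in the
  right half plane, so \<open>Ln\<close> inverts the chart on the ball.\<close>

lemma holomorphic_across_circle:
  assumes G: "continuous_on (ball z0 r) G" and r: "0 < r" "r \<le> norm (z0 - a)"
    and hol: "G holomorphic_on (ball z0 r - sphere a (norm (z0 - a)))"
  shows "G holomorphic_on ball z0 r"
proof -
  define \<rho> where "\<rho> = norm (z0 - a)"
  have \<rho>: "0 < \<rho>" "r \<le> \<rho>" and nz: "z0 - a \<noteq> 0" using r by (auto simp: \<rho>_def)
  define \<phi> where "\<phi> \<zeta> = a + (z0 - a) * exp \<zeta>" for \<zeta>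
  define S where "S = \<phi> -` ball z0 r"
  have \<phi>c: "continuous_on A \<phi>" and \<phi>h: "\<phi> holomorphic_on A" for A
    unfolding \<phi>_def[abs_def] by (auto intro!: continuous_intros holomorphic_intros)
  have S: "open S" unfolding S_def by (intro open_vimage \<phi>c) auto
  have n\<phi>: "norm (\<phi> \<zeta> - a) = \<rho> * exp (Re \<zeta>)" for \<zeta> by (simp add: \<phi>_def norm_mult \<rho>_def)
  have off: "\<phi> ` (S \<inter> {\<zeta>. Re \<zeta> \<noteq> 0}) \<subseteq> ball z0 r - sphere a \<rho>"
  proof (intro image_subsetI)
    fix \<zeta> assume z: "\<zeta> \<in> S \<inter> {\<zeta>. Re \<zeta> \<noteq> 0}"
    have "norm (\<phi> \<zeta> - a) \<noteq> \<rho>" unfolding n\<phi> using \<rho> z by simp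
    then show "\<phi> \<zeta> \<in> ball z0 r - sphere a \<rho>"
      using z by (auto simp: S_def dist_norm norm_minus_commute)
  qed
  have H: "(G \<circ> \<phi>) holomorphic_on (S \<inter> {\<zeta>. Re \<zeta> \<noteq> 0})"
    by (rule holomorphic_on_compose_gen[OF \<phi>h hol[folded \<rho>_def] off])
  have "(G \<circ> \<phi>) holomorphic_on S"
  proof (rule holomorphic_on_paste_across_line[OF S, of 1 _ 0])
    show "(G \<circ> \<phi>) holomorphic_on S \<inter> {z. 1 \<bullet> z < 0}"
      by (rule holomorphic_on_subset[OF H]) auto
    show "(G \<circ> \<phi>) holomorphic_on S \<inter> {z. 0 < 1 \<bullet> z}"
      by (rule holomorphic_on_subset[OF H]) auto
    show "continuous_on S (G \<circ> \<phi>)"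
      by (rule continuous_on_compose[OF \<phi>c continuous_on_subset[OF G]]) (auto simp: S_def)
  qed simp
  moreover define \<psi> where "\<psi> z = Ln ((z - a) / (z0 - a))" for z
  have pos: "0 < Re ((z - a) / (z0 - a))" if z: "z \<in> ball z0 r" for z
  proof -
    have "(z - a) / (z0 - a) - 1 = (z - z0) / (z0 - a)" using nz by (simp add: field_simps)
    then have "norm ((z - a) / (z0 - a) - 1) = norm (z - z0) / \<rho>" by (simp add: norm_divide \<rho>_def)
    also have "\<dots> < 1" using z \<rho> by (simp add: dist_norm norm_minus_commute)
    finally have "\<bar>Re ((z - a) / (z0 - a) - 1)\<bar> < 1"
      using abs_Re_le_cmod[of "(z - a) / (z0 - a) - 1"] by linarith
    then have "\<bar>Re ((z - a) / (z0 - a)) - 1\<bar> < 1" by (simp only: minus_complex.simps one_complex.simps)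
    then show ?thesis by linarith
  qed
  have "\<psi> holomorphic_on ball z0 r"
    unfolding \<psi>_def[abs_def]
  proof (intro holomorphic_intros)
    fix z assume "z \<in> ball z0 r"
    from pos[OF this] show "(z - a) / (z0 - a) \<notin> \<real>\<^sub>\<le>\<^sub>0"
      by (auto simp: complex_nonpos_Reals_iff)
  qed (use nz in auto)
  moreover have \<phi>\<psi>: "\<phi> (\<psi> z) = z" if "z \<in> ball z0 r" for z
  proof -
    have "(z - a) / (z0 - a) \<noteq> 0" using pos[OF that] by fastforce
    then have "exp (\<psi> z) = (z - a) / (z0 - a)" by (simp add: \<psi>_def)
    then show ?thesis using nz by (simp add: \<phi>_def)
  qed
  moreover have "\<psi> ` ball z0 r \<subseteq> S"
    by (intro image_subsetI) (simp add: S_def \<phi>\<psi> del: mem_ball)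
  ultimately have "((G \<circ> \<phi>) \<circ> \<psi>) holomorphic_on ball z0 r"
    by (intro holomorphic_on_compose_gen[of \<psi> _ "G \<circ> \<phi>" S])
  then show ?thesis
    by (rule holomorphic_transform) (simp add: \<phi>\<psi> del: mem_ball)
qed

section \<open>Liouville's theorem and Cauchy's formula across the contour\<close>

context circle_system
begin

text \<open>Equal limits from the two sides make the extension \<open>G\<close> continuous; it is
  then holomorphic across every circle, hence entire, and it has a limit at infinity.\<close>

lemma liouville:
  fixes F :: "complex \<Rightarrow> complex"
  assumes F: "F holomorphic_on - \<Sigma>"
    and L: "\<And>z. z \<in> \<Sigma> \<Longrightarrow> (F \<longlongrightarrow> L z) (at z within P)" "\<And>z. z \<in> \<Sigma> \<Longrightarrow> (F \<longlongrightarrow> L z) (at z within Q)"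
    and inf: "(F \<longlongrightarrow> c) at_infinity"
  shows "z \<notin> \<Sigma> \<Longrightarrow> F z = c" and "z \<in> \<Sigma> \<Longrightarrow> L z = c"
proof -
  define G where "G z = (if z \<in> \<Sigma> then L z else F z)" for z
  have GF: "z \<notin> \<Sigma> \<Longrightarrow> G z = F z" for z by (simp add: G_def)
  have Gh: "G holomorphic_on - \<Sigma>"
    by (rule holomorphic_transform[OF F]) (simp add: G_def)
  have LC: "(F \<longlongrightarrow> L z) (at z within - \<Sigma>)" if "z \<in> \<Sigma>" for z
    unfolding PQ(1)[symmetric] using L[OF that] by (simp add: Lim_Un)
  have cont: "isCont G z0" for z0
  proof (cases "z0 \<in> \<Sigma>")
    case False
    then show ?thesis
      using holomorphic_on_imp_continuous_on[OF Gh] open_compl by (simp add: continuous_on_eq_continuous_at)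
  next
    case True
    have "(G \<longlongrightarrow> L z0) (at z0)"
    proof (rule tendstoI)
      fix e :: real assume e: "0 < e"
      then have "\<forall>\<^sub>F w in at z0 within - \<Sigma>. dist (F w) (L z0) < e / 2"
        by (intro tendstoD[OF LC[OF True]]) simp
      then obtain d where d: "0 < d" "\<And>w. w \<notin> \<Sigma> \<Longrightarrow> w \<noteq> z0 \<Longrightarrow> dist w z0 < d \<Longrightarrow> dist (F w) (L z0) < e / 2"
        unfolding eventually_at by auto
      \<comment> \<open>Nearby contour points must be controlled too: \<open>L w\<close> is the
        limit from \<open>P\<close> of values of \<open>F\<close> at points that are themselves
        close to \<open>z0\<close>.\<close>
      have "dist (L w) (L z0) \<le> e / 2" if w: "w \<in> \<Sigma>" "dist w z0 < d" for w
      proof (rule tendsto_upperbound[OF tendsto_dist[OF L(1)[OF w(1)] tendsto_const] _ side_nontrivial[OF w(1)]])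
        have "\<forall>\<^sub>F v in at w within P. v \<in> P \<and> dist v w < d - dist w z0"
          using w(2) unfolding eventually_at by (intro exI[of _ "d - dist w z0"]) auto
        then show "\<forall>\<^sub>F v in at w within P. dist (F v) (L z0) \<le> e / 2"
        proof eventually_elim
          case (elim v)
          then have "v \<notin> \<Sigma>" using PQ by auto
          moreover from this have "v \<noteq> z0" using True by auto
          moreover have "dist v z0 < d" using elim dist_triangle[of v z0 w] by simp
          ultimately show ?case using d(2)[of v] by simp
        qed
      qed simp
      then have "dist (G w) (L z0) < e" if "w \<noteq> z0" "dist w z0 < d" for w
        using that d(2)[of w] e by (cases "w \<in> \<Sigma>") (force simp: G_def)+
      then show "\<forall>\<^sub>F w in at z0. dist (G w) (L z0) < e"
        unfolding eventually_at using d(1) by auto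
    qed
    then show ?thesis using True by (simp add: isCont_def G_def)
  qed
  have "G holomorphic_on UNIV"
  proof -
    have "G field_differentiable at z0" for z0
    proof (cases "z0 \<in> \<Sigma>")
      case False
      then show ?thesis using Gh open_compl by (simp add: holomorphic_on_open field_differentiable_def)
    next
      case True
      obtain \<gamma> where \<gamma>: "\<gamma> \<in> \<Gamma>" "z0 \<in> path_image \<gamma>" using True by (auto simp: contour_trace_def)
      obtain a \<rho> cw \<delta> where c: "circle_side \<Gamma> P \<gamma> a \<rho> cw \<delta>" using side[OF \<gamma>(1)] by blast
      have p: "0 < \<rho>" "path_image \<gamma> = sphere a \<rho>" using c by (auto simp: circle_side_def)
      have zr: "norm (z0 - a) = \<rho>" using \<gamma> p by (simp add: dist_norm norm_minus_commute)
      define K where "K = (\<Union>\<gamma>'\<in>\<Gamma> - {\<gamma>}. path_image \<gamma>')"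
      have "compact (path_image \<gamma>')" if "\<gamma>' \<in> \<Gamma>" for \<gamma>'
        using side[OF that] by (auto simp: circle_side_def)
      then have "compact K" unfolding K_def using fin by auto
      moreover have "z0 \<notin> K" using disj[OF \<gamma>(1)] \<gamma> by (auto simp: K_def)
      ultimately obtain \<eta> where \<eta>: "0 < \<eta>" "\<And>y. y \<in> K \<Longrightarrow> \<eta> \<le> dist z0 y"
        using separate_point_closed[of K z0] by (auto simp: compact_imp_closed)
      have SK: "\<Sigma> = sphere a \<rho> \<union> K" using \<gamma>(1) p(2) by (auto simp: contour_trace_def K_def)
      define r where "r = min \<eta> \<rho>"
      have r: "0 < r" "r \<le> \<eta>" "r \<le> \<rho>" using \<eta>(1) p(1) by (auto simp: r_def)
      have sub: "ball z0 r - sphere a (norm (z0 - a)) \<subseteq> - \<Sigma>"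
        using \<eta>(2) r SK zr by force
      have "G holomorphic_on ball z0 r"
        by (rule holomorphic_across_circle[where a = a])
          (use r zr holomorphic_on_subset[OF Gh sub] cont in \<open>auto intro: continuous_at_imp_continuous_on\<close>)
      then show ?thesis using r(1) by (intro holomorphic_on_imp_differentiable_at[of G "ball z0 r"]) auto
    qed
    then show ?thesis by (simp add: holomorphic_on_def)
  qed
  moreover have "(G \<longlongrightarrow> c) at_infinity"
  proof (rule Lim_transform_eventually[OF inf])
    obtain B where B: "\<And>z. z \<in> \<Sigma> \<Longrightarrow> norm z \<le> B"
      using compact_trace by (meson bounded_iff compact_imp_bounded)
    show "\<forall>\<^sub>F z in at_infinity. F z = G z"
      unfolding eventually_at_infinity using B by (intro exI[of _ "B + 1"]) (force simp: G_def)
  qed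
  ultimately have G: "G z = c" for z by (rule Liouville_weak)
  show "z \<notin> \<Sigma> \<Longrightarrow> F z = c" "z \<in> \<Sigma> \<Longrightarrow> L z = c" using G[of z] by (simp_all add: G_def)
qed

text \<open>\<open>F\<close> and the Cauchy integral of its jump have the same jump and both vanish
  at infinity, so their difference vanishes by \<open>liouville\<close>.\<close>

lemma cauchy_integral_eq:
  fixes F :: "complex \<Rightarrow> complex"
  assumes F: "F holomorphic_on - \<Sigma>"
    and L: "\<And>z. z \<in> \<Sigma> \<Longrightarrow> (F \<longlongrightarrow> Fp z) (at z within P)" "\<And>z. z \<in> \<Sigma> \<Longrightarrow> (F \<longlongrightarrow> Fm z) (at z within Q)"
    and inf: "(F \<longlongrightarrow> 0) at_infinity"
    and f: "\<And>\<gamma>. \<gamma> \<in> \<Gamma> \<Longrightarrow> sobolev_param 1 \<gamma> (f \<circ> \<gamma>)" and jump: "\<And>z. z \<in> \<Sigma> \<Longrightarrow> f z = Fp z - Fm z"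
    and z: "z \<notin> \<Sigma>"
  shows "1 / (2 * of_real pi * \<i>) * (\<Sum>\<gamma>\<in>\<Gamma>. contour_integral \<gamma> (\<lambda>w. f w / (w - z))) = F z"
proof -
  define C where "C = (\<lambda>z. 1 / (2 * of_real pi * \<i>) * (\<Sum>\<gamma>\<in>\<Gamma>. contour_integral \<gamma> (\<lambda>w. f w / (w - z))))"
  note cs = cauchy_sum[OF f, folded C_def]
  obtain lp lm where l: "\<And>z. z \<in> \<Sigma> \<Longrightarrow> (C \<longlongrightarrow> lp z) (at z within P)" "\<And>z. z \<in> \<Sigma> \<Longrightarrow> (C \<longlongrightarrow> lm z) (at z within Q)"
    "\<And>z. z \<in> \<Sigma> \<Longrightarrow> f z = lp z - lm z"
    using cs(3) by auto
  have "F z - C z = 0"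
  proof (rule liouville(1)[where F = "\<lambda>z. F z - C z" and L = "\<lambda>z. Fp z - lp z"])
    show "(\<lambda>z. F z - C z) holomorphic_on - \<Sigma>" by (intro holomorphic_intros F cs(1))
    fix z assume z: "z \<in> \<Sigma>"
    show "((\<lambda>z. F z - C z) \<longlongrightarrow> Fp z - lp z) (at z within P)"
      by (intro tendsto_intros L l z)
    have "Fp z - lp z = Fm z - lm z"
      using jump[OF z] l(3)[OF z] by (simp add: algebra_simps)
    then show "((\<lambda>z. F z - C z) \<longlongrightarrow> Fp z - lp z) (at z within Q)"
      using tendsto_diff[OF L(2)[OF z] l(2)[OF z]] by simp
  next
    show "((\<lambda>z. F z - C z) \<longlongrightarrow> 0) at_infinity"
      using tendsto_diff[OF inf cs(2)] by simp
  qed (rule z)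
  then show ?thesis by (simp add: C_def)
qed

section \<open>Boundary values and the class \<open>Hhol\<close>\<close>

lemma Hsob_entry:
  fixes f :: "complex \<Rightarrow> complex^2^2"
  assumes "f \<in> Hsob k \<Gamma>" "1 \<le> k" "\<gamma> \<in> \<Gamma>"
  shows "sobolev_param 1 \<gamma> ((\<lambda>z. f z $ i $ l) \<circ> \<gamma>)"
proof -
  have "sobolev_param k \<gamma> (f \<circ> \<gamma>)" using assms by (simp add: Hsob_def)
  then have "sobolev_param 1 \<gamma> (f \<circ> \<gamma>)" by (rule sobolev_param_mono) (use assms in simp)
  then show ?thesis using sobolev_param_matrix[OF regular[OF assms(3)], of 1 "f \<circ> \<gamma>"] by (simp add: o_def)
qed

lemma cauchy_integral_entry:
  "cauchy_integral \<Gamma> f z $ i $ l = 1 / (2 * of_real pi * \<i>) * (\<Sum>\<gamma>\<in>\<Gamma>. contour_integral \<gamma> (\<lambda>w. f w $ i $ l / (w - z)))"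
  by (simp add: cauchy_integral_def)

lemma cauchy_integral_limits:
  assumes f: "f \<in> Hsob k \<Gamma>" and k: "1 \<le> k"
  obtains Lp Lm where "\<And>z. z \<in> \<Sigma> \<Longrightarrow> (cauchy_integral \<Gamma> f \<longlongrightarrow> Lp z) (at z within P)"
    and "\<And>z. z \<in> \<Sigma> \<Longrightarrow> (cauchy_integral \<Gamma> f \<longlongrightarrow> Lm z) (at z within Q)"
proof -
  have "\<forall>i l. \<exists>lp lm. \<forall>z\<in>\<Sigma>. ((\<lambda>z. cauchy_integral \<Gamma> f z $ i $ l) \<longlongrightarrow> lp z) (at z within P) \<and>
      ((\<lambda>z. cauchy_integral \<Gamma> f z $ i $ l) \<longlongrightarrow> lm z) (at z within Q)"
  proof (intro allI)
    fix i l
    show "\<exists>lp lm. \<forall>z\<in>\<Sigma>. ((\<lambda>z. cauchy_integral \<Gamma> f z $ i $ l) \<longlongrightarrow> lp z) (at z within P) \<and>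
      ((\<lambda>z. cauchy_integral \<Gamma> f z $ i $ l) \<longlongrightarrow> lm z) (at z within Q)"
      unfolding cauchy_integral_entry using cauchy_sum(3)[OF Hsob_entry[OF f k], of i l] by blast
  qed
  then obtain lp lm where l: "\<And>i l z. z \<in> \<Sigma> \<Longrightarrow> ((\<lambda>z. cauchy_integral \<Gamma> f z $ i $ l) \<longlongrightarrow> lp i l z) (at z within P) \<and>
      ((\<lambda>z. cauchy_integral \<Gamma> f z $ i $ l) \<longlongrightarrow> lm i l z) (at z within Q)"
    unfolding choice_iff by blast
  show thesis
    by (rule that[of "\<lambda>z. \<chi> i l. lp i l z" "\<lambda>z. \<chi> i l. lm i l z"]) (simp_all add: mat_tendsto_iff l)
qed

text \<open>The class \<open>Hhol\<close> prescribes nontangential limits only. Its Cauchy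
  representation has unrestricted one-sided limits by Plemelj's formula, and these must coincide
  with the nontangential ones.\<close>

lemma Hhol_limits:
  assumes m: "m \<in> Hhol k \<Gamma> P" and k: "1 \<le> k" and z: "z \<in> \<Sigma>"
  shows "(m \<longlongrightarrow> bv_plus \<Gamma> P m z) (at z within P)" and "(m \<longlongrightarrow> bv_minus \<Gamma> P m z) (at z within Q)"
proof -
  obtain m0 where
    np: "has_nt_limit \<Sigma> P m z (bv_plus \<Gamma> P m z)" and nm: "has_nt_limit \<Sigma> Q m z (bv_minus \<Gamma> P m z)" and
    rp: "(\<lambda>z. bv_plus \<Gamma> P m z - m0) \<in> cauchy_range k \<Gamma> P" and
    rm: "(\<lambda>z. bv_minus \<Gamma> P m z - m0) \<in> cauchy_range k \<Gamma> Q" and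
    cp: "\<And>z. z \<in> P \<Longrightarrow> m z = m0 + cauchy_integral \<Gamma> (\<lambda>w. bv_plus \<Gamma> P m w - m0) z" and
    cm: "\<And>z. z \<in> Q \<Longrightarrow> m z = m0 - cauchy_integral \<Gamma> (\<lambda>w. bv_minus \<Gamma> P m w - m0) z"
    using m z unfolding Hhol_def by blast
  have fp: "(\<lambda>z. bv_plus \<Gamma> P m z - m0) \<in> Hsob k \<Gamma>" and fm: "(\<lambda>z. bv_minus \<Gamma> P m z - m0) \<in> Hsob k \<Gamma>"
    using rp rm by (auto simp: cauchy_range_def)
  obtain Lp where Lp: "(cauchy_integral \<Gamma> (\<lambda>w. bv_plus \<Gamma> P m w - m0) \<longlongrightarrow> Lp) (at z within P)"
    using cauchy_integral_limits[OF fp k] z by metis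
  have "(m \<longlongrightarrow> m0 + Lp) (at z within P)"
    by (rule Lim_transform_eventually[OF tendsto_add[OF tendsto_const Lp]]) (auto simp: eventually_at_filter cp)
  moreover from has_nt_limitI[OF this] nt_limit_eqI[OF z] np have "m0 + Lp = bv_plus \<Gamma> P m z"
    by (metis bv_plus_def)
  ultimately show "(m \<longlongrightarrow> bv_plus \<Gamma> P m z) (at z within P)" by simp
  obtain Lm where Lm: "(cauchy_integral \<Gamma> (\<lambda>w. bv_minus \<Gamma> P m w - m0) \<longlongrightarrow> Lm) (at z within Q)"
    using cauchy_integral_limits[OF fm k] z by metis
  have "(m \<longlongrightarrow> m0 - Lm) (at z within Q)"
    by (rule Lim_transform_eventually[OF tendsto_diff[OF tendsto_const Lm]]) (auto simp: eventually_at_filter cm)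
  moreover from has_nt_limitI[OF this] nt_limit_eqI[OF z] nm have "m0 - Lm = bv_minus \<Gamma> P m z"
    by (metis bv_minus_def)
  ultimately show "(m \<longlongrightarrow> bv_minus \<Gamma> P m z) (at z within Q)" by simp
qed

lemma bv_eqI:
  assumes "z \<in> \<Sigma>"
  shows "(m \<longlongrightarrow> L) (at z within P) \<Longrightarrow> bv_plus \<Gamma> P m z = L"
    and "(m \<longlongrightarrow> L) (at z within Q) \<Longrightarrow> bv_minus \<Gamma> P m z = L"
  unfolding bv_plus_def bv_minus_def using assms by (auto intro!: nt_limit_eqI has_nt_limitI)

lemma Hsob_cong:
  fixes f g :: "complex \<Rightarrow> 'a::euclidean_space"
  assumes "\<And>z. z \<in> \<Sigma> \<Longrightarrow> f z = g z" "f \<in> Hsob k \<Gamma>"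
  shows "g \<in> Hsob k \<Gamma>"
  unfolding Hsob_def
proof (intro CollectI ballI)
  fix \<gamma> assume \<gamma>: "\<gamma> \<in> \<Gamma>"
  have "sobolev_param k \<gamma> (f \<circ> \<gamma>)" using assms(2) \<gamma> by (simp add: Hsob_def)
  then show "sobolev_param k \<gamma> (g \<circ> \<gamma>)"
  proof (rule sobolev_param_cong[rotated])
    fix t :: real assume "t \<in> {0..1}"
    then have "\<gamma> t \<in> path_image \<gamma>" by (simp add: path_image_def)
    then have "\<gamma> t \<in> \<Sigma>" using \<gamma> by (auto simp: contour_trace_def)
    then show "(f \<circ> \<gamma>) t = (g \<circ> \<gamma>) t" using assms(1) by simp
  qed
qed

text \<open>The Cauchy representation and the range conditions follow from Sobolev boundary values
  attained as one-sided limits. The reason is \<open>cauchy_integral_eq\<close>, applied to the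
  function that equals \<open>m - m0\<close> on one side of the contour and 0 on the other.\<close>

lemma Hhol_intro:
  assumes hol: "holomorphic_mat_on m (- \<Sigma>)" and inf: "(m \<longlongrightarrow> m0) at_infinity" and k: "1 \<le> k"
    and mp: "\<And>z. z \<in> \<Sigma> \<Longrightarrow> (m \<longlongrightarrow> mp z) (at z within P)"
    and mm: "\<And>z. z \<in> \<Sigma> \<Longrightarrow> (m \<longlongrightarrow> mm z) (at z within Q)"
    and Sp: "(\<lambda>z. mp z - m0) \<in> Hsob k \<Gamma>" and Sm: "(\<lambda>z. mm z - m0) \<in> Hsob k \<Gamma>"
  shows "m \<in> Hhol k \<Gamma> P"
proof -
  have bp: "bv_plus \<Gamma> P m z = mp z" and bm: "bv_minus \<Gamma> P m z = mm z" if "z \<in> \<Sigma>" for z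
    using bv_eqI[OF that] mp[OF that] mm[OF that] by auto
  have Sp': "(\<lambda>z. bv_plus \<Gamma> P m z - m0) \<in> Hsob k \<Gamma>" by (rule Hsob_cong[OF _ Sp]) (simp add: bp)
  have Sm': "(\<lambda>z. bv_minus \<Gamma> P m z - m0) \<in> Hsob k \<Gamma>" by (rule Hsob_cong[OF _ Sm]) (simp add: bm)
  have hol': "(\<lambda>z. m z $ i $ l) holomorphic_on P" "(\<lambda>z. m z $ i $ l) holomorphic_on Q" for i l
    using hol PQ by (auto simp: holomorphic_mat_on_def intro: holomorphic_on_subset)
  have ent: "((\<lambda>z. m z $ i $ l) \<longlongrightarrow> mp z $ i $ l) (at z within P)" "((\<lambda>z. m z $ i $ l) \<longlongrightarrow> mm z $ i $ l) (at z within Q)"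
    if "z \<in> \<Sigma>" for z i l
    using mp[OF that] mm[OF that] by (auto simp: mat_tendsto_iff)
  have infe: "((\<lambda>z. m z $ i $ l - m0 $ i $ l) \<longlongrightarrow> 0) at_infinity" for i l
  proof -
    have "((\<lambda>z. m z $ i $ l) \<longlongrightarrow> m0 $ i $ l) at_infinity" using inf by (auto simp: mat_tendsto_iff)
    then show ?thesis by (rule LIM_zero)
  qed
  \<comment> \<open>Truncation to one side turns the boundary value from that side into a jump
    across the contour.\<close>
  define Fp where "Fp i l z = (if z \<in> P then m z $ i $ l - m0 $ i $ l else 0)" for i l z
  define Fm where "Fm i l z = (if z \<in> Q then m z $ i $ l - m0 $ i $ l else 0)" for i l z
  have "(\<lambda>z. if z \<in> A then u z else 0) holomorphic_on - \<Sigma>"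
    if A: "A = P \<and> B = Q \<or> A = Q \<and> B = P" and u: "u holomorphic_on A" for A B and u :: "complex \<Rightarrow> complex"
  proof -
    have "(\<lambda>z. if z \<in> A then u z else 0) holomorphic_on A" by (rule holomorphic_transform[OF u]) simp
    moreover have "(\<lambda>z. if z \<in> A then u z else 0) holomorphic_on B"
      by (rule holomorphic_transform[of "\<lambda>_. 0"]) (use A PQ in auto)
    ultimately have "(\<lambda>z. if z \<in> A then u z else 0) holomorphic_on (A \<union> B)"
      using A openP openQ by (intro holomorphic_on_Un) auto
    then show ?thesis using A PQ by (auto simp: Un_commute)
  qed
  note piece = this
  have Fph: "Fp i l holomorphic_on - \<Sigma>" for i l
    unfolding Fp_def[abs_def] by (rule piece[of P Q]) (auto intro!: holomorphic_intros hol')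
  have Fmh: "Fm i l holomorphic_on - \<Sigma>" for i l
    unfolding Fm_def[abs_def] by (rule piece[of Q P]) (auto intro!: holomorphic_intros hol')
  have Finf: "((\<lambda>z. if z \<in> A then m z $ i $ l - m0 $ i $ l else 0) \<longlongrightarrow> 0) at_infinity" for A i l
    by (rule Lim_null_comparison[OF _ tendsto_norm_zero[OF infe[of i l]]]) (auto intro!: always_eventually)
  have own: "((\<lambda>z. if z \<in> A then u z else 0) \<longlongrightarrow> c) (at z within A)" if "(u \<longlongrightarrow> c) (at z within A)" for A z c and u :: "complex \<Rightarrow> complex"
    by (rule Lim_transform_eventually[OF that]) (simp add: eventually_at_filter)
  have opp: "((\<lambda>z. if z \<in> A then u z else 0) \<longlongrightarrow> 0) (at z within B)" if "A \<inter> B = {}" for A B z and u :: "complex \<Rightarrow> complex"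
    by (rule Lim_transform_eventually[OF tendsto_const]) (use that in \<open>auto simp: eventually_at_filter intro!: always_eventually\<close>)
  have CP: "cauchy_integral \<Gamma> (\<lambda>w. bv_plus \<Gamma> P m w - m0) z $ i $ l = Fp i l z" if "z \<notin> \<Sigma>" for z i l
    unfolding cauchy_integral_entry
  proof (rule cauchy_integral_eq[where Fp = "\<lambda>z. mp z $ i $ l - m0 $ i $ l" and Fm = "\<lambda>_. 0"])
    show "(Fp i l \<longlongrightarrow> mp z $ i $ l - m0 $ i $ l) (at z within P)" if "z \<in> \<Sigma>" for z
      unfolding Fp_def[abs_def] by (intro own tendsto_intros ent that)
    show "(Fp i l \<longlongrightarrow> 0) (at z within Q)" for z
      unfolding Fp_def[abs_def] by (intro opp PQ)
    show "(Fp i l \<longlongrightarrow> 0) at_infinity" unfolding Fp_def[abs_def] by (rule Finf)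
    show "sobolev_param 1 \<gamma> ((\<lambda>w. (bv_plus \<Gamma> P m w - m0) $ i $ l) \<circ> \<gamma>)" if "\<gamma> \<in> \<Gamma>" for \<gamma>
      by (rule Hsob_entry[OF Sp' k that])
  qed (use Fph that in \<open>auto simp: bp\<close>)
  have CM: "cauchy_integral \<Gamma> (\<lambda>w. bv_minus \<Gamma> P m w - m0) z $ i $ l = - Fm i l z" if "z \<notin> \<Sigma>" for z i l
    unfolding cauchy_integral_entry
  proof (rule cauchy_integral_eq[where Fp = "\<lambda>_. 0" and Fm = "\<lambda>z. - (mm z $ i $ l - m0 $ i $ l)"])
    show "((\<lambda>z. - Fm i l z) \<longlongrightarrow> - (mm z $ i $ l - m0 $ i $ l)) (at z within Q)" if "z \<in> \<Sigma>" for z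
      unfolding Fm_def[abs_def] by (intro own tendsto_intros ent that)
    have "((\<lambda>z. - Fm i l z) \<longlongrightarrow> - 0) (at z within P)" for z
      unfolding Fm_def[abs_def] by (intro tendsto_minus opp) (use PQ in auto)
    then show "((\<lambda>z. - Fm i l z) \<longlongrightarrow> 0) (at z within P)" for z by simp
    have "((\<lambda>z. - Fm i l z) \<longlongrightarrow> - 0) at_infinity" unfolding Fm_def[abs_def] by (intro tendsto_minus Finf)
    then show "((\<lambda>z. - Fm i l z) \<longlongrightarrow> 0) at_infinity" by simp
    show "sobolev_param 1 \<gamma> ((\<lambda>w. (bv_minus \<Gamma> P m w - m0) $ i $ l) \<circ> \<gamma>)" if "\<gamma> \<in> \<Gamma>" for \<gamma>
      by (rule Hsob_entry[OF Sm' k that])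
  qed (use Fmh that in \<open>auto simp: bm intro!: holomorphic_intros\<close>)
  have cp: "m z = m0 + cauchy_integral \<Gamma> (\<lambda>w. bv_plus \<Gamma> P m w - m0) z" if "z \<in> P" for z
  proof -
    have "z \<notin> \<Sigma>" using that PS by blast
    then show ?thesis using that CP[of z] by (simp add: vec_eq_iff Fp_def)
  qed
  have cm: "m z = m0 - cauchy_integral \<Gamma> (\<lambda>w. bv_minus \<Gamma> P m w - m0) z" if "z \<in> Q" for z
  proof -
    have "z \<notin> \<Sigma>" using that PQ(3) by blast
    then show ?thesis using that CM[of z] by (simp add: vec_eq_iff Fm_def)
  qed
  have np: "has_nt_limit \<Sigma> P m z (bv_plus \<Gamma> P m z)" and nm: "has_nt_limit \<Sigma> Q m z (bv_minus \<Gamma> P m z)" if "z \<in> \<Sigma>" for z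
    using that by (auto simp: bp bm intro!: has_nt_limitI mp mm)
  have rp: "(\<lambda>z. bv_plus \<Gamma> P m z - m0) \<in> cauchy_range k \<Gamma> P"
    unfolding cauchy_range_def
  proof (intro CollectI conjI Sp' bexI[OF _ Sp'] ballI has_nt_limitI)
    fix z assume z: "z \<in> \<Sigma>"
    have "((\<lambda>z. m z - m0) \<longlongrightarrow> bv_plus \<Gamma> P m z - m0) (at z within P)"
      unfolding bp[OF z] by (intro tendsto_intros mp z)
    then show "(cauchy_integral \<Gamma> (\<lambda>w. bv_plus \<Gamma> P m w - m0) \<longlongrightarrow> bv_plus \<Gamma> P m z - m0) (at z within P)"
      by (rule Lim_transform_eventually) (simp add: eventually_at_filter cp)
  qed
  have rm: "(\<lambda>z. bv_minus \<Gamma> P m z - m0) \<in> cauchy_range k \<Gamma> Q"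
    unfolding cauchy_range_def
  proof (intro CollectI conjI Sm')
    \<comment> \<open>\<open>Q\<close> lies to the right of the contour, so the density whose Cauchy
      integral reproduces \<open>m - m0\<close> on \<open>Q\<close> is the negative of the boundary
      value.\<close>
    define f where "f w = - (bv_minus \<Gamma> P m w - m0)" for w
    have f: "f \<in> Hsob k \<Gamma>"
      unfolding Hsob_def f_def[abs_def]
    proof (intro CollectI ballI)
      fix \<gamma> assume \<gamma>: "\<gamma> \<in> \<Gamma>"
      have "sobolev_param k \<gamma> ((\<lambda>z. bv_minus \<Gamma> P m z - m0) \<circ> \<gamma>)" using Sm' \<gamma> by (simp add: Hsob_def)
      from sobolev_param_bounded_linear[OF regular[OF \<gamma>] bounded_linear_minus[OF bounded_linear_ident] this]
      show "sobolev_param k \<gamma> ((\<lambda>w. - (bv_minus \<Gamma> P m w - m0)) \<circ> \<gamma>)" by (simp add: o_def)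
    qed
    have cf: "cauchy_integral \<Gamma> f z = m z - m0" if z: "z \<in> Q" for z
    proof -
      have zS: "z \<notin> \<Sigma>" using z PQ by auto
      have "cauchy_integral \<Gamma> f z $ i $ l = Fm i l z" for i l
        unfolding cauchy_integral_entry
      proof (rule cauchy_integral_eq[where Fp = "\<lambda>_. 0" and Fm = "\<lambda>z. mm z $ i $ l - m0 $ i $ l"])
        show "(Fm i l \<longlongrightarrow> (mm z $ i $ l - m0 $ i $ l)) (at z within Q)" if "z \<in> \<Sigma>" for z
          unfolding Fm_def[abs_def] by (intro own tendsto_intros ent that)
        show "(Fm i l \<longlongrightarrow> 0) (at z within P)" for z
          unfolding Fm_def[abs_def] by (intro opp) (use PQ in auto)
        show "(Fm i l \<longlongrightarrow> 0) at_infinity" unfolding Fm_def[abs_def] by (rule Finf)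
        show "sobolev_param 1 \<gamma> ((\<lambda>w. f w $ i $ l) \<circ> \<gamma>)" if "\<gamma> \<in> \<Gamma>" for \<gamma>
          by (rule Hsob_entry[OF f k that])
      qed (use Fmh zS in \<open>auto simp: bm f_def\<close>)
      then show ?thesis using z by (simp add: vec_eq_iff Fm_def)
    qed
    show "\<exists>f\<in>Hsob k \<Gamma>. \<forall>z\<in>\<Sigma>. has_nt_limit \<Sigma> Q (cauchy_integral \<Gamma> f) z (bv_minus \<Gamma> P m z - m0)"
    proof (intro bexI[OF _ f] ballI has_nt_limitI)
      fix z assume z: "z \<in> \<Sigma>"
      have "((\<lambda>z. m z - m0) \<longlongrightarrow> bv_minus \<Gamma> P m z - m0) (at z within Q)"
        unfolding bm[OF z] by (intro tendsto_intros mm z)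
      then show "(cauchy_integral \<Gamma> f \<longlongrightarrow> bv_minus \<Gamma> P m z - m0) (at z within Q)"
        by (rule Lim_transform_eventually) (simp add: eventually_at_filter cf)
    qed
  qed
  show ?thesis
    unfolding Hhol_def using hol inf np nm rp rm cp cm by blast
qed

end

subsection \<open>The contour of the theorem\<close>

lemma inside_sphere: "0 < r \<Longrightarrow> inside (sphere a r) = ball (a::complex) r"
  using inside_frontier_eq_interior[of "cball a r"] by simp

lemma outside_sphere: "0 < r \<Longrightarrow> outside (sphere a r) = - cball (a::complex) r"
  using outside_frontier_eq_complement_closure[of "cball a r"] by simp

lemma sphere_cballD: "z \<in> sphere x r \<Longrightarrow> z \<in> cball x r"
  by simp

lemma inv_radius_less:
  assumes "0 < \<rho>" "\<rho> < norm a"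
  shows "inv_radius a \<rho> < norm (inv_center a \<rho>)"
proof -
  define D where "D = (norm a)\<^sup>2 - \<rho>\<^sup>2"
  have "0 < D" using assms by (simp add: D_def power_strict_mono)
  then show ?thesis
    unfolding inv_radius_def inv_center_def D_def[symmetric] using assms by (simp add: norm_divide divide_strict_right_mono)
qed

lemma inversion_ball:
  assumes \<rho>: "0 < \<rho>" "\<rho> < norm a" and z: "z \<noteq> 0"
  shows "z \<in> ball (inv_center a \<rho>) (inv_radius a \<rho>) \<longleftrightarrow> 1 / cnj z \<in> ball a \<rho>"
    and "z \<in> cball (inv_center a \<rho>) (inv_radius a \<rho>) \<longleftrightarrow> 1 / cnj z \<in> cball a \<rho>"
proof -
  define w where "w = 1 / cnj z"
  have w: "w \<noteq> 0" "1 / cnj w = z" using z by (auto simp: w_def)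
  show "z \<in> ball (inv_center a \<rho>) (inv_radius a \<rho>) \<longleftrightarrow> 1 / cnj z \<in> ball a \<rho>"
    "z \<in> cball (inv_center a \<rho>) (inv_radius a \<rho>) \<longleftrightarrow> 1 / cnj z \<in> cball a \<rho>"
    using inversion_circle(2,3)[OF \<rho> w(1)] unfolding w(2) w_def
    by (simp_all only: mem_ball mem_cball dist_norm norm_minus_commute le_less) (auto simp: norm_minus_commute)
qed

text \<open>The radial projection of \<open>z\<close> to the sphere is at distance
  \<open>\<bar>\<rho> - norm (z - a)\<bar>\<close> from \<open>z\<close>, which has to be at least
  the distance from the sphere to \<open>K\<close> if \<open>z \<in> K\<close>. Keeping
  \<open>\<delta> \<le> \<rho>\<close> excludes the centre, where there is no projection.\<close>

lemma sphere_gap: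
  fixes a :: complex
  assumes \<rho>: "0 < \<rho>" and K: "closed K" "sphere a \<rho> \<inter> K = {}"
  obtains \<delta> where "0 < \<delta>" "\<And>z. \<rho> - \<delta> < norm (z - a) \<Longrightarrow> norm (z - a) < \<rho> + \<delta> \<Longrightarrow> z \<notin> K"
proof -
  obtain d where d: "0 < d" "\<And>x y. x \<in> sphere a \<rho> \<Longrightarrow> y \<in> K \<Longrightarrow> d \<le> dist x y"
    using separate_compact_closed[OF compact_sphere K(1) K(2)] by blast
  define \<delta> where "\<delta> = min d \<rho>"
  have "z \<notin> K" if z: "\<rho> - \<delta> < norm (z - a)" "norm (z - a) < \<rho> + \<delta>" for z
  proof
    assume "z \<in> K"
    have n: "0 < norm (z - a)" using z(1) by (auto simp: \<delta>_def)
    then have za: "z \<noteq> a" by auto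
    define x where "x = a + of_real (\<rho> / norm (z - a)) * (z - a)"
    have "norm (x - a) = \<rho>" using \<rho> n by (simp add: x_def norm_mult norm_divide)
    then have "x \<in> sphere a \<rho>" by (simp add: dist_norm norm_minus_commute)
    then have "d \<le> dist x z" using d(2) \<open>z \<in> K\<close> by blast
    also have "x - z = of_real (\<rho> / norm (z - a) - 1) * (z - a)" by (simp add: x_def algebra_simps)
    then have "dist x z = \<bar>\<rho> / norm (z - a) - 1\<bar> * norm (z - a)" by (simp only: dist_norm norm_mult norm_of_real)
    also have "\<dots> = \<bar>\<rho> - norm (z - a)\<bar>"
    proof -
      have "\<bar>\<rho> / N - 1\<bar> * N = \<bar>\<rho> - N\<bar>" if "0 < N" for N
      proof -
        have "\<rho> / N - 1 = (\<rho> - N) / N" using that by (simp add: field_simps)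
        then show ?thesis using that by (simp add: abs_divide)
      qed
      then show ?thesis using n by blast
    qed
    also have "\<dots> < \<delta>" using z by auto
    finally show False by (simp add: \<delta>_def)
  qed
  moreover have "0 < \<delta>" using d \<rho> by (simp add: \<delta>_def)
  ultimately show thesis using that by blast
qed

locale pole_data =
  fixes J :: nat and p :: "nat \<Rightarrow> complex" and \<epsilon> :: "nat \<Rightarrow> real"
  assumes eps: "\<And>j. j \<in> {1..J} \<Longrightarrow> 0 < \<epsilon> j"
    and outer: "\<And>j. j \<in> {1..J} \<Longrightarrow> cball (p j) (\<epsilon> j) \<subseteq> {z. 1 < norm z}"
    and disjoint: "disjoint_family_on (\<lambda>j. cball (p j) (\<epsilon> j)) {1..J}"
begin

abbreviation "b j \<equiv> inv_center (p j) (\<epsilon> j)"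
abbreviation "s j \<equiv> inv_radius (p j) (\<epsilon> j)"

lemma eps_less: "j \<in> {1..J} \<Longrightarrow> \<epsilon> j < norm (p j)"
proof (rule ccontr)
  assume j: "j \<in> {1..J}" "\<not> \<epsilon> j < norm (p j)"
  then have "0 \<in> cball (p j) (\<epsilon> j)" by simp
  then have "0 \<in> {z::complex. 1 < norm z}" using outer[OF j(1)] by blast
  then show False by simp
qed

lemma s_pos: "j \<in> {1..J} \<Longrightarrow> 0 < s j"
  using inversion_circle(1)[OF eps eps_less, of j 1] by simp

lemma inner_zero: "j \<in> {1..J} \<Longrightarrow> 0 \<notin> cball (b j) (s j)"
  using inv_radius_less[OF eps eps_less, of j] by simp

lemma inner: "j \<in> {1..J} \<Longrightarrow> cball (b j) (s j) \<subseteq> ball 0 1"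
proof
  fix z assume j: "j \<in> {1..J}" and z: "z \<in> cball (b j) (s j)"
  have z0: "z \<noteq> 0" using inner_zero[OF j] z by auto
  then have "1 / cnj z \<in> cball (p j) (\<epsilon> j)" using inversion_ball(2)[OF eps[OF j] eps_less[OF j]] z by blast
  then have "1 < norm (1 / cnj z)" using outer[OF j] by blast
  then show "z \<in> ball 0 1" using z0 by (simp add: norm_divide)
qed

lemma disjoint_outer: "i \<in> {1..J} \<Longrightarrow> j \<in> {1..J} \<Longrightarrow> z \<in> cball (p i) (\<epsilon> i) \<Longrightarrow> z \<in> cball (p j) (\<epsilon> j) \<Longrightarrow> i = j"
  using disjoint unfolding disjoint_family_on_def by blast

lemma disjoint_inner:
  assumes "i \<in> {1..J}" "j \<in> {1..J}" "z \<in> cball (b i) (s i)" "z \<in> cball (b j) (s j)"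
  shows "i = j"
proof -
  have z0: "z \<noteq> 0" using inner_zero assms by auto
  have "1 / cnj z \<in> cball (p i) (\<epsilon> i)"
    using inversion_ball(2)[OF eps[OF assms(1)] eps_less[OF assms(1)] z0] assms(3) by blast
  moreover have "1 / cnj z \<in> cball (p j) (\<epsilon> j)"
    using inversion_ball(2)[OF eps[OF assms(2)] eps_less[OF assms(2)] z0] assms(4) by blast
  ultimately show ?thesis by (rule disjoint_outer[OF assms(1,2)])
qed

lemma norm_outer: "j \<in> {1..J} \<Longrightarrow> z \<in> cball (p j) (\<epsilon> j) \<Longrightarrow> 1 < norm z"
  using outer by blast

lemma norm_inner: "j \<in> {1..J} \<Longrightarrow> z \<in> cball (b j) (s j) \<Longrightarrow> norm z < 1"
  using inner[of j] by auto

lemma disjoint_mixed: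
  assumes "i \<in> {1..J}" "j \<in> {1..J}" "z \<in> cball (p i) (\<epsilon> i)"
  shows "z \<notin> cball (b j) (s j)"
  using norm_outer[OF assms(1,3)] norm_inner[OF assms(2), of z] by fastforce

lemma images:
  "path_image unit_circle = sphere 0 1"
  "j \<in> {1..J} \<Longrightarrow> path_image (pole_circle (p j) (\<epsilon> j)) = sphere (p j) (\<epsilon> j)"
  "j \<in> {1..J} \<Longrightarrow> path_image (pole_circle_sharp (p j) (\<epsilon> j)) = sphere (b j) (s j)"
  by (auto simp: unit_circle_eq path_image_pole_circle eps path_image_pole_circle_sharp[OF eps eps_less])

abbreviation "\<Gamma>\<^sub>0 \<equiv> contour J p \<epsilon>"

lemma trace_eq:
  "contour_trace \<Gamma>\<^sub>0 = sphere 0 1 \<union> (\<Union>j\<in>{1..J}. sphere (p j) (\<epsilon> j)) \<union> (\<Union>j\<in>{1..J}. sphere (b j) (s j))"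
  unfolding contour_trace_def contour_def using images by auto

abbreviation "P\<^sub>0 \<equiv> Omega_plus J p \<epsilon>"
abbreviation "Q\<^sub>0 \<equiv> minus_side \<Gamma>\<^sub>0 P\<^sub>0"

lemma plus_eq:
  "P\<^sub>0 = {z. 1 < norm z \<and> (\<forall>j\<in>{1..J}. z \<notin> cball (p j) (\<epsilon> j))} \<union> (\<Union>j\<in>{1..J}. ball (b j) (s j))"
proof -
  have "outside (path_image unit_circle) = {z. 1 < norm z}"
    using outside_sphere[of 1 0] by (auto simp: images)
  moreover have "outside (path_image (pole_circle (p j) (\<epsilon> j))) = - cball (p j) (\<epsilon> j)" if "j \<in> {1..J}" for j
    using outside_sphere[OF eps[OF that]] that by (simp add: images)
  moreover have "inside (path_image (pole_circle_sharp (p j) (\<epsilon> j))) = ball (b j) (s j)" if "j \<in> {1..J}" for j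
    using inside_sphere[OF s_pos[OF that]] that by (simp add: images)
  ultimately show ?thesis unfolding Omega_plus_def by auto
qed

lemma minus_eq:
  "Q\<^sub>0 = {z. norm z < 1 \<and> (\<forall>j\<in>{1..J}. z \<notin> cball (b j) (s j))} \<union> (\<Union>j\<in>{1..J}. ball (p j) (\<epsilon> j))"
proof (intro equalityI subsetI)
  fix z assume "z \<in> Q\<^sub>0"
  then have z: "norm z \<noteq> 1" "\<And>j. j \<in> {1..J} \<Longrightarrow> z \<notin> sphere (p j) (\<epsilon> j)" "\<And>j. j \<in> {1..J} \<Longrightarrow> z \<notin> sphere (b j) (s j)" "z \<notin> P\<^sub>0"
    unfolding minus_side_def trace_eq by auto
  show "z \<in> {z. norm z < 1 \<and> (\<forall>j\<in>{1..J}. z \<notin> cball (b j) (s j))} \<union> (\<Union>j\<in>{1..J}. ball (p j) (\<epsilon> j))"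
  proof (cases "norm z < 1")
    case True
    have "z \<notin> cball (b j) (s j)" if "j \<in> {1..J}" for j
    proof
      assume "z \<in> cball (b j) (s j)"
      then have "z \<in> ball (b j) (s j)" using z(3)[OF that] by (auto simp: le_less)
      then show False using z(4) that unfolding plus_eq by blast
    qed
    then show ?thesis using True by blast
  next
    case False
    then have "1 < norm z" using z(1) by simp
    then obtain j where j: "j \<in> {1..J}" "z \<in> cball (p j) (\<epsilon> j)" using z(4) unfolding plus_eq by blast
    then have "z \<in> ball (p j) (\<epsilon> j)" using z(2)[OF j(1)] by (auto simp: le_less)
    then show ?thesis using j(1) by blast
  qed
next
  fix z assume "z \<in> {z. norm z < 1 \<and> (\<forall>j\<in>{1..J}. z \<notin> cball (b j) (s j))} \<union> (\<Union>j\<in>{1..J}. ball (p j) (\<epsilon> j))"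
  then consider "norm z < 1" "\<forall>j\<in>{1..J}. z \<notin> cball (b j) (s j)" | j where "j \<in> {1..J}" "z \<in> ball (p j) (\<epsilon> j)" by blast
  then show "z \<in> Q\<^sub>0"
  proof cases
    case 1
    have "z \<notin> cball (p j) (\<epsilon> j)" if "j \<in> {1..J}" for j using norm_outer[OF that, of z] 1(1) by auto
    moreover have "z \<notin> sphere 0 1" "\<not> 1 < norm z" using 1(1) by auto
    ultimately have "z \<notin> contour_trace \<Gamma>\<^sub>0" "z \<notin> P\<^sub>0"
      using 1(2) sphere_cballD ball_subset_cball unfolding trace_eq plus_eq by blast+
    then show ?thesis by (simp add: minus_side_def)
  next
    case 2
    have zc: "z \<in> cball (p j) (\<epsilon> j)" and zn: "z \<notin> sphere (p j) (\<epsilon> j)" using 2 by auto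
    have n: "1 < norm z" using norm_outer[OF 2(1) zc] .
    have "z \<notin> cball (b i) (s i)" if "i \<in> {1..J}" for i using disjoint_mixed[OF 2(1) that zc] .
    moreover have "z \<notin> sphere (p i) (\<epsilon> i)" if "i \<in> {1..J}" for i
      using disjoint_outer[OF 2(1) that zc] zn by auto
    moreover have "z \<notin> sphere 0 1" using n by auto
    ultimately have "z \<notin> contour_trace \<Gamma>\<^sub>0" "z \<notin> P\<^sub>0"
      using zc 2(1) sphere_cballD ball_subset_cball unfolding trace_eq plus_eq by blast+
    then show ?thesis by (simp add: minus_side_def)
  qed
qed

lemma contour_cases:
  assumes "\<gamma> \<in> \<Gamma>\<^sub>0"
  obtains "\<gamma> = unit_circle" | j where "j \<in> {1..J}" "\<gamma> = pole_circle (p j) (\<epsilon> j)"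
    | j where "j \<in> {1..J}" "\<gamma> = pole_circle_sharp (p j) (\<epsilon> j)"
  using assms unfolding contour_def by blast

lemma open_sides: "open P\<^sub>0" "open Q\<^sub>0"
proof -
  have c: "closed (\<Union>j\<in>{1..J}. cball (p j) (\<epsilon> j))" "closed (\<Union>j\<in>{1..J}. cball (b j) (s j))" by auto
  have "P\<^sub>0 = ({z. 1 < norm z} - (\<Union>j\<in>{1..J}. cball (p j) (\<epsilon> j))) \<union> (\<Union>j\<in>{1..J}. ball (b j) (s j))"
    unfolding plus_eq by blast
  moreover have "open {z::complex. 1 < norm z}" by (intro open_Collect_less continuous_intros)
  ultimately show "open P\<^sub>0" using c by (auto intro!: open_Un open_Diff)
  have "Q\<^sub>0 = ({z. norm z < 1} - (\<Union>j\<in>{1..J}. cball (b j) (s j))) \<union> (\<Union>j\<in>{1..J}. ball (p j) (\<epsilon> j))"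
    unfolding minus_eq by blast
  moreover have "open {z::complex. norm z < 1}" by (intro open_Collect_less continuous_intros)
  ultimately show "open Q\<^sub>0" using c by (auto intro!: open_Un open_Diff)
qed

text \<open>An annulus around the circle has to avoid the union \<open>K\<close> of the small discs,
  and \<open>sphere_gap\<close> provides its width. The same method serves for the small circles,
  where \<open>K\<close> is made of the other small discs on the same side of the unit circle and
  everything across it.\<close>

lemma side_unit: "\<exists>\<delta>. circle_side \<Gamma>\<^sub>0 P\<^sub>0 unit_circle 0 1 True \<delta>"
proof -
  define K where "K = (\<Union>j\<in>{1..J}. cball (p j) (\<epsilon> j)) \<union> (\<Union>j\<in>{1..J}. cball (b j) (s j))"
  have K: "closed K" unfolding K_def by (intro closed_Un closed_UN) auto
  have d: "sphere 0 1 \<inter> K = {}" using norm_outer norm_inner unfolding K_def by fastforce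
  obtain \<delta> where \<delta>: "0 < \<delta>" "\<And>z. 1 - \<delta> < norm (z - 0) \<Longrightarrow> norm (z - 0) < 1 + \<delta> \<Longrightarrow> z \<notin> K"
    by (rule sphere_gap[OF _ K d]) auto
  have "circle_side \<Gamma>\<^sub>0 P\<^sub>0 unit_circle 0 1 True \<delta>"
    unfolding circle_side_def if_True
  proof (intro conjI allI impI)
    show "\<exists>T. tangent_loop unit_circle T" using tangent_loop_pole_circle[of 1 0] by (auto simp: unit_circle_eq)
    show "plemelj unit_circle 0 1 True" using plemelj_pole_circle[of 1 0] by (simp add: unit_circle_eq)
    fix z :: complex
    show "1 < norm (z - 0) \<and> norm (z - 0) < 1 + \<delta> \<Longrightarrow> z \<in> P\<^sub>0"
      using \<delta>(1) \<delta>(2)[of z] unfolding plus_eq by (auto simp: K_def)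
    show "1 - \<delta> < norm (z - 0) \<and> norm (z - 0) < 1 \<Longrightarrow> z \<in> Q\<^sub>0"
      using \<delta>(1) \<delta>(2)[of z] unfolding minus_eq by (auto simp: K_def)
  qed (use \<delta> images in auto)
  then show ?thesis by blast
qed

lemma side_pole:
  assumes j: "j \<in> {1..J}"
  shows "\<exists>\<delta>. circle_side \<Gamma>\<^sub>0 P\<^sub>0 (pole_circle (p j) (\<epsilon> j)) (p j) (\<epsilon> j) True \<delta>"
proof -
  define K where "K = cball 0 1 \<union> (\<Union>i\<in>{1..J} - {j}. cball (p i) (\<epsilon> i))"
  have K: "closed K" unfolding K_def by (intro closed_Un closed_UN) auto
  have d: "sphere (p j) (\<epsilon> j) \<inter> K = {}"
  proof (rule ccontr)
    assume "sphere (p j) (\<epsilon> j) \<inter> K \<noteq> {}"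
    then obtain z where z: "z \<in> cball (p j) (\<epsilon> j)" "z \<in> K" using sphere_cballD by blast
    then show False using norm_outer[OF j z(1)] disjoint_outer[OF j _ z(1)] by (auto simp: K_def)
  qed
  obtain \<delta> where \<delta>: "0 < \<delta>" "\<And>z. \<epsilon> j - \<delta> < norm (z - p j) \<Longrightarrow> norm (z - p j) < \<epsilon> j + \<delta> \<Longrightarrow> z \<notin> K"
    by (rule sphere_gap[OF eps[OF j] K d]) auto
  have "circle_side \<Gamma>\<^sub>0 P\<^sub>0 (pole_circle (p j) (\<epsilon> j)) (p j) (\<epsilon> j) True \<delta>"
    unfolding circle_side_def if_True
  proof (intro conjI allI impI)
    show "\<exists>T. tangent_loop (pole_circle (p j) (\<epsilon> j)) T" using tangent_loop_pole_circle[OF eps[OF j]] by blast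
    show "plemelj (pole_circle (p j) (\<epsilon> j)) (p j) (\<epsilon> j) True" by (rule plemelj_pole_circle[OF eps[OF j]])
    fix z :: complex
    show "z \<in> P\<^sub>0" if z: "\<epsilon> j < norm (z - p j) \<and> norm (z - p j) < \<epsilon> j + \<delta>"
    proof -
      have "z \<notin> K" using \<delta> z by auto
      moreover have "z \<notin> cball (p j) (\<epsilon> j)" using z by (simp add: dist_norm norm_minus_commute)
      ultimately have "1 < norm z \<and> (\<forall>i\<in>{1..J}. z \<notin> cball (p i) (\<epsilon> i))" unfolding K_def by fastforce
      then show ?thesis unfolding plus_eq by blast
    qed
    show "z \<in> Q\<^sub>0" if z: "\<epsilon> j - \<delta> < norm (z - p j) \<and> norm (z - p j) < \<epsilon> j"
    proof -
      have "z \<in> ball (p j) (\<epsilon> j)" using z by (simp add: dist_norm norm_minus_commute)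
      then show ?thesis unfolding minus_eq using j by blast
    qed
  qed (use \<delta> images eps j in auto)
  then show ?thesis by blast
qed

lemma side_sharp:
  assumes j: "j \<in> {1..J}"
  shows "\<exists>\<delta>. circle_side \<Gamma>\<^sub>0 P\<^sub>0 (pole_circle_sharp (p j) (\<epsilon> j)) (b j) (s j) False \<delta>"
proof -
  define K where "K = - ball 0 1 \<union> (\<Union>i\<in>{1..J} - {j}. cball (b i) (s i))"
  have K: "closed K" unfolding K_def by (intro closed_Un closed_UN) auto
  have d: "sphere (b j) (s j) \<inter> K = {}"
  proof (rule ccontr)
    assume "sphere (b j) (s j) \<inter> K \<noteq> {}"
    then obtain z where z: "z \<in> cball (b j) (s j)" "z \<in> K" using sphere_cballD by blast
    then show False using norm_inner[OF j z(1)] disjoint_inner[OF j _ z(1)] by (auto simp: K_def)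
  qed
  obtain \<delta> where \<delta>: "0 < \<delta>" "\<And>z. s j - \<delta> < norm (z - b j) \<Longrightarrow> norm (z - b j) < s j + \<delta> \<Longrightarrow> z \<notin> K"
    by (rule sphere_gap[OF s_pos[OF j] K d]) auto
  have "circle_side \<Gamma>\<^sub>0 P\<^sub>0 (pole_circle_sharp (p j) (\<epsilon> j)) (b j) (s j) False \<delta>"
    unfolding circle_side_def if_False
  proof (intro conjI allI impI)
    show "\<exists>T. tangent_loop (pole_circle_sharp (p j) (\<epsilon> j)) T" using tangent_loop_pole_circle_sharp[OF eps[OF j] eps_less[OF j]] by blast
    show "plemelj (pole_circle_sharp (p j) (\<epsilon> j)) (b j) (s j) False" by (rule plemelj_pole_circle_sharp[OF eps[OF j] eps_less[OF j]])
    fix z :: complex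
    show "z \<in> Q\<^sub>0" if z: "s j < norm (z - b j) \<and> norm (z - b j) < s j + \<delta>"
    proof -
      have "z \<notin> K" using \<delta> z by auto
      moreover have "z \<notin> cball (b j) (s j)" using z by (simp add: dist_norm norm_minus_commute)
      ultimately have "norm z < 1 \<and> (\<forall>i\<in>{1..J}. z \<notin> cball (b i) (s i))" unfolding K_def by fastforce
      then show ?thesis unfolding minus_eq by blast
    qed
    show "z \<in> P\<^sub>0" if z: "s j - \<delta> < norm (z - b j) \<and> norm (z - b j) < s j"
    proof -
      have "z \<in> ball (b j) (s j)" using z by (simp add: dist_norm norm_minus_commute)
      then show ?thesis unfolding plus_eq using j by blast
    qed
  qed (use \<delta> images s_pos j in auto)
  then show ?thesis by blast
qed

lemma trace_disjoint:
  "j \<in> {1..J} \<Longrightarrow> sphere 0 1 \<inter> sphere (p j) (\<epsilon> j) = {}"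
  "j \<in> {1..J} \<Longrightarrow> sphere 0 1 \<inter> sphere (b j) (s j) = {}"
  "i \<in> {1..J} \<Longrightarrow> j \<in> {1..J} \<Longrightarrow> sphere (p i) (\<epsilon> i) \<inter> sphere (b j) (s j) = {}"
  "i \<in> {1..J} \<Longrightarrow> j \<in> {1..J} \<Longrightarrow> i \<noteq> j \<Longrightarrow> sphere (p i) (\<epsilon> i) \<inter> sphere (p j) (\<epsilon> j) = {}"
  "i \<in> {1..J} \<Longrightarrow> j \<in> {1..J} \<Longrightarrow> i \<noteq> j \<Longrightarrow> sphere (b i) (s i) \<inter> sphere (b j) (s j) = {}"
proof -
  have sub: "sphere x r \<subseteq> cball x r" for x :: complex and r by auto
  show "j \<in> {1..J} \<Longrightarrow> sphere 0 1 \<inter> sphere (p j) (\<epsilon> j) = {}"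
    using norm_outer[of j] sub by fastforce
  show "j \<in> {1..J} \<Longrightarrow> sphere 0 1 \<inter> sphere (b j) (s j) = {}"
    using norm_inner[of j] sub by fastforce
  show "i \<in> {1..J} \<Longrightarrow> j \<in> {1..J} \<Longrightarrow> sphere (p i) (\<epsilon> i) \<inter> sphere (b j) (s j) = {}"
    using disjoint_mixed sub by blast
  show "i \<in> {1..J} \<Longrightarrow> j \<in> {1..J} \<Longrightarrow> i \<noteq> j \<Longrightarrow> sphere (p i) (\<epsilon> i) \<inter> sphere (p j) (\<epsilon> j) = {}"
    using disjoint_outer sub by blast
  show "i \<in> {1..J} \<Longrightarrow> j \<in> {1..J} \<Longrightarrow> i \<noteq> j \<Longrightarrow> sphere (b i) (s i) \<inter> sphere (b j) (s j) = {}"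
    using disjoint_inner sub by blast
qed

lemma circles: "circle_system \<Gamma>\<^sub>0 P\<^sub>0"
proof
  show "finite \<Gamma>\<^sub>0" by (simp add: contour_def)
  show "open P\<^sub>0" "open Q\<^sub>0" by (rule open_sides)+
  show "P\<^sub>0 \<inter> contour_trace \<Gamma>\<^sub>0 = {}"
  proof (rule ccontr)
    assume "P\<^sub>0 \<inter> contour_trace \<Gamma>\<^sub>0 \<noteq> {}"
    then obtain z where z: "z \<in> P\<^sub>0" "z \<in> contour_trace \<Gamma>\<^sub>0" by blast
    from z(1) consider "1 < norm z" "\<forall>j\<in>{1..J}. z \<notin> cball (p j) (\<epsilon> j)" | j where "j \<in> {1..J}" "z \<in> ball (b j) (s j)"
      unfolding plus_eq by blast
    then show False
    proof cases
      case 1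
      have "z \<notin> cball (b j) (s j)" if "j \<in> {1..J}" for j using norm_inner[OF that, of z] 1(1) by auto
      moreover have "z \<notin> sphere 0 1" using 1(1) by auto
      ultimately show False using z(2) 1(2) sphere_cballD unfolding trace_eq by blast
    next
      case 2
      have zc: "z \<in> cball (b j) (s j)" and zn: "z \<notin> sphere (b j) (s j)" using 2 by auto
      have n: "norm z < 1" using norm_inner[OF 2(1) zc] .
      have "z \<notin> cball (p i) (\<epsilon> i)" if "i \<in> {1..J}" for i using disjoint_mixed[OF that 2(1)] zc by blast
      moreover have "z \<notin> sphere (b i) (s i)" if "i \<in> {1..J}" for i
        using disjoint_inner[OF 2(1) that zc] zn by auto
      moreover have "z \<notin> sphere 0 1" using n by auto
      ultimately show False using z(2) sphere_cballD unfolding trace_eq by blast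
    qed
  qed
  show "\<exists>a \<rho> cw \<delta>. circle_side \<Gamma>\<^sub>0 P\<^sub>0 \<gamma> a \<rho> cw \<delta>" if "\<gamma> \<in> \<Gamma>\<^sub>0" for \<gamma>
    using that by (cases rule: contour_cases) (use side_unit side_pole side_sharp in blast)+
  show "path_image \<gamma> \<inter> path_image \<gamma>' = {}" if "\<gamma> \<in> \<Gamma>\<^sub>0" "\<gamma>' \<in> \<Gamma>\<^sub>0" "\<gamma> \<noteq> \<gamma>'" for \<gamma> \<gamma>'
    using that(1)
  proof (cases rule: contour_cases)
    case 1
    from that(2) show ?thesis
      by (cases rule: contour_cases) (use 1 that(3) trace_disjoint in \<open>simp_all add: images\<close>)
  next
    case (2 j)
    from that(2) show ?thesis
    proof (cases rule: contour_cases)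
      case 1
      then show ?thesis using 2 trace_disjoint(1) by (simp add: images Int_commute)
    next
      case i: (2 i)
      then have "i \<noteq> j" using 2 that(3) by auto
      then show ?thesis using 2 i trace_disjoint(4)[of j i] by (simp add: images)
    next
      case (3 i)
      then show ?thesis using 2 trace_disjoint(3) by (simp add: images)
    qed
  next
    case (3 j)
    from that(2) show ?thesis
    proof (cases rule: contour_cases)
      case 1
      then show ?thesis using 3 trace_disjoint(2) by (simp add: images Int_commute)
    next
      case (2 i)
      then show ?thesis using 3 trace_disjoint(3) by (simp add: images Int_commute)
    next
      case i: (3 i)
      then have "i \<noteq> j" using 3 that(3) by auto
      then show ?thesis using 3 i trace_disjoint(5)[of j i] by (simp add: images)
    qed
  qed
qed

sublocale circle_system \<Gamma>\<^sub>0 P\<^sub>0 by (rule circles)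

end

subsection \<open>The problem with poles\<close>

lemma sobolev_param_lser:
  fixes f :: "complex \<Rightarrow> complex"
  assumes y: "wt (real k) y" and k: "1 \<le> k" and f: "\<And>z. norm z = 1 \<Longrightarrow> f z = lser y z"
  shows "sobolev_param k unit_circle (f \<circ> unit_circle)"
proof -
  obtain h where h: "sobolev_param k unit_circle h" "h = fser (\<lambda>m. y (- m))"
    using wt_imp_sobolev_param[OF _ _ wt_reflect[OF y], of unit_circle "2 * pi"] speed_pole_circle[of 1 _ 0] k
    by (auto simp: unit_circle_eq)
  show ?thesis
  proof (rule sobolev_param_cong[OF _ h(1)])
    fix t :: real assume "t \<in> {0..1}"
    have "(f \<circ> unit_circle) t = lser y (expi (-1) t)"
      by (simp add: unit_circle_expi f expi_def)
    also have "\<dots> = infsum (\<lambda>m. y m * expi (- m) t) UNIV"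
      by (simp add: lser_def expi_def cis_power_int mult_ac)
    also have "\<dots> = h t"
      unfolding h(2) fser_def
      using infsum_reindex_bij_betw[of uminus UNIV UNIV "\<lambda>m::int. y m * expi (- m) t"] by simp
    finally show "h t = (f \<circ> unit_circle) t" by simp
  qed
qed

lemma conv_add_scaled:
  assumes x: "x summable_on UNIV" and w: "w summable_on UNIV" and q: "\<And>j. j \<in> I \<Longrightarrow> q j summable_on UNIV"
  shows "conv (\<lambda>m. x m - (\<Sum>j\<in>I. C j * q j m)) w m = conv x w m - (\<Sum>j\<in>I. C j * conv (q j) w m)"
proof -
  have sx: "(\<lambda>l. x (m - l) * w l) summable_on UNIV" by (rule conv_summable[OF x w])
  have sq: "(\<lambda>l. C j * (q j (m - l) * w l)) summable_on UNIV" if "j \<in> I" for j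
    by (rule summable_on_cmult_right[OF conv_summable[OF q[OF that] w]])
  have S: "(\<lambda>l. \<Sum>j\<in>I. C j * (q j (m - l) * w l)) summable_on UNIV"
    "infsum (\<lambda>l. \<Sum>j\<in>I. C j * (q j (m - l) * w l)) UNIV = (\<Sum>j\<in>I. infsum (\<lambda>l. C j * (q j (m - l) * w l)) UNIV)"
    using sq by (induction I rule: infinite_finite_induct) (auto simp: infsum_add intro: summable_on_add)
  have e: "infsum (\<lambda>l. x (m - l) * w l - (\<Sum>j\<in>I. C j * (q j (m - l) * w l))) UNIV
      = infsum (\<lambda>l. x (m - l) * w l) UNIV - infsum (\<lambda>l. \<Sum>j\<in>I. C j * (q j (m - l) * w l)) UNIV"
    using infsum_add[OF sx summable_on_uminus[THEN iffD2, OF S(1)]] by (simp add: infsum_uminus)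
  show ?thesis
    unfolding conv_def
    by (subst infsum_cmult_right'[symmetric], subst S(2)[symmetric], subst e[symmetric])
      (rule infsum_cong, simp add: left_diff_distrib sum_distrib_right mult.assoc)
qed

text \<open>For \<open>m \<ge> 0 \<ge> l\<close> the entry \<open>pole_out a (m - l)\<close> factors
  as \<open>pole_out a m * a powi l\<close>: the Hankel matrix of \<open>1 / (z - a)\<close> has
  rank one, and its functional is evaluation at \<open>a\<close>. In this way the value that the
  residue condition refers to appears.\<close>

lemma conv_pole_out:
  assumes "a \<noteq> 0" and supp: "\<And>m. 0 < m \<Longrightarrow> w m = 0" and "0 \<le> m"
  shows "conv (pole_out a) w m = pole_out a m * lser w a"
proof -
  have "pole_out a (m - l) * w l = pole_out a m * (w l * a powi l)" for l
  proof (cases "0 < l")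
    case False
    then have e: "nat (m - l) + 1 = (nat m + 1) + nat (- l)" using assms(3) by auto
    have "a powi l = inverse a ^ nat (- l)" using False by (cases "l = 0") (auto simp: power_int_def)
    then show ?thesis
      using False assms(3) unfolding pole_out_def by (simp only: e power_add) simp
  qed (simp add: supp)
  then show ?thesis unfolding conv_def lser_def by (simp only: infsum_cmult_right')
qed

text \<open>The mirror image of \<open>conv_pole_out\<close>, with evaluation at a point of the
  disc.\<close>

lemma conv_pole_in:
  assumes "b \<noteq> 0" and supp: "\<And>m. m < 0 \<Longrightarrow> u m = 0" and "m < 0"
  shows "conv (pole_in b) u m = pole_in b m * lser u b"
proof -
  have "pole_in b (m - l) * u l = pole_in b m * (u l * b powi l)" for l
  proof (cases "l < 0")
    case False
    then have e: "nat (- (m - l)) - 1 = (nat (- m) - 1) + nat l" using assms(3) by auto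
    have "b powi l = b ^ nat l" using False by (auto simp: power_int_def)
    then show ?thesis
      using False assms(3) unfolding pole_in_def by (simp only: e power_add) simp
  qed (simp add: supp)
  then show ?thesis unfolding conv_def lser_def by (simp only: infsum_cmult_right')
qed

text \<open>On the circle the conjugate of \<open>1 / (z - a)\<close> has its pole at the reflected
  point \<open>1 / cnj a\<close>, with a factor \<open>(1 / cnj a)\<^sup>2\<close>. This factor is
  the origin of the additional \<open>-2\<close> in the exponent of the second residue condition. At
  \<open>m = 0\<close> there would also be a constant, which the restriction to \<open>m < 0\<close>
  removes.\<close>

lemma cnj_pole_out: "a \<noteq> 0 \<Longrightarrow> m < 0 \<Longrightarrow> cnj (pole_out a (- m)) = - ((1 / cnj a)\<^sup>2 * pole_in (1 / cnj a) m)"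
proof -
  assume "a \<noteq> 0" "m < 0"
  then have e: "nat (- m) + 1 = 2 + (nat (- m) - 1)" by auto
  show ?thesis
    using \<open>m < 0\<close> unfolding pole_out_def pole_in_def by (simp only: e power_add) (simp add: inverse_eq_divide)
qed

text \<open>One row of the problem with poles, written in coefficients. \<open>u\<close> and
  \<open>w\<close> solve the Hankel equations, while \<open>g\<close> and \<open>h\<close> are the
  analytic parts of the first entry outside and of the second entry inside; they take up the
  frequencies on which the Hankel equations impose nothing.\<close>

lemma row_problem:
  fixes e1 e2 :: complex and p C :: "nat \<Rightarrow> complex"
  assumes s: "1 \<le> s" and a: "wt s a" and I: "finite I" "\<And>j. j \<in> I \<Longrightarrow> 1 < norm (p j)"
  obtains u w g h where "wt s u" "wt s w" "wt s g" "wt s h"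
    and "\<And>m. m < 0 \<Longrightarrow> u m = 0" "\<And>m. 0 < m \<Longrightarrow> w m = 0" "\<And>m. 0 < m \<Longrightarrow> g m = 0" "\<And>m. m < 0 \<Longrightarrow> h m = 0"
    and "w 0 = e2" "g 0 = e1"
    and "\<And>z. norm z = 1 \<Longrightarrow> (\<Sum>j\<in>I. C j * lser w (p j) / (z - p j)) + lser g z = lser u z + lser a z * lser w z"
    and "\<And>z. norm z = 1 \<Longrightarrow> lser w z =
      (\<Sum>j\<in>I. cnj (C j) * (1 / cnj (p j))\<^sup>2 * lser u (1 / cnj (p j)) / (z - 1 / cnj (p j))) + lser h z + cnj (lser a z) * lser u z"
proof -
  define b where "b j = 1 / cnj (p j)" for j
  have b: "norm (b j) < 1" "b j \<noteq> 0" "p j \<noteq> 0" if "j \<in> I" for j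
    using I(2)[OF that] by (auto simp: b_def norm_divide divide_less_eq)
  have s0: "0 \<le> s" and s2: "s > 1/2" using s by auto
  define as where "as m = cnj (a (- m))" for m
  have as: "wt s as" unfolding as_def[abs_def] by (intro wt_cnj wt_reflect a)
  have po: "wt s (pole_out (p j))" and pi: "wt s (pole_in (b j))" if "j \<in> I" for j
    using pole_out_wt[OF I(2)[OF that]] pole_in_wt[OF b(1)[OF that] s0] by auto
  \<comment> \<open>Each pole changes the symbol by \<open>- C j / (z - p j)\<close>; on nonnegative
    frequencies this reproduces the polar part with residue
    \<open>C j * lser w (p j)\<close>.\<close>
  define \<alpha> where "\<alpha> m = a m - (\<Sum>j\<in>I. C j * pole_out (p j) m)" for m
  have \<alpha>: "wt s \<alpha>" unfolding \<alpha>_def[abs_def] by (intro wt_diff wt_sum wt_cmult a po)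
  obtain u w where u: "wt s u" and w: "wt s w" and u0: "\<And>m. m < 0 \<Longrightarrow> u m = 0" and w0: "\<And>m. 0 < m \<Longrightarrow> w m = 0"
    and we: "w 0 = e2" and um: "\<And>m. 0 \<le> m \<Longrightarrow> u m = (if m = 0 then e1 else 0) - conv \<alpha> w m"
    and wm: "\<And>m. m < 0 \<Longrightarrow> w m = conv (\<lambda>m. cnj (\<alpha> (- m))) u m"
    by (rule hankel_solve[OF s \<alpha>]) blast
  note sm = wt_summable[OF _ s2]
  \<comment> \<open>At index 0 the Hankel equation for \<open>u\<close> also applies, and there the
    value of \<open>g\<close> must be the normalization \<open>e1\<close>.\<close>
  define g where "g m = (if m \<le> 0 then (if m < 0 then conv a w m else 0) + (if m = 0 then e1 else 0) else 0)" for m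
  define h where "h m = (if 0 \<le> m then w m - conv as u m else 0)" for m
  have g: "wt s g" unfolding g_def[abs_def] by (intro wt_if wt_add wt_delta wt_conv[OF s] a w)
  have h: "wt s h" unfolding h_def[abs_def] by (intro wt_if wt_diff wt_conv[OF s] as u w)
  define D where "D j = C j * lser w (p j)" for j
  define E where "E j = cnj (C j) * (b j)\<^sup>2 * lser u (b j)" for j
  have c1: "conv \<alpha> w m = conv a w m - (\<Sum>j\<in>I. C j * conv (pole_out (p j)) w m)" for m
    unfolding \<alpha>_def[abs_def] by (rule conv_add_scaled) (use a w po sm in auto)
  have eq1: "(\<Sum>j\<in>I. D j * pole_out (p j) m) + g m = u m + conv a w m" for m
  proof (cases "0 \<le> m")
    case True
    have "(\<Sum>j\<in>I. C j * conv (pole_out (p j)) w m) = (\<Sum>j\<in>I. D j * pole_out (p j) m)"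
      by (rule sum.cong) (simp_all add: conv_pole_out[OF b(3) w0 True] D_def)
    then show ?thesis using um[OF True] True by (simp add: c1 g_def)
  next
    case False
    then show ?thesis by (simp add: g_def u0 pole_out_def)
  qed
  have c2: "conv (\<lambda>m. cnj (\<alpha> (- m))) u m = conv as u m + (\<Sum>j\<in>I. E j * pole_in (b j) m)" if m: "m < 0" for m
  proof -
    have "conv (\<lambda>m. cnj (\<alpha> (- m))) u m = conv (\<lambda>m. as m - (\<Sum>j\<in>I. - (cnj (C j) * (b j)\<^sup>2) * pole_in (b j) m)) u m"
      unfolding conv_def
    proof (rule infsum_cong)
      fix l
      show "cnj (\<alpha> (- (m - l))) * u l = (as (m - l) - (\<Sum>j\<in>I. - (cnj (C j) * (b j)\<^sup>2) * pole_in (b j) (m - l))) * u l"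
      proof (cases "l < 0")
        case False
        then have ml: "m - l < 0" using m by simp
        have "cnj (\<alpha> (- (m - l))) = as (m - l) - (\<Sum>j\<in>I. cnj (C j) * cnj (pole_out (p j) (- (m - l))))"
          unfolding \<alpha>_def as_def by simp
        also have "(\<Sum>j\<in>I. cnj (C j) * cnj (pole_out (p j) (- (m - l)))) = (\<Sum>j\<in>I. - (cnj (C j) * (b j)\<^sup>2) * pole_in (b j) (m - l))"
          by (rule sum.cong) (simp_all only: cnj_pole_out[OF b(3) ml] b_def mult_minus_left mult_minus_right mult.assoc)
        finally show ?thesis by simp
      qed (simp add: u0)
    qed
    also have "\<dots> = conv as u m - (\<Sum>j\<in>I. - (cnj (C j) * (b j)\<^sup>2) * conv (pole_in (b j)) u m)"
      by (rule conv_add_scaled) (use as u pi sm in auto)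
    also have "(\<Sum>j\<in>I. - (cnj (C j) * (b j)\<^sup>2) * conv (pole_in (b j)) u m) = - (\<Sum>j\<in>I. E j * pole_in (b j) m)"
      unfolding sum_negf[symmetric]
      by (rule sum.cong) (simp_all add: conv_pole_in[OF b(2) u0 m] E_def)
    finally show ?thesis by simp
  qed
  have eq2: "w m = (\<Sum>j\<in>I. E j * pole_in (b j) m) + h m + conv as u m" for m
  proof (cases "0 \<le> m")
    case True
    then show ?thesis by (simp add: h_def pole_in_def)
  next
    case False
    then show ?thesis using wm[of m] c2[of m] by (simp add: h_def)
  qed
  show thesis
  proof (rule that[OF u w g h u0 w0 _ _ we])
    show "g m = 0" if "0 < m" for m using that by (simp add: g_def)
    show "h m = 0" if "m < 0" for m using that by (simp add: h_def)
    show "g 0 = e1" by (simp add: g_def)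
    fix z :: complex assume z: "norm z = 1"
    have s1: "(\<lambda>m. D j * pole_out (p j) m) summable_on UNIV" "(\<lambda>m. E j * pole_in (b j) m) summable_on UNIV" if "j \<in> I" for j
      by (rule sm, rule wt_cmult, use po pi that in blast)+
    have s3: "(\<lambda>m. \<Sum>j\<in>I. D j * pole_out (p j) m) summable_on UNIV" "(\<lambda>m. \<Sum>j\<in>I. E j * pole_in (b j) m) summable_on UNIV"
      by (rule sm, intro wt_sum wt_cmult, use po pi in blast)+
    have "lser (\<lambda>m. (\<Sum>j\<in>I. D j * pole_out (p j) m) + g m) z = lser (\<lambda>m. u m + conv a w m) z"
      unfolding eq1 ..
    then have "(\<Sum>j\<in>I. D j * lser (pole_out (p j)) z) + lser g z = lser u z + lser a z * lser w z"
      using z by (simp add: lser_add s3 s1 lser_sum sm g u w a conv_lser lser_cmult)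
    moreover have "lser (pole_out (p j)) z = 1 / (z - p j)" if "j \<in> I" for j
      using lser_pole_out[OF I(2)[OF that]] z by simp
    ultimately show "(\<Sum>j\<in>I. C j * lser w (p j) / (z - p j)) + lser g z = lser u z + lser a z * lser w z"
      by (simp add: D_def)
    have "lser w z = lser (\<lambda>m. (\<Sum>j\<in>I. E j * pole_in (b j) m) + h m + conv as u m) z"
      by (rule arg_cong[of _ _ "\<lambda>w. lser w z"]) (rule ext, rule eq2)
    also have "\<dots> = (\<Sum>j\<in>I. E j * lser (pole_in (b j)) z) + lser h z + lser as z * lser u z"
      using z by (simp add: lser_add s3 s1 lser_sum sm summable_on_add h u w as conv_lser lser_cmult)
    also have "(\<Sum>j\<in>I. E j * lser (pole_in (b j)) z) = (\<Sum>j\<in>I. E j / (z - b j))"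
      by (rule sum.cong) (use lser_pole_in[OF b(1)] z in auto)
    also have "lser as z = cnj (lser a z)"
      unfolding as_def[abs_def] using lser_cnj[OF z] by simp
    finally show "lser w z = (\<Sum>j\<in>I. cnj (C j) * (1 / cnj (p j))\<^sup>2 * lser u (1 / cnj (p j)) / (z - 1 / cnj (p j))) + lser h z + cnj (lser a z) * lser u z"
      by (simp add: E_def b_def)
  qed
qed

section \<open>Sectionally holomorphic functions with prescribed polar parts\<close>

lemma simple_pole_sum:
  fixes H :: "complex \<Rightarrow> complex"
  assumes I: "finite I" "i \<in> I" "inj_on q I" and H: "(H \<longlongrightarrow> L) (at (q i))"
  shows "((\<lambda>z. (z - q i) * ((\<Sum>j\<in>I. D j / (z - q j)) + H z)) \<longlongrightarrow> D i) (at (q i))"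
proof -
  have "((\<lambda>z. \<Sum>j\<in>I - {i}. D j / (z - q j)) \<longlongrightarrow> (\<Sum>j\<in>I - {i}. D j / (q i - q j))) (at (q i))"
  proof (rule tendsto_sum)
    fix j assume "j \<in> I - {i}"
    then have "q i - q j \<noteq> 0" using I by (auto simp: inj_on_def)
    then show "((\<lambda>z. D j / (z - q j)) \<longlongrightarrow> D j / (q i - q j)) (at (q i))" by (intro tendsto_intros)
  qed
  from tendsto_add[OF this H] have "((\<lambda>z. D i + (z - q i) * ((\<Sum>j\<in>I - {i}. D j / (z - q j)) + H z)) \<longlongrightarrow>
      D i + (q i - q i) * ((\<Sum>j\<in>I - {i}. D j / (q i - q j)) + L)) (at (q i))"
    by (intro tendsto_add[OF tendsto_const tendsto_mult] tendsto_diff tendsto_const tendsto_ident_at)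
  then have "((\<lambda>z. D i + (z - q i) * ((\<Sum>j\<in>I - {i}. D j / (z - q j)) + H z)) \<longlongrightarrow> D i) (at (q i))" by simp
  then show ?thesis
  proof (rule Lim_transform_eventually)
    have "\<forall>\<^sub>F z in at (q i). z \<noteq> q i" by (simp add: eventually_at_filter)
    then show "\<forall>\<^sub>F z in at (q i). D i + (z - q i) * ((\<Sum>j\<in>I - {i}. D j / (z - q j)) + H z) =
        (z - q i) * ((\<Sum>j\<in>I. D j / (z - q j)) + H z)"
      by eventually_elim (simp add: sum.remove[OF I(1,2)] distrib_left)
  qed
qed

text \<open>The general form of an entry of \<open>M\<close>: residues \<open>D j\<close> at
  \<open>p j\<close> and \<open>E j\<close> at the reflected points, with analytic parts
  \<open>g\<close> outside and \<open>h\<close> inside. On the circle itself the outer formula acts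
  as default value.\<close>

definition two_sided ::
  "nat set \<Rightarrow> (nat \<Rightarrow> complex) \<Rightarrow> (nat \<Rightarrow> complex) \<Rightarrow> (nat \<Rightarrow> complex) \<Rightarrow> (int \<Rightarrow> complex) \<Rightarrow> (int \<Rightarrow> complex) \<Rightarrow>
    complex \<Rightarrow> complex" where
  "two_sided I p D E g h z = (if norm z < 1 then (\<Sum>j\<in>I. E j / (z - 1 / cnj (p j))) + lser h z
     else (\<Sum>j\<in>I. D j / (z - p j)) + lser g z)"

lemma open_norm: "open {z::complex. norm z < 1}" "open {z::complex. 1 < norm z}"
  by (intro open_Collect_less continuous_intros)+

context
  fixes I :: "nat set" and p D E :: "nat \<Rightarrow> complex" and g h :: "int \<Rightarrow> complex" and s :: real
  assumes I: "finite I" "inj_on p I" "\<And>j. j \<in> I \<Longrightarrow> 1 < norm (p j)"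
    and s: "1 \<le> s" and g: "wt s g" "\<And>m. 0 < m \<Longrightarrow> g m = 0" and h: "wt s h" "\<And>m. m < 0 \<Longrightarrow> h m = 0"
begin

private abbreviation "F \<equiv> two_sided I p D E g h"
private abbreviation "b j \<equiv> 1 / cnj (p j)"

private lemma b: "j \<in> I \<Longrightarrow> norm (b j) < 1" "inj_on b I"
proof -
  have p0: "p j \<noteq> 0" if "j \<in> I" for j using I(3)[OF that] by auto
  show "j \<in> I \<Longrightarrow> norm (b j) < 1" using I(3)[of j] by (auto simp: norm_divide divide_less_eq)
  show "inj_on b I"
  proof (rule inj_onI)
    fix i j assume ij: "i \<in> I" "j \<in> I" "b i = b j"
    then have "cnj (p i) = cnj (p j)" using p0 by (simp add: field_simps)
    then show "i = j" using ij I(2) by (simp add: inj_on_def)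
  qed
qed

private lemma gh: "g summable_on UNIV" "h summable_on UNIV"
  using wt_summable[OF g(1)] wt_summable[OF h(1)] s by auto

lemmas two_sided_lser = lser_outside[OF gh(1) g(2)] lser_inside[OF gh(2) h(2)]

private lemma outer_limit: "1 < norm a \<Longrightarrow> (lser g \<longlongrightarrow> lser g a) (at a)"
  using holomorphic_on_imp_continuous_on[OF two_sided_lser(2)] open_norm(2)
  by (simp add: continuous_on_eq_continuous_at isCont_def)

private lemma inner_limit: "norm a < 1 \<Longrightarrow> (lser h \<longlongrightarrow> lser h a) (at a)"
  using holomorphic_on_imp_continuous_on[OF two_sided_lser(5)] open_ball
  by (simp add: continuous_on_eq_continuous_at isCont_def)

private lemma eventually_outer: "1 < norm a \<Longrightarrow> \<forall>\<^sub>F z in at a. (\<Sum>j\<in>I. D j / (z - p j)) + lser g z = F z"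
  using eventually_at_in_open'[OF open_norm(2), of a] by (auto simp: two_sided_def elim!: eventually_mono)

private lemma eventually_inner: "norm a < 1 \<Longrightarrow> \<forall>\<^sub>F z in at a. (\<Sum>j\<in>I. E j / (z - b j)) + lser h z = F z"
  using eventually_at_in_open'[OF open_norm(1), of a] by (auto simp: two_sided_def elim!: eventually_mono)

lemma two_sided_tendsto:
  shows "(\<And>j. j \<in> I \<Longrightarrow> D j = 0) \<Longrightarrow> 1 < norm a \<Longrightarrow> (F \<longlongrightarrow> lser g a) (at a)"
    and "(\<And>j. j \<in> I \<Longrightarrow> E j = 0) \<Longrightarrow> norm a < 1 \<Longrightarrow> (F \<longlongrightarrow> lser h a) (at a)"
proof -
  show "(F \<longlongrightarrow> lser g a) (at a)" if "\<And>j. j \<in> I \<Longrightarrow> D j = 0" "1 < norm a"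
    by (rule Lim_transform_eventually[OF outer_limit[OF that(2)]], rule eventually_mono[OF eventually_outer[OF that(2)]])
      (simp add: that(1))
  show "(F \<longlongrightarrow> lser h a) (at a)" if "\<And>j. j \<in> I \<Longrightarrow> E j = 0" "norm a < 1"
    by (rule Lim_transform_eventually[OF inner_limit[OF that(2)]], rule eventually_mono[OF eventually_inner[OF that(2)]])
      (simp add: that(1))
qed

lemma two_sided_holomorphic: "F holomorphic_on - (sphere 0 1 \<union> (p ` I \<union> b ` I))"
proof -
  define O1 where "O1 = {z. norm z < 1} - b ` I"
  define O2 where "O2 = {z. 1 < norm z} - p ` I"
  have cl: "closed (p ` I)" "closed (b ` I)" using I(1) by (auto intro: finite_imp_closed)
  have o: "open O1" "open O2" unfolding O1_def O2_def using open_norm cl by (auto intro: open_Diff)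
  have "(\<lambda>z. (\<Sum>j\<in>I. E j / (z - b j)) + lser h z) holomorphic_on O1"
    by (intro holomorphic_intros holomorphic_on_subset[OF two_sided_lser(5)]) (auto simp: O1_def)
  then have h1: "F holomorphic_on O1" by (rule holomorphic_transform) (auto simp: O1_def two_sided_def)
  have "(\<lambda>z. (\<Sum>j\<in>I. D j / (z - p j)) + lser g z) holomorphic_on O2"
    by (intro holomorphic_intros holomorphic_on_subset[OF two_sided_lser(2)]) (auto simp: O2_def)
  then have h2: "F holomorphic_on O2" by (rule holomorphic_transform) (auto simp: O2_def two_sided_def)
  have "F holomorphic_on O1 \<union> O2" by (rule holomorphic_on_Un[OF h1 h2 o])
  moreover have "- (sphere 0 1 \<union> (p ` I \<union> b ` I)) \<subseteq> O1 \<union> O2"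
    by (auto simp: O1_def O2_def not_less)
  ultimately show ?thesis by (rule holomorphic_on_subset)
qed

lemma two_sided_poles:
  assumes j: "j \<in> I"
  shows "((\<lambda>z. (z - p j) * F z) \<longlongrightarrow> D j) (at (p j))" and "((\<lambda>z. (z - b j) * F z) \<longlongrightarrow> E j) (at (b j))"
proof -
  show "((\<lambda>z. (z - p j) * F z) \<longlongrightarrow> D j) (at (p j))"
    by (rule Lim_transform_eventually[OF simple_pole_sum[OF I(1) j I(2) outer_limit[OF I(3)[OF j]]]])
      (rule eventually_mono[OF eventually_outer[OF I(3)[OF j]]], simp)
  show "((\<lambda>z. (z - b j) * F z) \<longlongrightarrow> E j) (at (b j))"
    by (rule Lim_transform_eventually[OF simple_pole_sum[OF I(1) j b(2) inner_limit[OF b(1)[OF j]]]])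
      (rule eventually_mono[OF eventually_inner[OF b(1)[OF j]]], simp)
qed

lemma two_sided_at_most_simple_pole: "a \<in> p ` I \<union> b ` I \<Longrightarrow> at_most_simple_pole F a"
  unfolding at_most_simple_pole_def using two_sided_poles by blast

lemma two_sided_residue:
  assumes j: "j \<in> I"
  shows "residue F (p j) = D j" and "residue F (b j) = E j"
proof -
  define O1 where "O1 = {z. norm z < 1} - b ` (I - {j})"
  define O2 where "O2 = {z. 1 < norm z} - p ` (I - {j})"
  have cl: "closed (p ` (I - {j}))" "closed (b ` (I - {j}))" using I(1) by (auto intro: finite_imp_closed)
  have o: "open O1" "open O2" unfolding O1_def O2_def using open_norm cl by (auto intro: open_Diff)
  have m: "b j \<in> O1" "p j \<in> O2" unfolding O1_def O2_def using b I j by (auto simp: inj_on_def)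
  have "F holomorphic_on O1 - {b j}" "F holomorphic_on O2 - {p j}"
    by (rule holomorphic_on_subset[OF two_sided_holomorphic], use I(3) b(1) in \<open>fastforce simp: O1_def O2_def\<close>)+
  then show "residue F (p j) = D j" "residue F (b j) = E j"
    using residue_simple'[OF o(1) m(1)] residue_simple'[OF o(2) m(2)] two_sided_poles[OF j] by (simp_all add: mult.commute)
qed

lemma two_sided_at_infinity: "(F \<longlongrightarrow> g 0) at_infinity"
proof -
  have "((\<lambda>z. D j / (z - p j)) \<longlongrightarrow> 0) at_infinity" for j
    unfolding diff_conv_add_uminus
    by (rule tendsto_divide_0[OF tendsto_const tendsto_add_filterlim_at_infinity'[OF filterlim_ident tendsto_const]])
  then have "((\<lambda>z. (\<Sum>j\<in>I. D j / (z - p j)) + lser g z) \<longlongrightarrow> (\<Sum>j\<in>I. 0) + g 0) at_infinity"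
    by (intro tendsto_add tendsto_sum two_sided_lser(3))
  then have "((\<lambda>z. (\<Sum>j\<in>I. D j / (z - p j)) + lser g z) \<longlongrightarrow> g 0) at_infinity" by simp
  then show ?thesis
    by (rule Lim_transform_eventually) (auto simp: eventually_at_infinity two_sided_def intro!: exI[of _ 1])
qed

lemma two_sided_limits:
  assumes z: "norm z = 1"
  shows "(F \<longlongrightarrow> (\<Sum>j\<in>I. D j / (z - p j)) + lser g z) (at z within {w. norm w > 1})"
    and "(F \<longlongrightarrow> (\<Sum>j\<in>I. E j / (z - b j)) + lser h z) (at z within {w. norm w < 1})"
proof -
  have zp: "z - p j \<noteq> 0" "z - b j \<noteq> 0" if "j \<in> I" for j using I(3)[OF that] b(1)[OF that] z by auto
  have "(lser g \<longlongrightarrow> lser g z) (at z within {w. norm w > 1})"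
    by (rule tendsto_within_subset[OF continuous_on_def[THEN iffD1, rule_format, OF two_sided_lser(1)]]) (use z in auto)
  then have "((\<lambda>z. (\<Sum>j\<in>I. D j / (z - p j)) + lser g z) \<longlongrightarrow> (\<Sum>j\<in>I. D j / (z - p j)) + lser g z) (at z within {w. norm w > 1})"
    by (intro tendsto_intros zp)
  then show "(F \<longlongrightarrow> (\<Sum>j\<in>I. D j / (z - p j)) + lser g z) (at z within {w. norm w > 1})"
    by (rule Lim_transform_eventually) (auto simp: eventually_at_filter two_sided_def)
  have "(lser h \<longlongrightarrow> lser h z) (at z within {w. norm w < 1})"
    by (rule tendsto_within_subset[OF continuous_on_def[THEN iffD1, rule_format, OF two_sided_lser(4)]]) (use z in auto)
  then have "((\<lambda>z. (\<Sum>j\<in>I. E j / (z - b j)) + lser h z) \<longlongrightarrow> (\<Sum>j\<in>I. E j / (z - b j)) + lser h z) (at z within {w. norm w < 1})"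
    by (intro tendsto_intros zp)
  then show "(F \<longlongrightarrow> (\<Sum>j\<in>I. E j / (z - b j)) + lser h z) (at z within {w. norm w < 1})"
    by (rule Lim_transform_eventually) (auto simp: eventually_at_filter two_sided_def)
qed

lemma two_sided_sobolev:
  assumes k: "s = real k" and f1: "\<And>z. norm z = 1 \<Longrightarrow> f1 z = (\<Sum>j\<in>I. D j / (z - p j)) + lser g z"
    and f2: "\<And>z. norm z = 1 \<Longrightarrow> f2 z = (\<Sum>j\<in>I. E j / (z - b j)) + lser h z"
  shows "sobolev_param k unit_circle (f1 \<circ> unit_circle)" and "sobolev_param k unit_circle (f2 \<circ> unit_circle)"
proof -
  have k1: "1 \<le> k" using k s by simp
  have s0: "0 \<le> s" "1/2 < s" using s by auto
  have w: "wt s (pole_out (p j))" "wt s (pole_in (b j))" if "j \<in> I" for j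
    using pole_out_wt[OF I(3)[OF that]] pole_in_wt[OF b(1)[OF that] s0(1)] by auto
  have W1: "wt s (\<lambda>m. \<Sum>j\<in>I. D j * pole_out (p j) m)" and W2: "wt s (\<lambda>m. \<Sum>j\<in>I. E j * pole_in (b j) m)"
    by (rule wt_sum, rule wt_cmult, use w in blast)+
  have S1: "(\<lambda>m. D j * pole_out (p j) m) summable_on UNIV" and S2: "(\<lambda>m. E j * pole_in (b j) m) summable_on UNIV" if "j \<in> I" for j
    using wt_summable[OF wt_cmult[OF w(1)[OF that]] s0(2)] wt_summable[OF wt_cmult[OF w(2)[OF that]] s0(2)] by blast+
  show "sobolev_param k unit_circle (f1 \<circ> unit_circle)"
  proof (rule sobolev_param_lser[OF _ k1])
    show "wt (real k) (\<lambda>m. (\<Sum>j\<in>I. D j * pole_out (p j) m) + g m)" unfolding k[symmetric] by (intro wt_add W1 g)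
    fix z :: complex assume z: "norm z = 1"
    have "(\<Sum>j\<in>I. D j / (z - p j)) = (\<Sum>j\<in>I. D j * lser (pole_out (p j)) z)"
      by (rule sum.cong) (use lser_pole_out I(3) z in auto)
    then show "f1 z = lser (\<lambda>m. (\<Sum>j\<in>I. D j * pole_out (p j) m) + g m) z"
      using z by (simp add: f1 lser_add lser_sum lser_cmult S1 wt_summable[OF W1 s0(2)] gh)
  qed
  show "sobolev_param k unit_circle (f2 \<circ> unit_circle)"
  proof (rule sobolev_param_lser[OF _ k1])
    show "wt (real k) (\<lambda>m. (\<Sum>j\<in>I. E j * pole_in (b j) m) + h m)" unfolding k[symmetric] by (intro wt_add W2 h)
    fix z :: complex assume z: "norm z = 1"
    have "(\<Sum>j\<in>I. E j / (z - b j)) = (\<Sum>j\<in>I. E j * lser (pole_in (b j)) z)"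
      by (rule sum.cong) (use lser_pole_in b(1) z in auto)
    then show "f2 z = lser (\<lambda>m. (\<Sum>j\<in>I. E j * pole_in (b j) m) + h m) z"
      using z by (simp add: f2 lser_add lser_sum lser_cmult S2 wt_summable[OF W2 s0(2)] gh)
  qed
qed

end

section \<open>Solution of the problem with poles, row by row\<close>

lemma mat2_nth [simp]:
  "mat2 a b c d $ 1 $ 1 = a" "mat2 a b c d $ 1 $ 2 = b" "mat2 a b c d $ 2 $ 1 = c" "mat2 a b c d $ 2 $ 2 = d"
  by (simp_all add: mat2_def)

lemma mat_mult_nth2: "(A ** B) $ i $ l = A $ i $ 1 * B $ 1 $ l + A $ i $ 2 * B $ 2 $ (l :: 2)" for A B :: "complex^2^2"
  by (simp add: matrix_matrix_mult_def sum_2)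

lemma mat1_eq: "mat 1 = mat2 1 0 0 1"
  by (simp add: vec_eq_iff forall_2 mat_def)

text \<open>Jump and residue matrices act from the right, so the rows of \<open>M\<close> decouple.
  Each row solves this vector problem, with the corresponding row of the identity as its value
  \<open>e\<close> at infinity.\<close>

definition row_sol ::
  "nat \<Rightarrow> int \<Rightarrow> (complex \<Rightarrow> complex) \<Rightarrow> nat \<Rightarrow> (nat \<Rightarrow> complex) \<Rightarrow> (nat \<Rightarrow> complex) \<Rightarrow> (2 \<Rightarrow> complex) \<Rightarrow>
    (2 \<Rightarrow> complex \<Rightarrow> complex) \<Rightarrow> (2 \<Rightarrow> complex \<Rightarrow> complex) \<Rightarrow> (2 \<Rightarrow> complex \<Rightarrow> complex) \<Rightarrow> bool" where
  "row_sol k n r J p c e F Fp Fm \<longleftrightarrow>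
    (\<forall>l. F l holomorphic_on - (sphere 0 1 \<union> poles J p)) \<and>
    (\<forall>a\<in>poles J p. \<forall>l. at_most_simple_pole (F l) a) \<and>
    (\<forall>l. sobolev_param k unit_circle (Fp l \<circ> unit_circle) \<and> sobolev_param k unit_circle (Fm l \<circ> unit_circle)) \<and>
    (\<forall>z\<in>sphere 0 1. \<forall>l. (F l \<longlongrightarrow> Fp l z) (at z within {w. norm w > 1}) \<and> (F l \<longlongrightarrow> Fm l z) (at z within {w. norm w < 1}) \<and>
       Fp l z = Fm 1 z * jump_V n r z $ 1 $ l + Fm 2 z * jump_V n r z $ 2 $ l) \<and>
    (\<forall>j\<in>{1..J}. ((\<lambda>z. F 2 z * (p j powi (-2*n) * c j)) \<longlongrightarrow> residue (F 1) (p j)) (at (p j)) \<and> residue (F 2) (p j) = 0) \<and>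
    (\<forall>j\<in>{1..J}. ((\<lambda>z. F 1 z * (cnj (p j) powi (-2*n - 2) * cnj (c j))) \<longlongrightarrow> residue (F 2) (1 / cnj (p j))) (at (1 / cnj (p j))) \<and>
       residue (F 1) (1 / cnj (p j)) = 0) \<and>
    (\<forall>l. (F l \<longlongrightarrow> e l) at_infinity)"

lemma row_solution:
  fixes p c :: "nat \<Rightarrow> complex"
  assumes k: "1 \<le> k" and r: "r \<in> Hsob k {unit_circle}" and inj: "inj_on p {1..J}"
    and p: "\<And>j. j \<in> {1..J} \<Longrightarrow> 1 < norm (p j)"
  shows "\<exists>F Fp Fm. row_sol k n r J p c e F Fp Fm"
proof -
  have k': "1 \<le> real k" using k by simp
  have "sobolev_param k (pole_circle 0 1) (r \<circ> pole_circle 0 1)"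
    using r by (simp add: Hsob_def unit_circle_eq)
  then obtain x where x: "wt (real k) x" "\<And>z. norm z = 1 \<Longrightarrow> r z = lser x z"
    using sobolev_pole_circle_lser[of 1 k 0 r, OF _ _ k] by auto
  \<comment> \<open>The coefficients of the symbol \<open>z powi (-2*n) * r z\<close>; the shift by
    the fixed amount \<open>2 * n\<close> keeps the weight.\<close>
  define a where "a m = x (m + 2 * n)" for m
  have a: "wt (real k) a" unfolding a_def[abs_def] by (rule wt_shift[OF x(1)]) simp
  have la: "lser a z = z powi (-2*n) * r z" if "norm z = 1" for z
    unfolding a_def[abs_def] using lser_shift[OF that, of x "2 * n"] x(2)[OF that] by simp
  define C where "C j = p j powi (-2*n) * c j" for j
  define I where "I = {1..J}"
  have I: "finite I" "inj_on p I" and pI: "\<And>j. j \<in> I \<Longrightarrow> 1 < norm (p j)" using inj p by (auto simp: I_def)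
  obtain u w g h where wt: "wt (real k) u" "wt (real k) w" "wt (real k) g" "wt (real k) h"
    and supp: "\<And>m. m < 0 \<Longrightarrow> u m = 0" "\<And>m. 0 < m \<Longrightarrow> w m = 0" "\<And>m. 0 < m \<Longrightarrow> g m = 0" "\<And>m. m < 0 \<Longrightarrow> h m = 0"
    and ini: "w 0 = e 2" "g 0 = e 1"
    and j1: "\<And>z. norm z = 1 \<Longrightarrow> (\<Sum>j\<in>I. C j * lser w (p j) / (z - p j)) + lser g z = lser u z + lser a z * lser w z"
    and j2: "\<And>z. norm z = 1 \<Longrightarrow> lser w z =
      (\<Sum>j\<in>I. cnj (C j) * (1 / cnj (p j))\<^sup>2 * lser u (1 / cnj (p j)) / (z - 1 / cnj (p j))) + lser h z + cnj (lser a z) * lser u z"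
    by (rule row_problem[OF k' a I(1) pI, where ?e1.0 = "e 1" and ?e2.0 = "e 2" and C = C]) (assumption, rule that, assumption+)
  define D where "D j = C j * lser w (p j)" for j
  define E where "E j = cnj (C j) * (1 / cnj (p j))\<^sup>2 * lser u (1 / cnj (p j))" for j
  \<comment> \<open>The first entry has poles outside only and equals \<open>u\<close> inside; the
    second has poles inside only and equals \<open>w\<close> outside.\<close>
  define F1 where "F1 = two_sided I p D (\<lambda>_. 0) g u"
  define F2 where "F2 = two_sided I p (\<lambda>_. 0) E w h"
  define p1 where "p1 z = (\<Sum>j\<in>I. D j / (z - p j)) + lser g z" for z
  define m1 where "m1 z = (\<Sum>j\<in>I. (0::complex) / (z - 1 / cnj (p j))) + lser u z" for z
  define p2 where "p2 z = (\<Sum>j\<in>I. (0::complex) / (z - p j)) + lser w z" for z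
  define m2 where "m2 z = (\<Sum>j\<in>I. E j / (z - 1 / cnj (p j))) + lser h z" for z
  note A1 = I(1) I(2) pI k' wt(3) supp(3) wt(1) supp(1)
  note A2 = I(1) I(2) pI k' wt(2) supp(2) wt(4) supp(4)
  have po: "poles J p = p ` I \<union> (\<lambda>j. 1 / cnj (p j)) ` I" by (simp add: poles_def I_def)
  have "F1 holomorphic_on - (sphere 0 1 \<union> poles J p)" "F2 holomorphic_on - (sphere 0 1 \<union> poles J p)"
    unfolding F1_def F2_def po by (rule two_sided_holomorphic[OF A1], assumption+) (rule two_sided_holomorphic[OF A2], assumption+)
  moreover have "at_most_simple_pole F1 a" "at_most_simple_pole F2 a" if "a \<in> poles J p" for a
    unfolding F1_def F2_def
     by (rule two_sided_at_most_simple_pole[OF A1 that[unfolded po]], assumption+) (rule two_sided_at_most_simple_pole[OF A2 that[unfolded po]], assumption+)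
  moreover have "sobolev_param k unit_circle (p1 \<circ> unit_circle)" "sobolev_param k unit_circle (m1 \<circ> unit_circle)"
     by (rule two_sided_sobolev[OF A1 refl p1_def m1_def], assumption+)+
  moreover have "sobolev_param k unit_circle (p2 \<circ> unit_circle)" "sobolev_param k unit_circle (m2 \<circ> unit_circle)"
     by (rule two_sided_sobolev[OF A2 refl p2_def m2_def], assumption+)+
  moreover have "(F1 \<longlongrightarrow> p1 z) (at z within {w. norm w > 1})" "(F1 \<longlongrightarrow> m1 z) (at z within {w. norm w < 1})"
    "(F2 \<longlongrightarrow> p2 z) (at z within {w. norm w > 1})" "(F2 \<longlongrightarrow> m2 z) (at z within {w. norm w < 1})" if "norm z = 1" for z
    unfolding F1_def F2_def p1_def p2_def m1_def m2_def
    by (rule two_sided_limits(1)[OF A1 that] two_sided_limits(2)[OF A1 that] two_sided_limits(1)[OF A2 that] two_sided_limits(2)[OF A2 that], assumption+)+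
  moreover have "p1 z = m1 z * (1 + of_real ((norm (r z))\<^sup>2)) + m2 z * (z powi (-2*n) * r z)"
    "p2 z = m1 z * (z powi (2*n) * cnj (r z)) + m2 z" if z: "norm z = 1" for z
  proof -
    define A where "A = lser a z"
    have A: "A = z powi (-2*n) * r z" using la[OF z] by (simp add: A_def)
    have z0: "z \<noteq> 0" and cz: "cnj z = inverse z" using z by (auto simp: divide_conv_cnj inverse_eq_divide)
    have "cnj (z powi (-2*n)) = cnj z powi (-2*n)" by (simp add: power_int_def)
    also have "\<dots> = z powi (2*n)" using z0 by (simp add: cz power_int_minus power_int_inverse)
    finally have cA: "cnj A = z powi (2*n) * cnj (r z)" by (simp add: A)
    have nA: "of_real ((norm (r z))\<^sup>2) = A * cnj A"
      unfolding complex_norm_square[symmetric] using z by (simp add: A norm_mult norm_power_int)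
    \<comment> \<open>The two relations of \<open>row_problem\<close> are the triangular factors of
      the jump matrix. Inserting the second into the first produces the entry
      \<open>1 + of_real ((norm (r z))\<^sup>2)\<close>.\<close>
    have e1: "p1 z = m1 z + A * p2 z" and e2: "p2 z = m2 z + cnj A * m1 z"
      using j1[OF z] j2[OF z] by (simp_all add: p1_def p2_def m1_def m2_def D_def E_def A_def)
    show "p2 z = m1 z * (z powi (2*n) * cnj (r z)) + m2 z" unfolding cA[symmetric] e2 by simp
    show "p1 z = m1 z * (1 + of_real ((norm (r z))\<^sup>2)) + m2 z * (z powi (-2*n) * r z)"
      unfolding A[symmetric] nA e1 e2 by (simp add: algebra_simps)
  qed
  moreover have "residue F1 (p j) = D j" "residue F1 (1 / cnj (p j)) = 0" "residue F2 (p j) = 0" "residue F2 (1 / cnj (p j)) = E j"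
    if "j \<in> I" for j
    unfolding F1_def F2_def
    by (rule two_sided_residue(1)[OF A1 that] two_sided_residue(2)[OF A1 that] two_sided_residue(1)[OF A2 that] two_sided_residue(2)[OF A2 that], assumption+)+
  moreover have "((\<lambda>z. F2 z * C j) \<longlongrightarrow> D j) (at (p j))" 
    "((\<lambda>z. F1 z * (cnj (p j) powi (-2*n - 2) * cnj (c j))) \<longlongrightarrow> E j) (at (1 / cnj (p j)))" if j: "j \<in> I" for j
  proof -
    have "(F2 \<longlongrightarrow> lser w (p j)) (at (p j))"
      unfolding F2_def by (rule two_sided_tendsto(1)[OF A2 refl pI[OF j]], assumption+)
    from tendsto_mult_right[OF this, of "C j"] show "((\<lambda>z. F2 z * C j) \<longlongrightarrow> D j) (at (p j))" by (simp add: D_def mult.commute)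
    have p0: "p j \<noteq> 0" "norm (1 / cnj (p j)) < 1" using pI[OF j] by (auto simp: norm_divide divide_less_eq)
    have "cnj (p j) powi (-2*n - 2) = cnj (p j) powi (-2*n) / (cnj (p j))\<^sup>2"
      using p0(1) by (subst power_int_diff) auto
    moreover have "cnj (C j) = cnj (p j) powi (-2*n) * cnj (c j)" by (simp add: C_def power_int_def)
    ultimately have e: "cnj (p j) powi (-2*n - 2) * cnj (c j) = cnj (C j) * (1 / cnj (p j))\<^sup>2" by (simp add: power_divide)
    have "(F1 \<longlongrightarrow> lser u (1 / cnj (p j))) (at (1 / cnj (p j)))"
      unfolding F1_def by (rule two_sided_tendsto(2)[OF A1 refl p0(2)], assumption+)
    from tendsto_mult_right[OF this, of "cnj (C j) * (1 / cnj (p j))\<^sup>2"]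
    show "((\<lambda>z. F1 z * (cnj (p j) powi (-2*n - 2) * cnj (c j))) \<longlongrightarrow> E j) (at (1 / cnj (p j)))"
      unfolding e by (simp add: E_def mult.commute)
  qed
  moreover have "(F1 \<longlongrightarrow> e 1) at_infinity" "(F2 \<longlongrightarrow> e 2) at_infinity"
    unfolding F1_def F2_def ini[symmetric] by (rule two_sided_at_infinity[OF A1], assumption+) (rule two_sided_at_infinity[OF A2], assumption+)
  ultimately show ?thesis
    unfolding row_sol_def
    by (intro exI[of _ "\<lambda>l. if l = 1 then F1 else F2"] exI[of _ "\<lambda>l. if l = 1 then p1 else p2"] exI[of _ "\<lambda>l. if l = 1 then m1 else m2"])
      (simp add: forall_2 jump_V_def C_def I_def)
qed

lemma rhp_poles_exists:
  assumes k: "1 \<le> k" and r: "r \<in> Hsob k {unit_circle}" and inj: "inj_on p {1..J}"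
    and p: "\<And>j. j \<in> {1..J} \<Longrightarrow> 1 < norm (p j)"
  shows "\<exists>M. rhp_poles_solution k n r J p c M"
proof -
  have "\<forall>i::2. \<exists>F Fp Fm. row_sol k n r J p c (\<lambda>l. if i = l then 1 else 0) F Fp Fm"
    by (rule allI, rule row_solution[OF assms])
  then obtain F Fp Fm where "\<And>i. row_sol k n r J p c (\<lambda>l. if i = l then 1 else 0) (F i) (Fp i) (Fm i)"
    by metis
  note R = this[unfolded row_sol_def]
  have hol: "F i l holomorphic_on - (sphere 0 1 \<union> poles J p)" for i l using R[of i] by (elim conjE) blast
  have pol: "at_most_simple_pole (F i l) a" if "a \<in> poles J p" for i l a using R[of i] that by (elim conjE) blast
  have sob: "sobolev_param k unit_circle (Fp i l \<circ> unit_circle)" "sobolev_param k unit_circle (Fm i l \<circ> unit_circle)" for i l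
    using R[of i] by (elim conjE, blast)+
  have lim: "(F i l \<longlongrightarrow> Fp i l z) (at z within {w. norm w > 1})" "(F i l \<longlongrightarrow> Fm i l z) (at z within {w. norm w < 1})"
    and jump: "Fp i l z = Fm i 1 z * jump_V n r z $ 1 $ l + Fm i 2 z * jump_V n r z $ 2 $ l" if "z \<in> sphere 0 1" for i l z
    using R[of i] that by (elim conjE, blast)+
  have res: "((\<lambda>z. F i 2 z * (p j powi (-2*n) * c j)) \<longlongrightarrow> residue (F i 1) (p j)) (at (p j))"
    "residue (F i 2) (p j) = 0"
    "((\<lambda>z. F i 1 z * (cnj (p j) powi (-2*n - 2) * cnj (c j))) \<longlongrightarrow> residue (F i 2) (1 / cnj (p j))) (at (1 / cnj (p j)))"
    "residue (F i 1) (1 / cnj (p j)) = 0" if "j \<in> {1..J}" for i j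
    using R[of i] that by (elim conjE, blast)+
  have inf: "(F i l \<longlongrightarrow> (if i = l then 1 else 0)) at_infinity" for i l using R[of i] by (elim conjE) blast
  define M :: "complex \<Rightarrow> complex^2^2" where "M z = (\<chi> i l. F i l z)" for z
  define Mp :: "complex \<Rightarrow> complex^2^2" where "Mp z = (\<chi> i l. Fp i l z)" for z
  define Mm :: "complex \<Rightarrow> complex^2^2" where "Mm z = (\<chi> i l. Fm i l z)" for z
  have rs: "regular_speed unit_circle" using regular_speed_pole_circle[of 1 0] by (simp add: unit_circle_eq)
  have "rhp_poles_solution k n r J p c M"
    unfolding rhp_poles_solution_def
  proof (intro conjI)
    show "holomorphic_mat_on M (- (sphere 0 1 \<union> poles J p))" using hol by (simp add: holomorphic_mat_on_def M_def)
    show "\<forall>a\<in>poles J p. \<forall>i l. at_most_simple_pole (\<lambda>z. M z $ i $ l) a" using pol by (simp add: M_def)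
    show "\<exists>Mp Mm. Mp \<in> Hsob k {unit_circle} \<and> Mm \<in> Hsob k {unit_circle} \<and>
        (\<forall>z\<in>sphere 0 1. (M \<longlongrightarrow> Mp z) (at z within {w. norm w > 1}) \<and> (M \<longlongrightarrow> Mm z) (at z within {w. norm w < 1}) \<and>
                        Mp z = Mm z ** jump_V n r z)"
    proof (intro exI conjI ballI)
      show "Mp \<in> Hsob k {unit_circle}" "Mm \<in> Hsob k {unit_circle}"
        using sob by (simp_all add: Hsob_def sobolev_param_matrix[OF rs] Mp_def Mm_def o_def)
      fix z :: complex assume z: "z \<in> sphere 0 1"
      show "(M \<longlongrightarrow> Mp z) (at z within {w. norm w > 1})" "(M \<longlongrightarrow> Mm z) (at z within {w. norm w < 1})"
        unfolding mat_tendsto_iff using lim[OF z] by (simp_all add: M_def Mp_def Mm_def)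
      show "Mp z = Mm z ** jump_V n r z"
        unfolding vec_eq_iff mat_mult_nth2 using jump[OF z] by (simp add: Mp_def Mm_def)
    qed
    show "\<forall>j\<in>{1..J}. ((\<lambda>z. M z ** mat2 0 0 (p j powi (-2*n) * c j) 0) \<longlongrightarrow> residue_mat M (p j)) (at (p j))"
      unfolding mat_tendsto_iff mat_mult_nth2 using res(1,2) by (simp add: forall_2 M_def residue_mat_def)
    show "\<forall>j\<in>{1..J}. ((\<lambda>z. M z ** mat2 0 (cnj (p j) powi (-2*n - 2) * cnj (c j)) 0 0)
           \<longlongrightarrow> residue_mat M (1 / cnj (p j))) (at (1 / cnj (p j)))"
      unfolding mat_tendsto_iff mat_mult_nth2 using res(3,4) by (simp add: forall_2 M_def residue_mat_def)
    show "(M \<longlongrightarrow> mat 1) at_infinity"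
      unfolding mat_tendsto_iff using inf by (simp add: forall_2 M_def mat_def)
  qed
  then show ?thesis by blast
qed

subsection \<open>From poles to jumps\<close>

text \<open>\<open>h\<close> has residue 0 at an at most simple pole and therefore extends across
  \<open>a\<close>. The residue condition says that the residue of \<open>f\<close> is
  \<open>C\<close> times the value of this extension, so subtracting \<open>C / (z - a)\<close>
  times \<open>h\<close> removes the pole of \<open>f\<close>.\<close>

lemma simple_pole_pair:
  assumes S: "open S" "a \<in> S" and f: "f holomorphic_on S - {a}" and h: "h holomorphic_on S - {a}"
    and pf: "at_most_simple_pole f a" and ph: "at_most_simple_pole h a"
    and rh: "residue h a = 0" and rf: "((\<lambda>z. h z * C) \<longlongrightarrow> residue f a) (at a)"
  shows "\<exists>g. g holomorphic_on S \<and> (\<forall>z\<in>S - {a}. g z = h z)"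
    and "\<exists>g. g holomorphic_on S \<and> (\<forall>z\<in>S - {a}. g z = f z + h z * (- (C / (z - a))))"
proof -
  have res: "((\<lambda>z. (z - a) * f z) \<longlongrightarrow> residue f a) (at a)" if f: "f holomorphic_on S - {a}" and pf: "at_most_simple_pole f a" for f
  proof -
    obtain L where L: "((\<lambda>z. (z - a) * f z) \<longlongrightarrow> L) (at a)" using pf by (auto simp: at_most_simple_pole_def)
    then have "residue f a = L" by (intro residue_simple'[OF S f]) (simp add: mult.commute)
    then show ?thesis using L by simp
  qed
  have i: "a \<in> interior S" using S by (simp add: interior_open)
  show "\<exists>g. g holomorphic_on S \<and> (\<forall>z\<in>S - {a}. g z = h z)"
    using holomorphic_on_extend_lim[OF h i] res[OF h ph] rh by simp
  have "((\<lambda>z. (z - a) * f z - h z * C) \<longlongrightarrow> residue f a - residue f a) (at a)"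
    by (intro tendsto_diff res[OF f pf] rf)
  then have "((\<lambda>z. (z - a) * f z - h z * C) \<longlongrightarrow> 0) (at a)" by simp
  moreover have "\<forall>\<^sub>F z in at a. (z - a) * f z - h z * C = (z - a) * (f z + h z * (- (C / (z - a))))"
    by (auto simp: eventually_at_filter right_diff_distrib distrib_left)
  ultimately have "((\<lambda>z. (z - a) * (f z + h z * (- (C / (z - a))))) \<longlongrightarrow> 0) (at a)"
    by (rule Lim_transform_eventually)
  moreover have "(\<lambda>z. f z + h z * (- (C / (z - a)))) holomorphic_on S - {a}"
    by (intro holomorphic_intros f h) auto
  ultimately show "\<exists>g. g holomorphic_on S \<and> (\<forall>z\<in>S - {a}. g z = f z + h z * (- (C / (z - a))))"
    using holomorphic_on_extend_lim[OF _ i] by blast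
qed

lemma tendsto_local:
  assumes "(F \<longlongrightarrow> L) (at z within S)" and N: "open N" "z \<in> N" and "A \<inter> N \<subseteq> S" and eq: "\<And>w. w \<in> A \<inter> N \<Longrightarrow> F w = m w"
  shows "(m \<longlongrightarrow> L) (at z within A)"
proof -
  have ev: "\<forall>\<^sub>F w in at z within A. w \<in> A \<inter> N"
    using N by (auto simp: eventually_at_filter eventually_nhds)
  have "(F \<longlongrightarrow> L) (at z within A)"
    by (rule tendsto_within_eventually[OF assms(1)]) (rule eventually_mono[OF ev], use assms(4) in blast)
  then show ?thesis by (rule Lim_transform_eventually) (rule eventually_mono[OF ev], rule eq)
qed

context pole_data
begin

abbreviation "q j \<equiv> 1 / cnj (p j)"

lemma pole_in_ball:
  assumes j: "j \<in> {1..J}"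
  shows "p j \<in> ball (p j) (\<epsilon> j)" "p j \<in> cball (p j) (\<epsilon> j)" "q j \<in> ball (b j) (s j)" "q j \<in> cball (b j) (s j)" "1 < norm (p j)"
proof -
  show pb: "p j \<in> ball (p j) (\<epsilon> j)" "p j \<in> cball (p j) (\<epsilon> j)" using eps[OF j] by auto
  then show n: "1 < norm (p j)" using norm_outer[OF j] by blast
  then have "q j \<noteq> 0" by auto
  then show "q j \<in> ball (b j) (s j)" "q j \<in> cball (b j) (s j)"
    using inversion_ball[OF eps[OF j] eps_less[OF j], of "q j"] pb by simp_all
qed

lemma poles_eq: "poles J p = p ` {1..J} \<union> q ` {1..J}"
  by (simp add: poles_def)

abbreviation "U \<equiv> - (sphere 0 1 \<union> poles J p)"

lemma open_U: "open U"
proof -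
  have "finite (poles J p)" by (simp add: poles_eq)
  then have "closed (sphere 0 1 \<union> poles J p)" by (intro closed_Un finite_imp_closed closed_sphere)
  then show ?thesis by (rule open_Compl)
qed

lemma U_I: "norm w \<noteq> 1 \<Longrightarrow> (\<And>i. i \<in> {1..J} \<Longrightarrow> w \<noteq> p i) \<Longrightarrow> (\<And>i. i \<in> {1..J} \<Longrightarrow> w \<noteq> q i) \<Longrightarrow> w \<in> U"
  unfolding poles_eq by (simp only: Compl_iff Un_iff mem_sphere_0) blast

lemma outer_sub_U:
  assumes j: "j \<in> {1..J}"
  shows "cball (p j) (\<epsilon> j) - {p j} \<subseteq> U" and "sphere (p j) (\<epsilon> j) \<subseteq> U"
proof -
  have "w \<in> U" if w: "w \<in> cball (p j) (\<epsilon> j)" "w \<noteq> p j" for w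
  proof -
    have "w \<noteq> p i" if "i \<in> {1..J}" for i using disjoint_outer[OF that j, of w] pole_in_ball[OF that] w by auto
    moreover have "w \<noteq> q i" if "i \<in> {1..J}" for i using disjoint_mixed[OF j that w(1)] pole_in_ball[OF that] by auto
    ultimately show ?thesis by (intro U_I) (use norm_outer[OF j w(1)] in auto)
  qed
  then show "cball (p j) (\<epsilon> j) - {p j} \<subseteq> U" "sphere (p j) (\<epsilon> j) \<subseteq> U" using eps[OF j] sphere_cballD by fastforce+
qed

lemma inner_sub_U:
  assumes j: "j \<in> {1..J}"
  shows "cball (b j) (s j) - {q j} \<subseteq> U" and "sphere (b j) (s j) \<subseteq> U"
proof -
  have *: "w \<in> U" if w: "w \<in> cball (b j) (s j)" "w \<noteq> q j" for w
  proof -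
    have "w \<noteq> q i" if "i \<in> {1..J}" for i using disjoint_inner[OF that j, of w] pole_in_ball[OF that] w by auto
    moreover have "w \<noteq> p i" if "i \<in> {1..J}" for i using disjoint_mixed[OF that j, of w] pole_in_ball[OF that] w by auto
    ultimately show ?thesis by (intro U_I) (use norm_inner[OF j w(1)] in auto)
  qed
  then show "cball (b j) (s j) - {q j} \<subseteq> U" by blast
  show "sphere (b j) (s j) \<subseteq> U"
  proof
    fix w assume w: "w \<in> sphere (b j) (s j)"
    have "w \<noteq> q j" using w pole_in_ball(3)[OF j] by auto
    then show "w \<in> U" using *[of w] sphere_cballD[OF w] by blast
  qed
qed

lemma rest_sub_U: "\<lbrakk>norm w \<noteq> 1; \<And>j. j \<in> {1..J} \<Longrightarrow> w \<notin> cball (p j) (\<epsilon> j); \<And>j. j \<in> {1..J} \<Longrightarrow> w \<notin> cball (b j) (s j)\<rbrakk> \<Longrightarrow> w \<in> U"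
  using pole_in_ball(2,4) by (intro U_I) blast+

lemma the_outer: "j \<in> {1..J} \<Longrightarrow> z \<in> cball (p j) (\<epsilon> j) \<Longrightarrow> (THE i. i \<in> {1..J} \<and> z \<in> cball (p i) (\<epsilon> i)) = j"
  by (rule the_equality) (use disjoint_outer in blast)+

lemma the_inner: "j \<in> {1..J} \<Longrightarrow> z \<in> cball (b j) (s j) \<Longrightarrow> (THE i. i \<in> {1..J} \<and> z \<in> cball (b i) (s i)) = j"
  by (rule the_equality) (use disjoint_inner in blast)+

lemma jump_v_unit: "z \<in> sphere 0 1 \<Longrightarrow> jump_v n r J p c \<epsilon> z = jump_V n r z"
  by (simp add: jump_v_def images)

lemma jump_v_pole:
  assumes j: "j \<in> {1..J}" and z: "z \<in> sphere (p j) (\<epsilon> j)"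
  shows "jump_v n r J p c \<epsilon> z = mat2 1 0 (p j powi (-2*n) * c j / (z - p j)) 1"
proof -
  have u: "z \<notin> path_image unit_circle" using trace_disjoint(1)[OF j] z unfolding images by blast
  have e: "\<exists>j\<in>{1..J}. z \<in> path_image (pole_circle (p j) (\<epsilon> j))" using images(2)[OF j] j z by blast
  have t: "(THE j. j \<in> {1..J} \<and> z \<in> path_image (pole_circle (p j) (\<epsilon> j))) = j"
    by (rule the_equality) (use images(2) j z trace_disjoint(4) in blast)+
  show ?thesis unfolding jump_v_def if_not_P[OF u] if_P[OF e] t Let_def ..
qed

lemma jump_v_sharp:
  assumes j: "j \<in> {1..J}" and z: "z \<in> sphere (b j) (s j)"
  shows "jump_v n r J p c \<epsilon> z = mat2 1 (- (cnj (p j) powi (-2*n - 2) * cnj (c j) / (z - q j))) 0 1"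
proof -
  have u: "z \<notin> path_image unit_circle" using trace_disjoint(2)[OF j] z unfolding images by blast
  have e: "\<not> (\<exists>j\<in>{1..J}. z \<in> path_image (pole_circle (p j) (\<epsilon> j)))" using images(2) trace_disjoint(3)[OF _ j] z by blast
  have t: "(THE j. j \<in> {1..J} \<and> z \<in> path_image (pole_circle_sharp (p j) (\<epsilon> j))) = j"
    by (rule the_equality) (use images(3) j z trace_disjoint(5) in blast)+
  show ?thesis unfolding jump_v_def if_not_P[OF u] if_not_P[OF e] t Let_def ..
qed

lemma sobolev_holomorphic_matrix:
  assumes \<gamma>: "tangent_loop \<gamma> T" "path_image \<gamma> \<subseteq> U" and G: "holomorphic_mat_on G U"
    and eq: "\<And>z. z \<in> path_image \<gamma> \<Longrightarrow> f z = G z"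
  shows "sobolev_param k \<gamma> ((\<lambda>z. f z - mat 1 :: complex^2^2) \<circ> \<gamma>)"
proof -
  have rs: "regular_speed \<gamma>" using \<gamma>(1) by (simp add: tangent_loop_def)
  show ?thesis
    unfolding sobolev_param_matrix[OF rs]
  proof (intro allI)
    fix i l
    have "sobolev_param k \<gamma> ((\<lambda>z. G z $ i $ l - mat 1 $ i $ l) \<circ> \<gamma>)"
      by (rule sobolev_param_holomorphic[OF \<gamma>(1) open_U \<gamma>(2)])
        (use G in \<open>auto simp: holomorphic_mat_on_def intro!: holomorphic_on_diff\<close>)
    then show "sobolev_param k \<gamma> (\<lambda>t. ((\<lambda>z. f z - mat 1) \<circ> \<gamma>) t $ i $ l)"
      by (rule sobolev_param_cong[rotated]) (simp add: eq path_image_def)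
  qed
qed


lemma jump_factor_tendsto:
  assumes j: "z \<in> U" and M: "holomorphic_mat_on M U" and G: "(\<lambda>z. G z) holomorphic_on U"
  shows "((\<lambda>z. M z ** mat2 1 0 (G z) 1) \<longlongrightarrow> M z ** mat2 1 0 (G z) 1) (at z)"
    and "((\<lambda>z. M z ** mat2 1 (G z) 0 1) \<longlongrightarrow> M z ** mat2 1 (G z) 0 1) (at z)"
    and "(M \<longlongrightarrow> M z) (at z)"
proof -
  have "((\<lambda>z. M z $ i $ l) \<longlongrightarrow> M z $ i $ l) (at z)" for i l
    using M j open_U holomorphic_on_imp_continuous_on[of "\<lambda>z. M z $ i $ l" U]
    by (simp add: holomorphic_mat_on_def continuous_on_eq_continuous_at isCont_def)
  moreover have "(G \<longlongrightarrow> G z) (at z)"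
    using j open_U holomorphic_on_imp_continuous_on[OF G] by (simp add: continuous_on_eq_continuous_at isCont_def)
  moreover from this have t: "((\<lambda>z. mat2 1 0 (G z) 1 $ i $ l) \<longlongrightarrow> mat2 1 0 (G z) 1 $ i $ l) (at z)"
    "((\<lambda>z. mat2 1 (G z) 0 1 $ i $ l) \<longlongrightarrow> mat2 1 (G z) 0 1 $ i $ l) (at z)" for i l
    using exhaust_2[of i] exhaust_2[of l] by auto
  ultimately show "((\<lambda>z. M z ** mat2 1 0 (G z) 1) \<longlongrightarrow> M z ** mat2 1 0 (G z) 1) (at z)"
    "((\<lambda>z. M z ** mat2 1 (G z) 0 1) \<longlongrightarrow> M z ** mat2 1 (G z) 0 1) (at z)" "(M \<longlongrightarrow> M z) (at z)"
    unfolding mat_tendsto_iff mat_mult_nth2 using t by (intro allI tendsto_add tendsto_mult; blast)+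
qed

text \<open>A small outer disc belongs to \<open>Q\<^sub>0\<close>, so the factor that removes its
  pole enters on the minus side and the jump matrix is its inverse. A small inner disc belongs to
  \<open>P\<^sub>0\<close>, so there the factor is itself the jump matrix. This accounts for the
  different signs in \<open>jump_v\<close>. The explicit relation between \<open>m\<close> and
  \<open>M\<close> is recorded because uniqueness for \<open>M\<close> is deduced from uniqueness
  for \<open>m\<close>.\<close>

lemma pole_problem_imp_contour_problem:
  fixes n :: int and c :: "nat \<Rightarrow> complex"
  defines "C \<equiv> \<lambda>j. p j powi (-2*n) * c j" and "C' \<equiv> \<lambda>j. cnj (p j) powi (-2*n - 2) * cnj (c j)"
  assumes k: "1 \<le> k" and sol: "rhp_poles_solution k n r J p c M"
  shows "\<exists>m. rhp_solution k \<Gamma>\<^sub>0 P\<^sub>0 (jump_v n r J p c \<epsilon>) m \<and>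
    (\<forall>z. (\<forall>j\<in>{1..J}. z \<notin> cball (p j) (\<epsilon> j)) \<and> (\<forall>j\<in>{1..J}. z \<notin> cball (b j) (s j)) \<longrightarrow> m z = M z) \<and>
    (\<forall>j\<in>{1..J}. \<forall>z\<in>ball (p j) (\<epsilon> j) - {p j}. m z = M z ** mat2 1 0 (- (C j / (z - p j))) 1) \<and>
    (\<forall>j\<in>{1..J}. \<forall>z\<in>ball (b j) (s j) - {q j}. m z = M z ** mat2 1 (- (C' j / (z - q j))) 0 1)"
proof -
  have hol: "holomorphic_mat_on M U" and pol: "\<And>a i l. a \<in> poles J p \<Longrightarrow> at_most_simple_pole (\<lambda>z. M z $ i $ l) a"
    and res1: "\<And>j. j \<in> {1..J} \<Longrightarrow> ((\<lambda>z. M z ** mat2 0 0 (C j) 0) \<longlongrightarrow> residue_mat M (p j)) (at (p j))"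
    and res2: "\<And>j. j \<in> {1..J} \<Longrightarrow> ((\<lambda>z. M z ** mat2 0 (C' j) 0 0) \<longlongrightarrow> residue_mat M (q j)) (at (q j))"
    and inf: "(M \<longlongrightarrow> mat 1) at_infinity"
    using sol unfolding rhp_poles_solution_def C_def C'_def by (elim conjE; blast)+
  have "\<exists>Mp Mm. Mp \<in> Hsob k {unit_circle} \<and> Mm \<in> Hsob k {unit_circle} \<and>
        (\<forall>z\<in>sphere 0 1. (M \<longlongrightarrow> Mp z) (at z within {w. norm w > 1}) \<and>
                        (M \<longlongrightarrow> Mm z) (at z within {w. norm w < 1}) \<and>
                        Mp z = Mm z ** jump_V n r z)"
    using sol unfolding rhp_poles_solution_def by (elim conjE)
  then obtain Mp Mm where sob: "Mp \<in> Hsob k {unit_circle}" "Mm \<in> Hsob k {unit_circle}"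
    and lim: "\<And>z. z \<in> sphere 0 1 \<Longrightarrow> (M \<longlongrightarrow> Mp z) (at z within {w. norm w > 1})"
      "\<And>z. z \<in> sphere 0 1 \<Longrightarrow> (M \<longlongrightarrow> Mm z) (at z within {w. norm w < 1})"
    and jump: "\<And>z. z \<in> sphere 0 1 \<Longrightarrow> Mp z = Mm z ** jump_V n r z"
    by blast
  have X: "\<exists>X. holomorphic_mat_on X (ball (p j) (\<epsilon> j)) \<and> (\<forall>z\<in>ball (p j) (\<epsilon> j) - {p j}. X z = M z ** mat2 1 0 (- (C j / (z - p j))) 1)"
    if j: "j \<in> {1..J}" for j
  proof -
    have h: "(\<lambda>z. M z $ i $ l) holomorphic_on ball (p j) (\<epsilon> j) - {p j}" for i l
      using hol holomorphic_on_subset[OF _ order_trans[OF Diff_mono[OF ball_subset_cball subset_refl] outer_sub_U(1)[OF j]]]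
      unfolding holomorphic_mat_on_def by blast
    have pa: "p j \<in> poles J p" using j by (simp add: poles_eq)
    note F = res1[OF j, unfolded mat_tendsto_iff mat_mult_nth2, rule_format]
    have r1: "((\<lambda>z. M z $ i $ 2 * C j) \<longlongrightarrow> residue (\<lambda>z. M z $ i $ 1) (p j)) (at (p j))"
      and r2: "residue (\<lambda>z. M z $ i $ 2) (p j) = 0" for i
      using F[of i 1] F[of i 2] by (simp_all add: residue_mat_def tendsto_const_iff)
    note sp = simple_pole_pair[OF open_ball pole_in_ball(1)[OF j] h h pol[OF pa] pol[OF pa] r2 r1]
    obtain X1 X2 where "\<And>i. X2 i holomorphic_on ball (p j) (\<epsilon> j)" "\<And>i z. z \<in> ball (p j) (\<epsilon> j) - {p j} \<Longrightarrow> X2 i z = M z $ i $ 2"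
      "\<And>i. X1 i holomorphic_on ball (p j) (\<epsilon> j)" "\<And>i z. z \<in> ball (p j) (\<epsilon> j) - {p j} \<Longrightarrow> X1 i z = M z $ i $ 1 + M z $ i $ 2 * (- (C j / (z - p j)))"
      using sp by metis
    then show ?thesis
      by (intro exI[of _ "\<lambda>z. \<chi> i l. if l = 1 then X1 i z else X2 i z"])
        (simp add: holomorphic_mat_on_def vec_eq_iff forall_2 mat_mult_nth2)
  qed
  have Y: "\<exists>Y. holomorphic_mat_on Y (ball (b j) (s j)) \<and> (\<forall>z\<in>ball (b j) (s j) - {q j}. Y z = M z ** mat2 1 (- (C' j / (z - q j))) 0 1)"
    if j: "j \<in> {1..J}" for j
  proof -
    have h: "(\<lambda>z. M z $ i $ l) holomorphic_on ball (b j) (s j) - {q j}" for i l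
      using hol holomorphic_on_subset[OF _ order_trans[OF Diff_mono[OF ball_subset_cball subset_refl] inner_sub_U(1)[OF j]]]
      unfolding holomorphic_mat_on_def by blast
    have pa: "q j \<in> poles J p" using j by (simp add: poles_eq)
    note F = res2[OF j, unfolded mat_tendsto_iff mat_mult_nth2, rule_format]
    have r1: "((\<lambda>z. M z $ i $ 1 * C' j) \<longlongrightarrow> residue (\<lambda>z. M z $ i $ 2) (q j)) (at (q j))"
      and r2: "residue (\<lambda>z. M z $ i $ 1) (q j) = 0" for i
      using F[of i 2] F[of i 1] by (simp_all add: residue_mat_def tendsto_const_iff)
    note sp = simple_pole_pair[OF open_ball pole_in_ball(3)[OF j] h h pol[OF pa] pol[OF pa] r2 r1]
    obtain X1 X2 where "\<And>i. X2 i holomorphic_on ball (b j) (s j)" "\<And>i z. z \<in> ball (b j) (s j) - {q j} \<Longrightarrow> X2 i z = M z $ i $ 1"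
      "\<And>i. X1 i holomorphic_on ball (b j) (s j)" "\<And>i z. z \<in> ball (b j) (s j) - {q j} \<Longrightarrow> X1 i z = M z $ i $ 2 + M z $ i $ 1 * (- (C' j / (z - q j)))"
      using sp by metis
    then show ?thesis
      by (intro exI[of _ "\<lambda>z. \<chi> i l. if l = 2 then X1 i z else X2 i z"])
        (simp add: holomorphic_mat_on_def vec_eq_iff forall_2 mat_mult_nth2)
  qed
  from X Y obtain X Y :: "nat \<Rightarrow> complex \<Rightarrow> complex^2^2" where
    X: "\<And>j. j \<in> {1..J} \<Longrightarrow> holomorphic_mat_on (X j) (ball (p j) (\<epsilon> j))"
      "\<And>j z. j \<in> {1..J} \<Longrightarrow> z \<in> ball (p j) (\<epsilon> j) - {p j} \<Longrightarrow> X j z = M z ** mat2 1 0 (- (C j / (z - p j))) 1"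
    and Y: "\<And>j. j \<in> {1..J} \<Longrightarrow> holomorphic_mat_on (Y j) (ball (b j) (s j))"
      "\<And>j z. j \<in> {1..J} \<Longrightarrow> z \<in> ball (b j) (s j) - {q j} \<Longrightarrow> Y j z = M z ** mat2 1 (- (C' j / (z - q j))) 0 1"
    by metis
  define m where "m z = (if \<exists>j\<in>{1..J}. z \<in> cball (p j) (\<epsilon> j) then X (THE j. j \<in> {1..J} \<and> z \<in> cball (p j) (\<epsilon> j)) z
    else if \<exists>j\<in>{1..J}. z \<in> cball (b j) (s j) then Y (THE j. j \<in> {1..J} \<and> z \<in> cball (b j) (s j)) z else M z)" for z
  have mX: "m z = X j z" if "j \<in> {1..J}" "z \<in> ball (p j) (\<epsilon> j)" for j z
  proof -
    have z: "z \<in> cball (p j) (\<epsilon> j)" using that(2) by simp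
    show ?thesis unfolding m_def the_outer[OF that(1) z] using that(1) z by auto
  qed
  have mY: "m z = Y j z" if "j \<in> {1..J}" "z \<in> ball (b j) (s j)" for j z
  proof -
    have z: "z \<in> cball (b j) (s j)" using that(2) by simp
    then have "\<not> (\<exists>i\<in>{1..J}. z \<in> cball (p i) (\<epsilon> i))" using disjoint_mixed[OF _ that(1)] by blast
    then show ?thesis unfolding m_def the_inner[OF that(1) z] using that(1) z by (simp only: if_False) auto
  qed
  have mM: "m z = M z" if "\<And>j. j \<in> {1..J} \<Longrightarrow> z \<notin> cball (p j) (\<epsilon> j)" "\<And>j. j \<in> {1..J} \<Longrightarrow> z \<notin> cball (b j) (s j)" for z
    unfolding m_def using that by auto
  define W where "W = {z. 1 < norm z \<and> (\<forall>j\<in>{1..J}. z \<notin> cball (p j) (\<epsilon> j))} \<union> {z. norm z < 1 \<and> (\<forall>j\<in>{1..J}. z \<notin> cball (b j) (s j))}"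
  have W: "open W" "W \<subseteq> U" "\<And>z. z \<in> W \<Longrightarrow> m z = M z"
  proof -
    have "W = ({z. 1 < norm z} - (\<Union>j\<in>{1..J}. cball (p j) (\<epsilon> j))) \<union> ({z. norm z < 1} - (\<Union>j\<in>{1..J}. cball (b j) (s j)))"
      unfolding W_def by blast
    then show "open W" using open_norm by (auto intro!: open_Un open_Diff closed_UN)
    have c: "norm z \<noteq> 1 \<and> (\<forall>j\<in>{1..J}. z \<notin> cball (p j) (\<epsilon> j)) \<and> (\<forall>j\<in>{1..J}. z \<notin> cball (b j) (s j))" if z: "z \<in> W" for z
    proof -
      from z consider "1 < norm z" "\<forall>j\<in>{1..J}. z \<notin> cball (p j) (\<epsilon> j)" | "norm z < 1" "\<forall>j\<in>{1..J}. z \<notin> cball (b j) (s j)"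
        unfolding W_def by blast
      then show ?thesis using norm_outer norm_inner by cases fastforce+
    qed
    show "W \<subseteq> U" using c rest_sub_U by blast
    show "m z = M z" if "z \<in> W" for z using c[OF that] by (intro mM) blast+
  qed
  have cov: "- \<Sigma> = W \<union> (\<Union>j\<in>{1..J}. ball (p j) (\<epsilon> j)) \<union> (\<Union>j\<in>{1..J}. ball (b j) (s j))"
    unfolding PQ(1)[symmetric] unfolding minus_eq unfolding plus_eq W_def by (simp only: Un_ac)
  have mhol: "holomorphic_mat_on m (- \<Sigma>)"
    unfolding holomorphic_mat_on_def cov
  proof (intro allI holomorphic_on_Un holomorphic_on_UN_open open_Un open_UN ballI open_ball W(1))
    fix i l
    show "(\<lambda>z. m z $ i $ l) holomorphic_on W"
      by (rule holomorphic_transform[of "\<lambda>z. M z $ i $ l"]) (use hol W holomorphic_on_subset in \<open>fastforce simp: holomorphic_mat_on_def simp del: Compl_Un\<close>)+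
    show "(\<lambda>z. m z $ i $ l) holomorphic_on ball (p j) (\<epsilon> j)" if "j \<in> {1..J}" for j
      by (rule holomorphic_transform[of "\<lambda>z. X j z $ i $ l"]) (use X(1)[OF that] mX[OF that] in \<open>auto simp: holomorphic_mat_on_def\<close>)
    show "(\<lambda>z. m z $ i $ l) holomorphic_on ball (b j) (s j)" if "j \<in> {1..J}" for j
      by (rule holomorphic_transform[of "\<lambda>z. Y j z $ i $ l"]) (use Y(1)[OF that] mY[OF that] in \<open>auto simp: holomorphic_mat_on_def\<close>)
  qed
  \<comment> \<open>The modified functions, continued by their formulas to all of \<open>U\<close>.
    They are holomorphic near the small circles, so the boundary values they give there are of every
    Sobolev order.\<close>
  define lo where "lo j z = M z ** mat2 1 0 (- (C j / (z - p j))) 1" for j z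
  define up where "up j z = M z ** mat2 1 (- (C' j / (z - q j))) 0 1" for j z
  \<comment> \<open>The boundary values from \<open>Q\<^sub>0\<close> are written down explicitly,
    and those from \<open>P\<^sub>0\<close> are defined by the jump relation, so that it only
    remains to verify the limits.\<close>
  define mm where "mm z = (if norm z = 1 then Mm z
    else if 1 < norm z then lo (THE j. j \<in> {1..J} \<and> z \<in> cball (p j) (\<epsilon> j)) z else M z)" for z
  define mp where "mp z = mm z ** jump_v n r J p c \<epsilon> z" for z
  have unit: "mm z = Mm z" "mp z = Mp z" if "z \<in> sphere 0 1" for z
    using that jump[OF that] by (simp_all add: mm_def mp_def jump_v_unit)
  have outer_val: "mm z = lo j z" "mp z = M z" if j: "j \<in> {1..J}" and z: "z \<in> sphere (p j) (\<epsilon> j)" for j z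
  proof -
    show e: "mm z = lo j z"
      using norm_outer[OF j sphere_cballD[OF z]] unfolding mm_def the_outer[OF j sphere_cballD[OF z]] by simp
    show "mp z = M z"
      unfolding mp_def e lo_def jump_v_pole[OF j z] C_def
      by (simp add: vec_eq_iff forall_2 mat_mult_nth2)
  qed
  have inner_val: "mm z = M z" "mp z = up j z" if j: "j \<in> {1..J}" and z: "z \<in> sphere (b j) (s j)" for j z
  proof -
    show e: "mm z = M z" using norm_inner[OF j sphere_cballD[OF z]] unfolding mm_def by simp
    show "mp z = up j z" unfolding mp_def e up_def jump_v_sharp[OF j z] C'_def ..
  qed
  have Ch: "(\<lambda>z. - (C j / (z - p j))) holomorphic_on U" "(\<lambda>z. - (C' j / (z - q j))) holomorphic_on U" if j: "j \<in> {1..J}" for j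
    by (intro holomorphic_intros; use j in \<open>auto simp: poles_eq\<close>)+
  have limits: "(m \<longlongrightarrow> mp z) (at z within P\<^sub>0)" "(m \<longlongrightarrow> mm z) (at z within Q\<^sub>0)" if z: "z \<in> \<Sigma>" for z
  proof -
    from z consider "z \<in> sphere 0 1" | j where "j \<in> {1..J}" "z \<in> sphere (p j) (\<epsilon> j)" | j where "j \<in> {1..J}" "z \<in> sphere (b j) (s j)"
      unfolding trace_eq by blast
    then have "(m \<longlongrightarrow> mp z) (at z within P\<^sub>0) \<and> (m \<longlongrightarrow> mm z) (at z within Q\<^sub>0)"
    proof cases
      case 1
      \<comment> \<open>Near a point of the unit circle, away from all small discs, \<open>m\<close>
        agrees with \<open>M\<close> and the sides of the contour are those of the unit
        circle.\<close>
      define N where "N = - ((\<Union>j\<in>{1..J}. cball (p j) (\<epsilon> j)) \<union> (\<Union>j\<in>{1..J}. cball (b j) (s j)))"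
      have N: "open N" "z \<in> N"
      proof -
        show "open N" unfolding N_def by (intro open_Compl closed_Un closed_UN) auto
        have "z \<notin> cball (p j) (\<epsilon> j)" "z \<notin> cball (b j) (s j)" if "j \<in> {1..J}" for j
          using norm_outer[OF that, of z] norm_inner[OF that, of z] 1 by auto
        then show "z \<in> N" unfolding N_def by blast
      qed
      have "M w = m w" if "w \<in> N" for w using that unfolding N_def by (intro mM[symmetric]) blast+
      moreover have "P\<^sub>0 \<inter> N \<subseteq> {w. 1 < norm w}" "Q\<^sub>0 \<inter> N \<subseteq> {w. norm w < 1}"
      proof -
        have "w \<notin> ball (p i) (\<epsilon> i)" "w \<notin> ball (b i) (s i)" if "w \<in> N" "i \<in> {1..J}" for i w
          using that ball_subset_cball unfolding N_def by blast+
        then show "P\<^sub>0 \<inter> N \<subseteq> {w. 1 < norm w}" "Q\<^sub>0 \<inter> N \<subseteq> {w. norm w < 1}"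
          unfolding minus_eq unfolding plus_eq by blast+
      qed
      ultimately show ?thesis
        unfolding unit[OF 1] using tendsto_local[OF lim(1)[OF 1] N] tendsto_local[OF lim(2)[OF 1] N] by blast
    next
      case (2 j)
      have zU: "z \<in> U" using outer_sub_U(2)[OF 2(1)] 2(2) by blast
      have z1: "1 < norm z" using norm_outer[OF 2(1) sphere_cballD[OF 2(2)]] .
      define N where "N = {w. 1 < norm w} \<inter> - {p j} \<inter> - (\<Union>i\<in>{1..J} - {j}. cball (p i) (\<epsilon> i))"
      have "z \<noteq> p j" using 2 eps[OF 2(1)] by auto
      moreover have "z \<notin> cball (p i) (\<epsilon> i)" if "i \<in> {1..J} - {j}" for i
        using disjoint_outer[OF 2(1) _ sphere_cballD[OF 2(2)]] that by blast
      ultimately have N: "open N" "z \<in> N"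
        unfolding N_def using z1 open_norm by (auto intro!: open_Int open_Compl closed_UN)
      have eq: "lo j w = m w" if w: "w \<in> Q\<^sub>0 \<inter> N" for w
      proof -
        have "w \<in> ball (p j) (\<epsilon> j) - {p j}" using w ball_subset_cball unfolding minus_eq N_def by fastforce
        then show ?thesis using mX[OF 2(1), of w] X(2)[OF 2(1)] by (simp add: lo_def)
      qed
      have PW: "P\<^sub>0 \<inter> {w. 1 < norm w} \<subseteq> W"
      proof
        fix w assume w: "w \<in> P\<^sub>0 \<inter> {w. 1 < norm w}"
        have "w \<notin> ball (b i) (s i)" if "i \<in> {1..J}" for i using norm_inner[OF that, of w] w by auto
        then show "w \<in> W" using w unfolding plus_eq W_def by blast
      qed
      have "(m \<longlongrightarrow> M z) (at z within P\<^sub>0)"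
        by (rule tendsto_local[OF jump_factor_tendsto(3)[OF zU hol Ch(1)[OF 2(1)]] open_norm(2)]) (use z1 PW W(3) in auto)
      moreover have "(m \<longlongrightarrow> lo j z) (at z within Q\<^sub>0)"
        by (rule tendsto_local[OF jump_factor_tendsto(1)[OF zU hol Ch(1)[OF 2(1)]] N, folded lo_def]) (use eq in auto)
      ultimately show ?thesis unfolding outer_val[OF 2] by blast
    next
      case (3 j)
      have zU: "z \<in> U" using inner_sub_U(2)[OF 3(1)] 3(2) by blast
      have z1: "norm z < 1" using norm_inner[OF 3(1) sphere_cballD[OF 3(2)]] .
      define N where "N = {w. norm w < 1} \<inter> - {q j} \<inter> - (\<Union>i\<in>{1..J} - {j}. cball (b i) (s i))"
      have "z \<noteq> q j" using 3 pole_in_ball(3)[OF 3(1)] by auto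
      moreover have "z \<notin> cball (b i) (s i)" if "i \<in> {1..J} - {j}" for i
        using disjoint_inner[OF 3(1) _ sphere_cballD[OF 3(2)]] that by blast
      ultimately have N: "open N" "z \<in> N"
        unfolding N_def using z1 open_norm by (auto intro!: open_Int open_Compl closed_UN)
      have eq: "up j w = m w" if w: "w \<in> P\<^sub>0 \<inter> N" for w
      proof -
        have "w \<in> ball (b j) (s j) - {q j}" using w ball_subset_cball unfolding plus_eq N_def by fastforce
        then show ?thesis using mY[OF 3(1), of w] Y(2)[OF 3(1)] by (simp add: up_def)
      qed
      have QW: "Q\<^sub>0 \<inter> {w. norm w < 1} \<subseteq> W"
      proof
        fix w assume w: "w \<in> Q\<^sub>0 \<inter> {w. norm w < 1}"
        have "w \<notin> ball (p i) (\<epsilon> i)" if "i \<in> {1..J}" for i using norm_outer[OF that, of w] w by auto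
        then show "w \<in> W" using w unfolding minus_eq W_def by blast
      qed
      have "(m \<longlongrightarrow> M z) (at z within Q\<^sub>0)"
        by (rule tendsto_local[OF jump_factor_tendsto(3)[OF zU hol Ch(1)[OF 3(1)]] open_norm(1)]) (use z1 QW W(3) in auto)
      moreover have "(m \<longlongrightarrow> up j z) (at z within P\<^sub>0)"
        by (rule tendsto_local[OF jump_factor_tendsto(2)[OF zU hol Ch(2)[OF 3(1)]] N, folded up_def]) (use eq in auto)
      ultimately show ?thesis unfolding inner_val[OF 3] by blast
    qed
    then show "(m \<longlongrightarrow> mp z) (at z within P\<^sub>0)" "(m \<longlongrightarrow> mm z) (at z within Q\<^sub>0)" by blast+
  qed
  have LU: "holomorphic_mat_on (lo j) U" "holomorphic_mat_on (up j) U" if j: "j \<in> {1..J}" for j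
  proof -
    have "(\<lambda>z. mat2 1 0 (- (C j / (z - p j))) 1 $ i $ l) holomorphic_on U" "(\<lambda>z. mat2 1 (- (C' j / (z - q j))) 0 1 $ i $ l) holomorphic_on U" for i l
      using Ch[OF j] exhaust_2[of i] exhaust_2[of l] by auto
    then show "holomorphic_mat_on (lo j) U" "holomorphic_mat_on (up j) U"
      using hol unfolding holomorphic_mat_on_def lo_def up_def mat_mult_nth2
      by (intro allI holomorphic_on_add holomorphic_on_mult; blast)+
  qed
  have minf: "(m \<longlongrightarrow> mat 1) at_infinity"
  proof (rule Lim_transform_eventually[OF inf])
    have "bounded (\<Union>j\<in>{1..J}. cball (p j) (\<epsilon> j))" by auto
    then obtain B where B: "\<And>j z. j \<in> {1..J} \<Longrightarrow> z \<in> cball (p j) (\<epsilon> j) \<Longrightarrow> norm z \<le> B"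
      unfolding bounded_iff by blast
    have "M z = m z" if "max B 1 + 1 \<le> norm z" for z
    proof (rule mM[symmetric])
      show "z \<notin> cball (p j) (\<epsilon> j)" if "j \<in> {1..J}" for j using B[OF that, of z] \<open>max B 1 + 1 \<le> norm z\<close> by auto
      show "z \<notin> cball (b j) (s j)" if "j \<in> {1..J}" for j using norm_inner[OF that, of z] \<open>max B 1 + 1 \<le> norm z\<close> by auto
    qed
    then show "\<forall>\<^sub>F z in at_infinity. M z = m z" unfolding eventually_at_infinity by blast
  qed
  have sobs: "sobolev_param k \<gamma> ((\<lambda>z. mp z - mat 1) \<circ> \<gamma>) \<and> sobolev_param k \<gamma> ((\<lambda>z. mm z - mat 1) \<circ> \<gamma>)" if "\<gamma> \<in> \<Gamma>\<^sub>0" for \<gamma>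
    using that
  proof (cases rule: contour_cases)
    case 1
    have rs: "regular_speed unit_circle" using regular_speed_pole_circle[of 1 0] by (simp add: unit_circle_eq)
    have c: "sobolev_param k unit_circle (Mp \<circ> unit_circle)" "sobolev_param k unit_circle (Mm \<circ> unit_circle)"
      using sob by (simp_all add: Hsob_def)
    have s: "sobolev_param k unit_circle ((\<lambda>z. Mp z - mat 1) \<circ> unit_circle)" "sobolev_param k unit_circle ((\<lambda>z. Mm z - mat 1) \<circ> unit_circle)"
      using sobolev_param_diff[OF rs c(1) sobolev_param_const[OF rs]] sobolev_param_diff[OF rs c(2) sobolev_param_const[OF rs]]
      by (simp_all add: o_def)
    have "unit_circle t \<in> sphere 0 1" if "t \<in> {0..1}" for t
      using that images(1) unfolding path_image_def by blast
    then show ?thesis unfolding 1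
      by (intro conjI sobolev_param_cong[OF _ s(1)] sobolev_param_cong[OF _ s(2)]) (simp_all only: o_apply unit)
  next
    case (2 j)
    note sh = sobolev_holomorphic_matrix[OF tangent_loop_pole_circle[OF eps[OF 2(1)]]]
    show ?thesis unfolding 2(2)
      using sh[OF _ hol, where f = mp] sh[OF _ LU(1)[OF 2(1)], where f = mm] images(2)[OF 2(1)] outer_sub_U(2)[OF 2(1)] outer_val[OF 2(1)] by blast
  next
    case (3 j)
    note sh = sobolev_holomorphic_matrix[OF tangent_loop_pole_circle_sharp[OF eps[OF 3(1)] eps_less[OF 3(1)]]]
    show ?thesis unfolding 3(2)
      using sh[OF _ hol, where f = mm] sh[OF _ LU(2)[OF 3(1)], where f = mp] images(3)[OF 3(1)] inner_sub_U(2)[OF 3(1)] inner_val[OF 3(1)] by blast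
  qed
  have "m \<in> Hhol k \<Gamma>\<^sub>0 P\<^sub>0"
    by (rule Hhol_intro[OF mhol minf k limits]) (use sobs in \<open>auto simp: Hsob_def\<close>)
  moreover have "bv_plus \<Gamma>\<^sub>0 P\<^sub>0 m z = bv_minus \<Gamma>\<^sub>0 P\<^sub>0 m z ** jump_v n r J p c \<epsilon> z" if z: "z \<in> \<Sigma>" for z
    using bv_eqI(1)[OF z limits(1)[OF z]] bv_eqI(2)[OF z limits(2)[OF z]] by (simp add: mp_def)
  ultimately have "rhp_solution k \<Gamma>\<^sub>0 P\<^sub>0 (jump_v n r J p c \<epsilon>) m"
    unfolding rhp_solution_def using minf by blast
  moreover have "m z = M z ** mat2 1 0 (- (C j / (z - p j))) 1" if "j \<in> {1..J}" "z \<in> ball (p j) (\<epsilon> j) - {p j}" for j z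
    using mX[OF that(1), of z] X(2)[OF that] that(2) by simp
  moreover have "m z = M z ** mat2 1 (- (C' j / (z - q j))) 0 1" if "j \<in> {1..J}" "z \<in> ball (b j) (s j) - {q j}" for j z
    using mY[OF that(1), of z] Y(2)[OF that] that(2) by simp
  ultimately show ?thesis using mM by (intro exI[of _ m] conjI) blast+
qed

end

subsection \<open>Uniqueness and partial indices\<close>

text \<open>The adjugate, used as the inverse of a matrix of determinant 1. Being linear in the
  entries, it inherits holomorphy and limits without any division.\<close>

definition adj2 :: "complex^2^2 \<Rightarrow> complex^2^2" where
  "adj2 A = mat2 (A $ 2 $ 2) (- (A $ 1 $ 2)) (- (A $ 2 $ 1)) (A $ 1 $ 1)"

lemma adj2_mult: "adj2 (A ** B) = adj2 B ** adj2 A"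
  by (simp add: adj2_def vec_eq_iff forall_2 mat_mult_nth2 algebra_simps)

lemma adj2_inverse:
  assumes "det A = 1"
  shows "A ** adj2 A = mat 1" and "adj2 A ** A = mat 1"
  using assms by (simp_all add: adj2_def det_2 vec_eq_iff forall_2 mat_mult_nth2 mat_def algebra_simps)

lemma det_adj2: "det (adj2 A) = det A"
  by (simp add: adj2_def det_2 algebra_simps)

lemma det_mat2: "det (mat2 a b c d) = a * d - b * c"
  by (simp add: det_2)

lemma tendsto_mat_mult: "(A \<longlongrightarrow> a) F \<Longrightarrow> (B \<longlongrightarrow> b) F \<Longrightarrow> ((\<lambda>z. A z ** B z) \<longlongrightarrow> a ** b) F" for a b :: "complex^2^2"
  unfolding mat_tendsto_iff mat_mult_nth2 by (intro allI tendsto_add tendsto_mult; blast)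

lemma tendsto_adj2: "(A \<longlongrightarrow> a) F \<Longrightarrow> ((\<lambda>z. adj2 (A z)) \<longlongrightarrow> adj2 a) F"
  unfolding mat_tendsto_iff adj2_def by (simp add: forall_2 tendsto_minus)

lemma tendsto_det: "(A \<longlongrightarrow> a) F \<Longrightarrow> ((\<lambda>z. det (A z)) \<longlongrightarrow> det a) F" for a :: "complex^2^2"
  unfolding mat_tendsto_iff det_2 by (intro tendsto_diff tendsto_mult; blast)

lemma holomorphic_mat_mult:
  "holomorphic_mat_on A S \<Longrightarrow> holomorphic_mat_on B S \<Longrightarrow> holomorphic_mat_on (\<lambda>z. A z ** B z) S"
  unfolding holomorphic_mat_on_def mat_mult_nth2 by (intro allI holomorphic_on_add holomorphic_on_mult; blast)

lemma holomorphic_adj2: "holomorphic_mat_on A S \<Longrightarrow> holomorphic_mat_on (\<lambda>z. adj2 (A z)) S"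
  unfolding holomorphic_mat_on_def adj2_def by (simp add: forall_2 holomorphic_on_minus)

lemma holomorphic_det: "holomorphic_mat_on A S \<Longrightarrow> (\<lambda>z. det (A z)) holomorphic_on S"
  unfolding holomorphic_mat_on_def det_2 by (intro holomorphic_on_diff holomorphic_on_mult; blast)

lemma matrix_inv_det:
  fixes A :: "complex^2^2"
  assumes "det A \<noteq> 0"
  shows "A ** matrix_inv A = mat 1" and "matrix_inv A ** A = mat 1"
proof -
  have "\<exists>B. A ** B = mat 1 \<and> B ** A = mat 1" using assms by (simp add: invertible_det_nz[symmetric] invertible_def)
  then show "A ** matrix_inv A = mat 1" "matrix_inv A ** A = mat 1"
    unfolding matrix_inv_def by (rule someI2_ex, simp)+
qed

lemma moebius_at_infinity: "((\<lambda>z. (z - a) / (z - b)) \<longlongrightarrow> 1) at_infinity" for a b :: complex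
proof -
  have "((\<lambda>z. (b - a) / (z - b)) \<longlongrightarrow> 0) at_infinity"
    unfolding diff_conv_add_uminus
    by (rule tendsto_divide_0[OF tendsto_const tendsto_add_filterlim_at_infinity'[OF filterlim_ident tendsto_const]])
  then have "((\<lambda>z. 1 + (b - a) / (z - b)) \<longlongrightarrow> 1 + 0) at_infinity" by (intro tendsto_add tendsto_const)
  then have "((\<lambda>z. 1 + (b - a) / (z - b)) \<longlongrightarrow> 1) at_infinity" by simp
  then show ?thesis
  proof (rule Lim_transform_eventually)
    have "1 + (b - a) / (z - b) = (z - a) / (z - b)" if "norm b + 1 \<le> norm z" for z
    proof -
      have "z - b \<noteq> 0" using that by auto
      then show ?thesis by (simp add: field_simps)
    qed
    then show "\<forall>\<^sub>F z in at_infinity. 1 + (b - a) / (z - b) = (z - a) / (z - b)"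
      unfolding eventually_at_infinity by blast
  qed
qed

context circle_system
begin

lemma liouville_mat:
  assumes X: "holomorphic_mat_on X (- \<Sigma>)" and inf: "(X \<longlongrightarrow> c) at_infinity"
    and L: "\<And>z. z \<in> \<Sigma> \<Longrightarrow> (X \<longlongrightarrow> L z) (at z within P)" "\<And>z. z \<in> \<Sigma> \<Longrightarrow> (X \<longlongrightarrow> L z) (at z within Q)"
    and z: "z \<notin> \<Sigma>"
  shows "X z = c"
proof -
  have "X z $ i $ l = c $ i $ l" for i l
    by (rule liouville(1)[where F = "\<lambda>z. X z $ i $ l" and L = "\<lambda>z. L z $ i $ l", OF _ _ _ _ z])
      (use X inf L in \<open>auto simp: holomorphic_mat_on_def mat_tendsto_iff\<close>)
  then show ?thesis by (simp add: vec_eq_iff)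
qed

lemma rhp_solutionD:
  assumes "rhp_solution k \<Gamma> P v m" and "1 \<le> k"
  shows "holomorphic_mat_on m (- \<Sigma>)" "(m \<longlongrightarrow> mat 1) at_infinity"
    and "z \<in> \<Sigma> \<Longrightarrow> (m \<longlongrightarrow> bv_minus \<Gamma> P m z ** v z) (at z within P)"
    and "z \<in> \<Sigma> \<Longrightarrow> (m \<longlongrightarrow> bv_minus \<Gamma> P m z) (at z within Q)"
proof -
  have m: "m \<in> Hhol k \<Gamma> P" using assms by (simp add: rhp_solution_def)
  show "holomorphic_mat_on m (- \<Sigma>)" using m by (simp add: Hhol_def)
  show "(m \<longlongrightarrow> mat 1) at_infinity" using assms by (simp add: rhp_solution_def)
  show "z \<in> \<Sigma> \<Longrightarrow> (m \<longlongrightarrow> bv_minus \<Gamma> P m z ** v z) (at z within P)" "z \<in> \<Sigma> \<Longrightarrow> (m \<longlongrightarrow> bv_minus \<Gamma> P m z) (at z within Q)"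
    using Hhol_limits[OF m assms(2)] assms(1) by (auto simp: rhp_solution_def)
qed

lemma rhp_solution_det:
  assumes m: "rhp_solution k \<Gamma> P v m" and k: "1 \<le> k" and v: "\<And>z. z \<in> \<Sigma> \<Longrightarrow> det (v z) = 1"
  shows "z \<notin> \<Sigma> \<Longrightarrow> det (m z) = 1" and "z \<in> \<Sigma> \<Longrightarrow> det (bv_minus \<Gamma> P m z) = 1"
proof -
  note D = rhp_solutionD[OF m k]
  have L: "((\<lambda>z. det (m z)) \<longlongrightarrow> det (bv_minus \<Gamma> P m z)) (at z within P)" if "z \<in> \<Sigma>" for z
    using tendsto_det[OF D(3)[OF that]] by (simp add: det_mul v[OF that])
  note lio = liouville[where F = "\<lambda>z. det (m z)" and L = "\<lambda>z. det (bv_minus \<Gamma> P m z)", OF holomorphic_det[OF D(1)] L tendsto_det[OF D(4)] tendsto_det[OF D(2)]]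
  show "z \<notin> \<Sigma> \<Longrightarrow> det (m z) = 1" "z \<in> \<Sigma> \<Longrightarrow> det (bv_minus \<Gamma> P m z) = 1"
    using lio by simp_all
qed

lemma rhp_solution_unique:
  assumes m: "rhp_solution k \<Gamma> P v m" and m': "rhp_solution k \<Gamma> P v m'" and k: "1 \<le> k"
    and v: "\<And>z. z \<in> \<Sigma> \<Longrightarrow> det (v z) = 1" and z: "z \<notin> \<Sigma>"
  shows "m' z = m z"
proof -
  note D = rhp_solutionD[OF m k] and D' = rhp_solutionD[OF m' k]
  define L where "L z = bv_minus \<Gamma> P m' z ** adj2 (bv_minus \<Gamma> P m z)" for z
  have "m' z ** adj2 (m z) = mat 1 ** adj2 (mat 1)"
  proof (rule liouville_mat[where L = L, OF _ _ _ _ z])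
    show "holomorphic_mat_on (\<lambda>z. m' z ** adj2 (m z)) (- \<Sigma>)"
      by (intro holomorphic_mat_mult holomorphic_adj2 D(1) D'(1))
    show "((\<lambda>z. m' z ** adj2 (m z)) \<longlongrightarrow> mat 1 ** adj2 (mat 1)) at_infinity"
      by (intro tendsto_mat_mult tendsto_adj2 D(2) D'(2))
    fix z assume z: "z \<in> \<Sigma>"
    show "((\<lambda>z. m' z ** adj2 (m z)) \<longlongrightarrow> L z) (at z within Q)"
      unfolding L_def by (intro tendsto_mat_mult tendsto_adj2 D(4) D'(4) z)
    \<comment> \<open>The factor \<open>v z ** adj2 (v z)\<close> in the middle is the identity, so
      the quotient of the two solutions has no jump.\<close>
    have "L z = bv_minus \<Gamma> P m' z ** v z ** adj2 (bv_minus \<Gamma> P m z ** v z)"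
      unfolding L_def adj2_mult
      by (metis adj2_inverse(1)[OF v[OF z]] matrix_mul_assoc matrix_mul_rid)
    then show "((\<lambda>z. m' z ** adj2 (m z)) \<longlongrightarrow> L z) (at z within P)"
      by (simp only:) (intro tendsto_mat_mult tendsto_adj2 D(3) D'(3) z)
  qed
  then have "m' z ** adj2 (m z) = mat 1"
    by (simp add: adj2_def mat1_eq vec_eq_iff forall_2 mat_mult_nth2)
  then have "m' z ** (adj2 (m z) ** m z) = m z"
    by (metis matrix_mul_assoc matrix_mul_lid)
  then show ?thesis by (simp add: adj2_inverse(2)[OF rhp_solution_det(1)[OF m k v z]])
qed

text \<open>Multiplying \<open>F\<close> by the power on \<open>P\<close> alone removes the jump.
  This is holomorphic because the pole \<open>zm\<close> lies in \<open>Q\<close>, and it leaves the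
  limit at infinity unchanged because the quotient tends to 1. The resulting constant is 0, as the
  power vanishes at \<open>zp\<close>; on \<open>Q\<close> nothing was altered, so
  \<open>F zm = 0\<close>.\<close>

lemma positive_index_zero:
  fixes F :: "complex \<Rightarrow> complex"
  assumes F: "F holomorphic_on - \<Sigma>" and inf: "(F \<longlongrightarrow> c) at_infinity"
    and L: "\<And>z. z \<in> \<Sigma> \<Longrightarrow> (F \<longlongrightarrow> Fp z) (at z within P)" "\<And>z. z \<in> \<Sigma> \<Longrightarrow> (F \<longlongrightarrow> Fm z) (at z within Q)"
    and jump: "\<And>z. z \<in> \<Sigma> \<Longrightarrow> Fm z = ((z - zp) / (z - zm)) ^ n * Fp z"
    and zp: "zp \<in> P" and zm: "zm \<in> Q" and n: "0 < n"
  shows "F zm = 0"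
proof -
  define \<phi> where "\<phi> z = ((z - zp) / (z - zm)) ^ n" for z
  define Y where "Y z = (if z \<in> P then \<phi> z * F z else F z)" for z
  have zm': "zm \<notin> P" "zm \<notin> \<Sigma>" and zp': "zp \<notin> \<Sigma>" using zm zp PQ by blast+
  have YQ: "Y z = F z" if "z \<in> Q" for z using that PQ unfolding Y_def by auto
  have Yh: "Y holomorphic_on - \<Sigma>"
    unfolding PQ(1)[symmetric]
  proof (rule holomorphic_on_Un)
    have "(\<lambda>z. \<phi> z * F z) holomorphic_on P"
      unfolding \<phi>_def[abs_def] using zm' PQ by (intro holomorphic_intros holomorphic_on_subset[OF F]) auto
    then show "Y holomorphic_on P" by (rule holomorphic_transform) (simp add: Y_def)
    have "F holomorphic_on Q" using PQ by (intro holomorphic_on_subset[OF F]) blast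
    then show "Y holomorphic_on Q" by (rule holomorphic_transform) (simp add: YQ)
  qed (use openP openQ in auto)
  have YP: "(Y \<longlongrightarrow> Fm z) (at z within P)" if z: "z \<in> \<Sigma>" for z
  proof -
    have "z - zm \<noteq> 0" using z zm' by auto
    then have "((\<lambda>z. \<phi> z * F z) \<longlongrightarrow> Fm z) (at z within P)"
      unfolding jump[OF z] \<phi>_def[abs_def] by (intro tendsto_intros L(1) z)
    then show ?thesis by (rule Lim_transform_eventually) (auto simp: eventually_at_filter Y_def)
  qed
  have YQl: "(Y \<longlongrightarrow> Fm z) (at z within Q)" if z: "z \<in> \<Sigma>" for z
    by (rule Lim_transform_eventually[OF L(2)[OF z]]) (auto simp: eventually_at_filter YQ)
  have "((\<lambda>z. \<phi> z * F z) \<longlongrightarrow> 1 ^ n * c) at_infinity"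
    unfolding \<phi>_def[abs_def] by (intro tendsto_mult tendsto_power moebius_at_infinity inf)
  then have Yinf: "(Y \<longlongrightarrow> c) at_infinity"
    unfolding Y_def[abs_def]
    by (intro filterlim_If tendsto_mono[OF inf_le1] inf) simp
  have lio: "Y z = c" if "z \<notin> \<Sigma>" for z
    by (rule liouville(1)[where F = Y and L = Fm, OF Yh YP YQl Yinf that])
  have "Y zp = 0" using zp n by (simp add: Y_def \<phi>_def)
  then have "c = 0" using lio[OF zp'] by simp
  then show ?thesis using lio[OF zm'(2)] YQ[OF zm] by simp
qed

text \<open>The solution \<open>m0\<close> is itself a factorization whose diagonal factor is the
  identity. Conversely, once \<open>k1 \<le> 0\<close> and \<open>0 \<le> k1 + k2\<close> are known,
  the ordering \<open>k2 \<le> k1\<close> leaves only zero.\<close>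

lemma partial_indices_zero:
  assumes m0: "rhp_solution k \<Gamma> P v m0" and k: "1 \<le> k" and v: "\<And>z. z \<in> \<Sigma> \<Longrightarrow> det (v z) = 1"
    and zp: "zp \<in> P" and zm: "zm \<in> Q"
  shows "partial_indices k \<Gamma> P zp zm v k1 k2 \<longleftrightarrow> k1 = 0 \<and> k2 = 0"
proof
  note D0 = rhp_solutionD[OF m0 k]
  have d0: "z \<notin> \<Sigma> \<Longrightarrow> det (m0 z) = 1" "z \<in> \<Sigma> \<Longrightarrow> det (bv_minus \<Gamma> P m0 z) = 1" for z
    using rhp_solution_det[OF m0 k] v by blast+
  have bp0: "bv_plus \<Gamma> P m0 z = bv_minus \<Gamma> P m0 z ** v z" if "z \<in> \<Sigma>" for z
    using m0 that by (simp add: rhp_solution_def)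
  {
    assume "k1 = 0 \<and> k2 = 0"
    have "m0 \<in> GHhol k \<Gamma> P"
      unfolding GHhol_def
    proof (intro CollectI conjI allI impI ballI)
      show "m0 \<in> Hhol k \<Gamma> P" using m0 by (simp add: rhp_solution_def)
      show "\<exists>m1. (m0 \<longlongrightarrow> m1) at_infinity \<and> det m1 \<noteq> 0" using D0(2) by (intro exI[of _ "mat 1"]) simp
    qed (simp_all add: d0 bp0 det_mul v)
    moreover have "v z = matrix_inv (bv_minus \<Gamma> P m0 z) ** mat2 1 0 0 1 ** bv_plus \<Gamma> P m0 z" if z: "z \<in> \<Sigma>" for z
    proof -
      have "matrix_inv (bv_minus \<Gamma> P m0 z) ** bv_minus \<Gamma> P m0 z = mat 1" using d0(2)[OF z] by (intro matrix_inv_det) simp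
      then show ?thesis by (simp add: bp0[OF z] matrix_mul_assoc flip: mat1_eq)
    qed
    ultimately show "partial_indices k \<Gamma> P zp zm v k1 k2"
      unfolding partial_indices_def using \<open>k1 = 0 \<and> k2 = 0\<close> by (auto intro!: bexI[of _ m0])
  }
  assume pi: "partial_indices k \<Gamma> P zp zm v k1 k2"
  define w where "w z = (z - zp) / (z - zm)" for z
  obtain m where m: "m \<in> GHhol k \<Gamma> P" and k12: "k2 \<le> k1"
    and f: "\<And>z. z \<in> \<Sigma> \<Longrightarrow> v z = matrix_inv (bv_minus \<Gamma> P m z) ** mat2 (w z powi k1) 0 0 (w z powi k2) ** bv_plus \<Gamma> P m z"
    using pi unfolding partial_indices_def w_def by blast
  have mH: "m \<in> Hhol k \<Gamma> P" and md: "\<And>z. z \<notin> \<Sigma> \<Longrightarrow> det (m z) \<noteq> 0"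
    and bd: "\<And>z. z \<in> \<Sigma> \<Longrightarrow> det (bv_plus \<Gamma> P m z) \<noteq> 0" "\<And>z. z \<in> \<Sigma> \<Longrightarrow> det (bv_minus \<Gamma> P m z) \<noteq> 0"
    using m by (auto simp: GHhol_def)
  obtain m1 where m1: "(m \<longlongrightarrow> m1) at_infinity" "det m1 \<noteq> 0" using m by (auto simp: GHhol_def)
  have mh: "holomorphic_mat_on m (- \<Sigma>)" using mH by (simp add: Hhol_def)
  note ml = Hhol_limits[OF mH k]
  have w0: "w z \<noteq> 0" if "z \<in> \<Sigma>" for z using that zp zm PQ by (auto simp: w_def)
  have jump: "bv_minus \<Gamma> P m z ** v z = mat2 (w z powi k1) 0 0 (w z powi k2) ** bv_plus \<Gamma> P m z" if z: "z \<in> \<Sigma>" for z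
  proof -
    show ?thesis unfolding f[OF z] by (simp add: matrix_mul_assoc matrix_inv_det(1)[OF bd(2)[OF z]])
  qed
  have k1: "k1 \<le> 0"
  proof (rule ccontr)
    assume "\<not> k1 \<le> 0"
    then have n: "0 < nat k1" by simp
    \<comment> \<open>Multiplying by the inverse of \<open>m0\<close> cancels \<open>v\<close>. The
      jump that remains is the diagonal matrix acting from the left, so the rows decouple and the
      first row carries the power \<open>k1\<close>.\<close>
    define X where "X z = m z ** adj2 (m0 z)" for z
    define Xp where "Xp z = bv_plus \<Gamma> P m z ** adj2 (bv_plus \<Gamma> P m0 z)" for z
    define Xm where "Xm z = bv_minus \<Gamma> P m z ** adj2 (bv_minus \<Gamma> P m0 z)" for z
    have X0: "X zm $ 1 $ l = 0" for l
    proof (rule positive_index_zero[where F = "\<lambda>z. X z $ 1 $ l" and Fp = "\<lambda>z. Xp z $ 1 $ l" and Fm = "\<lambda>z. Xm z $ 1 $ l", OF _ _ _ _ _ zp zm n])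
      have "holomorphic_mat_on X (- \<Sigma>)"
        unfolding X_def[abs_def] by (intro holomorphic_mat_mult holomorphic_adj2 mh D0(1))
      then show "(\<lambda>z. X z $ 1 $ l) holomorphic_on - \<Sigma>" by (simp add: holomorphic_mat_on_def)
      have "(X \<longlongrightarrow> m1 ** adj2 (mat 1)) at_infinity"
        unfolding X_def[abs_def] by (intro tendsto_mat_mult tendsto_adj2 m1 D0(2))
      then show "((\<lambda>z. X z $ 1 $ l) \<longlongrightarrow> (m1 ** adj2 (mat 1)) $ 1 $ l) at_infinity" by (simp add: mat_tendsto_iff)
      fix z assume z: "z \<in> \<Sigma>"
      have "(X \<longlongrightarrow> Xp z) (at z within P)"
        unfolding X_def[abs_def] Xp_def bp0[OF z] by (intro tendsto_mat_mult tendsto_adj2 ml D0(3) z)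
      then show "((\<lambda>z. X z $ 1 $ l) \<longlongrightarrow> Xp z $ 1 $ l) (at z within P)" by (simp add: mat_tendsto_iff)
      have "(X \<longlongrightarrow> Xm z) (at z within Q)"
        unfolding X_def[abs_def] Xm_def by (intro tendsto_mat_mult tendsto_adj2 ml D0(4) z)
      then show "((\<lambda>z. X z $ 1 $ l) \<longlongrightarrow> Xm z $ 1 $ l) (at z within Q)" by (simp add: mat_tendsto_iff)
      have "mat2 (w z powi k1) 0 0 (w z powi k2) ** Xp z = bv_minus \<Gamma> P m z ** (v z ** adj2 (v z)) ** adj2 (bv_minus \<Gamma> P m0 z)"
        unfolding Xp_def bp0[OF z] adj2_mult by (simp add: matrix_mul_assoc flip: jump[OF z])
      also have "\<dots> = Xm z" unfolding Xm_def adj2_inverse(1)[OF v[OF z]] by simp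
      finally have e: "mat2 (w z powi k1) 0 0 (w z powi k2) ** Xp z = Xm z" .
      have "Xm z $ 1 $ l = w z powi k1 * Xp z $ 1 $ l" using arg_cong[OF e, of "\<lambda>A :: complex^2^2. A $ 1 $ l"] by (simp add: mat_mult_nth2)
      then show "Xm z $ 1 $ l = ((z - zp) / (z - zm)) ^ nat k1 * Xp z $ 1 $ l"
        using n by (simp add: power_int_def w_def)
    qed
    have "zm \<notin> \<Sigma>" using zm PQ by blast
    then have "det (X zm) \<noteq> 0" using md[of zm] d0(1)[of zm] by (simp add: X_def det_mul det_adj2)
    then show False by (simp add: det_2 X0)
  qed
  have k2: "0 \<le> k1 + k2"
  proof (rule ccontr)
    assume "\<not> 0 \<le> k1 + k2"
    then have n: "0 < nat (- (k1 + k2))" by simp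
    have zmS: "zm \<notin> \<Sigma>" using zm PQ by blast
    have "inverse (det (m zm)) = 0"
    proof (rule positive_index_zero[where F = "\<lambda>z. inverse (det (m z))" and Fp = "\<lambda>z. inverse (det (bv_plus \<Gamma> P m z))"
          and Fm = "\<lambda>z. inverse (det (bv_minus \<Gamma> P m z))", OF _ _ _ _ _ zp zm n])
      show "(\<lambda>z. inverse (det (m z))) holomorphic_on - \<Sigma>"
        by (intro holomorphic_on_inverse holomorphic_det mh) (use md in auto)
      show "((\<lambda>z. inverse (det (m z))) \<longlongrightarrow> inverse (det m1)) at_infinity"
        by (intro tendsto_inverse tendsto_det m1)
      fix z assume z: "z \<in> \<Sigma>"
      show "((\<lambda>z. inverse (det (m z))) \<longlongrightarrow> inverse (det (bv_plus \<Gamma> P m z))) (at z within P)"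
        "((\<lambda>z. inverse (det (m z))) \<longlongrightarrow> inverse (det (bv_minus \<Gamma> P m z))) (at z within Q)"
        by (intro tendsto_inverse tendsto_det ml bd z)+
      have "det (bv_minus \<Gamma> P m z) = w z powi (k1 + k2) * det (bv_plus \<Gamma> P m z)"
        using arg_cong[OF jump[OF z], of det] w0[OF z] by (simp add: det_mul v[OF z] det_mat2 power_int_add)
      moreover have "inverse (w z powi (k1 + k2)) = w z ^ nat (- (k1 + k2))"
        using n by (simp add: power_int_def power_inverse)
      ultimately show "inverse (det (bv_minus \<Gamma> P m z)) = ((z - zp) / (z - zm)) ^ nat (- (k1 + k2)) * inverse (det (bv_plus \<Gamma> P m z))"
        by (simp add: w_def)
    qed
    then show False using md[OF zmS] by simp
  qed
  show "k1 = 0 \<and> k2 = 0" using k1 k2 k12 by simp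
qed

end

lemma (in pole_data) jump_v_det:
  assumes "z \<in> \<Sigma>"
  shows "det (jump_v n r J p c \<epsilon> z) = 1"
proof -
  from assms consider "z \<in> sphere 0 1" | j where "j \<in> {1..J}" "z \<in> sphere (p j) (\<epsilon> j)" | j where "j \<in> {1..J}" "z \<in> sphere (b j) (s j)"
    unfolding trace_eq by blast
  then show ?thesis
  proof cases
    case 1
    then have "z powi (2*n) * z powi (-2*n) = 1" by (subst power_int_add[symmetric]) auto
    then have "(z powi (2*n) * cnj (r z)) * (z powi (-2*n) * r z) = r z * cnj (r z)" by (simp add: mult_ac)
    then show ?thesis
      unfolding jump_v_unit[OF 1] jump_V_def det_mat2 complex_norm_square by simp
  qed (simp_all add: jump_v_pole jump_v_sharp det_mat2)
qed

text \<open>Both solutions pass to solutions of the jump problem, which coincide, and the factors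
  used in the passage are invertible because their determinant is 1.\<close>

lemma (in pole_data) rhp_poles_unique:
  assumes k: "1 \<le> k" and M: "rhp_poles_solution k n r J p c M" and M': "rhp_poles_solution k n r J p c M'" and z: "z \<in> U"
  shows "M' z = M z"
proof -
  obtain m where m: "rhp_solution k \<Gamma>\<^sub>0 P\<^sub>0 (jump_v n r J p c \<epsilon>) m"
    and m1: "\<And>z. (\<forall>j\<in>{1..J}. z \<notin> cball (p j) (\<epsilon> j)) \<and> (\<forall>j\<in>{1..J}. z \<notin> cball (b j) (s j)) \<Longrightarrow> m z = M z"
    and m2: "\<And>j z. j \<in> {1..J} \<Longrightarrow> z \<in> ball (p j) (\<epsilon> j) - {p j} \<Longrightarrow> m z = M z ** mat2 1 0 (- (p j powi (-2*n) * c j / (z - p j))) 1"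
    and m3: "\<And>j z. j \<in> {1..J} \<Longrightarrow> z \<in> ball (b j) (s j) - {q j} \<Longrightarrow> m z = M z ** mat2 1 (- (cnj (p j) powi (-2*n - 2) * cnj (c j) / (z - q j))) 0 1"
    using pole_problem_imp_contour_problem[OF k M] by (elim exE conjE) blast
  obtain m' where m': "rhp_solution k \<Gamma>\<^sub>0 P\<^sub>0 (jump_v n r J p c \<epsilon>) m'"
    and m1': "\<And>z. (\<forall>j\<in>{1..J}. z \<notin> cball (p j) (\<epsilon> j)) \<and> (\<forall>j\<in>{1..J}. z \<notin> cball (b j) (s j)) \<Longrightarrow> m' z = M' z"
    and m2': "\<And>j z. j \<in> {1..J} \<Longrightarrow> z \<in> ball (p j) (\<epsilon> j) - {p j} \<Longrightarrow> m' z = M' z ** mat2 1 0 (- (p j powi (-2*n) * c j / (z - p j))) 1"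
    and m3': "\<And>j z. j \<in> {1..J} \<Longrightarrow> z \<in> ball (b j) (s j) - {q j} \<Longrightarrow> m' z = M' z ** mat2 1 (- (cnj (p j) powi (-2*n - 2) * cnj (c j) / (z - q j))) 0 1"
    using pole_problem_imp_contour_problem[OF k M'] by (elim exE conjE) blast
  have mm: "m' w = m w" if "w \<notin> \<Sigma>" for w by (rule rhp_solution_unique[OF m m' k jump_v_det that])
  have cancel: "A = B" if "A ** G = B ** G" "det G = 1" for A B G :: "complex^2^2"
    by (metis that adj2_inverse(1) matrix_mul_assoc matrix_mul_rid)
  have off: "M' w = M w" if w: "w \<in> U" "w \<notin> \<Sigma>" for w
  proof -
    have "w \<in> P\<^sub>0 \<or> w \<in> Q\<^sub>0" using w(2) PQ(1) by blast
    then consider "1 < norm w" "\<forall>j\<in>{1..J}. w \<notin> cball (p j) (\<epsilon> j)" | "norm w < 1" "\<forall>j\<in>{1..J}. w \<notin> cball (b j) (s j)"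
      | j where "j \<in> {1..J}" "w \<in> ball (p j) (\<epsilon> j)" | j where "j \<in> {1..J}" "w \<in> ball (b j) (s j)"
      unfolding minus_eq unfolding plus_eq by blast
    then show ?thesis
    proof cases
      case 1
      have "w \<notin> cball (b j) (s j)" if "j \<in> {1..J}" for j using norm_inner[OF that, of w] 1(1) by auto
      then show ?thesis using m1[of w] m1'[of w] mm[OF w(2)] 1(2) by simp
    next
      case 2
      have "w \<notin> cball (p j) (\<epsilon> j)" if "j \<in> {1..J}" for j using norm_outer[OF that, of w] 2(1) by auto
      then show ?thesis using m1[of w] m1'[of w] mm[OF w(2)] 2(2) by simp
    next
      case (3 j)
      then have "w \<in> ball (p j) (\<epsilon> j) - {p j}" using w(1) by (auto simp: poles_eq)
      from cancel[OF mm[OF w(2), unfolded m2[OF 3(1) this] m2'[OF 3(1) this]]] show ?thesis by (simp add: det_mat2)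
    next
      case (4 j)
      then have "w \<in> ball (b j) (s j) - {q j}" using w(1) by (auto simp: poles_eq)
      from cancel[OF mm[OF w(2), unfolded m3[OF 4(1) this] m3'[OF 4(1) this]]] show ?thesis by (simp add: det_mat2)
    qed
  qed
  show ?thesis
  proof (cases "z \<in> \<Sigma>")
    case True
    \<comment> \<open>A point of \<open>U\<close> on the contour lies on one of the small circles,
      where \<open>M\<close> and \<open>M'\<close> are continuous; equality is carried over from the
      adjacent points of \<open>P\<^sub>0\<close>.\<close>
    have hol: "holomorphic_mat_on M U" "holomorphic_mat_on M' U" using M M' by (simp_all only: rhp_poles_solution_def)
    have L: "(M \<longlongrightarrow> M z) (at z within P\<^sub>0)" "(M' \<longlongrightarrow> M' z) (at z within P\<^sub>0)"
      using jump_factor_tendsto(3)[OF z hol(1) holomorphic_on_const] jump_factor_tendsto(3)[OF z hol(2) holomorphic_on_const]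
      by (auto intro: tendsto_within_subset)
    have "(M \<longlongrightarrow> M' z) (at z within P\<^sub>0)"
    proof (rule tendsto_local[OF L(2) open_U z])
      show "M' w = M w" if "w \<in> P\<^sub>0 \<inter> U" for w using off that PQ(1) by blast
    qed blast
    then show ?thesis using tendsto_unique[OF side_nontrivial[OF True, of P\<^sub>0] _ L(1)] by blast
  qed (rule off[OF z])
qed

theorem theorem10:
  fixes k J :: nat and n :: int
    and r :: "complex \<Rightarrow> complex"
    and p c :: "nat \<Rightarrow> complex"
    and \<epsilon> :: "nat \<Rightarrow> real"
    and zp zm :: complex
  assumes "k \<ge> 1"
    and "r \<in> Hsob k {unit_circle}"
    and "inj_on p {1..J}"
    and "\<And>j. j \<in> {1..J} \<Longrightarrow> norm (p j) > 1"
    and "\<And>j. j \<in> {1..J} \<Longrightarrow> \<epsilon> j > 0"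
    and "\<And>j. j \<in> {1..J} \<Longrightarrow> cball (p j) (\<epsilon> j) \<subseteq> {z. norm z > 1}"
    and "disjoint_family_on (\<lambda>j. cball (p j) (\<epsilon> j)) {1..J}"
    and "zp \<in> Omega_plus J p \<epsilon>"
    and "zm \<in> Omega_minus J p \<epsilon>"
  shows
    "(\<exists>m. rhp_solution k (contour J p \<epsilon>) (Omega_plus J p \<epsilon>) (jump_v n r J p c \<epsilon>) m \<and>
        (\<forall>m'. rhp_solution k (contour J p \<epsilon>) (Omega_plus J p \<epsilon>) (jump_v n r J p c \<epsilon>) m' \<longrightarrow>
           (\<forall>z\<in>- contour_trace (contour J p \<epsilon>). m' z = m z)))
     \<and>
     (\<exists>M. rhp_poles_solution k n r J p c M \<and>
        (\<forall>M'. rhp_poles_solution k n r J p c M' \<longrightarrow>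
           (\<forall>z\<in>- (sphere 0 1 \<union> poles J p). M' z = M z)))
     \<and>
     (\<forall>k1 k2. partial_indices k (contour J p \<epsilon>) (Omega_plus J p \<epsilon>) zp zm (jump_v n r J p c \<epsilon>) k1 k2
        \<longleftrightarrow> k1 = 0 \<and> k2 = 0)"
proof -
  interpret pole_data J p \<epsilon> by unfold_locales (use assms(5-7) in auto)
  obtain M where M: "rhp_poles_solution k n r J p c M"
    using rhp_poles_exists[OF assms(1-4)] by blast
  obtain m where m: "rhp_solution k \<Gamma>\<^sub>0 P\<^sub>0 (jump_v n r J p c \<epsilon>) m"
    using pole_problem_imp_contour_problem[OF assms(1) M] by blast
  have u: "m' z = m z" if "rhp_solution k \<Gamma>\<^sub>0 P\<^sub>0 (jump_v n r J p c \<epsilon>) m'" "z \<in> - \<Sigma>" for m' z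
    by (rule rhp_solution_unique[OF m that(1) assms(1) jump_v_det]) (use that(2) in auto)
  have i: "partial_indices k \<Gamma>\<^sub>0 P\<^sub>0 zp zm (jump_v n r J p c \<epsilon>) k1 k2 \<longleftrightarrow> k1 = 0 \<and> k2 = 0" for k1 k2
    by (rule partial_indices_zero[OF m assms(1) jump_v_det assms(8) assms(9)[unfolded Omega_minus_def]])
  show ?thesis
    using m u M rhp_poles_unique[OF assms(1) M] i by blast
qed

end
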